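(* Let $X$ be a compact complex orbifold which is also a Kähler complex space. Then the image of a Kähler class under the natural morphism $$H^2_{\mathrm{dR}}(X,\mathbb{R})\to H^2(X,\mathbb{R})$$ is an orbifold Kähler class (i.e. it contains an orbifold Kähler form). In particular, a Kähler complex space which is a (compact) orbifold is a Kähler orbifold.
   Context: A complex orbifold of dimension $n$ is a reduced complex space with only quotient singularities: it is covered by open sets $U_\alpha\simeq\tilde U_\alpha/G_\alpha$ with quotient maps $\pi_\alpha:\tilde U_\alpha\to U_\alpha$, where $\tilde U_\alpha\subset\mathbb{C}^n$ is open and $G_\alpha\subset GL_n(\mathbb{C})$ is finite and may be taken small (contains no complex reflection, i.e. no element whose fixed space has dimension $n-1$), the charts being compatible via equivariant open holomorphic embeddings; the holomorphic functions on $U_\alpha$ are the $G_\alpha$-invariant holomorphic functions on $\tilde U_\alpha$. An orbifold smooth form is a compatible collection of $G_\alpha$-invariant smooth forms on the $\tilde U_\alpha$. The de Rham cohomology of orbifold smooth forms is isomorphic to the singular cohomology $H^\bullet(X,\mathbb{R})$. An orbifold Kähler form is an orbifold smooth form which is a Kähler form on each $\tilde U_\alpha$; a Kähler orbifold is an orbifold admitting one, and an orbifold Kähler class is the class in $H^2(X,\mathbb{R})$ of an orbifold Kähler form. On the reduced complex space $X$, a smooth form is a form on $X_{\mathrm{reg}}$ which, in local embeddings of $X$ as a closed analytic subset of an open set $\Omega\subset\mathbb{C}^N$, is the restriction of a smooth form on $\Omega$. $H^\bullet_{\mathrm{dR}}(X,\mathbb{R})$ is the hypercohomology of the complex of sheaves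 of these smooth forms. Pulling back by $\pi_\alpha$, every smooth form on $X$ is an orbifold smooth form, which induces the natural morphism $H^2_{\mathrm{dR}}(X,\mathbb{R})\to H^2(X,\mathbb{R})$. A Kähler form on the complex space $X$ is a smooth $(1,1)$-form which is locally the restriction of $i\partial\bar\partial\varphi$ with $\varphi$ smooth strictly psh on $\Omega$; $X$ is a Kähler complex space if it admits one, and a Kähler class is the class in $H^2_{\mathrm{dR}}(X,\mathbb{R})$ of such a form. *)

theory Defs
  imports "HOL-Analysis.Analysis" "HOL-Analysis.Finite_Function_Topology" "HOL-Algebra.Bij" "HOL-Library.Function_Algebras"
begin

section \<open>Calculus on open subsets of complex number spaces\<close>

type_synonym cvec = "nat \<Rightarrow>\<^sub>0 complex"

text \<open>Local embeddings of a complex space have no common target dimension, so all the spaces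
  \<open>\<complex>\<^sup>n\<close> live inside the normed space of finitely supported sequences, \<open>\<complex>\<^sup>n\<close> being the sequences
  supported on \<open>{..<n}\<close>. The norm of \<^typ>\<open>cvec\<close> is the \<open>\<ell>\<^sup>1\<close>-norm, which induces the usual
  topology on each \<open>\<complex>\<^sup>n\<close>. Open subsets of \<open>\<complex>\<^sup>n\<close> are open relative to \<open>\<complex>\<^sup>n\<close>.\<close>

definition cvecs :: "nat \<Rightarrow> cvec set" where
  "cvecs n = {z. Poly_Mapping.keys z \<subseteq> {..<n}}"

abbreviation open_in_C :: "nat \<Rightarrow> cvec set \<Rightarrow> bool" where
  "open_in_C n D \<equiv> openin (top_of_set (cvecs n)) D"

definition cmul :: "complex \<Rightarrow> cvec \<Rightarrow> cvec" where
  "cmul c z = Poly_Mapping.map ((*) c) z"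

definition dird :: "cvec \<Rightarrow> (cvec \<Rightarrow> 'b::real_normed_vector) \<Rightarrow> cvec \<Rightarrow> 'b" where
  "dird v f z = vector_derivative (\<lambda>t. f (z + t *\<^sub>R v)) (at 0)"

fun Ck_on :: "nat \<Rightarrow> nat \<Rightarrow> cvec set \<Rightarrow> (cvec \<Rightarrow> 'b::real_normed_vector) \<Rightarrow> bool" where
  "Ck_on 0 n D f = continuous_on D f"
| "Ck_on (Suc k) n D f = (f differentiable_on D \<and> (\<forall>v\<in>cvecs n. Ck_on k n D (dird v f)))"

definition smooth_on_C :: "nat \<Rightarrow> cvec set \<Rightarrow> (cvec \<Rightarrow> 'b::real_normed_vector) \<Rightarrow> bool" where
  "smooth_on_C n D f \<longleftrightarrow> (\<forall>k. Ck_on k n D f)"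

definition holo_on :: "nat \<Rightarrow> cvec set \<Rightarrow> (cvec \<Rightarrow> complex) \<Rightarrow> bool" where
  "holo_on n D f \<longleftrightarrow> f differentiable_on D \<and>
     (\<forall>z\<in>D. \<forall>v\<in>cvecs n. dird (cmul \<i> v) f z = \<i> * dird v f z)"

definition holo_map :: "nat \<Rightarrow> nat \<Rightarrow> cvec set \<Rightarrow> (cvec \<Rightarrow> cvec) \<Rightarrow> bool" where
  "holo_map n m D F \<longleftrightarrow> F \<in> D \<rightarrow> cvecs m \<and>
     (\<forall>i<m. holo_on n D (\<lambda>z. Poly_Mapping.lookup (F z) i))"

definition wirt :: "nat \<Rightarrow> (cvec \<Rightarrow> complex) \<Rightarrow> cvec \<Rightarrow> complex" where
  "wirt j f z = (dird (Poly_Mapping.single j 1) f z - \<i> * dird (Poly_Mapping.single j \<i>) f z) / 2"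

definition wirt_bar :: "nat \<Rightarrow> (cvec \<Rightarrow> complex) \<Rightarrow> cvec \<Rightarrow> complex" where
  "wirt_bar j f z = (dird (Poly_Mapping.single j 1) f z + \<i> * dird (Poly_Mapping.single j \<i>) f z) / 2"

definition levi :: "nat \<Rightarrow> (cvec \<Rightarrow> real) \<Rightarrow> cvec \<Rightarrow> cvec \<Rightarrow> cvec \<Rightarrow> complex" where
  "levi n \<phi> z v w = (\<Sum>j<n. \<Sum>k<n. wirt j (wirt_bar k (\<lambda>y. complex_of_real (\<phi> y))) z
     * Poly_Mapping.lookup v j * cnj (Poly_Mapping.lookup w k))"

definition smooth_strictly_psh :: "nat \<Rightarrow> cvec set \<Rightarrow> (cvec \<Rightarrow> real) \<Rightarrow> bool" where
  "smooth_strictly_psh n D \<phi> \<longleftrightarrow> smooth_on_C n D \<phi> \<and>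
     (\<forall>z\<in>D. \<forall>v\<in>cvecs n. v \<noteq> 0 \<longrightarrow> 0 < Re (levi n \<phi> z v v))"


section \<open>Smooth real differential forms\<close>

text \<open>A form of degree \<open>k\<close> on \<open>D \<subseteq> \<complex>\<^sup>n\<close> assigns to a point and a list of \<open>k\<close> tangent vectors a real
  number. It is set to zero on all other arguments, so that equality of forms on \<open>D\<close> is equality.\<close>

type_synonym form = "cvec \<Rightarrow> cvec list \<Rightarrow> real"

definition tangent_lists :: "nat \<Rightarrow> nat \<Rightarrow> cvec list set" where
  "tangent_lists n k = {vs. length vs = k \<and> set vs \<subseteq> cvecs n}"

definition alternating_multilinear :: "nat \<Rightarrow> nat \<Rightarrow> (cvec list \<Rightarrow> real) \<Rightarrow> bool" where
  "alternating_multilinear n k L \<longleftrightarrow>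
     (\<forall>vs\<in>tangent_lists n k. \<forall>i<k. \<forall>u\<in>cvecs n. \<forall>w\<in>cvecs n. \<forall>a b.
        L (vs[i := a *\<^sub>R u + b *\<^sub>R w]) = a * L (vs[i := u]) + b * L (vs[i := w])) \<and>
     (\<forall>vs\<in>tangent_lists n k. \<forall>i j. i < j \<and> j < k \<and> vs ! i = vs ! j \<longrightarrow> L vs = 0)"

definition kforms :: "nat \<Rightarrow> nat \<Rightarrow> cvec set \<Rightarrow> form set" where
  "kforms n k D = {\<omega>.
     (\<forall>z vs. \<not> (z \<in> D \<and> vs \<in> tangent_lists n k) \<longrightarrow> \<omega> z vs = 0) \<and>
     (\<forall>z\<in>D. alternating_multilinear n k (\<omega> z)) \<and>
     (\<forall>vs\<in>tangent_lists n k. smooth_on_C n D (\<lambda>z. \<omega> z vs))}"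

definition omit :: "nat \<Rightarrow> 'b list \<Rightarrow> 'b list" where
  "omit i xs = take i xs @ drop (Suc i) xs"

text \<open>The vectors in the list are constant vector fields, so no Lie bracket terms occur.\<close>

definition ext_d :: "nat \<Rightarrow> cvec set \<Rightarrow> form \<Rightarrow> form" where
  "ext_d n D \<omega> = (\<lambda>z vs. if z \<in> D \<and> set vs \<subseteq> cvecs n
     then \<Sum>i<length vs. (-1) ^ i * dird (vs ! i) (\<lambda>y. \<omega> y (omit i vs)) z else 0)"

definition pull_form :: "nat \<Rightarrow> cvec set \<Rightarrow> (cvec \<Rightarrow> cvec) \<Rightarrow> form \<Rightarrow> form" where
  "pull_form n D F \<omega> = (\<lambda>z vs. if z \<in> D \<and> set vs \<subseteq> cvecs n
     then \<omega> (F z) (map (\<lambda>v. dird v F z) vs) else 0)"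

text \<open>The real form \<open>\<i>\<partial>\<partial>\<^sup>-\<phi> = \<i> \<Sum> \<phi>\<^sub>j\<^sub>k dz\<^sub>j \<and> dz\<^sub>k\<^sup>-\<close>, with
  \<open>(dz\<^sub>j \<and> dz\<^sub>k\<^sup>-)(v, w) = v\<^sub>j w\<^sub>k\<^sup>- - w\<^sub>j v\<^sub>k\<^sup>-\<close>.\<close>

definition i_ddbar :: "nat \<Rightarrow> cvec set \<Rightarrow> (cvec \<Rightarrow> real) \<Rightarrow> form" where
  "i_ddbar n D \<phi> = (\<lambda>z vs. if z \<in> D \<and> vs \<in> tangent_lists n 2
     then Re (\<i> * (levi n \<phi> z (vs ! 0) (vs ! 1) - levi n \<phi> z (vs ! 1) (vs ! 0))) else 0)"

definition type_1_1 :: "nat \<Rightarrow> cvec set \<Rightarrow> form \<Rightarrow> bool" where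
  "type_1_1 n D \<omega> \<longleftrightarrow> (\<forall>z\<in>D. \<forall>v\<in>cvecs n. \<forall>w\<in>cvecs n.
     \<omega> z [cmul \<i> v, cmul \<i> w] = \<omega> z [v, w])"

definition kahler_form_on :: "nat \<Rightarrow> cvec set \<Rightarrow> form \<Rightarrow> bool" where
  "kahler_form_on n D \<omega> \<longleftrightarrow> \<omega> \<in> kforms n 2 D \<and> ext_d n D \<omega> = 0 \<and> type_1_1 n D \<omega> \<and>
     (\<forall>z\<in>D. \<forall>v\<in>cvecs n. v \<noteq> 0 \<longrightarrow> 0 < \<omega> z [v, cmul \<i> v])"


section \<open>Reduced complex spaces\<close>

text \<open>A reduced complex space carries a sheaf of genuine functions. Membership of \<open>f\<close> in \<open>hol X V\<close>
  only depends on the values of \<open>f\<close> on \<open>V\<close>.\<close>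

record 'a ringed =
  utop :: "'a topology"
  hol :: "'a set \<Rightarrow> ('a \<Rightarrow> complex) set"

definition function_sheaf :: "'a ringed \<Rightarrow> bool" where
  "function_sheaf X \<longleftrightarrow>
     (\<forall>V f g. f \<in> hol X V \<longrightarrow> (\<forall>x\<in>V. g x = f x) \<longrightarrow> g \<in> hol X V) \<and>
     (\<forall>V W f. openin (utop X) V \<longrightarrow> openin (utop X) W \<longrightarrow> W \<subseteq> V \<longrightarrow> f \<in> hol X V \<longrightarrow> f \<in> hol X W) \<and>
     (\<forall>V f. openin (utop X) V \<longrightarrow>
        (\<forall>x\<in>V. \<exists>W. openin (utop X) W \<and> x \<in> W \<and> W \<subseteq> V \<and> f \<in> hol X W) \<longrightarrow> f \<in> hol X V)"

definition analytic_subset :: "nat \<Rightarrow> cvec set \<Rightarrow> cvec set \<Rightarrow> bool" where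
  "analytic_subset N \<Omega> S \<longleftrightarrow> closedin (top_of_set \<Omega>) S \<and>
     (\<forall>p\<in>\<Omega>. \<exists>\<Omega>' Fs. open_in_C N \<Omega>' \<and> p \<in> \<Omega>' \<and> \<Omega>' \<subseteq> \<Omega> \<and> finite Fs \<and>
        (\<forall>F\<in>Fs. holo_on N \<Omega>' F) \<and> S \<inter> \<Omega>' = {z \<in> \<Omega>'. \<forall>F\<in>Fs. F z = 0})"

definition local_embedding ::
  "'a ringed \<Rightarrow> 'a set \<Rightarrow> nat \<Rightarrow> cvec set \<Rightarrow> ('a \<Rightarrow> cvec) \<Rightarrow> bool" where
  "local_embedding X V N \<Omega> j \<longleftrightarrow>
     openin (utop X) V \<and> open_in_C N \<Omega> \<and> analytic_subset N \<Omega> (j ` V) \<and>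
     homeomorphic_map (subtopology (utop X) V) (top_of_set (j ` V)) j \<and>
     (\<forall>W f. openin (utop X) W \<and> W \<subseteq> V \<longrightarrow>
        (f \<in> hol X W \<longleftrightarrow>
         (\<forall>x\<in>W. \<exists>\<Omega>' F. open_in_C N \<Omega>' \<and> j x \<in> \<Omega>' \<and> \<Omega>' \<subseteq> \<Omega> \<and> holo_on N \<Omega>' F \<and>
            (\<forall>y\<in>W. j y \<in> \<Omega>' \<longrightarrow> f y = F (j y)))))"

definition reduced_complex_space :: "'a ringed \<Rightarrow> bool" where
  "reduced_complex_space X \<longleftrightarrow> Hausdorff_space (utop X) \<and> function_sheaf X \<and>
     (\<forall>x\<in>topspace (utop X). \<exists>V N \<Omega> j. x \<in> V \<and> local_embedding X V N \<Omega> j)"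


section \<open>Quotient charts and orbifolds\<close>

record 'a chart =
  cdim :: nat
  cdom :: "cvec set"
  cgrp :: "(cvec \<Rightarrow> cvec) set"
  cproj :: "cvec \<Rightarrow> 'a"

abbreviation cimg :: "'a chart \<Rightarrow> 'a set" where
  "cimg c \<equiv> cproj c ` cdom c"

definition cpre :: "'a chart \<Rightarrow> 'a set \<Rightarrow> cvec set" where
  "cpre c U = {z \<in> cdom c. cproj c z \<in> U}"

text \<open>A subgroup of \<^term>\<open>BijGroup (cvecs n)\<close> all of whose elements are complex linear is a subgroup of
  \<open>GL\<^sub>n(\<complex>)\<close>.\<close>

definition complex_linear_on :: "nat \<Rightarrow> (cvec \<Rightarrow> cvec) \<Rightarrow> bool" where
  "complex_linear_on n g \<longleftrightarrow> (\<forall>z\<in>cvecs n. \<forall>w\<in>cvecs n. g (z + w) = g z + g w) \<and>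
     (\<forall>c. \<forall>z\<in>cvecs n. g (cmul c z) = cmul c (g z))"

definition quotient_chart :: "'a ringed \<Rightarrow> 'a chart \<Rightarrow> bool" where
  "quotient_chart X c \<longleftrightarrow>
     open_in_C (cdim c) (cdom c) \<and>
     subgroup (cgrp c) (BijGroup (cvecs (cdim c))) \<and> finite (cgrp c) \<and>
     (\<forall>g\<in>cgrp c. complex_linear_on (cdim c) g \<and> g ` cdom c \<subseteq> cdom c) \<and>
     openin (utop X) (cimg c) \<and>
     quotient_map (top_of_set (cdom c)) (subtopology (utop X) (cimg c)) (cproj c) \<and>
     (\<forall>z\<in>cdom c. \<forall>w\<in>cdom c. cproj c z = cproj c w \<longleftrightarrow> (\<exists>g\<in>cgrp c. w = g z)) \<and>
     (\<forall>V f. openin (utop X) V \<and> V \<subseteq> cimg c \<longrightarrow>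
        (f \<in> hol X V \<longleftrightarrow> holo_on (cdim c) (cpre c V) (f \<circ> cproj c)))"

definition chart_embedding :: "'a chart \<Rightarrow> 'a chart \<Rightarrow> (cvec \<Rightarrow> cvec) \<Rightarrow> bool" where
  "chart_embedding c a e \<longleftrightarrow>
     cdim c = cdim a \<and> e ` cdom c \<subseteq> cdom a \<and> open_in_C (cdim a) (e ` cdom c) \<and>
     inj_on e (cdom c) \<and> holo_map (cdim c) (cdim a) (cdom c) e \<and>
     holo_map (cdim a) (cdim c) (e ` cdom c) (inv_into (cdom c) e) \<and>
     (\<forall>z\<in>cdom c. cproj a (e z) = cproj c z) \<and>
     (\<exists>\<theta>\<in>hom ((BijGroup (cvecs (cdim c)))\<lparr>carrier := cgrp c\<rparr>)
                ((BijGroup (cvecs (cdim a)))\<lparr>carrier := cgrp a\<rparr>).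
        inj_on \<theta> (cgrp c) \<and> (\<forall>g\<in>cgrp c. \<forall>z\<in>cdom c. e (g z) = \<theta> g (e z)))"

definition compatible_charts :: "'a ringed \<Rightarrow> 'a chart \<Rightarrow> 'a chart \<Rightarrow> bool" where
  "compatible_charts X a b \<longleftrightarrow> (\<forall>x\<in>cimg a \<inter> cimg b. \<exists>c e e'. quotient_chart X c \<and> x \<in> cimg c \<and>
     chart_embedding c a e \<and> chart_embedding c b e')"

text \<open>The groups are not required to be small: atlases of small charts are a special case.\<close>

definition complex_orbifold :: "'a ringed \<Rightarrow> nat \<Rightarrow> 'a chart set \<Rightarrow> bool" where
  "complex_orbifold X n \<A> \<longleftrightarrow> reduced_complex_space X \<and>
     (\<forall>a\<in>\<A>. quotient_chart X a \<and> cdim a = n) \<and>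
     (\<Union>a\<in>\<A>. cimg a) = topspace (utop X) \<and>
     (\<forall>a\<in>\<A>. \<forall>b\<in>\<A>. compatible_charts X a b)"

text \<open>The charts with trivial group are the (inverses of the) holomorphic coordinate charts of the
  manifold of regular points.\<close>

definition reg_charts :: "'a ringed \<Rightarrow> 'a chart set" where
  "reg_charts X = {c. quotient_chart X c \<and> cgrp c = {\<lambda>z\<in>cvecs (cdim c). z}}"


section \<open>Sheaves of forms\<close>

text \<open>A section over an open \<open>U\<close> is a family of forms indexed by charts, the form with index \<open>c\<close> living
  on the preimage of \<open>U\<close> in the domain of \<open>c\<close>, and vanishing for indices outside the atlas.\<close>

type_synonym 'a sec = "'a chart \<Rightarrow> form"

definition orb_forms :: "'a ringed \<Rightarrow> 'a chart set \<Rightarrow> nat \<Rightarrow> 'a set \<Rightarrow> 'a sec set" where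
  "orb_forms X \<A> k U = {\<sigma>.
     (\<forall>a. a \<notin> \<A> \<longrightarrow> \<sigma> a = 0) \<and>
     (\<forall>a\<in>\<A>. \<sigma> a \<in> kforms (cdim a) k (cpre a U) \<and>
        (\<forall>g\<in>cgrp a. pull_form (cdim a) (cpre a U) g (\<sigma> a) = \<sigma> a)) \<and>
     (\<forall>a\<in>\<A>. \<forall>b\<in>\<A>. \<forall>c e e'. quotient_chart X c \<longrightarrow>
        chart_embedding c a e \<longrightarrow> chart_embedding c b e' \<longrightarrow>
        pull_form (cdim c) (cpre c U) e (\<sigma> a) = pull_form (cdim c) (cpre c U) e' (\<sigma> b))}"

definition is_restriction ::
  "'a ringed \<Rightarrow> 'a sec \<Rightarrow> 'a set \<Rightarrow> ('a \<Rightarrow> cvec) \<Rightarrow> form \<Rightarrow> bool" where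
  "is_restriction X \<sigma> V j \<Theta> \<longleftrightarrow> (\<forall>c\<in>reg_charts X. \<forall>z\<in>cpre c V.
     \<sigma> c z = pull_form (cdim c) (cpre c V) (j \<circ> cproj c) \<Theta> z)"

definition space_forms :: "'a ringed \<Rightarrow> nat \<Rightarrow> 'a set \<Rightarrow> 'a sec set" where
  "space_forms X k U = {\<sigma> \<in> orb_forms X (reg_charts X) k U.
     \<forall>x\<in>U. \<exists>V N \<Omega> j \<Theta>. x \<in> V \<and> V \<subseteq> U \<and> local_embedding X V N \<Omega> j \<and>
       \<Theta> \<in> kforms N k \<Omega> \<and> is_restriction X \<sigma> V j \<Theta>}"

definition rst :: "'a set \<Rightarrow> 'a sec \<Rightarrow> 'a sec" where
  "rst U \<sigma> = (\<lambda>a z vs. if z \<in> cpre a U then \<sigma> a z vs else 0)"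

definition dsec :: "'a set \<Rightarrow> 'a sec \<Rightarrow> 'a sec" where
  "dsec U \<sigma> = (\<lambda>a. ext_d (cdim a) (cpre a U) (\<sigma> a))"

text \<open>The pull-back to the orbifold charts of a smooth form on the space is determined by its
  restriction to the preimage of the regular points, which is dense.\<close>

definition orb_pullback :: "'a ringed \<Rightarrow> 'a chart set \<Rightarrow> nat \<Rightarrow> 'a set \<Rightarrow> 'a sec \<Rightarrow> 'a sec" where
  "orb_pullback X \<A> k U \<sigma> = (THE \<tau>. \<tau> \<in> orb_forms X \<A> k U \<and>
     (\<forall>a\<in>\<A>. \<forall>c\<in>reg_charts X. \<forall>z\<in>cpre a (U \<inter> cimg c).
        \<tau> a z = pull_form (cdim a) (cpre a (U \<inter> cimg c))
                  (inv_into (cdom c) (cproj c) \<circ> cproj a) (\<sigma> c) z))"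


section \<open>Cohomology\<close>

text \<open>Cohomology of global sections.\<close>

definition closed_sections ::
  "'a topology \<Rightarrow> (nat \<Rightarrow> 'a set \<Rightarrow> 'a sec set) \<Rightarrow> nat \<Rightarrow> 'a sec set" where
  "closed_sections T S m = {\<sigma> \<in> S m (topspace T). dsec (topspace T) \<sigma> = 0}"

definition cohomologous ::
  "'a topology \<Rightarrow> (nat \<Rightarrow> 'a set \<Rightarrow> 'a sec set) \<Rightarrow> nat \<Rightarrow> ('a sec \<times> 'a sec) set" where
  "cohomologous T S m = {(\<sigma>, \<tau>). \<sigma> \<in> closed_sections T S m \<and> \<tau> \<in> closed_sections T S m \<and>
     (if m = 0 then \<sigma> = \<tau> else \<exists>\<eta>\<in>S (m - 1) (topspace T). \<sigma> - \<tau> = dsec (topspace T) \<eta>)}"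

definition global_cohomology ::
  "'a topology \<Rightarrow> (nat \<Rightarrow> 'a set \<Rightarrow> 'a sec set) \<Rightarrow> nat \<Rightarrow> 'a sec set set" where
  "global_cohomology T S m = closed_sections T S m // cohomologous T S m"

text \<open>Hypercohomology of the complex of sheaves \<open>S\<close>: the direct limit, over open covers, of the
  cohomology of the total complex of the Cech double complex. Covers indexed by the points of the
  space, the member with index \<open>x\<close> being a neighbourhood of \<open>x\<close>, are cofinal. They are directed by
  pointwise inclusion, and the refinement maps between them are plain restrictions. A cochain of total
  degree \<open>m\<close> has its component with index \<open>[x\<^sub>0, \<dots>, x\<^sub>p]\<close> in degree \<open>m - p\<close>.\<close>

definition nbhd_cover :: "'a topology \<Rightarrow> ('a \<Rightarrow> 'a set) \<Rightarrow> bool" where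
  "nbhd_cover T \<U> \<longleftrightarrow> (\<forall>x\<in>topspace T. openin T (\<U> x) \<and> x \<in> \<U> x)"

abbreviation meets :: "('a \<Rightarrow> 'a set) \<Rightarrow> 'a list \<Rightarrow> 'a set" where
  "meets \<U> xs \<equiv> \<Inter> (\<U> ` set xs)"

definition cech_indices :: "'a topology \<Rightarrow> nat \<Rightarrow> 'a list set" where
  "cech_indices T m = {xs. xs \<noteq> [] \<and> set xs \<subseteq> topspace T \<and> length xs \<le> m + 1}"

definition cochains ::
  "'a topology \<Rightarrow> (nat \<Rightarrow> 'a set \<Rightarrow> 'a sec set) \<Rightarrow> nat \<Rightarrow> ('a \<Rightarrow> 'a set) \<Rightarrow> ('a list \<Rightarrow> 'a sec) set" where
  "cochains T S m \<U> = {c. \<forall>xs. if xs \<in> cech_indices T m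
     then c xs \<in> S (m + 1 - length xs) (meets \<U> xs) else c xs = 0}"

definition total_d ::
  "'a topology \<Rightarrow> ('a \<Rightarrow> 'a set) \<Rightarrow> ('a list \<Rightarrow> 'a sec) \<Rightarrow> 'a list \<Rightarrow> 'a sec" where
  "total_d T \<U> c xs = (\<lambda>a z vs. if xs \<noteq> [] \<and> set xs \<subseteq> topspace T
     then (\<Sum>i<length xs. (-1) ^ i * rst (meets \<U> xs) (c (omit i xs)) a z vs)
          + (-1) ^ (length xs - 1) * dsec (meets \<U> xs) (c xs) a z vs
     else 0)"

definition hyper_cocycles ::
  "'a topology \<Rightarrow> (nat \<Rightarrow> 'a set \<Rightarrow> 'a sec set) \<Rightarrow> nat \<Rightarrow>
    (('a \<Rightarrow> 'a set) \<times> ('a list \<Rightarrow> 'a sec)) set" where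
  "hyper_cocycles T S m = {(\<U>, c). nbhd_cover T \<U> \<and> c \<in> cochains T S m \<U> \<and> total_d T \<U> c = 0}"

definition refine :: "('a \<Rightarrow> 'a set) \<Rightarrow> ('a list \<Rightarrow> 'a sec) \<Rightarrow> 'a list \<Rightarrow> 'a sec" where
  "refine \<W> c xs = rst (meets \<W> xs) (c xs)"

definition hyper_rel ::
  "'a topology \<Rightarrow> (nat \<Rightarrow> 'a set \<Rightarrow> 'a sec set) \<Rightarrow> nat \<Rightarrow>
    ((('a \<Rightarrow> 'a set) \<times> ('a list \<Rightarrow> 'a sec)) \<times> (('a \<Rightarrow> 'a set) \<times> ('a list \<Rightarrow> 'a sec))) set" where
  "hyper_rel T S m = {((\<U>, c), (\<V>, c')).
     (\<U>, c) \<in> hyper_cocycles T S m \<and> (\<V>, c') \<in> hyper_cocycles T S m \<and>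
     (\<exists>\<W>. nbhd_cover T \<W> \<and> (\<forall>x\<in>topspace T. \<W> x \<subseteq> \<U> x \<inter> \<V> x) \<and>
        (\<exists>b \<in> (if m = 0 then {0} else cochains T S (m - 1) \<W>).
           refine \<W> c - refine \<W> c' = total_d T \<W> b))}"

type_synonym 'a hyperclass = "(('a \<Rightarrow> 'a set) \<times> ('a list \<Rightarrow> 'a sec)) set"

definition hypercohomology ::
  "'a topology \<Rightarrow> (nat \<Rightarrow> 'a set \<Rightarrow> 'a sec set) \<Rightarrow> nat \<Rightarrow> 'a hyperclass set" where
  "hypercohomology T S m = hyper_cocycles T S m // hyper_rel T S m"

definition form_hyperclass ::
  "'a topology \<Rightarrow> (nat \<Rightarrow> 'a set \<Rightarrow> 'a sec set) \<Rightarrow> nat \<Rightarrow> 'a sec \<Rightarrow> 'a hyperclass" where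
  "form_hyperclass T S m \<sigma> = hyper_rel T S m ``
     {(\<lambda>_. topspace T, \<lambda>xs. if length xs = 1 \<and> set xs \<subseteq> topspace T then \<sigma> else 0)}"


section \<open>The natural morphism\<close>

definition H_dR :: "'a ringed \<Rightarrow> nat \<Rightarrow> 'a hyperclass set" where
  "H_dR X m = hypercohomology (utop X) (space_forms X) m"

text \<open>The real cohomology of the orbifold, in its de Rham model.\<close>

definition H_orb :: "'a ringed \<Rightarrow> 'a chart set \<Rightarrow> nat \<Rightarrow> 'a sec set set" where
  "H_orb X \<A> m = global_cohomology (utop X) (orb_forms X \<A>) m"

definition orb_class :: "'a ringed \<Rightarrow> 'a chart set \<Rightarrow> nat \<Rightarrow> 'a sec \<Rightarrow> 'a sec set" where
  "orb_class X \<A> m \<sigma> = cohomologous (utop X) (orb_forms X \<A>) m `` {\<sigma>}"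

definition hyper_pullback ::
  "'a ringed \<Rightarrow> 'a chart set \<Rightarrow> nat \<Rightarrow> 'a hyperclass \<Rightarrow> 'a hyperclass" where
  "hyper_pullback X \<A> m \<kappa> = (\<Union>(\<U>, c)\<in>\<kappa>. hyper_rel (utop X) (orb_forms X \<A>) m ``
     {(\<U>, \<lambda>xs. if xs \<in> cech_indices (utop X) m
               then orb_pullback X \<A> (m + 1 - length xs) (meets \<U> xs) (c xs) else 0)})"

text \<open>Sheaves of orbifold smooth forms have partitions of unity, so on a compact orbifold the following
  comparison map is a bijection from \<open>H_orb X \<A> m\<close> onto the hypercohomology of the complex of orbifold
  smooth forms.\<close>

definition orb_comparison ::
  "'a ringed \<Rightarrow> 'a chart set \<Rightarrow> nat \<Rightarrow> 'a sec set \<Rightarrow> 'a hyperclass" where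
  "orb_comparison X \<A> m h = (\<Union>\<sigma>\<in>h. form_hyperclass (utop X) (orb_forms X \<A>) m \<sigma>)"

definition natural_morphism ::
  "'a ringed \<Rightarrow> 'a chart set \<Rightarrow> nat \<Rightarrow> 'a hyperclass \<Rightarrow> 'a sec set" where
  "natural_morphism X \<A> m \<kappa> =
     inv_into (H_orb X \<A> m) (orb_comparison X \<A> m) (hyper_pullback X \<A> m \<kappa>)"


section \<open>Kaehler forms and classes\<close>

definition kahler_form :: "'a ringed \<Rightarrow> 'a sec \<Rightarrow> bool" where
  "kahler_form X \<omega> \<longleftrightarrow> \<omega> \<in> space_forms X 2 (topspace (utop X)) \<and>
     (\<forall>c\<in>reg_charts X. type_1_1 (cdim c) (cdom c) (\<omega> c)) \<and>
     (\<forall>x\<in>topspace (utop X). \<exists>V N \<Omega> j \<phi>. x \<in> V \<and> local_embedding X V N \<Omega> j \<and>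
        smooth_strictly_psh N \<Omega> \<phi> \<and> is_restriction X \<omega> V j (i_ddbar N \<Omega> \<phi>))"

definition kahler_complex_space :: "'a ringed \<Rightarrow> bool" where
  "kahler_complex_space X \<longleftrightarrow> reduced_complex_space X \<and> (\<exists>\<omega>. kahler_form X \<omega>)"

definition kahler_class :: "'a ringed \<Rightarrow> 'a hyperclass \<Rightarrow> bool" where
  "kahler_class X \<kappa> \<longleftrightarrow> \<kappa> \<in> H_dR X 2 \<and>
     (\<exists>\<omega>. kahler_form X \<omega> \<and> \<kappa> = form_hyperclass (utop X) (space_forms X) 2 \<omega>)"

definition orbifold_kahler_form :: "'a ringed \<Rightarrow> 'a chart set \<Rightarrow> 'a sec \<Rightarrow> bool" where
  "orbifold_kahler_form X \<A> \<omega> \<longleftrightarrow> \<omega> \<in> orb_forms X \<A> 2 (topspace (utop X)) \<and>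
     (\<forall>a\<in>\<A>. kahler_form_on (cdim a) (cdom a) (\<omega> a))"

definition kahler_orbifold :: "'a ringed \<Rightarrow> nat \<Rightarrow> 'a chart set \<Rightarrow> bool" where
  "kahler_orbifold X n \<A> \<longleftrightarrow> complex_orbifold X n \<A> \<and> (\<exists>\<omega>. orbifold_kahler_form X \<A> \<omega>)"

definition orbifold_kahler_class :: "'a ringed \<Rightarrow> 'a chart set \<Rightarrow> 'a sec set \<Rightarrow> bool" where
  "orbifold_kahler_class X \<A> h \<longleftrightarrow> h \<in> H_orb X \<A> 2 \<and>
     (\<exists>\<omega>. orbifold_kahler_form X \<A> \<omega> \<and> h = orb_class X \<A> 2 \<omega>)"

end

(*
A local Kaehler potential phi on an ambient space pulls back along pi_a and the local embedding j to
phi o j o pi_a on the orbifold chart a. So the pull-back of a Kaehler form omega is semipositive, and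
its degenerate directions at a point are the kernel of the differential of j o pi_a.

The chart carries the invariant function u_a(z) = sum_g |g z|^2, which is strictly plurisubharmonic.
Let f be a finite sum of products beta u_a, where the bump functions beta come from the ambient spaces
of the embeddings. In a degenerate direction all relevant derivatives of beta vanish, so there
i ddbar f is the positive combination of the forms beta i ddbar u_a. By compactness of X and of the unit
sphere, omega + eps i ddbar f is positive for small eps > 0, and it is cohomologous to the pull-back
of omega since i ddbar f is exact. No estimate on the degeneracy of omega is needed.

To compare classes one uses that, by partitions of unity, global orbifold forms that become
cohomologous in the Cech double complex already differ by the differential of a global form.
Identities between pulled back forms hold because they hold at the points with trivial isotropy, which
are dense.
*)

theory Submission
  imports Defs "HOL-Complex_Analysis.Complex_Analysis"
begin

section \<open>The coordinate spaces\<close>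

text \<open>Both summands of the final form have local potentials that are functions on X itself,
  one function serving all charts. Hence closedness, type (1,1) and the behaviour under changes of
  charts reduce to the naturality of i ddbar of functions under holomorphic maps. This uses second
  derivatives, while the function sheaf only yields functions that are once differentiable with
  complex linear differential; smoothness is recovered from Cauchy's formula along complex lines. A
  bump function rho o F is harmless in a direction v with dF v = 0: its first derivatives along v
  and iv factor through dF v, and its Levi form is that of rho at dF v. A bump function made in a
  chart would have no such property. The class of the form is a second obstacle. The pull-back is a
  definite description and the natural morphism a chosen preimage, so existence and uniqueness of
  the pull-back and injectivity of the comparison map are all proved. A regular chart is tied to the
  atlas only through the function sheaf, and the passage between them takes place at points with
  trivial isotropy, around which an orbifold chart restricts to a regular one.\<close>

abbreviation coord :: "cvec \<Rightarrow> nat \<Rightarrow> complex" where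
  "coord \<equiv> Poly_Mapping.lookup"

lemma cvecs_iff: "z \<in> cvecs n \<longleftrightarrow> (\<forall>i\<ge>n. coord z i = 0)"
  unfolding cvecs_def in_keys_iff subset_iff mem_Collect_eq lessThan_iff by (meson not_le)

lemma coord_scaleR [simp]: "coord (a *\<^sub>R z) i = a *\<^sub>R coord z i"
proof -
  have "finite {i. a *\<^sub>R coord z i \<noteq> 0}"
    by (rule finite_subset[OF _ finite_lookup[of z]]) auto
  then show ?thesis by (simp add: scaleR_poly_mapping_def)
qed

lemma coord_cmul [simp]: "coord (cmul c z) i = c * coord z i"
  by (simp add: cmul_def map.rep_eq when_def)

lemma cvec_eqI: "(\<And>i. coord z i = coord w i) \<Longrightarrow> z = w"
  by (rule poly_mapping_eqI)

lemma cvec_eqI_on: "z \<in> cvecs n \<Longrightarrow> w \<in> cvecs n \<Longrightarrow> (\<And>i. i < n \<Longrightarrow> coord z i = coord w i) \<Longrightarrow> z = w"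
  by (rule cvec_eqI) (metis cvecs_iff not_le)

lemma coord_sum [simp]: "coord (sum f A) i = (\<Sum>x\<in>A. coord (f x) i)"
  by (simp add: lookup_sum)

lemma coord_add [simp]: "coord (z + w) i = coord z i + coord w i"
  and coord_diff [simp]: "coord (z - w) i = coord z i - coord w i"
  by (simp_all add: lookup_add lookup_minus)

lemma coord_single: "coord (Poly_Mapping.single i c) j = (if j = i then c else 0)"
  by (simp add: lookup_single when_def)

lemma cvecs_zero [simp]: "0 \<in> cvecs n"
  by (simp add: cvecs_iff)

lemma cvecs_add [simp]: "z \<in> cvecs n \<Longrightarrow> w \<in> cvecs n \<Longrightarrow> z + w \<in> cvecs n"
  and cvecs_diff [simp]: "z \<in> cvecs n \<Longrightarrow> w \<in> cvecs n \<Longrightarrow> z - w \<in> cvecs n"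
  and cvecs_scaleR [simp]: "z \<in> cvecs n \<Longrightarrow> a *\<^sub>R z \<in> cvecs n"
  and cvecs_cmul [simp]: "z \<in> cvecs n \<Longrightarrow> cmul c z \<in> cvecs n"
  by (simp_all add: cvecs_iff)

lemma cvecs_single [simp]: "i < n \<Longrightarrow> Poly_Mapping.single i c \<in> cvecs n"
  by (auto simp: cvecs_iff coord_single)

lemma cvecs_sum [simp]: "(\<And>x. x \<in> A \<Longrightarrow> f x \<in> cvecs n) \<Longrightarrow> sum f A \<in> cvecs n"
  by (simp add: cvecs_iff)

lemma cmul_add: "cmul c (z + w) = cmul c z + cmul c w"
  and cmul_add_left: "cmul (c + d) z = cmul c z + cmul d z"
  and cmul_cmul: "cmul c (cmul d z) = cmul (c * d) z"
  and cmul_scaleR: "cmul c (a *\<^sub>R z) = a *\<^sub>R cmul c z"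
  and cmul_zero [simp]: "cmul c 0 = 0"
  and cmul_zero_left [simp]: "cmul 0 z = 0"
  and cmul_one [simp]: "cmul 1 z = z"
  and cmul_of_real: "cmul (complex_of_real a) z = a *\<^sub>R z"
  by (auto intro!: cvec_eqI simp: algebra_simps scaleR_conv_of_real)

lemma norm_eq_sum_coord:
  assumes "z \<in> cvecs n"
  shows "norm z = (\<Sum>i<n. norm (coord z i))"
proof -
  have "norm z = (\<Sum>i\<in>Poly_Mapping.keys z. norm (coord z i))"
    by (simp add: norm_poly_mapping_def dist_poly_mapping_def)
  also have "\<dots> = (\<Sum>i<n. norm (coord z i))"
    using assms by (intro sum.mono_neutral_left) (auto simp: cvecs_def in_keys_iff)
  finally show ?thesis .
qed

lemma norm_coord_le: "norm (coord z i) \<le> norm z"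
proof (cases "i \<in> Poly_Mapping.keys z")
  case True
  have "norm (coord z i) \<le> (\<Sum>i\<in>Poly_Mapping.keys z. norm (coord z i))"
    by (rule member_le_sum[OF True]) auto
  then show ?thesis by (simp add: norm_poly_mapping_def dist_poly_mapping_def)
qed (simp add: in_keys_iff)

lemma bounded_linear_coord: "bounded_linear (\<lambda>z. coord z i)"
  by (rule bounded_linear_intro[where K=1]) (simp_all add: norm_coord_le)

lemma norm_single [simp]: "norm (Poly_Mapping.single i c :: cvec) = norm c"
  by (cases "c = 0") (simp_all add: norm_poly_mapping_def dist_poly_mapping_def)

lemma bounded_linear_single: "bounded_linear (\<lambda>c. Poly_Mapping.single i c :: cvec)"
  by (rule bounded_linear_intro[where K=1])
     (auto intro!: cvec_eqI simp: coord_single)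

lemma cvecs_expand: "z \<in> cvecs n \<Longrightarrow> z = (\<Sum>i<n. Poly_Mapping.single i (coord z i))"
  by (rule cvec_eqI) (auto simp: coord_single cvecs_iff)

text \<open>Sets open in \<open>cvecs n\<close> are open only relative to this subspace, so a
  derivative within them is determined on the subspace alone. Precomposing with this projection
  selects one representative; composing on the other side shows that derivatives of maps into
  \<open>cvecs n\<close> take values there.\<close>

definition trunc :: "nat \<Rightarrow> cvec \<Rightarrow> cvec" where
  "trunc n z = (\<Sum>i<n. Poly_Mapping.single i (coord z i))"

lemma trunc_in [simp]: "trunc n z \<in> cvecs n"
  unfolding trunc_def by (intro cvecs_sum cvecs_single) simp

lemma trunc_id [simp]: "z \<in> cvecs n \<Longrightarrow> trunc n z = z"
  unfolding trunc_def by (rule cvecs_expand[symmetric])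

lemma bounded_linear_trunc: "bounded_linear (trunc n)"
  unfolding trunc_def
  by (intro bounded_linear_sum bounded_linear_compose[OF bounded_linear_single bounded_linear_coord])

lemma bounded_linear_cmul: "bounded_linear (cmul c)"
proof (rule bounded_linear_intro[where K="norm c"])
  fix z :: cvec
  obtain n where n: "Poly_Mapping.keys z \<subseteq> {..<n}"
    using finite_nat_iff_bounded finite_keys by blast
  then have "z \<in> cvecs n" by (simp add: cvecs_def)
  then show "norm (cmul c z) \<le> norm z * norm c"
    using norm_eq_sum_coord[of z n] norm_eq_sum_coord[of "cmul c z" n]
    by (simp add: norm_mult sum_distrib_left mult.commute)
qed (simp_all add: cmul_add cmul_scaleR)

lemma bounded_linear_cmul_left: "bounded_linear (\<lambda>c. cmul c z)"
proof (rule bounded_linear_intro[where K="norm z"])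
  fix c :: complex
  obtain n where n: "Poly_Mapping.keys z \<subseteq> {..<n}"
    using finite_nat_iff_bounded finite_keys by blast
  then have "z \<in> cvecs n" by (simp add: cvecs_def)
  then show "norm (cmul c z) \<le> norm c * norm z"
    using norm_eq_sum_coord[of z n] norm_eq_sum_coord[of "cmul c z" n]
    by (simp add: norm_mult sum_distrib_left mult.commute)
qed (auto intro!: cvec_eqI simp: algebra_simps)

lemma norm_cmul: "norm (cmul c z) = norm c * norm z"
proof -
  obtain n where n: "Poly_Mapping.keys z \<subseteq> {..<n}"
    using finite_nat_iff_bounded finite_keys by blast
  then have "z \<in> cvecs n" by (simp add: cvecs_def)
  then show "norm (cmul c z) = norm c * norm z"
    using norm_eq_sum_coord[of z n] norm_eq_sum_coord[of "cmul c z" n]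
    by (simp add: norm_mult sum_distrib_left mult.commute)
qed

text \<open>The ambient type is infinite dimensional, with non-compact closed balls, so compactness
  is built up one complex coordinate at a time.\<close>

lemma compact_cvecs_ball: "compact {z \<in> cvecs n. norm z \<le> r}"
proof -
  \<comment> \<open>The induction only encloses the ball in a compact set, since a product of the
    previous set with a disc can be larger than the ball. A closed ball cuts out the right set at
    the end.\<close>
  have sub: "\<exists>K. compact K \<and> K \<subseteq> cvecs n \<and> {z \<in> cvecs n. norm z \<le> r} \<subseteq> K"
  proof (induction n)
    case 0
    have "cvecs 0 = {0}" by (auto simp: cvecs_def)
    then show ?case by (intro exI[of _ "{0}"]) auto
  next
    case (Suc n)
    then obtain K where K: "compact K" "K \<subseteq> cvecs n" "{z \<in> cvecs n. norm z \<le> r} \<subseteq> K" by blast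
    let ?f = "\<lambda>(z, c). z + Poly_Mapping.single n c :: cvec"
    have c: "compact (?f ` (K \<times> cball 0 r))"
      unfolding case_prod_beta
      by (intro compact_continuous_image compact_Times K compact_cball continuous_intros
          bounded_linear.continuous_on[OF bounded_linear_single])
    have "?f ` (K \<times> cball 0 r) \<subseteq> cvecs (Suc n)"
      using K(2) by (force simp: cvecs_iff coord_single)
    moreover have "{z \<in> cvecs (Suc n). norm z \<le> r} \<subseteq> ?f ` (K \<times> cball 0 r)"
    proof
      fix z assume z: "z \<in> {z \<in> cvecs (Suc n). norm z \<le> r}"
      have "norm (trunc n z) \<le> norm z"
      proof -
        have "norm (trunc n z) = (\<Sum>i<n. norm (coord (trunc n z) i))"
          by (rule norm_eq_sum_coord) simp
        also have "\<dots> = (\<Sum>i<n. norm (coord z i))"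
          by (rule sum.cong) (auto simp: trunc_def coord_single)
        also have "\<dots> \<le> norm z"
          using z norm_eq_sum_coord[of z "Suc n"] by simp
        finally show ?thesis .
      qed
      then have "trunc n z \<in> K" using K(3) z by auto
      moreover have "coord z n \<in> cball 0 r" using norm_coord_le[of z n] z by auto
      moreover have "z = ?f (trunc n z, coord z n)"
      proof -
        have "z = (\<Sum>i<Suc n. Poly_Mapping.single i (coord z i))"
          using z by (intro cvecs_expand) auto
        then show ?thesis by (simp add: trunc_def)
      qed
      ultimately show "z \<in> ?f ` (K \<times> cball 0 r)" by blast
    qed
    ultimately show ?case using c by blast
  qed
  then obtain K where K: "compact K" "K \<subseteq> cvecs n" "{z \<in> cvecs n. norm z \<le> r} \<subseteq> K" by blast
  have "{z \<in> cvecs n. norm z \<le> r} = K \<inter> cball 0 r" using K by auto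
  then show ?thesis using K(1) by (simp add: compact_Int_closed)
qed

section \<open>Real coordinates and relatively open sets\<close>

definition rbasis :: "nat \<Rightarrow> cvec" where
  "rbasis k = Poly_Mapping.single (k div 2) (if even k then 1 else \<i>)"

definition rcoord :: "nat \<Rightarrow> cvec \<Rightarrow> real" where
  "rcoord k z = (if even k then Re (coord z (k div 2)) else Im (coord z (k div 2)))"

lemma rbasis_in [simp]: "k < 2 * n \<Longrightarrow> rbasis k \<in> cvecs n"
  by (auto simp: rbasis_def)

lemma bounded_linear_rcoord: "bounded_linear (rcoord k)"
  unfolding rcoord_def
  by (cases "even k") (simp_all add: bounded_linear_compose[OF bounded_linear_Re bounded_linear_coord]
      bounded_linear_compose[OF bounded_linear_Im bounded_linear_coord])

text \<open>The real directions \<open>2 * j\<close> and \<open>Suc (2 * j)\<close> are e_j and i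
  e_j, so this regroups a sum over the real basis into one over complex coordinates.\<close>

lemma sum_double: "(\<Sum>k<2 * n. f k) = (\<Sum>j<n. f (2 * j) + f (Suc (2 * j)) :: 'b::ab_group_add)"
  by (induction n) (simp_all add: algebra_simps)

lemma rbasis_expand: 
  assumes "z \<in> cvecs n" shows "z = (\<Sum>k<2*n. rcoord k z *\<^sub>R rbasis k)"
proof -
  have "(\<Sum>k<2*n. rcoord k z *\<^sub>R rbasis k) = (\<Sum>j<n. Poly_Mapping.single j (coord z j))"
    unfolding sum_double
    by (intro sum.cong refl cvec_eqI) (auto simp: rcoord_def rbasis_def coord_single complex_eq_iff)
  then show ?thesis using cvecs_expand[OF assms] by simp
qed

lemma abs_rcoord_le: "\<bar>rcoord k z\<bar> \<le> norm z"
  using abs_Re_le_cmod[of "coord z (k div 2)"] abs_Im_le_cmod[of "coord z (k div 2)"]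
    norm_coord_le[of z "k div 2"] by (auto simp: rcoord_def)

lemma norm_rbasis [simp]: "norm (rbasis k) = 1"
  by (simp add: rbasis_def)

lemma open_in_C_iff:
  "open_in_C n D \<longleftrightarrow> D \<subseteq> cvecs n \<and> (\<forall>z\<in>D. \<exists>e>0. \<forall>y\<in>cvecs n. dist y z < e \<longrightarrow> y \<in> D)"
  unfolding openin_euclidean_subtopology_iff by auto

lemma open_in_C_subset: "open_in_C n D \<Longrightarrow> z \<in> D \<Longrightarrow> z \<in> cvecs n"
  by (auto simp: open_in_C_iff)

lemma open_in_C_ball: "z \<in> cvecs n \<Longrightarrow> open_in_C n (ball z r \<inter> cvecs n)"
  by (metis Int_commute open_ball openin_open_Int)

lemma open_in_C_ball_sub:
  assumes "open_in_C n D" "z \<in> D"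
  obtains r where "r > 0" "ball z r \<inter> cvecs n \<subseteq> D"
  using assms unfolding open_in_C_iff by (force simp: dist_commute)

lemma compact_cvecs_sphere: "compact {z \<in> cvecs n. norm z = 1}"
proof -
  have "closed {z::cvec. norm z = 1}" by (intro closed_Collect_eq continuous_intros)
  from compact_Int_closed[OF compact_cvecs_ball this, of n 1] show ?thesis
    by (rule back_subst[of compact]) auto
qed

section \<open>Directional derivatives\<close>

lemma add_scaleR_in_open:
  assumes "open_in_C n D" "z \<in> D" "v \<in> cvecs n"
  obtains e where "e > 0" "\<And>t. \<bar>t\<bar> < e \<Longrightarrow> z + t *\<^sub>R v \<in> D"
proof -
  obtain r where r: "r > 0" "ball z r \<inter> cvecs n \<subseteq> D" using open_in_C_ball_sub assms by blast
  show ?thesis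
  proof (rule that[of "r / (norm v + 1)"])
    show "0 < r / (norm v + 1)" using r by (simp add: add_nonneg_pos)
    fix t :: real assume "\<bar>t\<bar> < r / (norm v + 1)"
    then have "\<bar>t\<bar> * (norm v + 1) < r" by (simp add: pos_less_divide_eq add_nonneg_pos)
    then have "norm (t *\<^sub>R v) < r" by (simp add: algebra_simps)
    then have "z + t *\<^sub>R v \<in> ball z r \<inter> cvecs n"
      using assms open_in_C_subset by (auto simp: dist_norm)
    then show "z + t *\<^sub>R v \<in> D" using r by blast
  qed
qed

lemma has_vector_derivative_line:
  assumes "(f has_derivative f') (at z within D)" "open_in_C n D" "z \<in> D" "v \<in> cvecs n"
  shows "((\<lambda>t. f (z + t *\<^sub>R v)) has_vector_derivative f' v) (at 0)"
proof -
  obtain e where e: "e > 0" "\<And>t. \<bar>t\<bar> < e \<Longrightarrow> z + t *\<^sub>R v \<in> D"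
    using add_scaleR_in_open assms by blast
  let ?g = "\<lambda>t::real. z + t *\<^sub>R v"
  have "(?g has_derivative (\<lambda>t. t *\<^sub>R v)) (at 0 within {-e<..<e})"
    by (auto intro!: derivative_eq_intros)
  moreover have "(f has_derivative f') (at (?g 0) within D)" using assms(1) by simp
  then have "(f has_derivative f') (at (?g 0) within ?g ` {-e<..<e})"
    by (rule has_derivative_subset) (use e in auto)
  ultimately have "((\<lambda>t. f (?g t)) has_derivative (\<lambda>t. f' (t *\<^sub>R v))) (at 0 within {-e<..<e})"
    by (rule has_derivative_in_compose)
  then have "((\<lambda>t. f (?g t)) has_derivative (\<lambda>t. f' (t *\<^sub>R v))) (at 0)"
    using e by (subst (asm) at_within_open) auto
  moreover have "f' (t *\<^sub>R v) = t *\<^sub>R f' v" for t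
    using assms(1) by (simp add: has_derivative_def linear_cmul bounded_linear.linear)
  ultimately show ?thesis by (simp add: has_vector_derivative_def)
qed

lemma dird_eq:
  assumes "(f has_derivative f') (at z within D)" "open_in_C n D" "z \<in> D" "v \<in> cvecs n"
  shows "dird v f z = f' v"
  unfolding dird_def by (rule vector_derivative_at[OF has_vector_derivative_line[OF assms]])

text \<open>Displacements within \<open>D\<close> lie in \<open>cvecs n\<close>, where
  \<open>trunc n\<close> is the identity. An arbitrary derivative may therefore be replaced by its
  composite with \<open>trunc n\<close>, and this composite is known from the directional
  derivatives.\<close>

lemma has_derivative_dird:
  assumes "f differentiable (at z within D)" "open_in_C n D" "z \<in> D"
  shows "(f has_derivative (\<lambda>v. dird (trunc n v) f z)) (at z within D)"
proof -
  from assms(1) obtain f' where f': "(f has_derivative f') (at z within D)"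
    by (auto simp: differentiable_def)
  have b: "bounded_linear (\<lambda>v. f' (trunc n v))"
    using f' by (intro bounded_linear_compose[OF _ bounded_linear_trunc]) (simp add: has_derivative_def)
  have "(f has_derivative (\<lambda>v. f' (trunc n v))) (at z within D)"
    using f' b unfolding has_derivative_within
    by (auto elim!: Lim_transform_within[where d=1]
        simp: open_in_C_subset[OF assms(2)] assms(3))
  then show ?thesis using dird_eq[OF f' assms(2,3)] by simp
qed

lemma dird_line:
  assumes "f differentiable (at z within D)" "open_in_C n D" "z \<in> D" "v \<in> cvecs n"
  shows "((\<lambda>t. f (z + t *\<^sub>R v)) has_vector_derivative dird v f z) (at 0)"
  using has_vector_derivative_line[OF has_derivative_dird[OF assms(1-3)] assms(2-4)] assms(4) by simp

text \<open>No differentiability enters: both functions have the same vector derivatives along the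
  line, so the choice operator in \<open>vector_derivative\<close> returns the same value, whatever
  it is.\<close>

lemma dird_cong:
  assumes "open_in_C n D" "z \<in> D" "v \<in> cvecs n" "\<And>y. y \<in> D \<Longrightarrow> f y = g y"
  shows "dird v f z = dird v g z"
proof -
  obtain e where e: "e > 0" "\<And>t. \<bar>t\<bar> < e \<Longrightarrow> z + t *\<^sub>R v \<in> D"
    using add_scaleR_in_open assms by blast
  have ev: "\<forall>\<^sub>F t in at (0::real). f (z + t *\<^sub>R v) = g (z + t *\<^sub>R v)"
    unfolding eventually_at using e assms(4) by (auto intro!: exI[of _ e])
  then have ev2: "\<forall>\<^sub>F t in at (0::real). g (z + t *\<^sub>R v) = f (z + t *\<^sub>R v)"
    by (simp add: eq_commute)
  have "((\<lambda>t. f (z + t *\<^sub>R v)) has_vector_derivative d) (at 0) \<longleftrightarrow>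
        ((\<lambda>t. g (z + t *\<^sub>R v)) has_vector_derivative d) (at 0)" for d
    unfolding has_vector_derivative_def
    using has_derivative_transform_eventually[OF _ ev] has_derivative_transform_eventually[OF _ ev2]
      assms(2,4) by auto
  then show ?thesis by (simp add: dird_def vector_derivative_def)
qed

lemma differentiable_at_cong:
  assumes "f differentiable (at z within D)" "z \<in> D" "\<And>y. y \<in> D \<Longrightarrow> f y = g y"
  shows "g differentiable (at z within D)"
  using assms unfolding differentiable_def by (metis has_derivative_transform)

lemma differentiable_on_cong':
  assumes "f differentiable_on D" "\<And>y. y \<in> D \<Longrightarrow> f y = g y"
  shows "g differentiable_on D"
  using assms unfolding differentiable_on_def by (metis differentiable_at_cong)

lemma dird_linear:
  assumes "f differentiable (at z within D)" "open_in_C n D" "z \<in> D" "u \<in> cvecs n" "v \<in> cvecs n"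
  shows "dird (a *\<^sub>R u + b *\<^sub>R v) f z = a *\<^sub>R dird u f z + b *\<^sub>R dird v f z"
proof -
  have "linear (\<lambda>v. dird (trunc n v) f z)"
    using has_derivative_dird[OF assms(1-3)] by (simp add: has_derivative_def bounded_linear.linear)
  from linear_add[OF this, of "a *\<^sub>R u" "b *\<^sub>R v"] linear_cmul[OF this, of a u] linear_cmul[OF this, of b v]
  show ?thesis using assms by simp
qed

lemma dird_sum_dir:
  assumes "f differentiable (at z within D)" "open_in_C n D" "z \<in> D" "\<And>i. i \<in> I \<Longrightarrow> u i \<in> cvecs n"
  shows "dird (\<Sum>i\<in>I. a i *\<^sub>R u i) f z = (\<Sum>i\<in>I. a i *\<^sub>R dird (u i) f z)"
proof -
  have "linear (\<lambda>v. dird (trunc n v) f z)"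
    using has_derivative_dird[OF assms(1-3)] by (simp add: has_derivative_def bounded_linear.linear)
  have "dird (a i *\<^sub>R u i) f z = a i *\<^sub>R dird (u i) f z" if "i \<in> I" for i
    using linear_cmul[OF \<open>linear _\<close>, of "a i" "u i"] that assms(4) by simp
  with linear_sum[OF \<open>linear _\<close>, of "\<lambda>i. a i *\<^sub>R u i" I] show ?thesis
    using assms(4) by simp
qed

lemma dird_rbasis:
  assumes "f differentiable (at z within D)" "open_in_C n D" "z \<in> D" "v \<in> cvecs n"
  shows "dird v f z = (\<Sum>k<2*n. rcoord k v *\<^sub>R dird (rbasis k) f z)"
  by (subst rbasis_expand[OF assms(4)], rule dird_sum_dir[OF assms(1-3)]) simp

lemma dird_const [simp]: "dird v (\<lambda>_. c) z = 0"
  unfolding dird_def by simp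

lemma dird_id [simp]: "dird v (\<lambda>y. y) z = v"
  unfolding dird_def by (rule vector_derivative_at) (auto intro!: derivative_eq_intros)

lemma dird_bounded_linear:
  assumes "bounded_linear L"
  shows "dird v L z = L v"
  unfolding dird_def
proof (rule vector_derivative_at)
  interpret bounded_linear L by fact
  show "((\<lambda>t. L (z + t *\<^sub>R v)) has_vector_derivative L v) (at 0)"
    by (auto simp: has_vector_derivative_def add scaleR intro!: derivative_eq_intros)
qed

lemma dird_linear_comp:
  assumes "f differentiable (at z within D)" "open_in_C n D" "z \<in> D" "v \<in> cvecs n" "bounded_linear L"
  shows "dird v (\<lambda>y. L (f y)) z = L (dird v f z)"
  using dird_eq[OF bounded_linear.has_derivative[OF assms(5) has_derivative_dird[OF assms(1-3)]] assms(2-4)]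
    assms(4) by simp

lemma dird_bilinear:
  assumes "f differentiable (at z within D)" "g differentiable (at z within D)"
    "open_in_C n D" "z \<in> D" "v \<in> cvecs n" "bounded_bilinear B"
  shows "dird v (\<lambda>y. B (f y) (g y)) z = B (f z) (dird v g z) + B (dird v f z) (g z)"
  using dird_eq[OF bounded_bilinear.FDERIV[OF assms(6) has_derivative_dird[OF assms(1,3,4)]
        has_derivative_dird[OF assms(2,3,4)]] assms(3-5)] assms(5) by simp

lemma dird_add:
  assumes "f differentiable (at z within D)" "g differentiable (at z within D)"
    "open_in_C n D" "z \<in> D" "v \<in> cvecs n"
  shows "dird v (\<lambda>y. f y + g y) z = dird v f z + dird v g z"
  using dird_eq[OF has_derivative_add[OF has_derivative_dird[OF assms(1,3,4)]
        has_derivative_dird[OF assms(2,3,4)]] assms(3-5)] assms(5) by simp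

lemma dird_sum:
  assumes "\<And>i. i \<in> I \<Longrightarrow> f i differentiable (at z within D)"
    "open_in_C n D" "z \<in> D" "v \<in> cvecs n"
  shows "dird v (\<lambda>y. \<Sum>i\<in>I. f i y) z = (\<Sum>i\<in>I. dird v (f i) z)"
  using dird_eq[OF has_derivative_sum[OF has_derivative_dird[OF assms(1-3)]] assms(2-4)] assms(4) by simp

lemma differentiable_compose_on:
  assumes "F differentiable (at z within D)" "g differentiable (at (F z) within E)"
    "\<And>y. y \<in> D \<Longrightarrow> F y \<in> E"
  shows "(\<lambda>y. g (F y)) differentiable (at z within D)"
  using differentiable_chain_within[of F z D g] differentiable_within_subset[OF assms(2), of "F ` D"] assms
  by (auto simp: o_def)

lemma dird_compose_has_derivative:
  assumes "F differentiable (at z within D)" "(g has_derivative g') (at (F z) within E)"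
    "\<And>y. y \<in> D \<Longrightarrow> F y \<in> E" "open_in_C n D" "z \<in> D" "v \<in> cvecs n"
  shows "dird v (\<lambda>y. g (F y)) z = g' (dird v F z)"
proof -
  have "((\<lambda>y. g (F y)) has_derivative (\<lambda>v. g' (dird (trunc n v) F z))) (at z within D)"
    by (rule has_derivative_in_compose[OF has_derivative_dird[OF assms(1,4,5)]
          has_derivative_subset[OF assms(2)]]) (use assms(3) in auto)
  from dird_eq[OF this assms(4-6)] show ?thesis using assms(6) by simp
qed

text \<open>\<open>F\<close> coincides on \<open>D\<close> with \<open>trunc m\<close> composed with
  \<open>F\<close>, and the derivative passes through the bounded linear map
  \<open>trunc m\<close>.\<close>

lemma dird_in_cvecs:
  assumes "F differentiable (at z within D)" "\<And>y. y \<in> D \<Longrightarrow> F y \<in> cvecs m"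
    "open_in_C n D" "z \<in> D" "v \<in> cvecs n"
  shows "dird v F z \<in> cvecs m"
proof -
  have "dird v F z = dird v (\<lambda>y. trunc m (F y)) z"
    by (rule dird_cong[OF assms(3-5)]) (simp add: assms(2))
  also have "\<dots> = trunc m (dird v F z)"
    by (rule dird_linear_comp[OF assms(1,3-5) bounded_linear_trunc])
  finally show ?thesis by (metis trunc_in)
qed

lemma dird_compose:
  assumes "F differentiable (at z within D)" "g differentiable (at (F z) within E)"
    "\<And>y. y \<in> D \<Longrightarrow> F y \<in> E" "open_in_C n D" "open_in_C m E" "z \<in> D" "v \<in> cvecs n"
  shows "dird v (\<lambda>y. g (F y)) z = dird (dird v F z) g (F z)"
proof -
  have "F z \<in> E" using assms by simp
  have "dird v F z \<in> cvecs m"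
    by (rule dird_in_cvecs[OF assms(1) _ assms(4,6,7)]) (use assms(3,5) open_in_C_subset in blast)
  then show ?thesis
    using dird_compose_has_derivative[OF assms(1) has_derivative_dird[OF assms(2,5) \<open>F z \<in> E\<close>] assms(3,4,6,7)]
    by simp
qed

text \<open>The increment of \<open>f\<close> is split along the real basis and each step is estimated by the mean value
  inequality.\<close>

lemma differentiable_if_continuous_dird:
  fixes f :: "cvec \<Rightarrow> 'b::real_normed_vector"
  assumes D: "open_in_C n D" and z0: "z0 \<in> D"
    and deriv: "\<And>z v. z \<in> D \<Longrightarrow> v \<in> cvecs n \<Longrightarrow>
      ((\<lambda>t. f (z + t *\<^sub>R v)) has_vector_derivative g v z) (at 0)"
    and cont: "\<And>v. v \<in> cvecs n \<Longrightarrow> continuous_on D (g v)"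
  shows "f differentiable (at z0 within D)"
proof -
  let ?e = "rbasis" and ?N = "2 * n"
  define L where "L v = (\<Sum>k<?N. rcoord k v *\<^sub>R g (?e k) z0)" for v
  have bl: "bounded_linear L"
    unfolding L_def
    by (intro bounded_linear_sum bounded_linear_compose[OF bounded_linear_scaleR_left bounded_linear_rcoord])
  have "(f has_derivative L) (at z0 within D)"
    unfolding has_derivative_within_alt
  proof (intro conjI bl allI impI)
    fix \<epsilon> :: real assume "\<epsilon> > 0"
    \<comment> \<open>Each of the \<open>?N\<close> steps along the real basis costs
      \<open>\<epsilon>' * norm v\<close>, so together they stay below
      \<open>\<epsilon> * norm v\<close>. The summand 1 covers the case of dimension 0.\<close>
    define \<epsilon>' where "\<epsilon>' = \<epsilon> / (real ?N + 1)"
    have e': "\<epsilon>' > 0" using \<open>\<epsilon> > 0\<close> by (simp add: \<epsilon>'_def)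
    have "\<exists>d>0. \<forall>y\<in>D. dist y z0 < d \<longrightarrow> (\<forall>k<?N. dist (g (?e k) y) (g (?e k) z0) < \<epsilon>')"
    proof -
      have "\<forall>k<?N. \<exists>d>0. \<forall>y\<in>D. dist y z0 < d \<longrightarrow> dist (g (?e k) y) (g (?e k) z0) < \<epsilon>'"
        using cont z0 e' unfolding continuous_on_iff by simp
      then obtain d where d: "\<And>k. k < ?N \<Longrightarrow> d k > 0 \<and> (\<forall>y\<in>D. dist y z0 < d k \<longrightarrow> dist (g (?e k) y) (g (?e k) z0) < \<epsilon>')"
        by metis
      let ?d = "Min (insert 1 (d ` {..<?N}))"
      have "?d > 0" using d by (subst Min_gr_iff) auto
      moreover have "?d \<le> d k" if "k < ?N" for k using that by simp
      ultimately show ?thesis using d by (intro exI[of _ ?d]) (meson less_le_trans)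
    qed
    then obtain d1 where d1: "d1 > 0" "\<And>y k. y \<in> D \<Longrightarrow> dist y z0 < d1 \<Longrightarrow> k < ?N \<Longrightarrow> dist (g (?e k) y) (g (?e k) z0) < \<epsilon>'"
      by blast
    obtain r where r: "r > 0" "ball z0 r \<inter> cvecs n \<subseteq> D" using open_in_C_ball_sub D z0 by blast
    \<comment> \<open>An intermediate point differs from \<open>z0\<close> by at most
      \<open>?N\<close> terms of norm at most \<open>norm v\<close>, because a real coordinate is
      bounded by the norm. Dividing by \<open>?N + 1\<close> keeps the whole broken path within
      \<open>min d1 r\<close>.\<close>
    define d where "d = min d1 r / (real ?N + 1)"
    have "d > 0" using d1 r by (simp add: d_def)
    moreover have "norm (f y - f z0 - L (y - z0)) \<le> \<epsilon> * norm (y - z0)" if y: "y \<in> D" "norm (y - z0) < d" for y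
    proof -
      define v where "v = y - z0"
      have v: "v \<in> cvecs n" using y z0 D open_in_C_subset by (auto simp: v_def)
      define p where "p k = z0 + (\<Sum>i<k. rcoord i v *\<^sub>R ?e i)" for k
      have pN: "p ?N = y" using rbasis_expand[OF v] by (simp add: p_def v_def)
      have p0: "p 0 = z0" by (simp add: p_def)
      have near: "p k + t *\<^sub>R (rcoord k v *\<^sub>R ?e k) \<in> D \<and> dist (p k + t *\<^sub>R (rcoord k v *\<^sub>R ?e k)) z0 < d1"
        if k: "k < ?N" and t: "0 \<le> t" "t \<le> 1" for k t
      proof -
        let ?q = "p k + t *\<^sub>R (rcoord k v *\<^sub>R ?e k)"
        have eq: "?q - z0 = (\<Sum>i<k. rcoord i v *\<^sub>R ?e i) + t *\<^sub>R (rcoord k v *\<^sub>R ?e k)"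
          by (simp add: p_def)
        have "norm (?q - z0) \<le> norm (\<Sum>i<k. rcoord i v *\<^sub>R ?e i) + norm (t *\<^sub>R (rcoord k v *\<^sub>R ?e k))"
          unfolding eq by (rule norm_triangle_ineq)
        also have "\<dots> \<le> (\<Sum>i<k. norm v) + norm v"
        proof (intro add_mono)
          show "norm (\<Sum>i<k. rcoord i v *\<^sub>R ?e i) \<le> (\<Sum>i<k. norm v)"
            by (intro order_trans[OF norm_sum] sum_mono) (simp add: abs_rcoord_le)
          have "\<bar>t\<bar> * \<bar>rcoord k v\<bar> \<le> 1 * norm v"
            using t by (intro mult_mono) (auto simp: abs_rcoord_le)
          then show "norm (t *\<^sub>R (rcoord k v *\<^sub>R ?e k)) \<le> norm v"
            by (simp add: abs_mult)
        qed
        also have "\<dots> = real (Suc k) * norm v" by (simp add: algebra_simps)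
        also have "\<dots> \<le> (real ?N + 1) * norm v"
          using k by (intro mult_right_mono) auto
        also have "\<dots> < min d1 r"
          using y by (simp add: d_def v_def pos_less_divide_eq mult.commute)
        finally have *: "norm (?q - z0) < min d1 r" .
        have "?q \<in> cvecs n"
          using k z0 D open_in_C_subset unfolding p_def by (auto intro!: cvecs_add cvecs_scaleR cvecs_sum)
        with * r show ?thesis by (auto simp: dist_norm norm_minus_commute)
      qed
      have step: "norm (f (p (Suc k)) - f (p k) - rcoord k v *\<^sub>R g (?e k) z0) \<le> \<epsilon>' * norm v" if k: "k < ?N" for k
      proof -
        let ?a = "rcoord k v" and ?w = "rcoord k v *\<^sub>R ?e k"
        \<comment> \<open>Along the k-th segment this is \<open>f\<close> minus its expected linear
          growth; its derivative is small by continuity of \<open>g\<close> at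
          \<open>z0\<close>.\<close>
        define h where "h t = f (p k + t *\<^sub>R ?w) - (t * ?a) *\<^sub>R g (?e k) z0" for t :: real
        have hd: "(h has_vector_derivative ?a *\<^sub>R (g (?e k) (p k + t *\<^sub>R ?w) - g (?e k) z0)) (at t)"
          if t: "t \<in> {0..1}" for t
        proof -
          have "((\<lambda>s. f ((p k + t *\<^sub>R ?w) + s *\<^sub>R ?e k)) has_vector_derivative g (?e k) (p k + t *\<^sub>R ?w)) (at 0)"
            using near[OF k] t k by (intro deriv) auto
          then have "((\<lambda>s. f ((p k + t *\<^sub>R ?w) + s *\<^sub>R ?e k)) has_vector_derivative g (?e k) (p k + t *\<^sub>R ?w)) (at ((t - t) * ?a))"
            by simp
          then have "((\<lambda>s. f ((p k + t *\<^sub>R ?w) + s *\<^sub>R ?e k)) \<circ> (\<lambda>u. (u - t) * ?a) has_vector_derivative ?a *\<^sub>R g (?e k) (p k + t *\<^sub>R ?w)) (at t)"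
            by (intro vector_diff_chain_at) (auto intro!: derivative_eq_intros)
          then have "((\<lambda>u. f ((p k + t *\<^sub>R ?w) + ((u - t) * ?a) *\<^sub>R ?e k)) has_vector_derivative ?a *\<^sub>R g (?e k) (p k + t *\<^sub>R ?w)) (at t)"
            by (simp add: o_def)
          then have "((\<lambda>u. f (p k + u *\<^sub>R ?w)) has_vector_derivative ?a *\<^sub>R g (?e k) (p k + t *\<^sub>R ?w)) (at t)"
            by (simp add: algebra_simps)
          then show ?thesis unfolding h_def
            by (auto intro!: derivative_eq_intros simp: algebra_simps)
        qed
        have "norm (h 1 - h 0) \<le> (\<bar>?a\<bar> * \<epsilon>') * norm (1 - 0 :: real)"
        proof (rule differentiable_bound[of "{0..1}"])
          show "convex {0..1::real}" by simp
          fix t :: real assume t: "t \<in> {0..1}"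
          show "(h has_derivative (\<lambda>x. x *\<^sub>R (?a *\<^sub>R (g (?e k) (p k + t *\<^sub>R ?w) - g (?e k) z0)))) (at t within {0..1})"
            using hd[OF t] by (simp add: has_vector_derivative_def has_derivative_at_withinI)
          have "norm (g (?e k) (p k + t *\<^sub>R ?w) - g (?e k) z0) \<le> \<epsilon>'"
            using near[OF k, of t] t d1(2)[of "p k + t *\<^sub>R ?w" k] k by (auto simp: dist_norm)
          then have "\<bar>?a\<bar> * norm (g (?e k) (p k + t *\<^sub>R ?w) - g (?e k) z0) \<le> \<bar>?a\<bar> * \<epsilon>'"
            by (intro mult_left_mono) auto
          then show "onorm (\<lambda>x. x *\<^sub>R (?a *\<^sub>R (g (?e k) (p k + t *\<^sub>R ?w) - g (?e k) z0))) \<le> \<bar>?a\<bar> * \<epsilon>'"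
            by (intro onorm_le) (simp add: mult.commute[of "\<bar>?a\<bar> * \<epsilon>'"] mult_left_mono
                del: scaleR_scaleR)
        qed auto
        also have "\<dots> \<le> norm v * \<epsilon>'"
          using e' by (simp add: mult_right_mono abs_rcoord_le)
        finally show ?thesis
          by (simp add: h_def p_def algebra_simps)
      qed
      have "f y - f z0 - L v = (\<Sum>k<?N. f (p (Suc k)) - f (p k) - rcoord k v *\<^sub>R g (?e k) z0)"
        using sum_lessThan_telescope[of "\<lambda>k. f (p k)" ?N] by (simp add: sum_subtractf pN p0 L_def)
      also have "norm \<dots> \<le> (\<Sum>k<?N. \<epsilon>' * norm v)"
        by (intro order_trans[OF norm_sum] sum_mono) (use step in auto)
      also have "\<dots> = (real ?N * \<epsilon>') * norm v" by simp
      also have "\<dots> \<le> \<epsilon> * norm v"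
        using \<open>\<epsilon> > 0\<close> by (intro mult_right_mono) (auto simp: \<epsilon>'_def field_simps)
      finally show ?thesis by (simp add: v_def)
    qed
    ultimately show "\<exists>d>0. \<forall>y\<in>D. norm (y - z0) < d \<longrightarrow> norm (f y - f z0 - L (y - z0)) \<le> \<epsilon> * norm (y - z0)"
      by blast
  qed
  then show ?thesis by (auto simp: differentiable_def)
qed

section \<open>Smooth functions\<close>

lemma Ck_on_cong:
  assumes "open_in_C n D" "\<And>z. z \<in> D \<Longrightarrow> f z = g z" "Ck_on k n D f"
  shows "Ck_on k n D g"
  using assms(2,3)
proof (induction k arbitrary: f g)
  case 0
  then show ?case using continuous_on_eq[of D f g] by simp
next
  case (Suc k)
  have "Ck_on k n D (dird v g)" if v: "v \<in> cvecs n" for v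
  proof (rule Suc.IH)
    show "dird v f z = dird v g z" if "z \<in> D" for z
      by (rule dird_cong[OF assms(1) that v Suc.prems(1)])
    show "Ck_on k n D (dird v f)" using Suc.prems(2) v by simp
  qed
  then show ?case using Suc.prems differentiable_on_cong'[of f D g] by auto
qed

lemma Ck_on_Suc_imp: "Ck_on (Suc k) n D f \<Longrightarrow> Ck_on k n D f"
proof (induction k arbitrary: f)
  case 0
  then show ?case by (simp add: differentiable_imp_continuous_on)
next
  case (Suc k)
  have "f differentiable_on D" using Suc.prems unfolding Ck_on.simps by blast
  moreover have "Ck_on k n D (dird v f)" if "v \<in> cvecs n" for v
    using Suc.IH Suc.prems that unfolding Ck_on.simps(2)[of "Suc k"] by blast
  ultimately show ?case by simp
qed

lemma Ck_on_subset: "Ck_on k n D f \<Longrightarrow> E \<subseteq> D \<Longrightarrow> Ck_on k n E f"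
  by (induction k arbitrary: f) (auto intro: continuous_on_subset differentiable_on_subset)

lemma open_in_C_at_within:
  assumes "open_in_C n E" "E \<subseteq> D" "D \<subseteq> cvecs n" "z \<in> E"
  shows "at z within E = at z within D"
proof -
  obtain S where S: "open S" "E = cvecs n \<inter> S" using assms(1) by (auto simp: openin_open)
  show ?thesis
    by (rule at_within_nhd[of z S]) (use S assms in auto)
qed

lemma Ck_on_local:
  assumes "open_in_C n D" "\<And>z. z \<in> D \<Longrightarrow> \<exists>E. open_in_C n E \<and> z \<in> E \<and> E \<subseteq> D \<and> Ck_on k n E f"
  shows "Ck_on k n D f"
  using assms(2)
proof (induction k arbitrary: f)
  have D: "D \<subseteq> cvecs n" using assms(1) by (simp add: open_in_C_iff)
  case 0
  show ?case
    unfolding Ck_on.simps continuous_on_eq_continuous_within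
  proof
    fix z assume "z \<in> D"
    then obtain E where E: "open_in_C n E" "z \<in> E" "E \<subseteq> D" "Ck_on 0 n E f" using 0 by blast
    then have "continuous (at z within E) f" by (simp add: continuous_on_eq_continuous_within)
    then show "continuous (at z within D) f"
      using open_in_C_at_within[OF E(1,3) D E(2)] by simp
  qed
next
  have D: "D \<subseteq> cvecs n" using assms(1) by (simp add: open_in_C_iff)
  case (Suc k)
  have "f differentiable (at z within D)" if z: "z \<in> D" for z
  proof -
    obtain E where E: "open_in_C n E" "z \<in> E" "E \<subseteq> D" "Ck_on (Suc k) n E f" using Suc.prems[OF z] by blast
    then have "f differentiable (at z within E)" by (simp add: differentiable_on_def)
    then show ?thesis using open_in_C_at_within[OF E(1,3) D E(2)] by simp
  qed
  moreover have "Ck_on k n D (dird v f)" if "v \<in> cvecs n" for v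
    by (rule Suc.IH) (use Suc.prems that in fastforce)
  ultimately show ?case by (simp add: differentiable_on_def)
qed

lemma Ck_on_const: "Ck_on k n D (\<lambda>_. c)"
proof (induction k arbitrary: c)
  case (Suc k)
  have "dird v (\<lambda>_. c) = (\<lambda>_. 0)" for v :: cvec by (rule ext) simp
  with Suc show ?case by simp
qed simp

lemma Ck_on_bounded_linear:
  assumes "bounded_linear L" shows "Ck_on k n D L"
proof (cases k)
  case 0
  then show ?thesis using assms by (simp add: linear_continuous_on)
next
  case (Suc j)
  have "dird v L = (\<lambda>_. L v)" for v by (rule ext) (rule dird_bounded_linear[OF assms])
  moreover have "L differentiable_on D"
    using bounded_linear_imp_has_derivative[OF assms] by (auto simp: differentiable_on_def differentiable_def)
  ultimately show ?thesis by (simp add: Suc Ck_on_const)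
qed

lemma Ck_on_linear_comp:
  assumes D: "open_in_C n D" and L: "bounded_linear L" and f: "Ck_on k n D f"
  shows "Ck_on k n D (\<lambda>y. L (f y))"
  using f
proof (induction k arbitrary: f)
  case 0
  then show ?case using bounded_linear.continuous_on[OF L] by simp
next
  case (Suc k)
  then have fd: "f differentiable_on D" by simp
  have "Ck_on k n D (dird v (\<lambda>y. L (f y)))" if v: "v \<in> cvecs n" for v
  proof (rule Ck_on_cong[OF D])
    show "Ck_on k n D (\<lambda>z. L (dird v f z))" using Suc v by simp
    show "L (dird v f z) = dird v (\<lambda>y. L (f y)) z" if "z \<in> D" for z
      using dird_linear_comp[OF _ D that v L] fd that by (simp add: differentiable_on_def)
  qed
  moreover have "(\<lambda>y. L (f y)) differentiable_on D"
    using fd bounded_linear.has_derivative[OF L] unfolding differentiable_on_def differentiable_def by blast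
  ultimately show ?case by simp
qed

lemma Ck_on_add:
  assumes D: "open_in_C n D" and "Ck_on k n D f" "Ck_on k n D g"
  shows "Ck_on k n D (\<lambda>y. f y + g y)"
  using assms(2,3)
proof (induction k arbitrary: f g)
  case 0
  then show ?case by (simp add: continuous_on_add)
next
  case (Suc k)
  then have fd: "f differentiable_on D" "g differentiable_on D" by auto
  have "Ck_on k n D (dird v (\<lambda>y. f y + g y))" if v: "v \<in> cvecs n" for v
  proof (rule Ck_on_cong[OF D])
    show "Ck_on k n D (\<lambda>z. dird v f z + dird v g z)" using Suc v by simp
    show "dird v f z + dird v g z = dird v (\<lambda>y. f y + g y) z" if "z \<in> D" for z
      using dird_add[OF _ _ D that v, of f g] fd that by (simp add: differentiable_on_def)
  qed
  moreover have "(\<lambda>y. f y + g y) differentiable_on D"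
    using fd by (rule differentiable_on_add)
  ultimately show ?case by simp
qed

lemma Ck_on_bilinear:
  assumes D: "open_in_C n D" and B: "bounded_bilinear B" and "Ck_on k n D f" "Ck_on k n D g"
  shows "Ck_on k n D (\<lambda>y. B (f y) (g y))"
  using assms(3,4)
proof (induction k arbitrary: f g)
  case 0
  then show ?case using bounded_bilinear.continuous_on[OF B] by simp
next
  case (Suc k)
  then have fd: "f differentiable_on D" "g differentiable_on D" by auto
  have "Ck_on k n D (dird v (\<lambda>y. B (f y) (g y)))" if v: "v \<in> cvecs n" for v
  proof (rule Ck_on_cong[OF D])
    show "Ck_on k n D (\<lambda>z. B (f z) (dird v g z) + B (dird v f z) (g z))"
      by (intro Ck_on_add[OF D] Suc.IH) (use Suc.prems v Ck_on_Suc_imp in auto)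
    show "B (f z) (dird v g z) + B (dird v f z) (g z) = dird v (\<lambda>y. B (f y) (g y)) z" if "z \<in> D" for z
      using dird_bilinear[OF _ _ D that v B, of f g] fd that by (simp add: differentiable_on_def)
  qed
  moreover have "(\<lambda>y. B (f y) (g y)) differentiable_on D"
    using fd bounded_bilinear.FDERIV[OF B] unfolding differentiable_on_def differentiable_def by blast
  ultimately show ?case by simp
qed

lemma Ck_on_sum:
  assumes D: "open_in_C n D" and "\<And>i. i \<in> I \<Longrightarrow> Ck_on k n D (f i)"
  shows "Ck_on k n D (\<lambda>y. \<Sum>i\<in>I. f i y)"
  using assms(2)
  by (induction I rule: infinite_finite_induct) (simp_all add: Ck_on_const Ck_on_add[OF D])

section \<open>Infinitely differentiable functions\<close>

lemma smooth_on_C_I: "(\<And>k. Ck_on k n D f) \<Longrightarrow> smooth_on_C n D f"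
  and smooth_on_CD: "smooth_on_C n D f \<Longrightarrow> Ck_on k n D f"
  by (auto simp: smooth_on_C_def)

lemma smooth_on_C_diff: "smooth_on_C n D f \<Longrightarrow> f differentiable_on D"
  using smooth_on_CD[of n D f "Suc 0"] by simp

lemma smooth_on_C_diff_at: "smooth_on_C n D f \<Longrightarrow> z \<in> D \<Longrightarrow> f differentiable (at z within D)"
  using smooth_on_C_diff by (auto simp: differentiable_on_def)

lemma smooth_on_C_cont: "smooth_on_C n D f \<Longrightarrow> continuous_on D f"
  using smooth_on_CD[of n D f 0] by simp

lemma smooth_on_C_dird: "smooth_on_C n D f \<Longrightarrow> v \<in> cvecs n \<Longrightarrow> smooth_on_C n D (dird v f)"
  unfolding smooth_on_C_def by (metis Ck_on.simps(2))

lemma smooth_on_C_cong: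
  "open_in_C n D \<Longrightarrow> smooth_on_C n D f \<Longrightarrow> (\<And>z. z \<in> D \<Longrightarrow> f z = g z) \<Longrightarrow> smooth_on_C n D g"
  unfolding smooth_on_C_def using Ck_on_cong by metis

lemma smooth_on_C_subset: "smooth_on_C n D f \<Longrightarrow> E \<subseteq> D \<Longrightarrow> smooth_on_C n E f"
  unfolding smooth_on_C_def using Ck_on_subset by blast

lemma smooth_on_C_local:
  assumes "open_in_C n D" "\<And>z. z \<in> D \<Longrightarrow> \<exists>E. open_in_C n E \<and> z \<in> E \<and> E \<subseteq> D \<and> smooth_on_C n E f"
  shows "smooth_on_C n D f"
  by (rule smooth_on_C_I, rule Ck_on_local[OF assms(1)]) (use assms(2) smooth_on_CD in metis)

lemma smooth_on_C_const [simp]: "smooth_on_C n D (\<lambda>_. c)"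
  by (simp add: smooth_on_C_def Ck_on_const)

lemma smooth_on_C_bounded_linear: "bounded_linear L \<Longrightarrow> smooth_on_C n D L"
  by (simp add: smooth_on_C_def Ck_on_bounded_linear)

lemma smooth_on_C_linear_comp:
  "open_in_C n D \<Longrightarrow> bounded_linear L \<Longrightarrow> smooth_on_C n D f \<Longrightarrow> smooth_on_C n D (\<lambda>y. L (f y))"
  by (simp add: smooth_on_C_def Ck_on_linear_comp)

lemma smooth_on_C_add:
  "open_in_C n D \<Longrightarrow> smooth_on_C n D f \<Longrightarrow> smooth_on_C n D g \<Longrightarrow> smooth_on_C n D (\<lambda>y. f y + g y)"
  by (simp add: smooth_on_C_def Ck_on_add)

lemma smooth_on_C_diff':
  assumes "open_in_C n D" "smooth_on_C n D f" "smooth_on_C n D g"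
  shows "smooth_on_C n D (\<lambda>y. f y - g y)"
  using smooth_on_C_add[OF assms(1,2) smooth_on_C_linear_comp[OF assms(1) bounded_linear_minus[OF bounded_linear_ident] assms(3)]]
  by simp

lemma smooth_on_C_bilinear:
  "open_in_C n D \<Longrightarrow> bounded_bilinear B \<Longrightarrow> smooth_on_C n D f \<Longrightarrow> smooth_on_C n D g \<Longrightarrow>
   smooth_on_C n D (\<lambda>y. B (f y) (g y))"
  by (simp add: smooth_on_C_def Ck_on_bilinear)

lemmas smooth_on_C_mult = smooth_on_C_bilinear[OF _ bounded_bilinear_mult]
lemmas smooth_on_C_Re = smooth_on_C_linear_comp[OF _ bounded_linear_Re]
lemmas smooth_on_C_Im = smooth_on_C_linear_comp[OF _ bounded_linear_Im]

lemma smooth_on_C_sum: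
  "open_in_C n D \<Longrightarrow> (\<And>i. i \<in> I \<Longrightarrow> smooth_on_C n D (f i)) \<Longrightarrow> smooth_on_C n D (\<lambda>y. \<Sum>i\<in>I. f i y)"
  by (simp add: smooth_on_C_def Ck_on_sum)

text \<open>The chain rule gives a derivative of \<open>g\<close> in the direction
  \<open>dird v F z\<close>, which moves with the point. Expanded in the real basis it becomes a
  finite sum of products with fixed directions, to which the induction on the order, with
  \<open>g\<close> arbitrary, applies.\<close>

lemma smooth_on_C_compose:
  assumes D: "open_in_C n D" and E: "open_in_C m E" and F: "smooth_on_C n D F"
    and FE: "\<And>z. z \<in> D \<Longrightarrow> F z \<in> E" and g: "smooth_on_C m E g"
  shows "smooth_on_C n D (\<lambda>y. g (F y))"
proof (rule smooth_on_C_I)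
  fix k show "Ck_on k n D (\<lambda>y. g (F y))"
    using smooth_on_CD[OF g, of k]
  proof (induction k arbitrary: g)
    case 0
    then show ?case
      using continuous_on_compose2[of E g D F] smooth_on_C_cont[OF F] FE by auto
  next
    case (Suc k)
    then have gd: "g differentiable_on E" by simp
    have dF: "dird v F z \<in> cvecs m" if "z \<in> D" "v \<in> cvecs n" for z v
      using dird_in_cvecs[OF smooth_on_C_diff_at[OF F \<open>z \<in> D\<close>] _ D that] FE E open_in_C_subset by blast
    have "Ck_on k n D (dird v (\<lambda>y. g (F y)))" if v: "v \<in> cvecs n" for v
    proof (rule Ck_on_cong[OF D])
      show "Ck_on k n D (\<lambda>z. \<Sum>i<2*m. rcoord i (dird v F z) *\<^sub>R dird (rbasis i) g (F z))"
      proof (intro Ck_on_sum[OF D] Ck_on_bilinear[OF D bounded_bilinear_scaleR])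
        fix i assume "i \<in> {..<2*m}"
        then show "Ck_on k n D (\<lambda>z. dird (rbasis i) g (F z))"
          using Suc by simp
        show "Ck_on k n D (\<lambda>z. rcoord i (dird v F z))"
          by (intro Ck_on_linear_comp[OF D bounded_linear_rcoord] smooth_on_CD smooth_on_C_dird F v)
      qed
      fix z assume z: "z \<in> D"
      have gz: "g differentiable (at (F z) within E)" using gd FE z by (simp add: differentiable_on_def)
      show "(\<Sum>i<2*m. rcoord i (dird v F z) *\<^sub>R dird (rbasis i) g (F z)) = dird v (\<lambda>y. g (F y)) z"
        using dird_compose[OF smooth_on_C_diff_at[OF F z] gz FE D E z v]
          dird_rbasis[OF gz E FE[OF z] dF[OF z v]] by simp
    qed
    moreover have "(\<lambda>y. g (F y)) differentiable_on D"
      unfolding differentiable_on_def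
    proof
      fix z assume z: "z \<in> D"
      show "(\<lambda>y. g (F y)) differentiable at z within D"
        by (rule differentiable_compose_on[OF smooth_on_C_diff_at[OF F z] _ FE])
           (use gd FE[OF z] in \<open>auto simp: differentiable_on_def\<close>)
    qed
    ultimately show ?case by simp
  qed
qed

lemma smooth_on_C_coordwise:
  assumes D: "open_in_C n D" and F: "\<And>z. z \<in> D \<Longrightarrow> F z \<in> cvecs m"
    and c: "\<And>i. i < m \<Longrightarrow> smooth_on_C n D (\<lambda>z. coord (F z) i)"
  shows "smooth_on_C n D F"
proof (rule smooth_on_C_cong[OF D])
  show "smooth_on_C n D (\<lambda>z. \<Sum>i<m. Poly_Mapping.single i (coord (F z) i))"
    by (intro smooth_on_C_sum[OF D] smooth_on_C_linear_comp[OF D bounded_linear_single] c) simp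
  show "(\<Sum>i<m. Poly_Mapping.single i (coord (F z) i)) = F z" if "z \<in> D" for z
    using cvecs_expand[OF F[OF that]] by simp
qed

text \<open>The sequence \<open>\<psi>\<close> lists the successive derivatives of the outer
  function, so the induction on the order runs for all its members at once. It serves for the
  reciprocal and for the flat exponential.\<close>

lemma smooth_on_C_real_comp:
  fixes f :: "cvec \<Rightarrow> real" and \<psi> :: "nat \<Rightarrow> real \<Rightarrow> real"
  assumes D: "open_in_C n D" and f: "smooth_on_C n D f" and fS: "\<And>z. z \<in> D \<Longrightarrow> f z \<in> S"
    and d: "\<And>k x. x \<in> S \<Longrightarrow> (\<psi> k has_real_derivative \<psi> (Suc k) x) (at x)"
  shows "smooth_on_C n D (\<lambda>y. \<psi> i (f y))"
proof (rule smooth_on_C_I)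
  fix k
  have diff: "(\<lambda>y. \<psi> i (f y)) differentiable_on D" for i
    unfolding differentiable_on_def
  proof
    fix z assume z: "z \<in> D"
    have "\<psi> i differentiable (at (f z) within UNIV)"
      using d[OF fS[OF z]] has_field_derivative_imp_has_derivative unfolding differentiable_def by blast
    then show "(\<lambda>y. \<psi> i (f y)) differentiable at z within D"
      by (rule differentiable_compose_on[OF smooth_on_C_diff_at[OF f z]]) auto
  qed
  show "Ck_on k n D (\<lambda>y. \<psi> i (f y))"
  proof (induction k arbitrary: i)
    case 0
    then show ?case using diff differentiable_imp_continuous_on by auto
  next
    case (Suc k)
    have "Ck_on k n D (dird v (\<lambda>y. \<psi> i (f y)))" if v: "v \<in> cvecs n" for v
    proof (rule Ck_on_cong[OF D])
      show "Ck_on k n D (\<lambda>z. \<psi> (Suc i) (f z) * dird v f z)"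
        by (intro Ck_on_bilinear[OF D bounded_bilinear_mult] Suc smooth_on_CD smooth_on_C_dird f v)
      fix z assume z: "z \<in> D"
      have "(\<psi> i has_derivative (*) (\<psi> (Suc i) (f z))) (at (f z) within UNIV)"
        using d[OF fS[OF z]] by (simp add: has_field_derivative_def)
      from dird_compose_has_derivative[OF smooth_on_C_diff_at[OF f z] this _ D z v]
      show "\<psi> (Suc i) (f z) * dird v f z = dird v (\<lambda>y. \<psi> i (f y)) z" by simp
    qed
    then show ?case using diff by simp
  qed
qed

lemma smooth_on_C_inverse:
  fixes f :: "cvec \<Rightarrow> real"
  assumes "open_in_C n D" "smooth_on_C n D f" "\<And>z. z \<in> D \<Longrightarrow> f z \<noteq> 0"
  shows "smooth_on_C n D (\<lambda>y. inverse (f y))"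
proof -
  \<comment> \<open>The k-th derivative of the reciprocal.\<close>
  let ?\<psi> = "\<lambda>k x::real. (-1) ^ k * fact k * inverse x ^ (Suc k)"
  have "smooth_on_C n D (\<lambda>y. ?\<psi> 0 (f y))"
  proof (rule smooth_on_C_real_comp[where S="- {0}" and \<psi>="?\<psi>", OF assms(1,2)])
    show "(?\<psi> k has_real_derivative ?\<psi> (Suc k) x) (at x)" if "x \<in> - {0}" for k x
      using that
      by (auto intro!: derivative_eq_intros simp: divide_simps power_Suc[symmetric] simp del: power_Suc)
         (auto simp: algebra_simps)
  qed (use assms in auto)
  then show ?thesis by simp
qed

text \<open>The second difference of \<open>f\<close> over a small parallelogram with sides
  \<open>h *\<^sub>R u\<close> and \<open>h *\<^sub>R v\<close> is symmetric in the two sides. Two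
  applications of the mean value theorem turn it into h^2 times a mixed derivative at a nearby
  point, in either order, and continuity moves both points to \<open>z\<close>.\<close>

lemma dird_commute_real:
  fixes f :: "cvec \<Rightarrow> real"
  assumes D: "open_in_C n D" and f: "smooth_on_C n D f" and z: "z \<in> D" and u: "u \<in> cvecs n" and v: "v \<in> cvecs n"
  shows "dird u (dird v f) z = dird v (dird u f) z"
proof -
  let ?a = "dird u (dird v f)" and ?b = "dird v (dird u f)"
  have line: "((\<lambda>t. g (y + t *\<^sub>R w)) has_real_derivative dird w g (y + t *\<^sub>R w)) (at t)"
    if "y + t *\<^sub>R w \<in> D" "w \<in> cvecs n" "smooth_on_C n D g" for y w t and g :: "cvec \<Rightarrow> real"
  proof -
    have "((\<lambda>s. g ((y + t *\<^sub>R w) + s *\<^sub>R w)) has_real_derivative dird w g (y + t *\<^sub>R w)) (at 0)"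
      using dird_line[OF smooth_on_C_diff_at[OF that(3,1)] D that(1,2)]
      by (simp add: has_real_derivative_iff_has_vector_derivative)
    then have "((\<lambda>s. g ((y + t *\<^sub>R w) + s *\<^sub>R w)) has_real_derivative dird w g (y + t *\<^sub>R w)) (at (t + (-t)))"
      by simp
    then have "((\<lambda>s. g ((y + t *\<^sub>R w) + (s + (-t)) *\<^sub>R w)) has_real_derivative dird w g (y + t *\<^sub>R w)) (at t)"
      unfolding DERIV_shift by simp
    then show ?thesis by (simp add: algebra_simps)
  qed
  have key: "\<exists>p\<in>D. dist p z < e \<and> f (z + h *\<^sub>R u + h *\<^sub>R v) - f (z + h *\<^sub>R u) - f (z + h *\<^sub>R v) + f z = h * (h * dird v (dird u f) p)"
    if h: "h > 0" "h * (norm u + norm v) < e" and e: "ball z e \<inter> cvecs n \<subseteq> D" and u: "u \<in> cvecs n" and v: "v \<in> cvecs n" for h e u v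
  proof -
    have inD: "z + s *\<^sub>R u + t *\<^sub>R v \<in> D \<and> dist (z + s *\<^sub>R u + t *\<^sub>R v) z < e" if "0 \<le> s" "s \<le> h" "0 \<le> t" "t \<le> h" for s t
    proof -
      have "norm (s *\<^sub>R u + t *\<^sub>R v) \<le> s * norm u + t * norm v"
        using norm_triangle_ineq[of "s *\<^sub>R u" "t *\<^sub>R v"] that by simp
      also have "\<dots> \<le> h * norm u + h * norm v" using that by (intro add_mono mult_right_mono) auto
      finally have "norm (s *\<^sub>R u + t *\<^sub>R v) < e" using h by (simp add: algebra_simps)
      moreover have "z + s *\<^sub>R u + t *\<^sub>R v \<in> cvecs n"
        using open_in_C_subset[OF D z] u v by simp
      moreover have "dist (z + s *\<^sub>R u + t *\<^sub>R v) z = norm (s *\<^sub>R u + t *\<^sub>R v)"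
        by (simp add: dist_norm add.assoc)
      ultimately show ?thesis using e by (auto simp: dist_commute)
    qed
    have zv: "z + s *\<^sub>R u + h *\<^sub>R v = (z + h *\<^sub>R v) + s *\<^sub>R u" for s by (simp add: algebra_simps)
    have "\<exists>\<xi>. 0 < \<xi> \<and> \<xi> < h \<and> (f ((z + h *\<^sub>R v) + h *\<^sub>R u) - f (z + h *\<^sub>R u)) - (f ((z + h *\<^sub>R v) + 0 *\<^sub>R u) - f (z + 0 *\<^sub>R u))
        = (h - 0) * (dird u f ((z + h *\<^sub>R v) + \<xi> *\<^sub>R u) - dird u f (z + \<xi> *\<^sub>R u))"
    proof (rule MVT2)
      show "0 < h" by fact
      fix s assume s: "0 \<le> s" "s \<le> h"
      show "((\<lambda>s. f ((z + h *\<^sub>R v) + s *\<^sub>R u) - f (z + s *\<^sub>R u)) has_real_derivative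
         dird u f ((z + h *\<^sub>R v) + s *\<^sub>R u) - dird u f (z + s *\<^sub>R u)) (at s)"
        using inD[OF s, of h] inD[OF s, of 0] h unfolding zv
        by (intro DERIV_diff line f u) auto
    qed
    then obtain \<xi> where \<xi>: "0 < \<xi>" "\<xi> < h" "(f ((z + h *\<^sub>R v) + h *\<^sub>R u) - f (z + h *\<^sub>R u)) - (f (z + h *\<^sub>R v) - f z)
        = h * (dird u f (z + \<xi> *\<^sub>R u + h *\<^sub>R v) - dird u f (z + \<xi> *\<^sub>R u))" unfolding zv by auto
    have "\<exists>\<eta>. 0 < \<eta> \<and> \<eta> < h \<and> dird u f ((z + \<xi> *\<^sub>R u) + h *\<^sub>R v) - dird u f ((z + \<xi> *\<^sub>R u) + 0 *\<^sub>R v)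
        = (h - 0) * dird v (dird u f) ((z + \<xi> *\<^sub>R u) + \<eta> *\<^sub>R v)"
      using h \<xi> inD by (intro MVT2 line smooth_on_C_dird f u v) auto
    then obtain \<eta> where \<eta>: "0 < \<eta>" "\<eta> < h" "dird u f ((z + \<xi> *\<^sub>R u) + h *\<^sub>R v) - dird u f (z + \<xi> *\<^sub>R u)
        = h * dird v (dird u f) ((z + \<xi> *\<^sub>R u) + \<eta> *\<^sub>R v)" by auto
    show ?thesis
      by (rule bexI[of _ "z + \<xi> *\<^sub>R u + \<eta> *\<^sub>R v"])
         (use inD[of \<xi> \<eta>] \<xi> \<eta> in \<open>auto simp: algebra_simps\<close>)
  qed
  have cont: "continuous_on D ?a" "continuous_on D ?b"
    using f u v by (auto intro!: smooth_on_C_cont[of n] smooth_on_C_dird)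
  have "dist (?a z) (?b z) < e" if "e > 0" for e
  proof -
    have "e/2 > 0" using that by simp
    obtain d1 where d1: "d1 > 0" "\<forall>y\<in>D. dist y z < d1 \<longrightarrow> dist (?a y) (?a z) < e/2"
      using cont(1) z \<open>e/2 > 0\<close> unfolding continuous_on_iff by meson
    obtain d2 where d2: "d2 > 0" "\<forall>y\<in>D. dist y z < d2 \<longrightarrow> dist (?b y) (?b z) < e/2"
      using cont(2) z \<open>e/2 > 0\<close> unfolding continuous_on_iff by meson
    obtain r where r: "r > 0" "ball z r \<inter> cvecs n \<subseteq> D" using open_in_C_ball_sub D z by blast
    define d where "d = min r (min d1 d2)"
    have d: "d > 0" "ball z d \<inter> cvecs n \<subseteq> D" using r d1 d2 by (auto simp: d_def)
    \<comment> \<open>The summand 1 keeps \<open>s\<close> positive when both directions vanish;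
      with \<open>h = d / (2 * s)\<close> the parallelogram stays within distance \<open>d\<close>
      of \<open>z\<close>.\<close>
    define s where "s = norm u + norm v + 1"
    have s: "s > 0" by (simp add: s_def add_nonneg_pos)
    define h where "h = d / (2 * s)"
    have h: "h > 0" using d s by (simp add: h_def)
    have "h * (norm u + norm v) < h * s" using h by (simp add: s_def)
    also have "\<dots> \<le> d" using d s by (simp add: h_def)
    finally have hd: "h * (norm u + norm v) < d" "h * (norm v + norm u) < d" by (simp_all add: add.commute)
    obtain p where p: "p \<in> D" "dist p z < d"
      "f (z + h *\<^sub>R u + h *\<^sub>R v) - f (z + h *\<^sub>R u) - f (z + h *\<^sub>R v) + f z = h * (h * ?b p)"
      using key[OF h hd(1) d(2) u v] by blast
    obtain q where q: "q \<in> D" "dist q z < d"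
      "f (z + h *\<^sub>R v + h *\<^sub>R u) - f (z + h *\<^sub>R v) - f (z + h *\<^sub>R u) + f z = h * (h * ?a q)"
      using key[OF h hd(2) d(2) v u] by blast
    have "h * (h * ?b p) = h * (h * ?a q)"
      unfolding p(3)[symmetric] q(3)[symmetric] by (simp add: algebra_simps)
    then have "?b p = ?a q" using h by simp
    then show ?thesis
      using d1(2)[rule_format, OF q(1)] d2(2)[rule_format, OF p(1)] p(2) q(2)
        dist_triangle_half_r[of "?a q" "?a z" e "?b z"] by (simp add: d_def)
  qed
  then show ?thesis by (metis dist_nz less_irrefl)
qed

lemma dird_commute_complex:
  fixes f :: "cvec \<Rightarrow> complex"
  assumes D: "open_in_C n D" and f: "smooth_on_C n D f" and z: "z \<in> D" and u: "u \<in> cvecs n" and v: "v \<in> cvecs n"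
  shows "dird u (dird v f) z = dird v (dird u f) z"
proof -
  have L: "dird u (dird v (\<lambda>y. L (f y))) z = L (dird u (dird v f) z)"
    if L: "bounded_linear L" and u: "u \<in> cvecs n" and v: "v \<in> cvecs n" for L :: "complex \<Rightarrow> real" and u v
  proof -
    have "dird u (dird v (\<lambda>y. L (f y))) z = dird u (\<lambda>y. L (dird v f y)) z"
      by (rule dird_cong[OF D z u], rule dird_linear_comp[OF smooth_on_C_diff_at[OF f] D _ v L])
    also have "\<dots> = L (dird u (dird v f) z)"
      by (rule dird_linear_comp[OF smooth_on_C_diff_at[OF smooth_on_C_dird[OF f v] z] D z u L])
    finally show ?thesis .
  qed
  have "L (dird u (dird v f) z) = L (dird v (dird u f) z)" if "bounded_linear L" for L :: "complex \<Rightarrow> real"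
    using L[OF that u v] L[OF that v u] dird_commute_real[OF D smooth_on_C_linear_comp[OF D that f] z u v]
    by simp
  from this[OF bounded_linear_Re] this[OF bounded_linear_Im] show ?thesis
    by (simp add: complex_eq_iff)
qed

section \<open>Holomorphic functions\<close>

text \<open>This form of holomorphy asks for nothing jointly in several variables beyond continuity.
  It is therefore easy to pass on to directional derivatives, which is the step that produces
  smoothness; on relatively open sets it turns out equivalent to \<open>holo_on\<close>.\<close>

definition line_holo :: "nat \<Rightarrow> cvec set \<Rightarrow> (cvec \<Rightarrow> complex) \<Rightarrow> bool" where
  "line_holo n D f \<longleftrightarrow> continuous_on D f \<and>
     (\<forall>z\<in>D. \<forall>v\<in>cvecs n. (\<lambda>c. f (z + cmul c v)) field_differentiable (at 0))"

lemma add_cmul_in_open: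
  assumes "open_in_C n D" "z \<in> D" "v \<in> cvecs n"
  obtains e where "e > 0" "\<And>c. norm c < e \<Longrightarrow> z + cmul c v \<in> D"
proof -
  obtain r where r: "r > 0" "ball z r \<inter> cvecs n \<subseteq> D" using open_in_C_ball_sub assms by blast
  show ?thesis
  proof (rule that[of "r / (norm v + 1)"])
    show "0 < r / (norm v + 1)" using r by (simp add: add_nonneg_pos)
    fix c :: complex assume "norm c < r / (norm v + 1)"
    then have "norm c * (norm v + 1) < r" by (simp add: pos_less_divide_eq add_nonneg_pos)
    then have "norm (cmul c v) < r" by (simp add: algebra_simps norm_cmul) (smt (verit) norm_ge_zero)
    then have "z + cmul c v \<in> ball z r \<inter> cvecs n"
      using assms open_in_C_subset by (auto simp: dist_norm)
    then show "z + cmul c v \<in> D" using r by blast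
  qed
qed

lemma cmul_Re_Im: "cmul c v = Re c *\<^sub>R v + Im c *\<^sub>R cmul \<i> v"
  by (rule cvec_eqI) (simp add: complex_eq_iff)

lemma line_holo_deriv:
  assumes "line_holo n D f" "z \<in> D" "v \<in> cvecs n"
  shows "((\<lambda>c. f (z + cmul c v)) has_field_derivative dird v f z) (at 0)"
    and "((\<lambda>t. f (z + t *\<^sub>R v)) has_vector_derivative dird v f z) (at 0)"
    and "dird (cmul \<i> v) f z = \<i> * dird v f z"
proof -
  obtain d where d: "((\<lambda>c. f (z + cmul c v)) has_field_derivative d) (at 0)"
    using assms by (auto simp: line_holo_def field_differentiable_def)
  have comp: "((\<lambda>t. f (z + t *\<^sub>R cmul a v)) has_vector_derivative a * d) (at 0)" for a
  proof -
    have "((\<lambda>t. complex_of_real t * a) has_vector_derivative a) (at 0)"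
      by (auto simp: has_vector_derivative_def scaleR_conv_of_real intro!: derivative_eq_intros)
    from field_vector_diff_chain_at[OF this, of "\<lambda>c. f (z + cmul c v)" d] d
    have "((\<lambda>c. f (z + cmul c v)) \<circ> (\<lambda>t. complex_of_real t * a) has_vector_derivative a * d) (at 0)"
      by simp
    then show ?thesis by (simp add: o_def cmul_cmul[symmetric] cmul_of_real)
  qed
  from comp[of 1] show *: "((\<lambda>t. f (z + t *\<^sub>R v)) has_vector_derivative dird v f z) (at 0)"
    unfolding dird_def by (simp add: vector_derivative_works[symmetric] differentiableI_vector)
  have dd: "d = dird v f z" using comp[of 1] by (simp add: dird_def vector_derivative_at)
  then show "((\<lambda>c. f (z + cmul c v)) has_field_derivative dird v f z) (at 0)" using d by simp
  show "dird (cmul \<i> v) f z = \<i> * dird v f z"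
    using comp[of \<i>] dd by (simp add: dird_def vector_derivative_at)
qed

lemma line_holo_deriv_at:
  assumes f: "line_holo n D f" and "z + cmul c v \<in> D" "v \<in> cvecs n"
  shows "((\<lambda>c. f (z + cmul c v)) has_field_derivative dird v f (z + cmul c v)) (at c)"
proof -
  have "((\<lambda>s. f ((z + cmul c v) + cmul s v)) has_field_derivative dird v f (z + cmul c v)) (at 0)"
    using line_holo_deriv(1)[OF assms] .
  then have "((\<lambda>s. f ((z + cmul c v) + cmul s v)) has_field_derivative dird v f (z + cmul c v)) (at (c + (-c)))"
    by simp
  then have "((\<lambda>s. f ((z + cmul c v) + cmul (s + (-c)) v)) has_field_derivative dird v f (z + cmul c v)) (at c)"
    unfolding DERIV_shift by simp
  then show ?thesis by (simp add: add.assoc cmul_add_left[symmetric])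
qed

text \<open>Cauchy's formula for the first derivative. With the circle parametrised by [0,1] the
  factor 2 pi i cancels and one of the two denominators is absorbed by the velocity.\<close>

lemma Cauchy_deriv_integral:
  assumes f: "f holomorphic_on S" "open S" "cball 0 \<rho> \<subseteq> S" "\<rho> > 0"
    and d: "(f has_field_derivative d) (at 0)"
  defines "e \<equiv> \<lambda>t::real. of_real \<rho> * exp (2 * of_real pi * \<i> * of_real t)"
  shows "d = integral {0..1} (\<lambda>t. f (e t) / e t)"
proof -
  have en: "e t \<noteq> 0" for t using \<open>\<rho> > 0\<close> by (simp add: e_def)
  have cp: "circlepath 0 \<rho> t = e t" for t by (simp add: circlepath e_def)
  have "(f has_field_derivative (1 / (2 * of_real pi * \<i>) * contour_integral (circlepath 0 \<rho>) (\<lambda>u. f u / (u - 0)^2))) (at 0)"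
    using f ball_subset_cball[of 0 \<rho>]
    by (intro Cauchy_derivative_integral_circlepath holomorphic_on_imp_continuous_on[OF holomorphic_on_subset[OF f(1)]]
        holomorphic_on_subset[OF f(1)]) auto
  then have "d = 1 / (2 * of_real pi * \<i>) * contour_integral (circlepath 0 \<rho>) (\<lambda>u. f u / (u - 0)^2)"
    using d DERIV_unique by blast
  also have "\<dots> = 1 / (2 * of_real pi * \<i>) * integral {0..1} (\<lambda>t. 2 * of_real pi * \<i> * (f (e t) / e t))"
    unfolding contour_integral_integral
  proof (rule arg_cong2[where f="(*)"], rule refl, rule integral_cong)
    fix t :: real assume "t \<in> {0..1}"
    have "vector_derivative (circlepath 0 \<rho>) (at t) = 2 * of_real pi * \<i> * e t"
      by (simp add: vector_derivative_circlepath e_def)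
    then show "f (circlepath 0 \<rho> t) / (circlepath 0 \<rho> t - 0)\<^sup>2 * vector_derivative (circlepath 0 \<rho>) (at t)
        = 2 * of_real pi * \<i> * (f (e t) / e t)"
      using en[of t] by (simp add: cp power2_eq_square)
  qed
  also have "\<dots> = integral {0..1} (\<lambda>t. f (e t) / e t)"
    by (subst integral_mult_right) simp
  finally show ?thesis .
qed

text \<open>One circle serves all points near \<open>z0\<close>. This makes the directional
  derivative an integral depending on a parameter, so that continuity and differentiability can be
  read off from the integrand.\<close>

lemma line_holo_dird_integral:
  assumes D: "open_in_C n D" and f: "line_holo n D f" and z0: "z0 \<in> D" and v: "v \<in> cvecs n"
  obtains r e where "r > 0" "ball z0 r \<inter> cvecs n \<subseteq> D" "continuous_on {0..1} e" "\<And>t. e t \<noteq> 0"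
    "\<And>y t. y \<in> ball z0 r \<inter> cvecs n \<Longrightarrow> y + cmul (e t) v \<in> D"
    "\<And>y. y \<in> ball z0 r \<inter> cvecs n \<Longrightarrow> dird v f y = integral (cbox 0 1) (\<lambda>t::real. f (y + cmul (e t) v) / e t)"
proof -
  obtain r0 where r0: "r0 > 0" "ball z0 r0 \<inter> cvecs n \<subseteq> D" using open_in_C_ball_sub D z0 by blast
  \<comment> \<open>Half of the available radius is for the base point \<open>y\<close> and half for
    the circle: \<open>\<rho> * (norm v + 1) = r\<close>, so a disc of radius \<open>\<rho>\<close>
    in the direction \<open>v\<close> around a point of the smaller ball stays in
    \<open>D\<close>.\<close>
  define r where "r = r0 / 2"
  define \<rho> where "\<rho> = r / (norm v + 1)"
  have r: "r > 0" using r0 by (simp add: r_def)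
  have \<rho>: "\<rho> > 0" using r by (simp add: \<rho>_def add_nonneg_pos)
  define e where "e = (\<lambda>t::real. of_real \<rho> * exp (2 * of_real pi * \<i> * of_real t))"
  have inD: "y + cmul c v \<in> D" if "y \<in> ball z0 r \<inter> cvecs n" "norm c * (norm v + 1) < 2 * r - dist z0 y" for y c
  proof -
    have "norm c * norm v < 2 * r - dist z0 y"
      using that(2) by (simp add: algebra_simps) (smt (verit) norm_ge_zero)
    then have "dist z0 (y + cmul c v) < 2 * r"
      using dist_triangle_less_add[of z0 y "dist z0 y"] dist_triangle[of z0 "y + cmul c v" y]
      by (simp add: dist_norm norm_cmul)
    then show ?thesis using r0 that v by (auto simp: r_def)
  qed
  have rr: "\<rho> * (norm v + 1) = r"
    using norm_ge_zero[of v] unfolding \<rho>_def by (simp del: norm_ge_zero)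
  show ?thesis
  proof (rule that[of r e])
    show "r > 0" by fact
    show "ball z0 r \<inter> cvecs n \<subseteq> D" using r0 by (auto simp: r_def)
    show "continuous_on {0..1} e" unfolding e_def by (intro continuous_intros)
    show "e t \<noteq> 0" for t using \<rho> by (simp add: e_def)
    have ne: "norm (e t) = \<rho>" for t using \<rho> by (simp add: e_def norm_mult)
    show "y + cmul (e t) v \<in> D" if "y \<in> ball z0 r \<inter> cvecs n" for y t
      using that by (intro inD) (auto simp: ne rr)
    fix y assume y: "y \<in> ball z0 r \<inter> cvecs n"
    \<comment> \<open>The parameters known to keep the complex line through \<open>y\<close> inside
      \<open>D\<close>. As \<open>dist z0 y < r\<close>, this open disc contains the closed disc of
      radius \<open>\<rho>\<close>, as Cauchy's formula requires.\<close>
    define S where "S = ball (0::complex) ((2 * r - dist z0 y) / (norm v + 1))"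
    have SD: "y + cmul c v \<in> D" if "c \<in> S" for c
      using that by (intro inD[OF y]) (auto simp: S_def pos_less_divide_eq add_nonneg_pos)
    have "(\<lambda>c. f (y + cmul c v)) holomorphic_on S"
      using line_holo_deriv_at[OF f SD v] holomorphic_on_open[of S] unfolding S_def by blast
    moreover have "cball 0 \<rho> \<subseteq> S"
      unfolding S_def \<rho>_def using y by (intro cball_subset_ball_iff[THEN iffD2] disjI1)
        (auto simp: divide_strict_right_mono add_nonneg_pos)
    moreover have "((\<lambda>c. f (y + cmul c v)) has_field_derivative dird v f y) (at 0)"
      using y r0 by (intro line_holo_deriv(1)[OF f _ v]) (auto simp: r_def)
    ultimately show "dird v f y = integral (cbox 0 1) (\<lambda>t::real. f (y + cmul (e t) v) / e t)"
      using Cauchy_deriv_integral[of "\<lambda>c. f (y + cmul c v)" S \<rho> "dird v f y"] \<rho>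
      by (simp add: e_def S_def)
  qed
qed

lemma continuous_on_cmul [continuous_intros]:
  "continuous_on A c \<Longrightarrow> continuous_on A (\<lambda>x. cmul (c x) v)"
  by (rule bounded_linear.continuous_on[OF bounded_linear_cmul_left])

lemma continuous_on_dird_line_holo:
  assumes D: "open_in_C n D" and f: "line_holo n D f" and v: "v \<in> cvecs n"
  shows "continuous_on D (dird v f)"
  unfolding continuous_on_eq_continuous_within
proof
  fix z0 assume z0: "z0 \<in> D"
  obtain r e where r: "r > 0" "ball z0 r \<inter> cvecs n \<subseteq> D" and e: "continuous_on {0..1} e" "\<And>t. e t \<noteq> 0"
    and inD: "\<And>y t. y \<in> ball z0 r \<inter> cvecs n \<Longrightarrow> y + cmul (e t) v \<in> D"
    and eq: "\<And>y. y \<in> ball z0 r \<inter> cvecs n \<Longrightarrow> dird v f y = integral (cbox 0 1) (\<lambda>t::real. f (y + cmul (e t) v) / e t)"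
    by (rule line_holo_dird_integral[OF D f z0 v]) (rule that)
  let ?U = "ball z0 r \<inter> cvecs n"
  have fc: "continuous_on D f" using f by (simp add: line_holo_def)
  have "continuous_on ?U (\<lambda>y. integral (cbox 0 1) (\<lambda>t::real. f (y + cmul (e t) v) / e t))"
  proof (rule integral_continuous_on_param)
    have 1: "continuous_on (?U \<times> cbox 0 1) (\<lambda>x. e (snd x))"
      by (rule continuous_on_compose2[OF e(1)]) (auto intro: continuous_intros)
    have "continuous_on (?U \<times> cbox 0 1) (\<lambda>x. f (fst x + cmul (e (snd x)) v))"
      by (rule continuous_on_compose2[OF fc]) (use inD in \<open>auto intro!: 1[simplified] continuous_intros\<close>)
    then show "continuous_on (?U \<times> cbox 0 1) (\<lambda>(y, t). f (y + cmul (e t) v) / e t)"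
      unfolding case_prod_beta by (intro continuous_on_divide 1) (use e in auto)
  qed
  then have "continuous_on ?U (dird v f)"
    by (rule continuous_on_eq) (use eq in simp)
  moreover have "z0 \<in> ?U" using z0 r D open_in_C_subset by auto
  ultimately have "continuous (at z0 within ?U) (dird v f)" by (simp add: continuous_on_eq_continuous_within)
  moreover have "at z0 within ?U = at z0 within D"
    by (rule open_in_C_at_within[OF _ r(2) _ \<open>z0 \<in> ?U\<close>]) (use D z0 open_in_C_ball[of z0 n r] open_in_C_subset in \<open>auto simp: open_in_C_iff\<close>)
  ultimately show "continuous (at z0 within D) (dird v f)" by simp
qed

text \<open>The integral formula for \<open>dird v f\<close> is differentiated under the integral
  sign along the complex line in another direction \<open>u\<close>. The integrand is then
  \<open>dird u f\<close>, whose continuity is already known.\<close>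

lemma line_holo_dird:
  assumes D: "open_in_C n D" and f: "line_holo n D f" and v: "v \<in> cvecs n"
  shows "line_holo n D (dird v f)"
  unfolding line_holo_def
proof (intro conjI ballI)
  show "continuous_on D (dird v f)" by (rule continuous_on_dird_line_holo[OF assms])
  fix z0 u assume z0: "z0 \<in> D" and u: "u \<in> cvecs n"
  obtain r e where r: "r > 0" "ball z0 r \<inter> cvecs n \<subseteq> D" and e: "continuous_on {0..1} e" "\<And>t. e t \<noteq> 0"
    and inD: "\<And>y t. y \<in> ball z0 r \<inter> cvecs n \<Longrightarrow> y + cmul (e t) v \<in> D"
    and eq: "\<And>y. y \<in> ball z0 r \<inter> cvecs n \<Longrightarrow> dird v f y = integral (cbox 0 1) (\<lambda>t::real. f (y + cmul (e t) v) / e t)"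
    by (rule line_holo_dird_integral[OF D f z0 v]) (rule that)
  let ?U = "ball z0 r \<inter> cvecs n"
  have "z0 \<in> ?U" using z0 r D open_in_C_subset by auto
  obtain \<delta> where \<delta>: "\<delta> > 0" "\<And>c. norm c < \<delta> \<Longrightarrow> z0 + cmul c u \<in> ?U"
    using add_cmul_in_open[OF open_in_C_ball[of z0 n r] \<open>z0 \<in> ?U\<close> u] z0 D open_in_C_subset by metis
  have fc: "continuous_on D f" "continuous_on D (dird u f)"
    using f continuous_on_dird_line_holo[OF D f u] by (simp_all add: line_holo_def)
  let ?f = "\<lambda>s t. f (z0 + cmul s u + cmul (e t) v) / e t"
  let ?f' = "\<lambda>s t. dird u f (z0 + cmul s u + cmul (e t) v) / e t"
  have cont: "continuous_on (ball 0 \<delta> \<times> cbox 0 1) (\<lambda>(s, t). g (z0 + cmul s u + cmul (e t) v) / e t)"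
    if "continuous_on D g" for g
  proof -
    have 1: "continuous_on (ball 0 \<delta> \<times> cbox 0 1) (\<lambda>x :: complex \<times> real. e (snd x))"
      by (rule continuous_on_compose2[OF e(1)]) (auto intro: continuous_intros)
    have "continuous_on (ball 0 \<delta> \<times> cbox 0 1) (\<lambda>x. g (z0 + cmul (fst x) u + cmul (e (snd x)) v))"
      by (rule continuous_on_compose2[OF that])
         (use inD \<delta> in \<open>auto intro!: 1[simplified] continuous_intros\<close>)
    then show ?thesis
      unfolding case_prod_beta by (intro continuous_on_divide 1) (use e in auto)
  qed
  have "((\<lambda>s. integral (cbox 0 1) (?f s)) has_field_derivative integral (cbox 0 1) (?f' 0)) (at 0 within ball 0 \<delta>)"
  proof (rule leibniz_rule_field_derivative)
    fix s :: complex and t :: real assume st: "s \<in> ball 0 \<delta>" "t \<in> cbox 0 1"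
    have swap: "z0 + cmul s u + cmul (e t) v = z0 + cmul (e t) v + cmul s u" for s by (simp add: algebra_simps)
    have "((\<lambda>s. f (z0 + cmul (e t) v + cmul s u)) has_field_derivative dird u f (z0 + cmul (e t) v + cmul s u)) (at s)"
      using inD[OF \<delta>(2), of s t] st by (intro line_holo_deriv_at[OF f _ u]) (auto simp: swap)
    from DERIV_cdivide[OF has_field_derivative_at_within[OF this]]
    show "((\<lambda>s. ?f s t) has_field_derivative ?f' s t) (at s within ball 0 \<delta>)"
      by (simp add: swap)
  next
    fix s :: complex assume s: "s \<in> ball 0 \<delta>"
    have "continuous_on (cbox 0 1) (\<lambda>t. (\<lambda>(s, t). f (z0 + cmul s u + cmul (e t) v) / e t) (s, t))"
      by (rule continuous_on_compose2[OF cont[OF fc(1)]]) (use s in \<open>auto intro!: continuous_intros\<close>)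
    then show "?f s integrable_on cbox 0 1" by (intro integrable_continuous) simp
  next
    show "continuous_on (ball 0 \<delta> \<times> cbox 0 1) (\<lambda>(x, t). ?f' x t)" by (rule cont[OF fc(2)])
  qed (use \<delta> in auto)
  then have "((\<lambda>s. integral (cbox 0 1) (?f s)) has_field_derivative integral (cbox 0 1) (?f' 0)) (at 0)"
    using \<delta> by (subst (asm) at_within_open) auto
  then have "((\<lambda>s. dird v f (z0 + cmul s u)) has_field_derivative integral (cbox 0 1) (?f' 0)) (at 0)"
    by (rule has_field_derivative_transform_within_open[where S="ball 0 \<delta>"])
       (use \<delta> eq in auto)
  then show "(\<lambda>c. dird v f (z0 + cmul c u)) field_differentiable at 0"
    by (auto simp: field_differentiable_def)
qed

text \<open>Continuous directional derivatives give total differentiability, here without any joint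
  hypothesis beyond continuity of \<open>f\<close>.\<close>

lemma line_holo_differentiable_on:
  assumes D: "open_in_C n D" and f: "line_holo n D f"
  shows "f differentiable_on D"
  unfolding differentiable_on_def
proof
  fix z assume "z \<in> D"
  then show "f differentiable at z within D"
    using line_holo_deriv(2)[OF f] continuous_on_dird_line_holo[OF D f]
    by (intro differentiable_if_continuous_dird[OF D, where g="\<lambda>v. dird v f"]) auto
qed

text \<open>From right to left this is total differentiability by continuous partial derivatives.
  From left to right, the complex linear differential makes the restriction to a complex line
  differentiable in the complex sense.\<close>

lemma holo_on_iff_line_holo:
  assumes D: "open_in_C n D"
  shows "holo_on n D f \<longleftrightarrow> line_holo n D f"
proof
  assume "line_holo n D f"
  then show "holo_on n D f"
    using line_holo_differentiable_on[OF D] line_holo_deriv(3) by (auto simp: holo_on_def)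
next
  assume f: "holo_on n D f"
  show "line_holo n D f"
    unfolding line_holo_def
  proof (intro conjI ballI)
    show "continuous_on D f" using f by (simp add: holo_on_def differentiable_imp_continuous_on)
    fix z v assume z: "z \<in> D" and v: "v \<in> cvecs n"
    have fz: "f differentiable (at z within D)" using f z by (simp add: holo_on_def differentiable_on_def)
    obtain e where e: "e > 0" "\<And>c. norm c < e \<Longrightarrow> z + cmul c v \<in> D" using add_cmul_in_open D z v by metis
    have "((\<lambda>c. z + cmul c v) has_derivative (\<lambda>c. 0 + cmul c v)) (at 0 within ball 0 e)"
      by (intro has_derivative_add has_derivative_const bounded_linear_imp_has_derivative bounded_linear_cmul_left)
    moreover have "(f has_derivative (\<lambda>v. dird (trunc n v) f z)) (at (z + cmul 0 v) within (\<lambda>c. z + cmul c v) ` ball 0 e)"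
      by (rule has_derivative_subset[of _ _ _ D]) (use has_derivative_dird[OF fz D z] e in auto)
    ultimately have "((\<lambda>c. f (z + cmul c v)) has_derivative (\<lambda>c. dird (trunc n (0 + cmul c v)) f z)) (at 0 within ball 0 e)"
      by (rule has_derivative_in_compose)
    then have "((\<lambda>c. f (z + cmul c v)) has_derivative (\<lambda>c. dird (trunc n (0 + cmul c v)) f z)) (at 0)"
      using e by (subst (asm) at_within_open) auto
    moreover have "dird (trunc n (0 + cmul c v)) f z = dird v f z * c" for c
    proof -
      have "dird (cmul c v) f z = Re c *\<^sub>R dird v f z + Im c *\<^sub>R (\<i> * dird v f z)"
        unfolding cmul_Re_Im[of c] using f z v dird_linear[OF fz D z v cvecs_cmul[OF v]] by (simp add: holo_on_def)
      also have "\<dots> = dird v f z * c" by (simp add: complex_eq_iff)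
      finally show ?thesis using v by simp
    qed
    ultimately have "((\<lambda>c. f (z + cmul c v)) has_field_derivative dird v f z) (at 0)"
      by (simp add: has_field_derivative_def)
    then show "(\<lambda>c. f (z + cmul c v)) field_differentiable (at 0)"
      by (auto simp: field_differentiable_def)
  qed
qed

text \<open>The class \<open>line_holo\<close> is closed under directional derivatives and consists
  of differentiable functions, so induction on the order goes through.\<close>

lemma smooth_on_C_holo_on:
  assumes D: "open_in_C n D" and f: "holo_on n D f"
  shows "smooth_on_C n D f"
proof (rule smooth_on_C_I)
  fix k
  have "line_holo n D f" using f holo_on_iff_line_holo[OF D] by simp
  then show "Ck_on k n D f"
  proof (induction k arbitrary: f)
    case 0
    then show ?case by (simp add: line_holo_def)
  next
    case (Suc k)
    then show ?case using line_holo_differentiable_on[OF D] line_holo_dird[OF D] by simp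
  qed
qed

section \<open>Operations on holomorphic functions and maps\<close>

lemma holo_on_cong:
  assumes D: "open_in_C n D" and "holo_on n D f" "\<And>z. z \<in> D \<Longrightarrow> f z = g z"
  shows "holo_on n D g"
proof -
  have "dird v g z = dird v f z" if "z \<in> D" "v \<in> cvecs n" for v z
    by (rule dird_cong[OF D that, symmetric, OF assms(3)])
  then show ?thesis
    using assms(2) differentiable_on_cong'[OF _ assms(3)] unfolding holo_on_def by auto
qed

lemma holo_on_subset: "holo_on n D f \<Longrightarrow> E \<subseteq> D \<Longrightarrow> holo_on n E f"
  unfolding holo_on_def using differentiable_on_subset by blast

lemma holo_on_local:
  assumes D: "open_in_C n D" and loc: "\<And>z. z \<in> D \<Longrightarrow> \<exists>E. open_in_C n E \<and> z \<in> E \<and> E \<subseteq> D \<and> holo_on n E f"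
  shows "holo_on n D f"
  unfolding holo_on_def
proof (intro conjI ballI)
  have "Ck_on (Suc 0) n D f"
    by (rule Ck_on_local[OF D]) (use loc smooth_on_C_holo_on smooth_on_CD in metis)
  then show "f differentiable_on D" by simp
  fix z v assume "z \<in> D" "v \<in> cvecs n"
  then show "dird (cmul \<i> v) f z = \<i> * dird v f z" using loc[of z] by (auto simp: holo_on_def)
qed

lemma holo_mapD:
  assumes D: "open_in_C n D" and F: "holo_map n m D F"
  shows "smooth_on_C n D F" and "\<And>z. z \<in> D \<Longrightarrow> F z \<in> cvecs m"
    and "\<And>z v. z \<in> D \<Longrightarrow> v \<in> cvecs n \<Longrightarrow> dird v F z \<in> cvecs m"
    and "\<And>z v. z \<in> D \<Longrightarrow> v \<in> cvecs n \<Longrightarrow> dird (cmul \<i> v) F z = cmul \<i> (dird v F z)"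
proof -
  show m: "F z \<in> cvecs m" if "z \<in> D" for z using F that by (auto simp: holo_map_def)
  have h: "holo_on n D (\<lambda>z. coord (F z) i)" if "i < m" for i using F that by (simp add: holo_map_def)
  show s: "smooth_on_C n D F"
    by (rule smooth_on_C_coordwise[OF D m smooth_on_C_holo_on[OF D h]])
  show c: "dird v F z \<in> cvecs m" if "z \<in> D" "v \<in> cvecs n" for z v
    by (rule dird_in_cvecs[OF smooth_on_C_diff_at[OF s that(1)] m D that])
  have lin: "dird v (\<lambda>y. coord (F y) i) z = coord (dird v F z) i" if "z \<in> D" "v \<in> cvecs n" for v z i
    by (rule dird_linear_comp[OF smooth_on_C_diff_at[OF s that(1)] D that bounded_linear_coord])
  show "dird (cmul \<i> v) F z = cmul \<i> (dird v F z)" if zv: "z \<in> D" "v \<in> cvecs n" for z v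
  proof (rule cvec_eqI_on[of _ m])
    fix i assume "i < m"
    then show "coord (dird (cmul \<i> v) F z) i = coord (cmul \<i> (dird v F z)) i"
      using h[of i] zv lin[OF zv(1), of "cmul \<i> v" i] lin[OF zv, of i] by (simp add: holo_on_def)
  qed (use c zv in auto)
qed

lemma holo_on_compose:
  assumes D: "open_in_C n D" and E: "open_in_C m E" and F: "holo_map n m D F"
    and FE: "\<And>z. z \<in> D \<Longrightarrow> F z \<in> E" and g: "holo_on m E g"
  shows "holo_on n D (\<lambda>z. g (F z))"
  unfolding holo_on_def
proof (intro conjI ballI)
  note F' = holo_mapD[OF D F]
  have gs: "smooth_on_C m E g" by (rule smooth_on_C_holo_on[OF E g])
  show "(\<lambda>z. g (F z)) differentiable_on D"
    by (rule smooth_on_C_diff[OF smooth_on_C_compose[OF D E F'(1) FE gs]])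
  fix z v assume z: "z \<in> D" and v: "v \<in> cvecs n"
  have ch: "dird w (\<lambda>z. g (F z)) z = dird (dird w F z) g (F z)" if "w \<in> cvecs n" for w
    by (rule dird_compose[OF smooth_on_C_diff_at[OF F'(1) z] smooth_on_C_diff_at[OF gs FE[OF z]] FE D E z that])
  show "dird (cmul \<i> v) (\<lambda>z. g (F z)) z = \<i> * dird v (\<lambda>z. g (F z)) z"
    using ch[OF v] ch[OF cvecs_cmul[OF v]] F'(3,4)[OF z v] g FE[OF z] by (simp add: holo_on_def)
qed

lemma holo_map_compose:
  assumes D: "open_in_C n D" and E: "open_in_C m E" and F: "holo_map n m D F"
    and FE: "\<And>z. z \<in> D \<Longrightarrow> F z \<in> E" and G: "holo_map m k E G"
  shows "holo_map n k D (\<lambda>z. G (F z))"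
  unfolding holo_map_def
proof (intro conjI allI impI)
  show "(\<lambda>z. G (F z)) \<in> D \<rightarrow> cvecs k" using FE G by (auto simp: holo_map_def)
  fix i assume "i < k"
  then show "holo_on n D (\<lambda>z. coord (G (F z)) i)"
    by (intro holo_on_compose[OF D E F FE]) (use G in \<open>auto simp: holo_map_def\<close>)
qed

lemma holo_map_subset: "holo_map n m D F \<Longrightarrow> E \<subseteq> D \<Longrightarrow> holo_map n m E F"
  unfolding holo_map_def using holo_on_subset by blast

lemma holo_on_coord: "open_in_C n D \<Longrightarrow> holo_on n D (\<lambda>z. coord z i)"
  using smooth_on_C_diff[OF smooth_on_C_bounded_linear[OF bounded_linear_coord]]
  by (auto simp: holo_on_def dird_bounded_linear[OF bounded_linear_coord])

lemma complex_linear_on_expand: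
  assumes g: "complex_linear_on n g" and z: "z \<in> cvecs n"
  shows "g z = (\<Sum>j<n. cmul (coord z j) (g (Poly_Mapping.single j 1)))"
proof -
  have s: "g (\<Sum>j\<in>A. f j) = (\<Sum>j\<in>A. g (f j))" if "finite A" "\<And>j. j \<in> A \<Longrightarrow> f j \<in> cvecs n" for A and f :: "nat \<Rightarrow> cvec"
    using that
  proof (induction A)
    case empty
    have "g (cmul 0 0) = cmul 0 (g 0)" using g cvecs_zero unfolding complex_linear_on_def by blast
    then show ?case by simp
  next
    case (insert x F)
    then show ?case using g by (simp add: complex_linear_on_def)
  qed
  have "cmul c (Poly_Mapping.single j 1) = Poly_Mapping.single j c" for j c
    by (rule cvec_eqI) (simp add: coord_single)
  then have "(\<Sum>j<n. cmul (coord z j) (Poly_Mapping.single j 1)) = z"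
    using cvecs_expand[OF z, symmetric] by simp
  then have "g z = g (\<Sum>j<n. cmul (coord z j) (Poly_Mapping.single j 1))" by simp
  also have "\<dots> = (\<Sum>j<n. cmul (coord z j) (g (Poly_Mapping.single j 1)))"
    using g by (subst s) (auto simp: complex_linear_on_def)
  finally show ?thesis .
qed

text \<open>The elements of a chart group are linear on \<open>cvecs n\<close> only, being
  extensional elsewhere, so they are not linear maps of the whole type. Each coordinate is replaced
  by the globally linear functional \<open>L\<close> that agrees with it on
  \<open>D\<close>.\<close>

lemma holo_map_linear:
  assumes D: "open_in_C n D" and g: "complex_linear_on n g" and gn: "\<And>z. z \<in> cvecs n \<Longrightarrow> g z \<in> cvecs n"
  shows "holo_map n n D g"
  unfolding holo_map_def
proof (intro conjI allI impI)
  have Dn: "z \<in> cvecs n" if "z \<in> D" for z using D that open_in_C_subset by blast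
  then show "g \<in> D \<rightarrow> cvecs n" using gn by auto
  fix i assume "i < n"
  define L where "L z = (\<Sum>j<n. coord z j * coord (g (Poly_Mapping.single j 1)) i)" for z
  have bl: "bounded_linear L"
    unfolding L_def
    by (intro bounded_linear_sum bounded_linear_compose[OF bounded_linear_mult_left bounded_linear_coord])
  have "holo_on n D L"
    using smooth_on_C_diff[OF smooth_on_C_bounded_linear[OF bl]]
    by (auto simp: holo_on_def dird_bounded_linear[OF bl] L_def sum_distrib_left mult.assoc)
  then show "holo_on n D (\<lambda>z. coord (g z) i)"
    by (rule holo_on_cong[OF D]) (simp add: complex_linear_on_expand[OF g Dn] L_def)
qed

section \<open>Levi forms and second derivatives\<close>

abbreviation hess :: "(cvec \<Rightarrow> real) \<Rightarrow> cvec \<Rightarrow> cvec \<Rightarrow> cvec \<Rightarrow> real" where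
  "hess \<phi> z u w \<equiv> dird u (dird w \<phi>) z"

lemma hess_commute:
  "open_in_C n D \<Longrightarrow> smooth_on_C n D \<phi> \<Longrightarrow> z \<in> D \<Longrightarrow> u \<in> cvecs n \<Longrightarrow> w \<in> cvecs n \<Longrightarrow>
   hess \<phi> z u w = hess \<phi> z w u"
  by (rule dird_commute_real)

lemma hess_linear_left:
  assumes "open_in_C n D" "smooth_on_C n D \<phi>" "z \<in> D" "u \<in> cvecs n" "u' \<in> cvecs n" "w \<in> cvecs n"
  shows "hess \<phi> z (a *\<^sub>R u + b *\<^sub>R u') w = a * hess \<phi> z u w + b * hess \<phi> z u' w"
  using dird_linear[OF smooth_on_C_diff_at[OF smooth_on_C_dird[OF assms(2,6)] assms(3)] assms(1,3-5)] by simp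

lemma hess_linear_right:
  assumes "open_in_C n D" "smooth_on_C n D \<phi>" "z \<in> D" "u \<in> cvecs n" "u' \<in> cvecs n" "w \<in> cvecs n"
  shows "hess \<phi> z w (a *\<^sub>R u + b *\<^sub>R u') = a * hess \<phi> z w u + b * hess \<phi> z w u'"
  using hess_linear_left[OF assms, of a b] hess_commute[OF assms(1-3), of w] assms by simp

lemma cmul_i_i: "cmul \<i> (cmul \<i> v) = (-1) *\<^sub>R v"
  by (rule cvec_eqI) (simp add: mult.assoc[symmetric])

lemma hess_i_i:
  assumes "open_in_C n D" "smooth_on_C n D \<phi>" "z \<in> D" "u \<in> cvecs n" "w \<in> cvecs n"
  shows "hess \<phi> z (cmul \<i> (cmul \<i> u)) w = - hess \<phi> z u w"
    and "hess \<phi> z w (cmul \<i> (cmul \<i> u)) = - hess \<phi> z w u"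
  using hess_linear_left[OF assms(1-4) assms(4,5), of "-1" 0] hess_linear_right[OF assms(1-4) assms(4,5), of "-1" 0]
  by (simp_all add: cmul_i_i)

lemma linear_on_sum:
  fixes T :: "cvec \<Rightarrow> 'b::real_vector"
  assumes "\<And>u u' a b. u \<in> cvecs n \<Longrightarrow> u' \<in> cvecs n \<Longrightarrow> T (a *\<^sub>R u + b *\<^sub>R u') = a *\<^sub>R T u + b *\<^sub>R T u'"
    and "finite I" "\<And>i. i \<in> I \<Longrightarrow> u i \<in> cvecs n"
  shows "T (\<Sum>i\<in>I. a i *\<^sub>R u i) = (\<Sum>i\<in>I. a i *\<^sub>R T (u i))"
  using assms(2,3)
proof (induction I)
  case empty
  then show ?case using assms(1)[of 0 0 0 0] by simp
next
  case (insert x F)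
  then have "(\<Sum>i\<in>F. a i *\<^sub>R u i) \<in> cvecs n" by simp
  then show ?case using insert assms(1)[of "u x" "\<Sum>i\<in>F. a i *\<^sub>R u i" "a x" 1] by simp
qed

lemma complex_linear_expand:
  fixes T :: "cvec \<Rightarrow> complex"
  assumes lin: "\<And>u u' a b. u \<in> cvecs n \<Longrightarrow> u' \<in> cvecs n \<Longrightarrow> T (a *\<^sub>R u + b *\<^sub>R u') = a *\<^sub>R T u + b *\<^sub>R T u'"
    and i: "\<And>u. u \<in> cvecs n \<Longrightarrow> T (cmul \<i> u) = \<i> * T u" and v: "v \<in> cvecs n"
  shows "T v = (\<Sum>j<n. coord v j * T (Poly_Mapping.single j 1))"
proof -
  have si: "Poly_Mapping.single j \<i> = cmul \<i> (Poly_Mapping.single j 1)" for j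
    by (rule cvec_eqI) (simp add: coord_single)
  have "T v = T (\<Sum>k<2*n. rcoord k v *\<^sub>R rbasis k)" using rbasis_expand[OF v] by simp
  also have "\<dots> = (\<Sum>k<2*n. rcoord k v *\<^sub>R T (rbasis k))"
    by (rule linear_on_sum[of n T, OF lin]) auto
  also have "\<dots> = (\<Sum>j<n. coord v j * T (Poly_Mapping.single j 1))"
    unfolding sum_double
    by (rule sum.cong[OF refl], simp add: rcoord_def rbasis_def si i)
       (simp add: complex_eq_iff)
  finally show ?thesis .
qed

text \<open>A quarter of (d/dx_j - i d/dy_j)(d/dx_k + i d/dy_k) multiplied out, with
  \<open>e\<close> and \<open>f\<close> the unit vectors in the x and y directions.\<close>

lemma wirt_wirt_bar:
  assumes D: "open_in_C n D" and \<phi>: "smooth_on_C n D \<phi>" and z: "z \<in> D" and jk: "j < n" "k < n"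
  defines "e \<equiv> \<lambda>j. Poly_Mapping.single j (1::complex)" and "f \<equiv> \<lambda>j. Poly_Mapping.single j \<i>"
  shows "wirt j (wirt_bar k (\<lambda>y. complex_of_real (\<phi> y))) z =
    (complex_of_real (hess \<phi> z (e j) (e k) + hess \<phi> z (f j) (f k))
      + \<i> * complex_of_real (hess \<phi> z (e j) (f k) - hess \<phi> z (f j) (e k))) / 4"
proof -
  have ef: "e i \<in> cvecs n" "f i \<in> cvecs n" if "i < n" for i using that by (simp_all add: e_def f_def)
  define L1 L2 where "L1 = (\<lambda>x. complex_of_real x / 2)" and "L2 = (\<lambda>x. \<i> * complex_of_real x / 2)"
  have L: "bounded_linear L1" "bounded_linear L2"
    unfolding L1_def L2_def
    by (intro bounded_linear_compose[OF bounded_linear_divide] bounded_linear_of_real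
        bounded_linear_compose[OF bounded_linear_mult_right])+
  have bar: "wirt_bar k (\<lambda>y. complex_of_real (\<phi> y)) y = L1 (dird (e k) \<phi> y) + L2 (dird (f k) \<phi> y)" if "y \<in> D" for y
    using dird_linear_comp[OF smooth_on_C_diff_at[OF \<phi> that] D that _ bounded_linear_of_real[where 'a=complex]] ef[OF jk(2)]
    by (simp add: wirt_bar_def L1_def L2_def e_def f_def add_divide_distrib)
  have dd: "dird u (wirt_bar k (\<lambda>y. complex_of_real (\<phi> y))) z = L1 (hess \<phi> z u (e k)) + L2 (hess \<phi> z u (f k))"
    if u: "u \<in> cvecs n" for u
  proof -
    have s: "smooth_on_C n D (dird (e k) \<phi>)" "smooth_on_C n D (dird (f k) \<phi>)"
      using ef[OF jk(2)] by (simp_all add: smooth_on_C_dird[OF \<phi>])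
    have "dird u (wirt_bar k (\<lambda>y. complex_of_real (\<phi> y))) z = dird u (\<lambda>y. L1 (dird (e k) \<phi> y) + L2 (dird (f k) \<phi> y)) z"
      by (rule dird_cong[OF D z u bar])
    also have "\<dots> = dird u (\<lambda>y. L1 (dird (e k) \<phi> y)) z + dird u (\<lambda>y. L2 (dird (f k) \<phi> y)) z"
      by (rule dird_add[OF smooth_on_C_diff_at[OF smooth_on_C_linear_comp[OF D L(1) s(1)] z]
            smooth_on_C_diff_at[OF smooth_on_C_linear_comp[OF D L(2) s(2)] z] D z u])
    also have "\<dots> = L1 (hess \<phi> z u (e k)) + L2 (hess \<phi> z u (f k))"
      using dird_linear_comp[OF smooth_on_C_diff_at[OF s(1) z] D z u L(1)]
        dird_linear_comp[OF smooth_on_C_diff_at[OF s(2) z] D z u L(2)] by simp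
    finally show ?thesis .
  qed
  show ?thesis
    using dd[OF ef(1)[OF jk(1)]] dd[OF ef(2)[OF jk(1)]]
    by (simp add: wirt_def e_def f_def L1_def L2_def complex_eq_iff)
qed

text \<open>The right-hand side is complex linear in \<open>v\<close> and conjugate linear in
  \<open>w\<close>, hence determined by its values on unit vectors, where it is
  \<open>wirt_wirt_bar\<close>. Free of coordinates, the Levi form becomes accessible to the chain
  rule.\<close>

lemma levi_hess:
  assumes D: "open_in_C n D" and \<phi>: "smooth_on_C n D \<phi>" and z: "z \<in> D" and v: "v \<in> cvecs n" and w: "w \<in> cvecs n"
  shows "levi n \<phi> z v w =
    (complex_of_real (hess \<phi> z v w + hess \<phi> z (cmul \<i> v) (cmul \<i> w))
      + \<i> * complex_of_real (hess \<phi> z v (cmul \<i> w) - hess \<phi> z (cmul \<i> v) w)) / 4"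
proof -
  define B where "B v w = (complex_of_real (hess \<phi> z v w + hess \<phi> z (cmul \<i> v) (cmul \<i> w))
      + \<i> * complex_of_real (hess \<phi> z v (cmul \<i> w) - hess \<phi> z (cmul \<i> v) w)) / 4" for v w
  note H = hess_linear_left[OF D \<phi> z] hess_linear_right[OF D \<phi> z] hess_i_i[OF D \<phi> z]
  have 1: "B (a *\<^sub>R u + b *\<^sub>R u') w = a *\<^sub>R B u w + b *\<^sub>R B u' w"
    if "u \<in> cvecs n" "u' \<in> cvecs n" "w \<in> cvecs n" for u u' w a b
    using that by (simp add: B_def H cmul_add cmul_scaleR complex_eq_iff algebra_simps add_divide_distrib diff_divide_distrib)
  have 2: "B w (a *\<^sub>R u + b *\<^sub>R u') = a *\<^sub>R B w u + b *\<^sub>R B w u'"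
    if "u \<in> cvecs n" "u' \<in> cvecs n" "w \<in> cvecs n" for u u' w a b
    using that by (simp add: B_def H cmul_add cmul_scaleR complex_eq_iff algebra_simps add_divide_distrib diff_divide_distrib)
  have 3: "B (cmul \<i> u) w = \<i> * B u w" "B u (cmul \<i> w) = - \<i> * B u w" if "u \<in> cvecs n" "w \<in> cvecs n" for u w
    using that by (simp_all add: B_def H complex_eq_iff diff_divide_distrib add_divide_distrib)
  let ?e = "\<lambda>j. Poly_Mapping.single j (1::complex)"
  have "B v w = (\<Sum>j<n. coord v j * B (?e j) w)"
    by (rule complex_linear_expand[of n "\<lambda>v. B v w"]) (use 1 3 v w in auto)
  also have "\<dots> = (\<Sum>j<n. \<Sum>k<n. B (?e j) (?e k) * coord v j * cnj (coord w k))"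
  proof (rule sum.cong[OF refl])
    fix j assume "j \<in> {..<n}"
    then have ej: "?e j \<in> cvecs n" by simp
    \<comment> \<open>Conjugation turns the conjugate linear argument into a complex linear one, so
      the same expansion applies.\<close>
    have "cnj (B (?e j) w) = (\<Sum>k<n. coord w k * cnj (B (?e j) (?e k)))"
      by (rule complex_linear_expand[of n "\<lambda>w. cnj (B (?e j) w)"]) (use 2 3 ej w in auto)
    from arg_cong[OF this, of cnj] show "coord v j * B (?e j) w = (\<Sum>k<n. B (?e j) (?e k) * coord v j * cnj (coord w k))"
      by (simp add: sum_distrib_left mult_ac)
  qed
  also have "\<dots> = levi n \<phi> z v w"
    unfolding levi_def
  proof (intro sum.cong refl)
    fix j k assume "j \<in> {..<n}" "k \<in> {..<n}"
    moreover have "Poly_Mapping.single j \<i> = cmul \<i> (?e j)" for j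
      by (rule cvec_eqI) (simp add: coord_single)
    ultimately show "B (?e j) (?e k) * coord v j * cnj (coord w k) =
        wirt j (wirt_bar k (\<lambda>y. complex_of_real (\<phi> y))) z * coord v j * cnj (coord w k)"
      using wirt_wirt_bar[OF D \<phi> z, of j k] by (simp add: B_def)
  qed
  finally show ?thesis by (simp add: B_def)
qed

lemma Re_levi:
  assumes "open_in_C n D" "smooth_on_C n D \<phi>" "z \<in> D" "v \<in> cvecs n"
  shows "Re (levi n \<phi> z v v) = (hess \<phi> z v v + hess \<phi> z (cmul \<i> v) (cmul \<i> v)) / 4"
  by (subst levi_hess[OF assms assms(4)]) simp

lemma tangent_lists_0 [simp]: "vs \<in> tangent_lists n 0 \<longleftrightarrow> vs = []"
  by (auto simp: tangent_lists_def)

lemma tangent_lists_1: "vs \<in> tangent_lists n (Suc 0) \<longleftrightarrow> (\<exists>v\<in>cvecs n. vs = [v])"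
  by (auto simp: tangent_lists_def length_Suc_conv)

lemma tangent_lists_2: "vs \<in> tangent_lists n 2 \<longleftrightarrow> (\<exists>v\<in>cvecs n. \<exists>w\<in>cvecs n. vs = [v, w])"
  by (auto simp: tangent_lists_def length_Suc_conv numeral_2_eq_2)

text \<open>Of the expression in \<open>levi_hess\<close>, the real part is symmetric in
  \<open>v\<close> and \<open>w\<close> and cancels; the imaginary part is antisymmetric and
  doubles.\<close>

lemma i_ddbar_hess:
  assumes "open_in_C n D" "smooth_on_C n D \<phi>" "z \<in> D" "v \<in> cvecs n" "w \<in> cvecs n"
  shows "i_ddbar n D \<phi> z [v, w] = (hess \<phi> z (cmul \<i> v) w - hess \<phi> z v (cmul \<i> w)) / 2"
proof -
  have "[v, w] \<in> tangent_lists n 2" using assms by (auto simp: tangent_lists_2)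
  then show ?thesis
    using assms(3) hess_commute[OF assms(1-3)] assms(4,5)
    by (simp add: i_ddbar_def levi_hess[OF assms(1-3)] diff_divide_distrib)
qed

text \<open>Half the Laplacian of \<open>\<phi>\<close> along the complex line through
  \<open>z\<close> in the direction \<open>v\<close>. All positivity arguments run through these
  values.\<close>

lemma i_ddbar_pos_eq:
  assumes "open_in_C n D" "smooth_on_C n D \<phi>" "z \<in> D" "v \<in> cvecs n"
  shows "i_ddbar n D \<phi> z [v, cmul \<i> v] = (hess \<phi> z v v + hess \<phi> z (cmul \<i> v) (cmul \<i> v)) / 2"
  using i_ddbar_hess[OF assms, of "cmul \<i> v"] hess_i_i[OF assms(1-3)] assms(4) by simp

lemma i_ddbar_type_1_1:
  assumes "open_in_C n D" "smooth_on_C n D \<phi>"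
  shows "type_1_1 n D (i_ddbar n D \<phi>)"
  unfolding type_1_1_def
  using assms by (auto simp: i_ddbar_hess[OF assms] hess_i_i[OF assms])

text \<open>The inner derivative of \<open>\<phi>\<close> is taken in a direction that moves with
  the point; written in the real basis it can be differentiated by the product rule. The last term
  comes from the motion of that direction.\<close>

lemma hess_compose:
  assumes D: "open_in_C n D" and E: "open_in_C m E" and F: "smooth_on_C n D F"
    and FE: "\<And>z. z \<in> D \<Longrightarrow> F z \<in> E" and \<phi>: "smooth_on_C m E \<phi>" and z: "z \<in> D"
    and v: "v \<in> cvecs n" and w: "w \<in> cvecs n"
  shows "hess (\<lambda>y. \<phi> (F y)) z v w =
    hess \<phi> (F z) (dird v F z) (dird w F z) + dird (dird v (dird w F) z) \<phi> (F z)"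
proof -
  have Em: "F y \<in> cvecs m" if "y \<in> D" for y using FE[OF that] E open_in_C_subset by blast
  have dF: "dird u F y \<in> cvecs m" if "u \<in> cvecs n" "y \<in> D" for u y
    by (rule dird_in_cvecs[OF smooth_on_C_diff_at[OF F that(2)] Em D that(2,1)])
  have sF: "smooth_on_C n D (dird w F)" by (rule smooth_on_C_dird[OF F w])
  have ddF: "dird v (dird w F) z \<in> cvecs m"
    by (rule dird_in_cvecs[OF smooth_on_C_diff_at[OF sF z] dF[OF w] D z v])
  let ?e = rbasis
  have s\<phi>: "smooth_on_C m E (dird (?e k) \<phi>)" if "k < 2*m" for k
    using that by (intro smooth_on_C_dird \<phi>) simp
  have s1: "smooth_on_C n D (\<lambda>y. rcoord k (dird w F y))" for k
    by (rule smooth_on_C_linear_comp[OF D bounded_linear_rcoord sF])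
  have s2: "smooth_on_C n D (\<lambda>y. dird (?e k) \<phi> (F y))" if "k < 2*m" for k
    by (rule smooth_on_C_compose[OF D E F FE s\<phi>[OF that]])
  have "hess (\<lambda>y. \<phi> (F y)) z v w = dird v (\<lambda>y. \<Sum>k<2*m. rcoord k (dird w F y) * dird (?e k) \<phi> (F y)) z"
  proof (rule dird_cong[OF D z v])
    fix y assume y: "y \<in> D"
    show "dird w (\<lambda>y. \<phi> (F y)) y = (\<Sum>k<2*m. rcoord k (dird w F y) * dird (?e k) \<phi> (F y))"
      using dird_compose[OF smooth_on_C_diff_at[OF F y] smooth_on_C_diff_at[OF \<phi> FE[OF y]] FE D E y w]
        dird_rbasis[OF smooth_on_C_diff_at[OF \<phi> FE[OF y]] E FE[OF y] dF[OF w y]] by simp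
  qed
  also have "\<dots> = (\<Sum>k<2*m. dird v (\<lambda>y. rcoord k (dird w F y) * dird (?e k) \<phi> (F y)) z)"
    by (rule dird_sum[OF _ D z v])
       (use smooth_on_C_diff_at[OF smooth_on_C_mult[OF D s1 s2] z] in auto)
  also have "\<dots> = (\<Sum>k<2*m. rcoord k (dird w F z) * hess \<phi> (F z) (dird v F z) (?e k)
      + rcoord k (dird v (dird w F) z) * dird (?e k) \<phi> (F z))"
  proof (rule sum.cong[OF refl])
    fix k assume "k \<in> {..<2*m}"
    then have k: "k < 2*m" by simp
    show "dird v (\<lambda>y. rcoord k (dird w F y) * dird (?e k) \<phi> (F y)) z = rcoord k (dird w F z) * hess \<phi> (F z) (dird v F z) (?e k)
      + rcoord k (dird v (dird w F) z) * dird (?e k) \<phi> (F z)"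
      using dird_bilinear[OF smooth_on_C_diff_at[OF s1 z] smooth_on_C_diff_at[OF s2[OF k] z] D z v bounded_bilinear_mult]
        dird_linear_comp[OF smooth_on_C_diff_at[OF sF z] D z v bounded_linear_rcoord[of k]]
        dird_compose[OF smooth_on_C_diff_at[OF F z] smooth_on_C_diff_at[OF s\<phi>[OF k] FE[OF z]] FE D E z v]
      by simp
  qed
  also have "\<dots> = hess \<phi> (F z) (dird v F z) (dird w F z) + dird (dird v (dird w F) z) \<phi> (F z)"
  proof -
    have "hess \<phi> (F z) (dird v F z) (dird w F z) = hess \<phi> (F z) (dird w F z) (dird v F z)"
      by (rule hess_commute[OF E \<phi> FE[OF z] dF[OF v z] dF[OF w z]])
    also have "\<dots> = (\<Sum>k<2*m. rcoord k (dird w F z) * hess \<phi> (F z) (?e k) (dird v F z))"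
      using dird_rbasis[OF smooth_on_C_diff_at[OF smooth_on_C_dird[OF \<phi> dF[OF v z]] FE[OF z]] E FE[OF z] dF[OF w z]] by simp
    also have "\<dots> = (\<Sum>k<2*m. rcoord k (dird w F z) * hess \<phi> (F z) (dird v F z) (?e k))"
      using hess_commute[OF E \<phi> FE[OF z] dF[OF v z]] by (intro sum.cong) auto
    finally show ?thesis
      using dird_rbasis[OF smooth_on_C_diff_at[OF \<phi> FE[OF z]] E FE[OF z] ddF] by (simp add: sum.distrib)
  qed
  finally show ?thesis .
qed

text \<open>The second derivatives of a holomorphic \<open>F\<close> are complex bilinear. So the
  terms of \<open>hess_compose\<close> containing them agree for (iv, w) and (v, iw) and cancel in
  the difference that defines i ddbar; what is left is the Hessian of \<open>\<phi>\<close> at the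
  image directions.\<close>

lemma i_ddbar_pull:
  assumes D: "open_in_C n D" and E: "open_in_C m E" and F: "holo_map n m D F"
    and FE: "\<And>z. z \<in> D \<Longrightarrow> F z \<in> E" and \<phi>: "smooth_on_C m E \<phi>"
  shows "pull_form n D F (i_ddbar m E \<phi>) = i_ddbar n D (\<lambda>y. \<phi> (F y))"
proof (intro ext)
  fix z vs
  note F' = holo_mapD[OF D F]
  have s: "smooth_on_C n D (\<lambda>y. \<phi> (F y))" by (rule smooth_on_C_compose[OF D E F'(1) FE \<phi>])
  show "pull_form n D F (i_ddbar m E \<phi>) z vs = i_ddbar n D (\<lambda>y. \<phi> (F y)) z vs"
  proof (cases "z \<in> D \<and> vs \<in> tangent_lists n 2")
    case False
    then show ?thesis by (auto simp: pull_form_def i_ddbar_def tangent_lists_def)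
  next
    case True
    then obtain v w where vw: "v \<in> cvecs n" "w \<in> cvecs n" "vs = [v, w]" and z: "z \<in> D"
      by (auto simp: tangent_lists_2)
    have ddi: "dird (cmul \<i> v) (dird w F) z = cmul \<i> (dird v (dird w F) z)"
      "dird v (dird (cmul \<i> w) F) z = cmul \<i> (dird v (dird w F) z)" if v: "v \<in> cvecs n" and w: "w \<in> cvecs n" for v w
    proof -
      have *: "coord (dird u (dird u' F) z) i = dird u (dird u' (\<lambda>y. coord (F y) i)) z"
        if u: "u \<in> cvecs n" and u': "u' \<in> cvecs n" for u u' i
      proof -
        have "dird u (dird u' (\<lambda>y. coord (F y) i)) z = dird u (\<lambda>y. coord (dird u' F y) i) z"
          by (rule dird_cong[OF D z u])
             (rule dird_linear_comp[OF smooth_on_C_diff_at[OF F'(1)] D _ u' bounded_linear_coord])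
        also have "\<dots> = coord (dird u (dird u' F) z) i"
          by (rule dird_linear_comp[OF smooth_on_C_diff_at[OF smooth_on_C_dird[OF F'(1) u'] z] D z u bounded_linear_coord])
        finally show ?thesis by simp
      qed
      \<comment> \<open>Symmetry of second derivatives is known for complex-valued functions, so it
        is applied to each coordinate of \<open>F\<close>.\<close>
      have sw: "dird u (dird u' F) z = dird u' (dird u F) z" if u: "u \<in> cvecs n" and u': "u' \<in> cvecs n" for u u'
      proof (rule cvec_eqI)
        fix i
        have "smooth_on_C n D (\<lambda>y. coord (F y) i)"
          by (rule smooth_on_C_linear_comp[OF D bounded_linear_coord F'(1)])
        from dird_commute_complex[OF D this z u u']
        show "coord (dird u (dird u' F) z) i = coord (dird u' (dird u F) z) i"
          by (simp add: *[OF u u'] *[OF u' u])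
      qed
      have i: "dird u (dird (cmul \<i> u') F) z = cmul \<i> (dird u (dird u' F) z)" if u: "u \<in> cvecs n" and u': "u' \<in> cvecs n" for u u'
      proof -
        have "dird u (dird (cmul \<i> u') F) z = dird u (\<lambda>y. cmul \<i> (dird u' F y)) z"
          by (rule dird_cong[OF D z u F'(4)[OF _ u']])
        also have "\<dots> = cmul \<i> (dird u (dird u' F) z)"
          by (rule dird_linear_comp[OF smooth_on_C_diff_at[OF smooth_on_C_dird[OF F'(1) u'] z] D z u bounded_linear_cmul])
        finally show ?thesis .
      qed
      show "dird v (dird (cmul \<i> w) F) z = cmul \<i> (dird v (dird w F) z)" by (rule i[OF v w])
      show "dird (cmul \<i> v) (dird w F) z = cmul \<i> (dird v (dird w F) z)"
        using i[OF w v] sw[OF cvecs_cmul[OF v] w] sw[OF v w] by simp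
    qed
    have "i_ddbar n D (\<lambda>y. \<phi> (F y)) z vs = (hess \<phi> (F z) (cmul \<i> (dird v F z)) (dird w F z) - hess \<phi> (F z) (dird v F z) (cmul \<i> (dird w F z))) / 2"
      using vw i_ddbar_hess[OF D s z vw(1,2)] hess_compose[OF D E F'(1) FE \<phi> z] ddi[OF vw(1,2)] F'(4)[OF z]
      by simp
    also have "\<dots> = i_ddbar m E \<phi> (F z) [dird v F z, dird w F z]"
      using i_ddbar_hess[OF E \<phi> FE[OF z] F'(3)[OF z vw(1)] F'(3)[OF z vw(2)]] by simp
    finally show ?thesis using z vw by (simp add: pull_form_def)
  qed
qed

section \<open>Forms\<close>

lemma kformsI:
  assumes "\<And>z vs. \<not> (z \<in> D \<and> vs \<in> tangent_lists n k) \<Longrightarrow> \<omega> z vs = 0"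
    and "\<And>z. z \<in> D \<Longrightarrow> alternating_multilinear n k (\<omega> z)"
    and "\<And>vs. vs \<in> tangent_lists n k \<Longrightarrow> smooth_on_C n D (\<lambda>z. \<omega> z vs)"
  shows "\<omega> \<in> kforms n k D"
  using assms by (simp add: kforms_def)

lemma kforms_zero_outside:
  "\<omega> \<in> kforms n k D \<Longrightarrow> \<not> (z \<in> D \<and> vs \<in> tangent_lists n k) \<Longrightarrow> \<omega> z vs = 0"
  by (simp add: kforms_def)

lemma kforms_alternating: "\<omega> \<in> kforms n k D \<Longrightarrow> z \<in> D \<Longrightarrow> alternating_multilinear n k (\<omega> z)"
  by (simp add: kforms_def)

lemma kforms_smooth:
  assumes "\<omega> \<in> kforms n k D"
  shows "smooth_on_C n D (\<lambda>z. \<omega> z vs)"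
proof (cases "vs \<in> tangent_lists n k")
  case False
  then have "(\<lambda>z. \<omega> z vs) = (\<lambda>_. 0)" using kforms_zero_outside[OF assms] by blast
  then show ?thesis by simp
qed (use assms in \<open>simp add: kforms_def\<close>)

lemma kforms_nonempty_tangent: "\<omega> \<in> kforms n k D \<Longrightarrow> \<not> set vs \<subseteq> cvecs n \<Longrightarrow> \<omega> z vs = 0"
  by (rule kforms_zero_outside) (auto simp: tangent_lists_def)

lemma alternating_multilinear_1:
  assumes "\<And>u w a b. u \<in> cvecs n \<Longrightarrow> w \<in> cvecs n \<Longrightarrow> L [a *\<^sub>R u + b *\<^sub>R w] = a * L [u] + b * L [w]"
  shows "alternating_multilinear n (Suc 0) L"
  using assms by (auto simp: alternating_multilinear_def tangent_lists_1)

lemma alternating_multilinear_2: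
  assumes "\<And>u w x a b. u \<in> cvecs n \<Longrightarrow> w \<in> cvecs n \<Longrightarrow> x \<in> cvecs n \<Longrightarrow> L [a *\<^sub>R u + b *\<^sub>R w, x] = a * L [u, x] + b * L [w, x]"
    and "\<And>u w x a b. u \<in> cvecs n \<Longrightarrow> w \<in> cvecs n \<Longrightarrow> x \<in> cvecs n \<Longrightarrow> L [x, a *\<^sub>R u + b *\<^sub>R w] = a * L [x, u] + b * L [x, w]"
    and "\<And>x. x \<in> cvecs n \<Longrightarrow> L [x, x] = 0"
  shows "alternating_multilinear n 2 L"
  unfolding alternating_multilinear_def
proof (intro conjI ballI allI impI)
  fix vs i u w a b assume "vs \<in> tangent_lists n 2" "i < (2::nat)" "u \<in> cvecs n" "w \<in> cvecs n"
  then show "L (vs[i := a *\<^sub>R u + b *\<^sub>R w]) = a * L (vs[i := u]) + b * L (vs[i := w])"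
    using assms by (auto simp: tangent_lists_2 less_2_cases_iff)
next
  fix vs i j assume "vs \<in> tangent_lists n 2" "i < j \<and> j < (2::nat) \<and> vs ! i = vs ! j"
  then show "L vs = 0" using assms(3) by (auto simp: tangent_lists_2 less_2_cases_iff)
qed

lemma kforms_lincomb:
  assumes D: "open_in_C n D" and "\<omega> \<in> kforms n k D" "\<eta> \<in> kforms n k D"
  shows "(\<lambda>z vs. a * \<omega> z vs + b * \<eta> z vs) \<in> kforms n k D"
proof (rule kformsI)
  show "a * \<omega> z vs + b * \<eta> z vs = 0" if "\<not> (z \<in> D \<and> vs \<in> tangent_lists n k)" for z vs
    using that kforms_zero_outside[OF assms(2)] kforms_zero_outside[OF assms(3)] by simp
  show "alternating_multilinear n k (\<lambda>vs. a * \<omega> z vs + b * \<eta> z vs)" if "z \<in> D" for z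
    using assms(2,3)[THEN kforms_alternating, OF that] unfolding alternating_multilinear_def
    by (auto simp: algebra_simps)
  show "smooth_on_C n D (\<lambda>z. a * \<omega> z vs + b * \<eta> z vs)" for vs
    by (intro smooth_on_C_add[OF D] smooth_on_C_mult[OF D] smooth_on_C_const kforms_smooth[OF assms(2)] kforms_smooth[OF assms(3)])
qed

lemma kforms_0 [simp]: "(\<lambda>z vs. 0) \<in> kforms n k D"
  by (rule kformsI) (auto simp: alternating_multilinear_def)

lemma kforms_restrict:
  assumes D: "open_in_C n E" and "\<omega> \<in> kforms n k D" "E \<subseteq> D"
  shows "(\<lambda>z vs. if z \<in> E then \<omega> z vs else 0) \<in> kforms n k E"
proof (rule kformsI)
  show "(if z \<in> E then \<omega> z vs else 0) = 0" if "\<not> (z \<in> E \<and> vs \<in> tangent_lists n k)" for z vs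
    using that kforms_zero_outside[OF assms(2)] by auto
  show "alternating_multilinear n k (\<lambda>vs. if z \<in> E then \<omega> z vs else 0)" if "z \<in> E" for z
    using kforms_alternating[OF assms(2)] that assms(3) by auto
  show "smooth_on_C n E (\<lambda>z. if z \<in> E then \<omega> z vs else 0)" for vs
    by (rule smooth_on_C_cong[OF D smooth_on_C_subset[OF kforms_smooth[OF assms(2)] assms(3)]]) simp
qed

lemma kforms_local:
  assumes D: "open_in_C n D"
    and 0: "\<And>z vs. z \<notin> D \<Longrightarrow> \<omega> z vs = 0"
    and loc: "\<And>z. z \<in> D \<Longrightarrow> \<exists>E \<eta>. open_in_C n E \<and> z \<in> E \<and> E \<subseteq> D \<and> \<eta> \<in> kforms n k E \<and> (\<forall>y\<in>E. \<omega> y = \<eta> y)"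
  shows "\<omega> \<in> kforms n k D"
proof (rule kformsI)
  fix z vs assume "\<not> (z \<in> D \<and> vs \<in> tangent_lists n k)"
  then show "\<omega> z vs = 0"
  proof (cases "z \<in> D")
    case True
    then obtain E \<eta> where "z \<in> E" "\<eta> \<in> kforms n k E" "\<forall>y\<in>E. \<omega> y = \<eta> y" using loc by blast
    then show ?thesis using \<open>\<not> _\<close> True kforms_zero_outside by metis
  qed (rule 0)
next
  fix z assume "z \<in> D"
  then obtain E \<eta> where "z \<in> E" "\<eta> \<in> kforms n k E" "\<forall>y\<in>E. \<omega> y = \<eta> y" using loc by blast
  then show "alternating_multilinear n k (\<omega> z)" using kforms_alternating by metis
next
  fix vs
  show "smooth_on_C n D (\<lambda>z. \<omega> z vs)"
  proof (rule smooth_on_C_local[OF D])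
    fix z assume "z \<in> D"
    then obtain E \<eta> where E: "open_in_C n E" "z \<in> E" "E \<subseteq> D" "\<eta> \<in> kforms n k E" "\<forall>y\<in>E. \<omega> y = \<eta> y"
      using loc by blast
    have "smooth_on_C n E (\<lambda>z. \<omega> z vs)"
      by (rule smooth_on_C_cong[OF E(1) kforms_smooth[OF E(4)]]) (simp add: E(5))
    then show "\<exists>E. open_in_C n E \<and> z \<in> E \<and> E \<subseteq> D \<and> smooth_on_C n E (\<lambda>z. \<omega> z vs)" using E by blast
  qed
qed

section \<open>Pull-back of forms\<close>

lemma alternating_multilinear_sum:
  assumes L: "alternating_multilinear n k L" and "set xs \<subseteq> cvecs n" "set ys \<subseteq> cvecs n"
    "length xs + Suc (length ys) = k" "finite I" "\<And>i. i \<in> I \<Longrightarrow> u i \<in> cvecs n"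
  shows "L (xs @ (\<Sum>i\<in>I. a i *\<^sub>R u i) # ys) = (\<Sum>i\<in>I. a i * L (xs @ u i # ys))"
proof -
  have *: "L (xs @ (a *\<^sub>R u + b *\<^sub>R w) # ys) = a * L (xs @ u # ys) + b * L (xs @ w # ys)"
    if "u \<in> cvecs n" "w \<in> cvecs n" for u w a b
  proof -
    \<comment> \<open>The entry 0 is a placeholder, overwritten by the list updates in which
      multilinearity is phrased.\<close>
    have "xs @ 0 # ys \<in> tangent_lists n k" using assms by (auto simp: tangent_lists_def)
    moreover have "length xs < k" using assms by simp
    ultimately have "L ((xs @ 0 # ys)[length xs := a *\<^sub>R u + b *\<^sub>R w]) =
        a * L ((xs @ 0 # ys)[length xs := u]) + b * L ((xs @ 0 # ys)[length xs := w])"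
      using L that unfolding alternating_multilinear_def by blast
    then show ?thesis by simp
  qed
  from linear_on_sum[of n "\<lambda>x. L (xs @ x # ys)", OF _ assms(5,6)] * show ?thesis by simp
qed

text \<open>Smoothness of a form is stated for constant tangent vectors, but the vectors
  \<open>dird v F\<close> vary. The induction expands the last varying vector in the real basis and
  moves the constant basis vectors to the tail \<open>vs\<close>, until all entries are
  constant.\<close>

lemma pull_form_smooth:
  assumes D: "open_in_C n D" and E: "open_in_C m E" and F: "smooth_on_C n D F"
    and FE: "\<And>z. z \<in> D \<Longrightarrow> F z \<in> E" and \<omega>: "\<omega> \<in> kforms m k E"
    and "\<And>w. w \<in> set ws \<Longrightarrow> smooth_on_C n D w \<and> (\<forall>y\<in>D. w y \<in> cvecs m)"
    and "set vs \<subseteq> cvecs m" "length ws + length vs = k"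
  shows "smooth_on_C n D (\<lambda>y. \<omega> (F y) (map (\<lambda>w. w y) ws @ vs))"
  using assms(6-8)
proof (induction ws arbitrary: vs rule: rev_induct)
  case Nil
  show ?case
    using smooth_on_C_compose[OF D E F FE kforms_smooth[OF \<omega>]] by simp
next
  case (snoc w ws)
  have w: "smooth_on_C n D w" "\<And>y. y \<in> D \<Longrightarrow> w y \<in> cvecs m" using snoc.prems(1) by auto
  show ?case
  proof (rule smooth_on_C_cong[OF D])
    show "smooth_on_C n D (\<lambda>y. \<Sum>i<2*m. rcoord i (w y) * \<omega> (F y) (map (\<lambda>w. w y) ws @ rbasis i # vs))"
      by (intro smooth_on_C_sum[OF D] smooth_on_C_mult[OF D] smooth_on_C_linear_comp[OF D bounded_linear_rcoord] w(1) snoc.IH)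
         (use snoc.prems in auto)
    fix y assume y: "y \<in> D"
    have "\<omega> (F y) (map (\<lambda>w. w y) ws @ (\<Sum>i<2*m. rcoord i (w y) *\<^sub>R rbasis i) # vs) =
        (\<Sum>i<2*m. rcoord i (w y) * \<omega> (F y) (map (\<lambda>w. w y) ws @ rbasis i # vs))"
      by (rule alternating_multilinear_sum[OF kforms_alternating[OF \<omega> FE[OF y]]])
         (use snoc.prems y in auto)
    then show "(\<Sum>i<2*m. rcoord i (w y) * \<omega> (F y) (map (\<lambda>w. w y) ws @ rbasis i # vs)) =
        \<omega> (F y) (map (\<lambda>w. w y) (ws @ [w]) @ vs)"
      using rbasis_expand[OF w(2)[OF y], symmetric] by simp
  qed
qed

lemma pull_form_kforms:
  assumes D: "open_in_C n D" and E: "open_in_C m E" and F: "smooth_on_C n D F"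
    and FE: "\<And>z. z \<in> D \<Longrightarrow> F z \<in> E" and \<omega>: "\<omega> \<in> kforms m k E"
  shows "pull_form n D F \<omega> \<in> kforms n k D"
proof (rule kformsI)
  have dF: "dird v F z \<in> cvecs m" if "z \<in> D" "v \<in> cvecs n" for z v
    by (rule dird_in_cvecs[OF smooth_on_C_diff_at[OF F that(1)] _ D that]) (use FE E open_in_C_subset in blast)
  show "pull_form n D F \<omega> z vs = 0" if "\<not> (z \<in> D \<and> vs \<in> tangent_lists n k)" for z vs
    using that by (auto simp: pull_form_def tangent_lists_def intro!: kforms_zero_outside[OF \<omega>])
  show "alternating_multilinear n k (pull_form n D F \<omega> z)" if z: "z \<in> D" for z
    unfolding alternating_multilinear_def
  proof (intro conjI ballI allI impI)
    let ?T = "\<lambda>v. dird v F z"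
    have T: "map ?T vs \<in> tangent_lists m k" if "vs \<in> tangent_lists n k" for vs
      using that dF[OF z] by (auto simp: tangent_lists_def)
    have eq: "pull_form n D F \<omega> z vs = \<omega> (F z) (map ?T vs)" if "vs \<in> tangent_lists n k" for vs
      using that z by (auto simp: pull_form_def tangent_lists_def)
    have up: "vs[i := u] \<in> tangent_lists n k" if "vs \<in> tangent_lists n k" "u \<in> cvecs n" for vs u i
      using that set_update_subset_insert[of vs i u] by (auto simp: tangent_lists_def)
    fix vs i j
    {
      fix u w a b assume vs: "vs \<in> tangent_lists n k" "i < k" "u \<in> cvecs n" "w \<in> cvecs n"
      have "?T (a *\<^sub>R u + b *\<^sub>R w) = a *\<^sub>R ?T u + b *\<^sub>R ?T w"
        by (rule dird_linear[OF smooth_on_C_diff_at[OF F z] D z vs(3,4)])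
      moreover have "\<omega> (F z) ((map ?T vs)[i := a *\<^sub>R ?T u + b *\<^sub>R ?T w]) =
          a * \<omega> (F z) ((map ?T vs)[i := ?T u]) + b * \<omega> (F z) ((map ?T vs)[i := ?T w])"
        using kforms_alternating[OF \<omega> FE[OF z]] T[OF vs(1)] vs dF[OF z]
        unfolding alternating_multilinear_def by blast
      ultimately show "pull_form n D F \<omega> z (vs[i := a *\<^sub>R u + b *\<^sub>R w]) =
          a * pull_form n D F \<omega> z (vs[i := u]) + b * pull_form n D F \<omega> z (vs[i := w])"
        using vs by (simp add: eq[OF up] map_update)
    }
    assume vs: "vs \<in> tangent_lists n k" "i < j \<and> j < k \<and> vs ! i = vs ! j"
    then have "map ?T vs ! i = map ?T vs ! j" by (auto simp: tangent_lists_def)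
    then show "pull_form n D F \<omega> z vs = 0"
      using kforms_alternating[OF \<omega> FE[OF z]] T[OF vs(1)] vs eq[OF vs(1)]
      unfolding alternating_multilinear_def by metis
  qed
  fix vs assume vs: "vs \<in> tangent_lists n k"
  show "smooth_on_C n D (\<lambda>z. pull_form n D F \<omega> z vs)"
  proof (rule smooth_on_C_cong[OF D])
    show "smooth_on_C n D (\<lambda>y. \<omega> (F y) (map (\<lambda>w. w y) (map (\<lambda>v. dird v F) vs) @ []))"
      by (rule pull_form_smooth[OF D E F FE \<omega>])
         (use vs dF smooth_on_C_dird[OF F] in \<open>auto simp: tangent_lists_def\<close>)
  qed (use vs in \<open>auto simp: pull_form_def tangent_lists_def o_def\<close>)
qed

lemma pull_form_compose:
  assumes D: "open_in_C n D" and E: "open_in_C m E" and H: "open_in_C l H"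
    and F: "smooth_on_C n D F" and G: "smooth_on_C m E G"
    and FE: "\<And>z. z \<in> D \<Longrightarrow> F z \<in> E"
  shows "pull_form n D F (pull_form m E G \<omega>) = pull_form n D (\<lambda>y. G (F y)) \<omega>"
proof (intro ext)
  fix z vs
  have dF: "dird v F z \<in> cvecs m" if "z \<in> D" "v \<in> cvecs n" for z v
    by (rule dird_in_cvecs[OF smooth_on_C_diff_at[OF F that(1)] _ D that]) (use FE E open_in_C_subset in blast)
  show "pull_form n D F (pull_form m E G \<omega>) z vs = pull_form n D (\<lambda>y. G (F y)) \<omega> z vs"
  proof (cases "z \<in> D \<and> set vs \<subseteq> cvecs n")
    case True
    then have z: "z \<in> D" by simp
    have "dird (dird v F z) G (F z) = dird v (\<lambda>y. G (F y)) z" if "v \<in> set vs" for v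
      by (rule dird_compose[OF smooth_on_C_diff_at[OF F z] smooth_on_C_diff_at[OF G FE[OF z]] FE D E z, symmetric])
         (use that True in auto)
    then have "map (\<lambda>v. dird v G (F z)) (map (\<lambda>v. dird v F z) vs) = map (\<lambda>v. dird v (\<lambda>y. G (F y)) z) vs"
      by simp
    then show ?thesis using True FE[OF z] dF[OF z] by (auto simp: pull_form_def simp del: map_eq_conv map_map)
  qed (auto simp: pull_form_def)
qed

lemma pull_form_cong:
  assumes "open_in_C n D" "\<And>z. z \<in> D \<Longrightarrow> F z = G z"
  shows "pull_form n D F \<omega> = pull_form n D G \<omega>"
proof (intro ext)
  fix z vs
  show "pull_form n D F \<omega> z vs = pull_form n D G \<omega> z vs"
  proof (cases "z \<in> D \<and> set vs \<subseteq> cvecs n")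
    case True
    have "map (\<lambda>v. dird v F z) vs = map (\<lambda>v. dird v G z) vs"
      using dird_cong[OF assms(1) _ _ assms(2)] True by auto
    then show ?thesis using True assms(2) by (simp add: pull_form_def del: map_eq_conv)
  qed (auto simp: pull_form_def)
qed

lemma pull_form_cong_form:
  assumes "\<And>z. z \<in> D \<Longrightarrow> \<omega> (F z) = \<eta> (F z)"
  shows "pull_form n D F \<omega> = pull_form n D F \<eta>"
  using assms by (intro ext) (simp add: pull_form_def)

text \<open>A form carries its domain and is 0 outside, so shrinking a neighbourhood changes the
  form as an object. At a common point only the germ of the map matters; \<open>ext_d_at\<close> and
  \<open>i_ddbar_at\<close> play the same role.\<close>

lemma pull_form_at:
  assumes "open_in_C n D" "open_in_C n E" "z \<in> D" "z \<in> E" "\<And>y. y \<in> E \<Longrightarrow> y \<in> D \<Longrightarrow> F y = G y"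
  shows "pull_form n D F \<omega> z = pull_form n E G \<omega> z"
proof -
  have "open_in_C n (D \<inter> E)" using assms by (simp add: openin_Int)
  then have "dird v F z = dird v G z" if "v \<in> cvecs n" for v
    using dird_cong[of n "D \<inter> E" z v F G] that assms by simp
  then have "map (\<lambda>v. dird v F z) vs = map (\<lambda>v. dird v G z) vs" if "set vs \<subseteq> cvecs n" for vs
    using that by auto
  then show ?thesis using assms(3-5) by (auto simp: pull_form_def simp del: map_eq_conv)
qed

lemma pull_form_lincomb:
  "pull_form n D F (\<lambda>z vs. a * \<omega> z vs + b * \<eta> z vs) =
   (\<lambda>z vs. a * pull_form n D F \<omega> z vs + b * pull_form n D F \<eta> z vs)"
  by (intro ext) (simp add: pull_form_def)

section \<open>The exterior derivative and i ddbar\<close>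

lemma omit_simps [simp]: "omit 0 (x # xs) = xs" "omit (Suc i) (x # xs) = x # omit i xs"
  by (simp_all add: omit_def)

lemma set_omit: "set (omit i xs) \<subseteq> set xs"
  by (auto simp: omit_def dest: in_set_takeD in_set_dropD)

lemma length_omit: "i < length xs \<Longrightarrow> length (omit i xs) = length xs - 1"
  by (simp add: omit_def)

lemma ext_d_at:
  assumes "open_in_C n D" "open_in_C n E" "z \<in> D" "z \<in> E" "\<And>y. y \<in> E \<Longrightarrow> y \<in> D \<Longrightarrow> \<omega> y = \<eta> y"
  shows "ext_d n D \<omega> z = ext_d n E \<eta> z"
proof
  fix vs
  have DE: "open_in_C n (D \<inter> E)" using assms by (simp add: openin_Int)
  have "dird (vs ! i) (\<lambda>y. \<omega> y (omit i vs)) z = dird (vs ! i) (\<lambda>y. \<eta> y (omit i vs)) z"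
    if "set vs \<subseteq> cvecs n" "i < length vs" for i
    by (rule dird_cong[OF DE]) (use that assms in auto)
  then show "ext_d n D \<omega> z vs = ext_d n E \<eta> z vs"
    using assms(3,4) by (auto simp: ext_d_def intro!: sum.cong)
qed

lemma ext_d_smooth:
  assumes D: "open_in_C n D" and \<omega>: "\<omega> \<in> kforms n k D"
  shows "smooth_on_C n D (\<lambda>z. ext_d n D \<omega> z vs)"
proof (cases "set vs \<subseteq> cvecs n")
  case True
  show ?thesis
  proof (rule smooth_on_C_cong[OF D])
    show "smooth_on_C n D (\<lambda>z. \<Sum>i<length vs. (-1) ^ i * dird (vs ! i) (\<lambda>y. \<omega> y (omit i vs)) z)"
      by (intro smooth_on_C_sum[OF D] smooth_on_C_mult[OF D] smooth_on_C_const smooth_on_C_dird kforms_smooth[OF \<omega>])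
         (use True in auto)
  qed (simp add: ext_d_def True)
qed (simp add: ext_d_def)

lemma ext_d_lincomb:
  assumes D: "open_in_C n D" and \<omega>: "\<omega> \<in> kforms n k D" and \<eta>: "\<eta> \<in> kforms n k D"
  shows "ext_d n D (\<lambda>z vs. a * \<omega> z vs + b * \<eta> z vs) = (\<lambda>z vs. a * ext_d n D \<omega> z vs + b * ext_d n D \<eta> z vs)"
proof (intro ext)
  fix z vs
  show "ext_d n D (\<lambda>z vs. a * \<omega> z vs + b * \<eta> z vs) z vs = a * ext_d n D \<omega> z vs + b * ext_d n D \<eta> z vs"
  proof (cases "z \<in> D \<and> set vs \<subseteq> cvecs n")
    case True
    have "dird (vs ! i) (\<lambda>y. a * \<omega> y xs + b * \<eta> y xs) z = a * dird (vs ! i) (\<lambda>y. \<omega> y xs) z + b * dird (vs ! i) (\<lambda>y. \<eta> y xs) z"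
      if "i < length vs" for i xs
    proof -
      have z: "z \<in> D" and v: "vs ! i \<in> cvecs n" using True that by auto
      note d = smooth_on_C_diff_at[OF kforms_smooth[OF \<omega>] z] smooth_on_C_diff_at[OF kforms_smooth[OF \<eta>] z]
      show ?thesis
        using dird_add[OF smooth_on_C_diff_at[OF smooth_on_C_linear_comp[OF D bounded_linear_mult_right kforms_smooth[OF \<omega>]] z]
            smooth_on_C_diff_at[OF smooth_on_C_linear_comp[OF D bounded_linear_mult_right kforms_smooth[OF \<eta>]] z] D z v]
          dird_linear_comp[OF d(1) D z v bounded_linear_mult_right] dird_linear_comp[OF d(2) D z v bounded_linear_mult_right]
        by simp
    qed
    then show ?thesis using True by (simp add: ext_d_def sum.distrib sum_distrib_left algebra_simps)
  qed (auto simp: ext_d_def)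
qed

lemma ext_d_0form:
  assumes D: "open_in_C n D" and \<omega>: "\<omega> \<in> kforms n 0 D"
  shows "ext_d n D \<omega> z vs = (if z \<in> D \<and> vs \<in> tangent_lists n (Suc 0) then dird (vs ! 0) (\<lambda>y. \<omega> y []) z else 0)"
proof (cases "z \<in> D \<and> set vs \<subseteq> cvecs n")
  case True
  show ?thesis
  proof (cases "length vs = 1")
    case True
    then show ?thesis by (auto simp: ext_d_def tangent_lists_def length_Suc_conv)
  next
    case False
    have "(\<lambda>y. \<omega> y (omit i vs)) = (\<lambda>_. 0)" if "i < length vs" for i
    proof -
      have "length (omit i vs) \<noteq> 0" using that False length_omit[OF that] by simp
      then show ?thesis by (intro ext kforms_zero_outside[OF \<omega>]) auto
    qed
    then show ?thesis using False by (simp add: ext_d_def tangent_lists_def)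
  qed
qed (auto simp: ext_d_def tangent_lists_def)

lemma ext_d_0form_kforms:
  assumes D: "open_in_C n D" and \<omega>: "\<omega> \<in> kforms n 0 D"
  shows "ext_d n D \<omega> \<in> kforms n (Suc 0) D"
proof (rule kformsI)
  show "ext_d n D \<omega> z vs = 0" if "\<not> (z \<in> D \<and> vs \<in> tangent_lists n (Suc 0))" for z vs
    using that ext_d_0form[OF assms] by auto
  show "alternating_multilinear n (Suc 0) (ext_d n D \<omega> z)" if "z \<in> D" for z
    using that dird_linear[OF smooth_on_C_diff_at[OF kforms_smooth[OF \<omega>]] D]
    by (intro alternating_multilinear_1) (simp add: ext_d_0form[OF assms] tangent_lists_1)
qed (rule ext_d_smooth[OF assms])

lemma ext_d_ext_d_0form:
  assumes D: "open_in_C n D" and \<omega>: "\<omega> \<in> kforms n 0 D"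
  shows "ext_d n D (ext_d n D \<omega>) = 0"
proof (intro ext)
  fix z vs
  show "ext_d n D (ext_d n D \<omega>) z vs = 0 z vs"
  proof (cases "z \<in> D \<and> set vs \<subseteq> cvecs n")
    case True
    show ?thesis
    proof (cases "length vs = 2")
      case True
      then obtain v w where vw: "vs = [v, w]" by (auto simp: length_Suc_conv numeral_2_eq_2)
      with \<open>z \<in> D \<and> _\<close> have z: "z \<in> D" "v \<in> cvecs n" "w \<in> cvecs n" by auto
      have "dird u (\<lambda>y. ext_d n D \<omega> y [x]) z = hess (\<lambda>y. \<omega> y []) z u x" if "u \<in> cvecs n" "x \<in> cvecs n" for u x
        by (rule dird_cong[OF D z(1) that(1)]) (simp add: ext_d_0form[OF assms] tangent_lists_1 that)
      then show ?thesis
        using z vw hess_commute[OF D kforms_smooth[OF \<omega>] z]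
        by (simp add: ext_d_def[of n D "ext_d n D \<omega>"] numeral_2_eq_2)
    next
      case False
      have "(\<lambda>y. ext_d n D \<omega> y (omit i vs)) = (\<lambda>_. 0)" if "i < length vs" for i
        using that False length_omit[OF that]
        by (intro ext kforms_zero_outside[OF ext_d_0form_kforms[OF assms]]) (auto simp: tangent_lists_def)
      then show ?thesis by (simp add: ext_d_def[of n D "ext_d n D \<omega>"])
    qed
  qed (auto simp: ext_d_def)
qed

lemma ext_d_pull_0form:
  assumes D: "open_in_C n D" and E: "open_in_C m E" and F: "smooth_on_C n D F"
    and FE: "\<And>z. z \<in> D \<Longrightarrow> F z \<in> E" and \<omega>: "\<omega> \<in> kforms m 0 E"
  shows "pull_form n D F (ext_d m E \<omega>) = ext_d n D (pull_form n D F \<omega>)"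
proof (intro ext)
  fix z vs
  have p: "pull_form n D F \<omega> \<in> kforms n 0 D" by (rule pull_form_kforms[OF assms])
  show "pull_form n D F (ext_d m E \<omega>) z vs = ext_d n D (pull_form n D F \<omega>) z vs"
  proof (cases "z \<in> D \<and> vs \<in> tangent_lists n (Suc 0)")
    case True
    then obtain v where z: "z \<in> D" and v: "v \<in> cvecs n" "vs = [v]" by (auto simp: tangent_lists_1)
    have "dird v F z \<in> cvecs m"
      by (rule dird_in_cvecs[OF smooth_on_C_diff_at[OF F z] _ D z v(1)]) (use FE E open_in_C_subset in blast)
    moreover have "dird v (\<lambda>y. pull_form n D F \<omega> y []) z = dird v (\<lambda>y. \<omega> (F y) []) z"
      by (rule dird_cong[OF D z v(1)]) (simp add: pull_form_def)
    moreover have "dird v (\<lambda>y. \<omega> (F y) []) z = dird (dird v F z) (\<lambda>y. \<omega> y []) (F z)"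
      by (rule dird_compose[OF smooth_on_C_diff_at[OF F z] smooth_on_C_diff_at[OF kforms_smooth[OF \<omega>] FE[OF z]] FE D E z v(1)])
    ultimately show ?thesis
      using z v FE[OF z] by (simp add: ext_d_0form[OF D p] pull_form_def[of _ _ _ "ext_d m E \<omega>"] ext_d_0form[OF E \<omega>] tangent_lists_1)
  next
    case False
    then show ?thesis
      by (auto simp: ext_d_0form[OF D p] pull_form_def[of _ _ _ "ext_d m E \<omega>"] ext_d_0form[OF E \<omega>] tangent_lists_def)
  qed
qed

text \<open>A primitive of \<open>\<i>\<partial>\<partial>\<^sup>-\<phi>\<close>: the real form \<open>w \<mapsto> - d\<phi>(\<i>w) / 2\<close>.\<close>

definition dc_form :: "nat \<Rightarrow> cvec set \<Rightarrow> (cvec \<Rightarrow> real) \<Rightarrow> form" where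
  "dc_form n D \<phi> = (\<lambda>z vs. if z \<in> D \<and> vs \<in> tangent_lists n (Suc 0)
     then - (dird (cmul \<i> (vs ! 0)) \<phi> z) / 2 else 0)"

lemma dc_form_kforms:
  assumes D: "open_in_C n D" and \<phi>: "smooth_on_C n D \<phi>"
  shows "dc_form n D \<phi> \<in> kforms n (Suc 0) D"
proof (rule kformsI)
  show "alternating_multilinear n (Suc 0) (dc_form n D \<phi> z)" if "z \<in> D" for z
    using that dird_linear[OF smooth_on_C_diff_at[OF \<phi>] D]
    by (intro alternating_multilinear_1)
       (simp add: dc_form_def tangent_lists_1 cmul_add cmul_scaleR field_simps)
  fix vs assume vs: "vs \<in> tangent_lists n (Suc 0)"
  show "smooth_on_C n D (\<lambda>z. dc_form n D \<phi> z vs)"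
  proof (rule smooth_on_C_cong[OF D])
    show "smooth_on_C n D (\<lambda>z. (- 1 / 2) * dird (cmul \<i> (vs ! 0)) \<phi> z)"
      by (intro smooth_on_C_mult[OF D] smooth_on_C_const smooth_on_C_dird \<phi>)
         (use vs in \<open>auto simp: tangent_lists_1\<close>)
  qed (simp add: dc_form_def vs)
qed (auto simp: dc_form_def)

lemma dc_form_pull:
  assumes D: "open_in_C n D" and E: "open_in_C m E" and F: "holo_map n m D F"
    and FE: "\<And>z. z \<in> D \<Longrightarrow> F z \<in> E" and \<phi>: "smooth_on_C m E \<phi>"
  shows "pull_form n D F (dc_form m E \<phi>) = dc_form n D (\<lambda>y. \<phi> (F y))"
proof (intro ext)
  fix z vs
  note F' = holo_mapD[OF D F]
  show "pull_form n D F (dc_form m E \<phi>) z vs = dc_form n D (\<lambda>y. \<phi> (F y)) z vs"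
  proof (cases "z \<in> D \<and> vs \<in> tangent_lists n (Suc 0)")
    case True
    then obtain v where z: "z \<in> D" and v: "v \<in> cvecs n" "vs = [v]" by (auto simp: tangent_lists_1)
    show ?thesis
      using z v FE[OF z] F'(3,4)[OF z v(1)]
        dird_compose[OF smooth_on_C_diff_at[OF F'(1) z] smooth_on_C_diff_at[OF \<phi> FE[OF z]] FE D E z cvecs_cmul[OF v(1)]]
      by (simp add: dc_form_def pull_form_def tangent_lists_1)
  qed (auto simp: pull_form_def dc_form_def tangent_lists_def)
qed

text \<open>The two terms of the exterior derivative are the two mixed Hessians of
  \<open>i_ddbar_hess\<close>. Thus i ddbar of a global function is exact, which is what leaves the
  cohomology class unchanged in the end.\<close>

lemma ext_d_dc_form:
  assumes D: "open_in_C n D" and \<phi>: "smooth_on_C n D \<phi>"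
  shows "ext_d n D (dc_form n D \<phi>) = i_ddbar n D \<phi>"
proof (intro ext)
  fix z vs
  show "ext_d n D (dc_form n D \<phi>) z vs = i_ddbar n D \<phi> z vs"
  proof (cases "z \<in> D \<and> set vs \<subseteq> cvecs n")
    case True
    show ?thesis
    proof (cases "length vs = 2")
      case True
      then obtain v w where vw: "vs = [v, w]" by (auto simp: length_Suc_conv numeral_2_eq_2)
      with \<open>z \<in> D \<and> _\<close> have z: "z \<in> D" "v \<in> cvecs n" "w \<in> cvecs n" by auto
      have "dird u (\<lambda>y. dc_form n D \<phi> y [x]) z = - hess \<phi> z u (cmul \<i> x) / 2" if u: "u \<in> cvecs n" and x: "x \<in> cvecs n" for u x
      proof -
        have "dird u (\<lambda>y. dc_form n D \<phi> y [x]) z = dird u (\<lambda>y. (-1/2) * dird (cmul \<i> x) \<phi> y) z"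
          by (rule dird_cong[OF D z(1) u]) (simp add: dc_form_def tangent_lists_1 x)
        also have "\<dots> = (-1/2) * hess \<phi> z u (cmul \<i> x)"
          by (rule dird_linear_comp[OF smooth_on_C_diff_at[OF smooth_on_C_dird[OF \<phi>] z(1)] D z(1) u bounded_linear_mult_right])
             (simp add: x)
        finally show ?thesis by simp
      qed
      then show ?thesis
        using z vw hess_commute[OF D \<phi> z(1), of w "cmul \<i> v"]
        by (simp add: ext_d_def numeral_2_eq_2 i_ddbar_hess[OF D \<phi> z] field_simps)
    next
      case False
      have "(\<lambda>y. dc_form n D \<phi> y (omit i vs)) = (\<lambda>_. 0)" if "i < length vs" for i
        using that False length_omit[OF that]
        by (intro ext kforms_zero_outside[OF dc_form_kforms[OF assms]]) (auto simp: tangent_lists_def)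
      then show ?thesis using False by (simp add: ext_d_def i_ddbar_def tangent_lists_def)
    qed
  qed (auto simp: ext_d_def i_ddbar_def tangent_lists_def)
qed

lemma i_ddbar_kforms:
  assumes D: "open_in_C n D" and \<phi>: "smooth_on_C n D \<phi>"
  shows "i_ddbar n D \<phi> \<in> kforms n 2 D"
proof (rule kformsI)
  show "i_ddbar n D \<phi> z vs = 0" if "\<not> (z \<in> D \<and> vs \<in> tangent_lists n 2)" for z vs
    using that by (auto simp: i_ddbar_def)
  show "alternating_multilinear n 2 (i_ddbar n D \<phi> z)" if z: "z \<in> D" for z
    by (intro alternating_multilinear_2)
       (use hess_commute[OF D \<phi> z] in \<open>simp_all add: i_ddbar_hess[OF D \<phi> z] cmul_add cmul_scaleR
          hess_linear_left[OF D \<phi> z] hess_linear_right[OF D \<phi> z] field_simps\<close>)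
  show "smooth_on_C n D (\<lambda>z. i_ddbar n D \<phi> z vs)" for vs
    \<comment> \<open>Smoothness comes from the primitive.\<close>
    unfolding ext_d_dc_form[OF assms, symmetric] by (rule ext_d_smooth[OF D dc_form_kforms[OF assms]])
qed

text \<open>By symmetry of third derivatives the arguments of \<open>T\<close> may be permuted, and
  the six terms of the exterior derivative cancel in pairs.\<close>

lemma ext_d_i_ddbar:
  assumes D: "open_in_C n D" and \<phi>: "smooth_on_C n D \<phi>"
  shows "ext_d n D (i_ddbar n D \<phi>) = 0"
proof (intro ext)
  fix z vs
  show "ext_d n D (i_ddbar n D \<phi>) z vs = 0 z vs"
  proof (cases "z \<in> D \<and> set vs \<subseteq> cvecs n")
    case True
    show ?thesis
    proof (cases "length vs = 3")
      case True
      then obtain a b c where abc: "vs = [a, b, c]" by (auto simp: length_Suc_conv numeral_3_eq_3)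
      with \<open>z \<in> D \<and> _\<close> have z: "z \<in> D" "a \<in> cvecs n" "b \<in> cvecs n" "c \<in> cvecs n" by auto
      define T where "T u v w = dird u (dird v (dird w \<phi>)) z" for u v w
      have T1: "T u v w = T v u w" if "u \<in> cvecs n" "v \<in> cvecs n" "w \<in> cvecs n" for u v w
        unfolding T_def by (rule dird_commute_real[OF D smooth_on_C_dird[OF \<phi> that(3)] z(1) that(1,2)])
      have T2: "T u v w = T u w v" if "u \<in> cvecs n" "v \<in> cvecs n" "w \<in> cvecs n" for u v w
        unfolding T_def by (rule dird_cong[OF D z(1) that(1)], rule dird_commute_real[OF D \<phi> _ that(2,3)])
      have d: "dird u (\<lambda>y. i_ddbar n D \<phi> y [v, w]) z = (T u (cmul \<i> v) w - T u v (cmul \<i> w)) / 2"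
        if u: "u \<in> cvecs n" and v: "v \<in> cvecs n" and w: "w \<in> cvecs n" for u v w
      proof -
        have s: "smooth_on_C n D (\<lambda>y. hess \<phi> y v' w')" if "v' \<in> cvecs n" "w' \<in> cvecs n" for v' w'
          by (intro smooth_on_C_dird \<phi> that)
        have "dird u (\<lambda>y. i_ddbar n D \<phi> y [v, w]) z = dird u (\<lambda>y. (1/2) * hess \<phi> y (cmul \<i> v) w + (-1/2) * hess \<phi> y v (cmul \<i> w)) z"
          by (rule dird_cong[OF D z(1) u]) (simp add: i_ddbar_hess[OF D \<phi> _ v w] diff_divide_distrib)
        also have "\<dots> = dird u (\<lambda>y. (1/2) * hess \<phi> y (cmul \<i> v) w) z + dird u (\<lambda>y. (-1/2) * hess \<phi> y v (cmul \<i> w)) z"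
          by (rule dird_add[OF smooth_on_C_diff_at[OF smooth_on_C_linear_comp[OF D bounded_linear_mult_right s] z(1)]
                smooth_on_C_diff_at[OF smooth_on_C_linear_comp[OF D bounded_linear_mult_right s] z(1)] D z(1) u])
             (simp_all add: v w)
        also have "\<dots> = (1/2) * T u (cmul \<i> v) w + (-1/2) * T u v (cmul \<i> w)"
          unfolding T_def
          by (intro arg_cong2[where f="(+)"]; rule dird_linear_comp[OF smooth_on_C_diff_at[OF s z(1)] D z(1) u bounded_linear_mult_right])
             (simp_all add: v w)
        finally show ?thesis by (simp add: diff_divide_distrib)
      qed
      have "ext_d n D (i_ddbar n D \<phi>) z vs =
          (T a (cmul \<i> b) c - T a b (cmul \<i> c)) / 2 - (T b (cmul \<i> a) c - T b a (cmul \<i> c)) / 2 + (T c (cmul \<i> a) b - T c a (cmul \<i> b)) / 2"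
        using z abc by (simp add: ext_d_def numeral_3_eq_3 numeral_2_eq_2 d lessThan_Suc)
          (simp add: field_simps)
      moreover have "T a (cmul \<i> b) c = T c a (cmul \<i> b)"
        using T2[of a "cmul \<i> b" c] T1[of a c "cmul \<i> b"] z by simp
      moreover have "T a b (cmul \<i> c) = T b a (cmul \<i> c)" using T1 z by simp
      moreover have "T b (cmul \<i> a) c = T c (cmul \<i> a) b"
        using T2[of b "cmul \<i> a" c] T1[of b c "cmul \<i> a"] T2[of c b "cmul \<i> a"] z by simp
      ultimately have "ext_d n D (i_ddbar n D \<phi>) z vs =
          (T c a (cmul \<i> b) - T b a (cmul \<i> c)) / 2 - (T c (cmul \<i> a) b - T b a (cmul \<i> c)) / 2 + (T c (cmul \<i> a) b - T c a (cmul \<i> b)) / 2"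
        by (simp only:)
      moreover have "(x - y) / 2 - (w - y) / 2 + (w - x) / 2 = 0" for x y w :: real
        by (simp add: field_simps)
      ultimately show ?thesis by (simp only: zero_fun_apply)
    next
      case False
      have "(\<lambda>y. i_ddbar n D \<phi> y (omit i vs)) = (\<lambda>_. 0)" if "i < length vs" for i
      proof -
        have "length (omit i vs) \<noteq> 2" using that False length_omit[OF that] by linarith
        then show ?thesis by (simp add: i_ddbar_def tangent_lists_def)
      qed
      then show ?thesis by (simp add: ext_d_def)
    qed
  qed (auto simp: ext_d_def)
qed

lemma i_ddbar_cong:
  assumes D: "open_in_C n D" and \<phi>: "smooth_on_C n D \<phi>" and eq: "\<And>z. z \<in> D \<Longrightarrow> \<phi> z = \<psi> z"
  shows "i_ddbar n D \<phi> = i_ddbar n D \<psi>"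
proof (intro ext)
  fix z vs
  have \<psi>: "smooth_on_C n D \<psi>" by (rule smooth_on_C_cong[OF D \<phi> eq])
  have h: "hess \<phi> z u w = hess \<psi> z u w" if "z \<in> D" "u \<in> cvecs n" "w \<in> cvecs n" for u w
    by (rule dird_cong[OF D that(1,2)], rule dird_cong[OF D _ that(3) eq])
  show "i_ddbar n D \<phi> z vs = i_ddbar n D \<psi> z vs"
  proof (cases "z \<in> D \<and> vs \<in> tangent_lists n 2")
    case True
    then obtain v w where "z \<in> D" "v \<in> cvecs n" "w \<in> cvecs n" "vs = [v, w]"
      by (auto simp: tangent_lists_2)
    then show ?thesis
      by (simp add: i_ddbar_hess[OF D \<phi>] i_ddbar_hess[OF D \<psi>] h)
  qed (auto simp: i_ddbar_def)
qed

lemma dc_form_cong: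
  assumes D: "open_in_C n D" and eq: "\<And>z. z \<in> D \<Longrightarrow> \<phi> z = \<psi> z"
  shows "dc_form n D \<phi> = dc_form n D \<psi>"
  using dird_cong[OF D _ _ eq] by (intro ext) (auto simp: dc_form_def tangent_lists_1)

section \<open>Quotient charts\<close>

lemma open_in_C_trans:
  "openin (top_of_set E) A \<Longrightarrow> A = B \<Longrightarrow> open_in_C n E \<Longrightarrow> open_in_C n B"
  using openin_trans by blast

lemma open_in_C_vimage:
  assumes D: "open_in_C n D" and F: "continuous_on D F" and FE: "F \<in> D \<rightarrow> cvecs m" and E: "open_in_C m E"
  shows "open_in_C n {z \<in> D. F z \<in> E}"
proof -
  obtain S where S: "open S" "E = cvecs m \<inter> S" using E by (auto simp: openin_open)
  have "openin (top_of_set D) (D \<inter> F -` S)"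
    using continuous_openin_preimage_gen[OF F S(1)] .
  moreover have "D \<inter> F -` S = {z \<in> D. F z \<in> E}" using FE S by auto
  ultimately show ?thesis using D by (rule open_in_C_trans)
qed

lemma quotient_map_openinI:
  assumes "quotient_map X Y f" "U \<subseteq> topspace Y" "openin X {x \<in> topspace X. f x \<in> U}"
  shows "openin Y U"
  using assms(1)[unfolded quotient_map_def, THEN conjunct2, rule_format, OF assms(2)] assms(3) by blast

section \<open>The group action on a quotient chart\<close>

locale qchart =
  fixes X :: "'a ringed" and c :: "'a chart"
  assumes qc: "quotient_chart X c"
begin

abbreviation "n \<equiv> cdim c"
abbreviation "D \<equiv> cdom c"
abbreviation "G \<equiv> cgrp c"
abbreviation "p \<equiv> cproj c"

lemma dom_open: "open_in_C n D"
  and img_open: "openin (utop X) (cimg c)"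
  and fin: "finite G"
  and grp: "subgroup G (BijGroup (cvecs n))"
  and lin: "\<And>g. g \<in> G \<Longrightarrow> complex_linear_on n g"
  and g_dom: "\<And>g z. g \<in> G \<Longrightarrow> z \<in> D \<Longrightarrow> g z \<in> D"
  and qm: "quotient_map (top_of_set D) (subtopology (utop X) (cimg c)) p"
  and fibre: "\<And>z w. z \<in> D \<Longrightarrow> w \<in> D \<Longrightarrow> p z = p w \<longleftrightarrow> (\<exists>g\<in>G. w = g z)"
  and hol_iff: "\<And>V f. openin (utop X) V \<Longrightarrow> V \<subseteq> cimg c \<Longrightarrow> f \<in> hol X V \<longleftrightarrow> holo_on n (cpre c V) (f \<circ> p)"
  using qc unfolding quotient_chart_def by blast+

lemma dom_sub: "z \<in> D \<Longrightarrow> z \<in> cvecs n"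
  using dom_open open_in_C_subset by blast

lemma g_bij: "g \<in> G \<Longrightarrow> bij_betw g (cvecs n) (cvecs n)"
  and g_ext: "g \<in> G \<Longrightarrow> g \<in> extensional (cvecs n)"
  using subgroup.subset[OF grp] by (auto simp: BijGroup_def Bij_def)

lemma g_in: "g \<in> G \<Longrightarrow> z \<in> cvecs n \<Longrightarrow> g z \<in> cvecs n"
  using g_bij by (auto simp: bij_betw_def)

lemma id_in_G: "(\<lambda>z\<in>cvecs n. z) \<in> G"
  using subgroup.one_closed[OF grp] by (simp add: BijGroup_def)

lemma g_inverse:
  assumes g: "g \<in> G"
  obtains h where "h \<in> G" "\<And>z. z \<in> cvecs n \<Longrightarrow> h (g z) = z" "\<And>z. z \<in> cvecs n \<Longrightarrow> g (h z) = z"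
proof
  have gB: "g \<in> Bij (cvecs n)" using subgroup.subset[OF grp] g by (auto simp: BijGroup_def)
  let ?h = "\<lambda>x\<in>cvecs n. inv_into (cvecs n) g x"
  show "?h \<in> G"
    using subgroup.m_inv_closed[OF grp g] inv_BijGroup[OF gB] by simp
  show "?h (g z) = z" if "z \<in> cvecs n" for z
    using that g_bij[OF g] g_in[OF g] by (simp add: bij_betw_inv_into_left)
  show "g (?h z) = z" if "z \<in> cvecs n" for z
    using that g_bij[OF g] by (simp add: bij_betw_inv_into_right)
qed

lemma g_holo: "g \<in> G \<Longrightarrow> open_in_C n E \<Longrightarrow> holo_map n n E g"
  using holo_map_linear[OF _ lin g_in] .

lemma g_cont: "g \<in> G \<Longrightarrow> continuous_on D g"
  using smooth_on_C_cont[OF holo_mapD(1)[OF dom_open g_holo[OF _ dom_open]]] .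

lemma proj_g: "g \<in> G \<Longrightarrow> z \<in> D \<Longrightarrow> p (g z) = p z"
  using fibre[of z "g z"] g_dom by auto

lemma cpre_open:
  assumes "openin (utop X) U"
  shows "open_in_C n (cpre c U)"
proof -
  have "openin (subtopology (utop X) (cimg c)) (U \<inter> cimg c)"
    using assms by (simp add: openin_subtopology_Int)
  then have "openin (top_of_set D) {x \<in> topspace (top_of_set D). p x \<in> U \<inter> cimg c}"
    using qm openin_subset[of "subtopology (utop X) (cimg c)" "U \<inter> cimg c"] unfolding quotient_map_def by blast
  moreover have "{x \<in> topspace (top_of_set D). p x \<in> U \<inter> cimg c} = cpre c U"
    by (auto simp: cpre_def)
  ultimately show ?thesis using dom_open by (rule open_in_C_trans)
qed

text \<open>The preimage of the image of \<open>E\<close> is the union of the sets carried into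
  \<open>E\<close> by the group elements, each of which is open; the quotient topology does the
  rest.\<close>

lemma proj_open:
  assumes E: "open_in_C n E" "E \<subseteq> D"
  shows "openin (utop X) (p ` E)"
proof -
  have "openin (top_of_set D) {z \<in> D. g z \<in> E}" if "g \<in> G" for g
    by (rule openin_subset_trans[OF open_in_C_vimage[OF dom_open g_cont[OF that] _ E(1)]])
       (use that dom_open dom_sub g_in in \<open>auto simp: open_in_C_iff\<close>)
  then have "openin (top_of_set D) (\<Union>g\<in>G. {z \<in> D. g z \<in> E})" by blast
  moreover have "(\<Union>g\<in>G. {z \<in> D. g z \<in> E}) = {x \<in> topspace (top_of_set D). p x \<in> p ` E}"
  proof (rule Set.set_eqI, rule iffI)
    fix z assume "z \<in> {x \<in> topspace (top_of_set D). p x \<in> p ` E}"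
    then obtain w where "z \<in> D" "w \<in> E" "p z = p w" by auto
    then show "z \<in> (\<Union>g\<in>G. {z \<in> D. g z \<in> E})" using fibre[of z w] E(2) by auto
  next
    fix z assume "z \<in> (\<Union>g\<in>G. {z \<in> D. g z \<in> E})"
    then obtain g where g: "g \<in> G" "z \<in> D" "g z \<in> E" by auto
    then have "p z = p (g z)" by (simp add: proj_g)
    with g show "z \<in> {x \<in> topspace (top_of_set D). p x \<in> p ` E}" by auto
  qed
  moreover have "p ` E \<subseteq> topspace (subtopology (utop X) (cimg c))"
    using openin_subset[OF img_open] E(2) by auto
  ultimately have "openin (subtopology (utop X) (cimg c)) (p ` E)"
    by (intro quotient_map_openinI[OF qm]) (simp_all only:)
  then show ?thesis using img_open by (simp add: openin_open_subtopology)
qed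

section \<open>Points with trivial isotropy\<close>

definition free :: "cvec \<Rightarrow> bool" where
  "free z \<longleftrightarrow> z \<in> D \<and> (\<forall>g\<in>G. g z = z \<longrightarrow> g = (\<lambda>z\<in>cvecs n. z))"

text \<open>The group is finite, so its nontrivial elements can be treated one after the other,
  shrinking the open set each time. A linear \<open>g\<close> that fixes a nonempty open set
  pointwise is the identity: it fixes \<open>z\<close> and \<open>z + t *\<^sub>R y\<close> for
  small nonzero \<open>t\<close>, hence every vector \<open>y\<close>.\<close>

lemma free_dense:
  assumes E: "open_in_C n E" "E \<subseteq> D" "E \<noteq> {}"
  shows "\<exists>z\<in>E. free z"
proof -
  let ?id = "\<lambda>z\<in>cvecs n. z"
  have "\<exists>E'. open_in_C n E' \<and> E' \<subseteq> E \<and> E' \<noteq> {} \<and> (\<forall>z\<in>E'. \<forall>g\<in>S. g z \<noteq> z)"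
    if "finite S" "S \<subseteq> G - {?id}" for S
    using that
  proof (induction S)
    case empty
    show ?case using E by auto
  next
    case (insert g S)
    then obtain E' where E': "open_in_C n E'" "E' \<subseteq> E" "E' \<noteq> {}" "\<forall>z\<in>E'. \<forall>g\<in>S. g z \<noteq> z" by auto
    have g: "g \<in> G" "g \<noteq> ?id" using insert by auto
    have op: "open_in_C n {z \<in> E'. g z - z \<in> - {0}}"
    proof -
      have "openin (top_of_set E') (E' \<inter> (\<lambda>z. g z - z) -` (- {0}))"
        by (intro continuous_openin_preimage_gen continuous_intros continuous_on_subset[OF g_cont[OF g(1)]])
           (use E' E in auto)
      moreover have "E' \<inter> (\<lambda>z. g z - z) -` (- {0}) = {z \<in> E'. g z - z \<in> - {0}}" by auto
      ultimately show ?thesis using E'(1) by (rule open_in_C_trans)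
    qed
    have "{z \<in> E'. g z - z \<in> - {0}} \<noteq> {}"
    proof
      assume "{z \<in> E'. g z - z \<in> - {0}} = {}"
      then have fixE: "g z = z" if "z \<in> E'" for z using that by auto
      obtain z where z: "z \<in> E'" using E'(3) by blast
      have zn: "z \<in> cvecs n" using z E'(1) open_in_C_subset by blast
      have "g y = y" if y: "y \<in> cvecs n" for y
      proof -
        obtain e where e: "e > 0" "\<And>t. \<bar>t\<bar> < e \<Longrightarrow> z + t *\<^sub>R y \<in> E'" by (rule add_scaleR_in_open[OF E'(1) z y]) (rule that)
        define t where "t = e / 2"
        have t: "t \<noteq> 0" "\<bar>t\<bar> < e" using e by (auto simp: t_def)
        have "z + t *\<^sub>R y = g (z + cmul (complex_of_real t) y)"
          using fixE[OF e(2)[OF t(2)]] by (simp add: cmul_of_real)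
        also have "\<dots> = g z + cmul (complex_of_real t) (g y)"
          using lin[OF g(1)] zn y by (simp add: complex_linear_on_def)
        finally show ?thesis using fixE[OF z] t by (simp add: cmul_of_real)
      qed
      then have "g = ?id" using g_ext[OF g(1)] by (auto simp: extensional_def fun_eq_iff)
      with g show False by simp
    qed
    with op E' show ?case by (intro exI[of _ "{z \<in> E'. g z - z \<in> - {0}}"]) auto
  qed
  from this[of "G - {?id}"] fin obtain E' where "E' \<subseteq> E" "E' \<noteq> {}" "\<forall>z\<in>E'. \<forall>g\<in>G - {?id}. g z \<noteq> z"
    by auto
  then show ?thesis using E(2) unfolding free_def by blast
qed

lemma eq_if_eq_on_free:
  fixes f g :: "cvec \<Rightarrow> real"
  assumes E: "open_in_C n E" "E \<subseteq> D" and "continuous_on E f" "continuous_on E g"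
    and eq: "\<And>z. z \<in> E \<Longrightarrow> free z \<Longrightarrow> f z = g z" and z: "z \<in> E"
  shows "f z = g z"
proof (rule ccontr)
  assume "f z \<noteq> g z"
  let ?S = "E \<inter> (\<lambda>z. f z - g z) -` (- {0})"
  have "openin (top_of_set E) ?S"
    by (intro continuous_openin_preimage_gen continuous_intros assms)
  then have "open_in_C n ?S" using E(1) openin_trans by blast
  moreover have "?S \<noteq> {}" using z \<open>f z \<noteq> g z\<close> by auto
  ultimately obtain w where "w \<in> ?S" "free w" using free_dense[of ?S] E(2) by blast
  then show False using eq by auto
qed

text \<open>Each nontrivial \<open>g\<close> moves \<open>z\<close> by a positive distance, hence
  moves a small ball around \<open>z\<close> off itself; finitely many radii have a positive
  minimum.\<close>

lemma free_separate:
  assumes z: "free z"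
  shows "\<exists>r>0. \<forall>g\<in>G - {\<lambda>z\<in>cvecs n. z}. \<forall>y\<in>ball z r \<inter> D. g y \<notin> ball z r"
proof -
  have zD: "z \<in> D" using z by (simp add: free_def)
  have "\<exists>r>0. \<forall>g\<in>S. \<forall>y\<in>ball z r \<inter> D. g y \<notin> ball z r"
    if "finite S" "S \<subseteq> G - {\<lambda>z\<in>cvecs n. z}" for S
    using that
  proof (induction S)
    case empty
    show ?case by (auto intro: exI[of _ 1])
  next
    case (insert g S)
    then obtain r where r: "r > 0" "\<forall>g\<in>S. \<forall>y\<in>ball z r \<inter> D. g y \<notin> ball z r" by auto
    have "g \<in> G" "g \<noteq> (\<lambda>z\<in>cvecs n. z)" using insert.prems by auto
    then have g: "g \<in> G" "g z \<noteq> z" using z unfolding free_def by blast+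
    \<comment> \<open>A point within \<open>d\<close> of both \<open>z\<close> and
      \<open>g z\<close> would contradict the triangle inequality.\<close>
    define d where "d = dist (g z) z / 2"
    have d: "d > 0" using g by (simp add: d_def)
    obtain r' where r': "r' > 0" "\<And>y. y \<in> D \<Longrightarrow> dist y z < r' \<Longrightarrow> dist (g y) (g z) < d"
      using g_cont[OF g(1)] zD d unfolding continuous_on_iff by meson
    have "g y \<notin> ball z (min r (min r' d))" if "y \<in> ball z (min r (min r' d)) \<inter> D" for y
    proof
      assume "g y \<in> ball z (min r (min r' d))"
      then have "dist (g y) z < d" by (simp add: dist_commute)
      moreover have "dist (g y) (g z) < d" using r'(2)[of y] that by (simp add: dist_commute)
      ultimately show False
        using dist_triangle[of "g z" z "g y"] by (simp add: d_def dist_commute)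
    qed
    with r r' d show ?case by (intro exI[of _ "min r (min r' d)"]) auto
  qed
  from this[of "G - {\<lambda>z\<in>cvecs n. z}"] fin show ?thesis by auto
qed

text \<open>Such charts with trivial group are how forms on the space, which are families indexed by
  regular charts, are evaluated in orbifold charts.\<close>

definition sub_chart :: "cvec set \<Rightarrow> 'a chart" where
  "sub_chart B = \<lparr>cdim = n, cdom = B, cgrp = {\<lambda>z\<in>cvecs n. z}, cproj = p\<rparr>"

lemma sub_chart_simps [simp]: "cdim (sub_chart B) = n" "cdom (sub_chart B) = B"
   "cgrp (sub_chart B) = {\<lambda>z\<in>cvecs n. z}" "cproj (sub_chart B) = p"
  by (simp_all add: sub_chart_def)

lemma cpre_sub_chart: "B \<subseteq> D \<Longrightarrow> cpre (sub_chart B) U = B \<inter> cpre c U"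
  by (auto simp: cpre_def)

text \<open>Separation makes the projection injective on \<open>B\<close>. The delicate point is the
  sheaf: \<open>hol_iff\<close> tests a function on the full preimage of \<open>V\<close>, the new
  chart only on the part inside \<open>B\<close>. Every point of the preimage is carried into
  \<open>B\<close> by some group element, and the function is invariant, so holomorphy spreads by
  composition with that element.\<close>

lemma sub_chart_reg:
  assumes B: "open_in_C n B" "B \<subseteq> D"
    and sep: "\<And>g y. g \<in> G \<Longrightarrow> g \<noteq> (\<lambda>z\<in>cvecs n. z) \<Longrightarrow> y \<in> B \<Longrightarrow> g y \<notin> B"
  shows "sub_chart B \<in> reg_charts X"
proof -
  let ?id = "\<lambda>z\<in>cvecs n. z"
  have Bn: "z \<in> cvecs n" if "z \<in> B" for z using that B dom_sub by blast
  have inj: "p z = p w \<longleftrightarrow> z = w" if zw: "z \<in> B" "w \<in> B" for z w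
  proof
    assume "p z = p w"
    then obtain g where "g \<in> G" "w = g z" using fibre[of z w] zw B(2) by blast
    then show "z = w" using sep[of g z] zw Bn by (cases "g = ?id") auto
  qed simp
  have cont: "continuous_map (top_of_set D) (subtopology (utop X) (cimg c)) p"
    using qm quotient_imp_continuous_map by blast
  have top: "topspace (subtopology (utop X) (p ` B)) = p ` B"
    using openin_subset[OF proj_open[OF B]] by auto
  have "quotient_map (top_of_set B) (subtopology (utop X) (p ` B)) p"
  proof (rule continuous_open_imp_quotient_map)
    have "continuous_map (top_of_set D) (utop X) p"
      using cont continuous_map_in_subtopology by blast
    then have "continuous_map (subtopology (top_of_set D) B) (utop X) p"
      by (rule continuous_map_from_subtopology)
    moreover have "subtopology (top_of_set D) B = top_of_set B"
      using B(2) by (simp add: subtopology_subtopology Int_absorb1)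
    ultimately show "continuous_map (top_of_set B) (subtopology (utop X) (p ` B)) p"
      by (simp add: continuous_map_in_subtopology)
    show "open_map (top_of_set B) (subtopology (utop X) (p ` B)) p"
      unfolding open_map_def
    proof (intro allI impI)
      fix E assume "openin (top_of_set B) E"
      then have "open_in_C n E" "E \<subseteq> B" using B(1) openin_trans openin_imp_subset by blast+
      then have "openin (utop X) (p ` E)" "p ` E \<subseteq> p ` B" using proj_open B(2) by auto
      then show "openin (subtopology (utop X) (p ` B)) (p ` E)"
        by (simp add: openin_open_subtopology[OF proj_open[OF B]])
    qed
  qed (simp only: top topspace_euclidean_subtopology)
  moreover have "f \<in> hol X V \<longleftrightarrow> holo_on n (B \<inter> cpre c V) (f \<circ> p)" if V: "openin (utop X) V" "V \<subseteq> p ` B" for V f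
  proof -
    have "V \<subseteq> cimg c" using V B by auto
    then have iff: "f \<in> hol X V \<longleftrightarrow> holo_on n (cpre c V) (f \<circ> p)" using hol_iff V by blast
    have op: "open_in_C n (B \<inter> cpre c V)" using B(1) cpre_open[OF V(1)] by (simp add: openin_Int)
    have "holo_on n (cpre c V) (f \<circ> p)" if h: "holo_on n (B \<inter> cpre c V) (f \<circ> p)"
    proof (rule holo_on_local[OF cpre_open[OF V(1)]])
      fix z assume z: "z \<in> cpre c V"
      then obtain w where w: "w \<in> B" "p z = p w" using V(2) by (auto simp: cpre_def)
      then obtain g where g: "g \<in> G" "w = g z" using fibre[of z w] z B by (auto simp: cpre_def)
      let ?E = "{y \<in> cpre c V. g y \<in> B \<inter> cpre c V}"
      have cD: "cpre c V \<subseteq> D" by (auto simp: cpre_def)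
      have gE: "g \<in> cpre c V \<rightarrow> cvecs n" using g_in[OF g(1)] cD dom_sub by auto
      have E: "open_in_C n ?E"
        by (rule open_in_C_vimage[OF cpre_open[OF V(1)] continuous_on_subset[OF g_cont[OF g(1)] cD] gE op])
      have "holo_on n ?E (\<lambda>y. (f \<circ> p) (g y))"
        by (rule holo_on_compose[OF E op g_holo[OF g(1) E] _ h]) auto
      then have "holo_on n ?E (f \<circ> p)"
        by (rule holo_on_cong[OF E]) (use cD proj_g[OF g(1)] in auto)
      moreover have "z \<in> ?E" using z w g g_dom by (auto simp: cpre_def)
      ultimately show "\<exists>E. open_in_C n E \<and> z \<in> E \<and> E \<subseteq> cpre c V \<and> holo_on n E (f \<circ> p)"
        using E by blast
    qed
    moreover have "holo_on n (B \<inter> cpre c V) (f \<circ> p)" if "holo_on n (cpre c V) (f \<circ> p)"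
      using holo_on_subset[OF that] by auto
    ultimately show ?thesis using iff by blast
  qed
  moreover have "subgroup {?id} (BijGroup (cvecs n))"
    using group.triv_subgroup[OF group_BijGroup[of "cvecs n"]] by (simp add: BijGroup_def)
  moreover have "complex_linear_on n ?id"
    by (simp add: complex_linear_on_def)
  ultimately show ?thesis
    using B(1) proj_open[OF B] Bn inj unfolding reg_charts_def quotient_chart_def
    by (auto simp: cpre_sub_chart[OF B(2)])
qed

lemma reg_chart_at_free:
  assumes z: "free z" and E: "open_in_C n E" "z \<in> E"
  obtains B where "open_in_C n B" "z \<in> B" "B \<subseteq> E \<inter> D" "sub_chart B \<in> reg_charts X"
proof -
  have zD: "z \<in> D" using z by (simp add: free_def)
  obtain r where r: "r > 0" "\<forall>g\<in>G - {\<lambda>z\<in>cvecs n. z}. \<forall>y\<in>ball z r \<inter> D. g y \<notin> ball z r"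
    using free_separate[OF z] by blast
  define B where "B = ball z r \<inter> (D \<inter> E)"
  have "open_in_C n B"
    using openin_Int_open[OF openin_Int[OF dom_open E(1)] open_ball[of z r]] by (simp add: B_def Int_commute)
  then show ?thesis
    using r zD E by (intro that[of B] sub_chart_reg) (auto simp: B_def)
qed

end

section \<open>Forms on an orbifold\<close>

lemma orb_formsI:
  assumes "\<And>a. a \<notin> \<A> \<Longrightarrow> \<sigma> a = 0"
    and "\<And>a. a \<in> \<A> \<Longrightarrow> \<sigma> a \<in> kforms (cdim a) k (cpre a U)"
    and "\<And>a g. a \<in> \<A> \<Longrightarrow> g \<in> cgrp a \<Longrightarrow> pull_form (cdim a) (cpre a U) g (\<sigma> a) = \<sigma> a"
    and "\<And>a b c e e'. a \<in> \<A> \<Longrightarrow> b \<in> \<A> \<Longrightarrow> quotient_chart X c \<Longrightarrow> chart_embedding c a e \<Longrightarrow> chart_embedding c b e' \<Longrightarrow>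
        pull_form (cdim c) (cpre c U) e (\<sigma> a) = pull_form (cdim c) (cpre c U) e' (\<sigma> b)"
  shows "\<sigma> \<in> orb_forms X \<A> k U"
  using assms unfolding orb_forms_def by blast

lemma orb_formsD:
  assumes "\<sigma> \<in> orb_forms X \<A> k U"
  shows "a \<notin> \<A> \<Longrightarrow> \<sigma> a = 0"
    and "a \<in> \<A> \<Longrightarrow> \<sigma> a \<in> kforms (cdim a) k (cpre a U)"
    and "a \<in> \<A> \<Longrightarrow> g \<in> cgrp a \<Longrightarrow> pull_form (cdim a) (cpre a U) g (\<sigma> a) = \<sigma> a"
    and "a \<in> \<A> \<Longrightarrow> b \<in> \<A> \<Longrightarrow> quotient_chart X c \<Longrightarrow> chart_embedding c a e \<Longrightarrow> chart_embedding c b e' \<Longrightarrow>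
        pull_form (cdim c) (cpre c U) e (\<sigma> a) = pull_form (cdim c) (cpre c U) e' (\<sigma> b)"
  using assms unfolding orb_forms_def by blast+

lemma orb_forms_outside:
  assumes "\<sigma> \<in> orb_forms X \<A> k U" "z \<notin> cpre a U"
  shows "\<sigma> a z vs = 0"
  using orb_formsD(1,2)[OF assms(1), of a] kforms_zero_outside assms(2) by (cases "a \<in> \<A>") auto

lemma orb_forms_zero [simp]: "0 \<in> orb_forms X \<A> k U"
proof (rule orb_formsI)
  show "(0 :: 'a sec) a \<in> kforms (cdim a) k (cpre a U)" for a
    using kforms_0[of "cdim a" k "cpre a U"] by (simp add: zero_fun_def)
qed (auto simp: pull_form_def fun_eq_iff)

lemma cpre_mono: "V \<subseteq> U \<Longrightarrow> cpre a V \<subseteq> cpre a U"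
  by (auto simp: cpre_def)

lemma chart_embeddingD:
  assumes "chart_embedding c a e"
  shows "cdim c = cdim a" "holo_map (cdim c) (cdim a) (cdom c) e"
    and "\<And>z. z \<in> cdom c \<Longrightarrow> e z \<in> cdom a" "\<And>z. z \<in> cdom c \<Longrightarrow> cproj a (e z) = cproj c z"
    and "\<And>z U. z \<in> cpre c U \<Longrightarrow> e z \<in> cpre a U"
  using assms unfolding chart_embedding_def cpre_def by auto

section \<open>Functions and forms in an orbifold atlas\<close>

locale orb =
  fixes X :: "'a ringed" and n :: nat and \<A> :: "'a chart set"
  assumes orb: "complex_orbifold X n \<A>"
begin

lemma ch: "a \<in> \<A> \<Longrightarrow> qchart X a"
  and dim: "a \<in> \<A> \<Longrightarrow> cdim a = n"
  and cover: "(\<Union>a\<in>\<A>. cimg a) = topspace (utop X)"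
  and compat: "a \<in> \<A> \<Longrightarrow> b \<in> \<A> \<Longrightarrow> compatible_charts X a b"
  and space: "reduced_complex_space X"
  using orb unfolding complex_orbifold_def qchart_def by blast+

lemma pre_open: "a \<in> \<A> \<Longrightarrow> openin (utop X) U \<Longrightarrow> open_in_C n (cpre a U)"
  using qchart.cpre_open[OF ch] dim by metis

lemma dom_open: "a \<in> \<A> \<Longrightarrow> open_in_C n (cdom a)"
  using qchart.dom_open[OF ch] dim by metis

lemma proj_in: "a \<in> \<A> \<Longrightarrow> z \<in> cdom a \<Longrightarrow> cproj a z \<in> topspace (utop X)"
  using cover by blast

lemma pre_top: "a \<in> \<A> \<Longrightarrow> cpre a (topspace (utop X)) = cdom a"
  using proj_in by (auto simp: cpre_def)

lemma g_pre: "a \<in> \<A> \<Longrightarrow> g \<in> cgrp a \<Longrightarrow> z \<in> cpre a U \<Longrightarrow> g z \<in> cpre a U"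
  using qchart.proj_g[OF ch] qchart.g_dom[OF ch] unfolding cpre_def by auto

lemma g_holo: "a \<in> \<A> \<Longrightarrow> g \<in> cgrp a \<Longrightarrow> open_in_C n D \<Longrightarrow> holo_map n n D g"
  using qchart.g_holo[OF ch, of a g D] dim by simp

lemma emb_holo:
  assumes "a \<in> \<A>" "quotient_chart X c" "chart_embedding c a e" "openin (utop X) U"
  shows "cdim c = n" "open_in_C n (cpre c U)" "holo_map n n (cpre c U) e"
proof -
  show cn: "cdim c = n" using chart_embeddingD(1)[OF assms(3)] dim[OF assms(1)] by simp
  show "open_in_C n (cpre c U)"
    using qchart.cpre_open[of X c U] assms cn by (simp add: qchart_def)
  show "holo_map n n (cpre c U) e"
    using holo_map_subset[OF chart_embeddingD(2)[OF assms(3)], of "cpre c U"] cn dim[OF assms(1)]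
    by (auto simp: cpre_def)
qed

text \<open>\<open>\<Phi>\<close> stands for \<open>i_ddbar n\<close> or \<open>dc_form n\<close>.
  Naturality under holomorphic maps, together with dependence on the values on the domain only,
  yields invariance and compatibility at once, because group elements and chart embeddings leave a
  function on X unchanged.\<close>

lemma orb_forms_of_fun:
  assumes U: "openin (utop X) U"
    and k: "\<And>a. a \<in> \<A> \<Longrightarrow> \<Phi> (cpre a U) (\<lambda>z. h (cproj a z)) \<in> kforms n k (cpre a U)"
    and pull: "\<And>D F a. open_in_C n D \<Longrightarrow> a \<in> \<A> \<Longrightarrow> holo_map n n D F \<Longrightarrow> (\<And>z. z \<in> D \<Longrightarrow> F z \<in> cpre a U) \<Longrightarrow>
        pull_form n D F (\<Phi> (cpre a U) (\<lambda>z. h (cproj a z))) = \<Phi> D (\<lambda>y. h (cproj a (F y)))"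
    and cong: "\<And>D \<phi> \<psi> a F. open_in_C n D \<Longrightarrow> a \<in> \<A> \<Longrightarrow> holo_map n n D F \<Longrightarrow> (\<And>z. z \<in> D \<Longrightarrow> F z \<in> cpre a U) \<Longrightarrow>
        (\<And>y. y \<in> D \<Longrightarrow> h (cproj a (F y)) = \<psi> y) \<Longrightarrow> \<Phi> D (\<lambda>y. h (cproj a (F y))) = \<Phi> D \<psi>"
  shows "(\<lambda>a. if a \<in> \<A> then \<Phi> (cpre a U) (\<lambda>z. h (cproj a z)) else 0) \<in> orb_forms X \<A> k U"
proof (rule orb_formsI)
  fix a g assume a: "a \<in> \<A>" and g: "g \<in> cgrp a"
  have "pull_form n (cpre a U) g (\<Phi> (cpre a U) (\<lambda>z. h (cproj a z))) = \<Phi> (cpre a U) (\<lambda>y. h (cproj a (g y)))"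
    by (rule pull[OF pre_open[OF a U] a g_holo[OF a g pre_open[OF a U]] g_pre[OF a g]])
  also have "\<dots> = \<Phi> (cpre a U) (\<lambda>y. h (cproj a y))"
    by (rule cong[OF pre_open[OF a U] a g_holo[OF a g pre_open[OF a U]] g_pre[OF a g]])
       (use qchart.proj_g[OF ch[OF a] g] in \<open>auto simp: cpre_def\<close>)
  finally show "pull_form (cdim a) (cpre a U) g (if a \<in> \<A> then \<Phi> (cpre a U) (\<lambda>z. h (cproj a z)) else 0) =
      (if a \<in> \<A> then \<Phi> (cpre a U) (\<lambda>z. h (cproj a z)) else 0)"
    using a dim by simp
next
  fix a b c e e' assume ab: "a \<in> \<A>" "b \<in> \<A>" and c: "quotient_chart X c" "chart_embedding c a e" "chart_embedding c b e'"
  have *: "pull_form n (cpre c U) e (\<Phi> (cpre a U) (\<lambda>z. h (cproj a z))) = \<Phi> (cpre c U) (\<lambda>y. h (cproj c y))"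
    if "a \<in> \<A>" "chart_embedding c a e" for a e
  proof -
    note e = emb_holo[OF that(1) c(1) that(2) U]
    have "pull_form n (cpre c U) e (\<Phi> (cpre a U) (\<lambda>z. h (cproj a z))) = \<Phi> (cpre c U) (\<lambda>y. h (cproj a (e y)))"
      by (rule pull[OF e(2) that(1) e(3) chart_embeddingD(5)[OF that(2)]])
    also have "\<dots> = \<Phi> (cpre c U) (\<lambda>y. h (cproj c y))"
      by (rule cong[OF e(2) that(1) e(3) chart_embeddingD(5)[OF that(2)]])
         (use chart_embeddingD(4)[OF that(2)] in \<open>auto simp: cpre_def\<close>)
    finally show ?thesis .
  qed
  show "pull_form (cdim c) (cpre c U) e (if a \<in> \<A> then \<Phi> (cpre a U) (\<lambda>z. h (cproj a z)) else 0) =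
      pull_form (cdim c) (cpre c U) e' (if b \<in> \<A> then \<Phi> (cpre b U) (\<lambda>z. h (cproj b z)) else 0)"
    using *[OF ab(1) c(2)] *[OF ab(2) c(3)] ab emb_holo(1)[OF ab(1) c(1,2) U] by simp
qed (use k dim in auto)

definition smooth_fun :: "'a set \<Rightarrow> ('a \<Rightarrow> real) \<Rightarrow> bool" where
  "smooth_fun U h \<longleftrightarrow> (\<forall>a\<in>\<A>. smooth_on_C n (cpre a U) (\<lambda>z. h (cproj a z)))"

lemma smooth_funD: "smooth_fun U h \<Longrightarrow> a \<in> \<A> \<Longrightarrow> smooth_on_C n (cpre a U) (\<lambda>z. h (cproj a z))"
  by (simp add: smooth_fun_def)

lemma smooth_fun_local:
  assumes U: "openin (utop X) U"
    and "\<And>x. x \<in> U \<Longrightarrow> \<exists>V h'. openin (utop X) V \<and> x \<in> V \<and> V \<subseteq> U \<and> smooth_fun V h' \<and> (\<forall>y\<in>V. h y = h' y)"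
  shows "smooth_fun U h"
  unfolding smooth_fun_def
proof
  fix a assume a: "a \<in> \<A>"
  show "smooth_on_C n (cpre a U) (\<lambda>z. h (cproj a z))"
  proof (rule smooth_on_C_local[OF pre_open[OF a U]])
    fix z assume z: "z \<in> cpre a U"
    then have "cproj a z \<in> U" by (simp add: cpre_def)
    then obtain V h' where V: "openin (utop X) V" "cproj a z \<in> V" "V \<subseteq> U" "smooth_fun V h'" "\<forall>y\<in>V. h y = h' y"
      using assms(2) by blast
    have "smooth_on_C n (cpre a V) (\<lambda>z. h (cproj a z))"
      by (rule smooth_on_C_cong[OF pre_open[OF a V(1)] smooth_funD[OF V(4) a]]) (use V in \<open>auto simp: cpre_def\<close>)
    then show "\<exists>E. open_in_C n E \<and> z \<in> E \<and> E \<subseteq> cpre a U \<and> smooth_on_C n E (\<lambda>z. h (cproj a z))"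
      using z V pre_open[OF a V(1)] by (intro exI[of _ "cpre a V"]) (auto simp: cpre_def)
  qed
qed

lemma smooth_fun_subset: "smooth_fun U h \<Longrightarrow> V \<subseteq> U \<Longrightarrow> smooth_fun V h"
  unfolding smooth_fun_def by (intro ballI) (rule smooth_on_C_subset[OF _ cpre_mono], auto)

lemma smooth_fun_const: "smooth_fun U (\<lambda>_. c)"
  by (simp add: smooth_fun_def)

lemma smooth_fun_mult: "openin (utop X) U \<Longrightarrow> smooth_fun U f \<Longrightarrow> smooth_fun U g \<Longrightarrow> smooth_fun U (\<lambda>x. f x * g x)"
  unfolding smooth_fun_def by (simp add: smooth_on_C_mult pre_open)

lemma smooth_fun_sum:
  "openin (utop X) U \<Longrightarrow> (\<And>i. i \<in> I \<Longrightarrow> smooth_fun U (f i)) \<Longrightarrow> smooth_fun U (\<lambda>x. \<Sum>i\<in>I. f i x)"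
  unfolding smooth_fun_def by (simp add: smooth_on_C_sum pre_open)

lemma smooth_fun_inverse:
  "openin (utop X) U \<Longrightarrow> smooth_fun U f \<Longrightarrow> (\<And>x. x \<in> U \<Longrightarrow> f x \<noteq> 0) \<Longrightarrow> smooth_fun U (\<lambda>x. inverse (f x))"
  unfolding smooth_fun_def
  by (intro ballI smooth_on_C_inverse pre_open) (simp_all add: cpre_def)

definition ddbar_sec :: "'a set \<Rightarrow> ('a \<Rightarrow> real) \<Rightarrow> 'a sec" where
  "ddbar_sec U h = (\<lambda>a. if a \<in> \<A> then i_ddbar n (cpre a U) (\<lambda>z. h (cproj a z)) else 0)"

definition dc_sec :: "'a set \<Rightarrow> ('a \<Rightarrow> real) \<Rightarrow> 'a sec" where
  "dc_sec U h = (\<lambda>a. if a \<in> \<A> then dc_form n (cpre a U) (\<lambda>z. h (cproj a z)) else 0)"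

lemma ddbar_sec_orb_forms:
  assumes U: "openin (utop X) U" and h: "smooth_fun U h"
  shows "ddbar_sec U h \<in> orb_forms X \<A> 2 U"
  unfolding ddbar_sec_def
proof (rule orb_forms_of_fun[OF U])
  show "i_ddbar n (cpre a U) (\<lambda>z. h (cproj a z)) \<in> kforms n 2 (cpre a U)" if "a \<in> \<A>" for a
    by (rule i_ddbar_kforms[OF pre_open[OF that U] smooth_funD[OF h that]])
  fix D F a assume D: "open_in_C n D" "a \<in> \<A>" "holo_map n n D F" "\<And>z. z \<in> D \<Longrightarrow> F z \<in> cpre a U"
  show "pull_form n D F (i_ddbar n (cpre a U) (\<lambda>z. h (cproj a z))) = i_ddbar n D (\<lambda>y. h (cproj a (F y)))"
    by (rule i_ddbar_pull[OF D(1) pre_open[OF D(2) U] D(3,4) smooth_funD[OF h D(2)]])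
  show "i_ddbar n D (\<lambda>y. h (cproj a (F y))) = i_ddbar n D \<psi>"
    if "\<And>y. y \<in> D \<Longrightarrow> h (cproj a (F y)) = \<psi> y" for \<psi>
    by (rule i_ddbar_cong[OF D(1) smooth_on_C_compose[OF D(1) pre_open[OF D(2) U] holo_mapD(1)[OF D(1,3)] D(4) smooth_funD[OF h D(2)]] that])
qed

lemma dc_sec_orb_forms:
  assumes U: "openin (utop X) U" and h: "smooth_fun U h"
  shows "dc_sec U h \<in> orb_forms X \<A> (Suc 0) U"
  unfolding dc_sec_def
proof (rule orb_forms_of_fun[OF U])
  show "dc_form n (cpre a U) (\<lambda>z. h (cproj a z)) \<in> kforms n (Suc 0) (cpre a U)" if "a \<in> \<A>" for a
    by (rule dc_form_kforms[OF pre_open[OF that U] smooth_funD[OF h that]])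
  fix D F a assume D: "open_in_C n D" "a \<in> \<A>" "holo_map n n D F" "\<And>z. z \<in> D \<Longrightarrow> F z \<in> cpre a U"
  show "pull_form n D F (dc_form n (cpre a U) (\<lambda>z. h (cproj a z))) = dc_form n D (\<lambda>y. h (cproj a (F y)))"
    by (rule dc_form_pull[OF D(1) pre_open[OF D(2) U] D(3,4) smooth_funD[OF h D(2)]])
  show "dc_form n D (\<lambda>y. h (cproj a (F y))) = dc_form n D \<psi>"
    if "\<And>y. y \<in> D \<Longrightarrow> h (cproj a (F y)) = \<psi> y" for \<psi>
    by (rule dc_form_cong[OF D(1) that])
qed

lemma dsec_dc_sec:
  assumes U: "openin (utop X) U" and h: "smooth_fun U h"
  shows "dsec U (dc_sec U h) = ddbar_sec U h"
proof
  fix a show "dsec U (dc_sec U h) a = ddbar_sec U h a"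
    using ext_d_dc_form[OF pre_open[OF _ U] smooth_funD[OF h]] dim
    by (cases "a \<in> \<A>") (auto simp: dsec_def dc_sec_def ddbar_sec_def ext_d_def fun_eq_iff)
qed

section \<open>Operations on the sheaves of orbifold forms\<close>

lemma orb_forms_lincomb:
  assumes U: "openin (utop X) U" and "\<sigma> \<in> orb_forms X \<A> k U" "\<tau> \<in> orb_forms X \<A> k U"
  shows "(\<lambda>a z vs. x * \<sigma> a z vs + y * \<tau> a z vs) \<in> orb_forms X \<A> k U"
proof (rule orb_formsI)
  show "(\<lambda>z vs. x * \<sigma> a z vs + y * \<tau> a z vs) = 0" if "a \<notin> \<A>" for a
    using that orb_formsD(1)[OF assms(2)] orb_formsD(1)[OF assms(3)] by (simp add: zero_fun_def)
  show "(\<lambda>z vs. x * \<sigma> a z vs + y * \<tau> a z vs) \<in> kforms (cdim a) k (cpre a U)" if "a \<in> \<A>" for a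
    using kforms_lincomb[OF pre_open[OF that U]] orb_formsD(2)[OF assms(2) that] orb_formsD(2)[OF assms(3) that] dim[OF that]
    by simp
  show "pull_form (cdim a) (cpre a U) g (\<lambda>z vs. x * \<sigma> a z vs + y * \<tau> a z vs) = (\<lambda>z vs. x * \<sigma> a z vs + y * \<tau> a z vs)"
    if "a \<in> \<A>" "g \<in> cgrp a" for a g
    unfolding pull_form_lincomb orb_formsD(3)[OF assms(2) that] orb_formsD(3)[OF assms(3) that] ..
  show "pull_form (cdim c) (cpre c U) e (\<lambda>z vs. x * \<sigma> a z vs + y * \<tau> a z vs) =
      pull_form (cdim c) (cpre c U) e' (\<lambda>z vs. x * \<sigma> b z vs + y * \<tau> b z vs)"
    if "a \<in> \<A>" "b \<in> \<A>" "quotient_chart X c" "chart_embedding c a e" "chart_embedding c b e'" for a b c e e'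
    unfolding pull_form_lincomb orb_formsD(4)[OF assms(2) that] orb_formsD(4)[OF assms(3) that] ..
qed

lemma orb_forms_add:
  assumes "openin (utop X) U" "\<sigma> \<in> orb_forms X \<A> k U" "\<tau> \<in> orb_forms X \<A> k U"
  shows "\<sigma> + \<tau> \<in> orb_forms X \<A> k U"
  using orb_forms_lincomb[OF assms, of 1 1] by (simp add: plus_fun_def)

lemma orb_forms_sum:
  assumes "openin (utop X) U" "\<And>i. i \<in> I \<Longrightarrow> \<sigma> i \<in> orb_forms X \<A> k U"
  shows "(\<Sum>i\<in>I. \<sigma> i) \<in> orb_forms X \<A> k U"
  using assms(2) by (induction I rule: infinite_finite_induct) (simp_all add: orb_forms_add[OF assms(1)])

text \<open>All the conditions can be tested pointwise in the base, including invariance and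
  compatibility, since group elements and embeddings map the preimage of \<open>V\<close> to the
  preimage of \<open>V\<close>. This is the gluing step for pull-backs and for global
  primitives.\<close>

lemma orb_forms_local:
  assumes U: "openin (utop X) U"
    and 0: "\<And>a. a \<notin> \<A> \<Longrightarrow> \<sigma> a = 0" "\<And>a z vs. z \<notin> cpre a U \<Longrightarrow> \<sigma> a z vs = 0"
    and loc: "\<And>x. x \<in> U \<Longrightarrow> \<exists>V \<tau>. openin (utop X) V \<and> x \<in> V \<and> V \<subseteq> U \<and> \<tau> \<in> orb_forms X \<A> k V \<and>
        (\<forall>a\<in>\<A>. \<forall>z\<in>cpre a V. \<sigma> a z = \<tau> a z)"
  shows "\<sigma> \<in> orb_forms X \<A> k U"
proof (rule orb_formsI)
  fix a assume a: "a \<in> \<A>"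
  have "\<sigma> a \<in> kforms n k (cpre a U)"
  proof (rule kforms_local[OF pre_open[OF a U] 0(2)])
    fix z assume z: "z \<in> cpre a U"
    then have xU: "cproj a z \<in> U" by (simp add: cpre_def)
    obtain V \<tau> where V: "openin (utop X) V" "cproj a z \<in> V" "V \<subseteq> U" "\<tau> \<in> orb_forms X \<A> k V"
      "\<forall>a\<in>\<A>. \<forall>z\<in>cpre a V. \<sigma> a z = \<tau> a z" using loc[OF xU] by blast
    have "\<tau> a \<in> kforms n k (cpre a V)" using orb_formsD(2)[OF V(4) a] dim[OF a] by simp
    then show "\<exists>E \<eta>. open_in_C n E \<and> z \<in> E \<and> E \<subseteq> cpre a U \<and> \<eta> \<in> kforms n k E \<and> (\<forall>y\<in>E. \<sigma> a y = \<eta> y)"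
      using z V pre_open[OF a V(1)] a by (intro exI[of _ "cpre a V"] exI[of _ "\<tau> a"]) (auto simp: cpre_def)
  qed
  then show "\<sigma> a \<in> kforms (cdim a) k (cpre a U)" using dim[OF a] by simp
  fix g assume g: "g \<in> cgrp a"
  show "pull_form (cdim a) (cpre a U) g (\<sigma> a) = \<sigma> a"
  proof (intro ext)
    fix z vs
    show "pull_form (cdim a) (cpre a U) g (\<sigma> a) z vs = \<sigma> a z vs"
    proof (cases "z \<in> cpre a U")
      case True
      then have xU: "cproj a z \<in> U" by (simp add: cpre_def)
      obtain V \<tau> where V: "cproj a z \<in> V" "\<tau> \<in> orb_forms X \<A> k V" "\<forall>a\<in>\<A>. \<forall>z\<in>cpre a V. \<sigma> a z = \<tau> a z" using loc[OF xU] by blast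
      have zV: "z \<in> cpre a V" using True V by (auto simp: cpre_def)
      have "pull_form (cdim a) (cpre a V) g (\<tau> a) z vs = \<tau> a z vs" using orb_formsD(3)[OF V(2) a g] by simp
      then show ?thesis using zV True V(3) a g_pre[OF a g zV] by (auto simp: pull_form_def split: if_splits)
    qed (simp add: pull_form_def 0(2))
  qed
next
  fix a b c e e' assume ab: "a \<in> \<A>" "b \<in> \<A>" and c: "quotient_chart X c" "chart_embedding c a e" "chart_embedding c b e'"
  show "pull_form (cdim c) (cpre c U) e (\<sigma> a) = pull_form (cdim c) (cpre c U) e' (\<sigma> b)"
  proof (intro ext)
    fix z vs
    show "pull_form (cdim c) (cpre c U) e (\<sigma> a) z vs = pull_form (cdim c) (cpre c U) e' (\<sigma> b) z vs"
    proof (cases "z \<in> cpre c U")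
      case True
      then have xU: "cproj c z \<in> U" by (simp add: cpre_def)
      obtain V \<tau> where V: "cproj c z \<in> V" "\<tau> \<in> orb_forms X \<A> k V" "\<forall>a\<in>\<A>. \<forall>z\<in>cpre a V. \<sigma> a z = \<tau> a z" using loc[OF xU] by blast
      have zV: "z \<in> cpre c V" using True V by (auto simp: cpre_def)
      have "pull_form (cdim c) (cpre c V) e (\<tau> a) z vs = pull_form (cdim c) (cpre c V) e' (\<tau> b) z vs"
        using orb_formsD(4)[OF V(2) ab c] by simp
      then show ?thesis
        using zV True V(3) ab chart_embeddingD(5)[OF c(2) zV] chart_embeddingD(5)[OF c(3) zV]
        by (auto simp: pull_form_def split: if_splits)
    qed (simp add: pull_form_def)
  qed
qed (rule 0(1))

lemma orb_forms_rst:
  assumes V: "openin (utop X) V" "V \<subseteq> U" and \<sigma>: "\<sigma> \<in> orb_forms X \<A> k U"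
  shows "rst V \<sigma> \<in> orb_forms X \<A> k V"
proof (rule orb_formsI)
  show "rst V \<sigma> a = 0" if "a \<notin> \<A>" for a
    by (intro ext) (simp add: rst_def orb_formsD(1)[OF \<sigma> that])
  show "rst V \<sigma> a \<in> kforms (cdim a) k (cpre a V)" if a: "a \<in> \<A>" for a
    using kforms_restrict[OF pre_open[OF a V(1)] _ cpre_mono[OF V(2)]] orb_formsD(2)[OF \<sigma> a] dim[OF a]
    by (simp add: rst_def)
  show "pull_form (cdim a) (cpre a V) g (rst V \<sigma> a) = rst V \<sigma> a" if a: "a \<in> \<A>" and g: "g \<in> cgrp a" for a g
  proof (intro ext)
    fix z vs
    have "pull_form (cdim a) (cpre a U) g (\<sigma> a) z vs = \<sigma> a z vs" using orb_formsD(3)[OF \<sigma> a g] by simp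
    then show "pull_form (cdim a) (cpre a V) g (rst V \<sigma> a) z vs = rst V \<sigma> a z vs"
      using g_pre[OF a g, of z V] cpre_mono[OF V(2), of a] by (auto simp: pull_form_def rst_def split: if_splits)
  qed
  fix a b c e e' assume ab: "a \<in> \<A>" "b \<in> \<A>" and c: "quotient_chart X c" "chart_embedding c a e" "chart_embedding c b e'"
  show "pull_form (cdim c) (cpre c V) e (rst V \<sigma> a) = pull_form (cdim c) (cpre c V) e' (rst V \<sigma> b)"
  proof (intro ext)
    fix z vs
    have "pull_form (cdim c) (cpre c U) e (\<sigma> a) z vs = pull_form (cdim c) (cpre c U) e' (\<sigma> b) z vs"
      using orb_formsD(4)[OF \<sigma> ab c] by simp
    then show "pull_form (cdim c) (cpre c V) e (rst V \<sigma> a) z vs = pull_form (cdim c) (cpre c V) e' (rst V \<sigma> b) z vs"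
      using chart_embeddingD(5)[OF c(2), of z V] chart_embeddingD(5)[OF c(3), of z V] cpre_mono[OF V(2), of c]
      by (auto simp: pull_form_def rst_def split: if_splits)
  qed
qed

lemma orb_forms_mult:
  assumes U: "openin (utop X) U" and \<sigma>: "\<sigma> \<in> orb_forms X \<A> k U" and h: "smooth_fun U h"
  shows "(\<lambda>a z vs. h (cproj a z) * \<sigma> a z vs) \<in> orb_forms X \<A> k U"
proof (rule orb_formsI)
  show "(\<lambda>z vs. h (cproj a z) * \<sigma> a z vs) = 0" if "a \<notin> \<A>" for a
    using orb_formsD(1)[OF \<sigma> that] by (simp add: zero_fun_def)
  show "(\<lambda>z vs. h (cproj a z) * \<sigma> a z vs) \<in> kforms (cdim a) k (cpre a U)" if a: "a \<in> \<A>" for a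
  proof (rule kformsI)
    note k = orb_formsD(2)[OF \<sigma> a]
    show "h (cproj a z) * \<sigma> a z vs = 0" if "\<not> (z \<in> cpre a U \<and> vs \<in> tangent_lists (cdim a) k)" for z vs
      using kforms_zero_outside[OF k that] by simp
    show "alternating_multilinear (cdim a) k (\<lambda>vs. h (cproj a z) * \<sigma> a z vs)" if "z \<in> cpre a U" for z
      using kforms_alternating[OF k that] unfolding alternating_multilinear_def by (auto simp: algebra_simps)
    show "smooth_on_C (cdim a) (cpre a U) (\<lambda>z. h (cproj a z) * \<sigma> a z vs)" for vs
      unfolding dim[OF a]
      by (rule smooth_on_C_mult[OF pre_open[OF a U] smooth_funD[OF h a] kforms_smooth[OF k[unfolded dim[OF a]]]])
  qed
  show "pull_form (cdim a) (cpre a U) g (\<lambda>z vs. h (cproj a z) * \<sigma> a z vs) = (\<lambda>z vs. h (cproj a z) * \<sigma> a z vs)"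
    if a: "a \<in> \<A>" and g: "g \<in> cgrp a" for a g
  proof (intro ext)
    fix z vs
    have "pull_form (cdim a) (cpre a U) g (\<sigma> a) z vs = \<sigma> a z vs" using orb_formsD(3)[OF \<sigma> a g] by simp
    then show "pull_form (cdim a) (cpre a U) g (\<lambda>z vs. h (cproj a z) * \<sigma> a z vs) z vs = h (cproj a z) * \<sigma> a z vs"
      using qchart.proj_g[OF ch[OF a] g, of z] by (auto simp: pull_form_def cpre_def split: if_splits)
  qed
  fix a b c e e' assume ab: "a \<in> \<A>" "b \<in> \<A>" and c: "quotient_chart X c" "chart_embedding c a e" "chart_embedding c b e'"
  show "pull_form (cdim c) (cpre c U) e (\<lambda>z vs. h (cproj a z) * \<sigma> a z vs) = pull_form (cdim c) (cpre c U) e' (\<lambda>z vs. h (cproj b z) * \<sigma> b z vs)"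
  proof (intro ext)
    fix z vs
    have "pull_form (cdim c) (cpre c U) e (\<sigma> a) z vs = pull_form (cdim c) (cpre c U) e' (\<sigma> b) z vs"
      using orb_formsD(4)[OF \<sigma> ab c] by simp
    then show "pull_form (cdim c) (cpre c U) e (\<lambda>z vs. h (cproj a z) * \<sigma> a z vs) z vs = pull_form (cdim c) (cpre c U) e' (\<lambda>z vs. h (cproj b z) * \<sigma> b z vs) z vs"
      using chart_embeddingD(4)[OF c(2), of z] chart_embeddingD(4)[OF c(3), of z]
      by (auto simp: pull_form_def cpre_def split: if_splits)
  qed
qed

lemma dsec_0_orb_forms:
  assumes U: "openin (utop X) U" and \<sigma>: "\<sigma> \<in> orb_forms X \<A> 0 U"
  shows "dsec U \<sigma> \<in> orb_forms X \<A> (Suc 0) U"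
proof (rule orb_formsI)
  show "dsec U \<sigma> a = 0" if "a \<notin> \<A>" for a
    using orb_formsD(1)[OF \<sigma> that] by (simp add: dsec_def ext_d_def fun_eq_iff)
  have k: "\<sigma> a \<in> kforms n 0 (cpre a U)" if "a \<in> \<A>" for a using orb_formsD(2)[OF \<sigma> that] dim[OF that] by simp
  show "dsec U \<sigma> a \<in> kforms (cdim a) (Suc 0) (cpre a U)" if a: "a \<in> \<A>" for a
    using ext_d_0form_kforms[OF pre_open[OF a U] k[OF a]] dim[OF a] by (simp add: dsec_def)
  show "pull_form (cdim a) (cpre a U) g (dsec U \<sigma> a) = dsec U \<sigma> a" if a: "a \<in> \<A>" and g: "g \<in> cgrp a" for a g
    using ext_d_pull_0form[OF pre_open[OF a U] pre_open[OF a U]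
        holo_mapD(1)[OF pre_open[OF a U] g_holo[OF a g pre_open[OF a U]]] g_pre[OF a g] k[OF a]]
      orb_formsD(3)[OF \<sigma> a g] dim[OF a] by (simp add: dsec_def)
  fix a b c e e' assume ab: "a \<in> \<A>" "b \<in> \<A>" and c: "quotient_chart X c" "chart_embedding c a e" "chart_embedding c b e'"
  have *: "pull_form n (cpre c U) e (ext_d n (cpre a U) (\<sigma> a)) = ext_d n (cpre c U) (pull_form n (cpre c U) e (\<sigma> a))"
    if "a \<in> \<A>" "chart_embedding c a e" for a e
  proof -
    note eh = emb_holo[OF that(1) c(1) that(2) U]
    show ?thesis
      by (rule ext_d_pull_0form[OF eh(2) pre_open[OF that(1) U] holo_mapD(1)[OF eh(2,3)]
            chart_embeddingD(5)[OF that(2)] k[OF that(1)]])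
  qed
  show "pull_form (cdim c) (cpre c U) e (dsec U \<sigma> a) = pull_form (cdim c) (cpre c U) e' (dsec U \<sigma> b)"
    using orb_formsD(4)[OF \<sigma> ab c]
    unfolding dsec_def dim[OF ab(1)] dim[OF ab(2)] emb_holo(1)[OF ab(1) c(1,2) U] *[OF ab(1) c(2)] *[OF ab(2) c(3)]
    by simp
qed

text \<open>Compatibility provides a third chart embedded in both, but its embeddings reach only the
  orbits of \<open>z\<close> and \<open>w\<close>. Correcting by group elements \<open>g\<close> and
  \<open>h\<close> gives the map h o e' o e^{-1} o g from a neighbourhood of \<open>z\<close> in one
  chart to the other.\<close>

lemma transition:
  assumes ab: "a \<in> \<A>" "b \<in> \<A>" and z: "z \<in> cdom a" and w: "w \<in> cdom b" and eq: "cproj a z = cproj b w"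
  obtains D F where "open_in_C n D" "z \<in> D" "D \<subseteq> cdom a" "holo_map n n D F" "F z = w"
    "\<And>y. y \<in> D \<Longrightarrow> F y \<in> cdom b" "\<And>y. y \<in> D \<Longrightarrow> cproj b (F y) = cproj a y"
    "\<And>y v. y \<in> D \<Longrightarrow> v \<in> cvecs n \<Longrightarrow> v \<noteq> 0 \<Longrightarrow> dird v F y \<noteq> 0"
proof -
  interpret A: qchart X a by (rule ch[OF ab(1)])
  interpret B: qchart X b by (rule ch[OF ab(2)])
  have na: "cdim a = n" "cdim b = n" using dim ab by auto
  obtain c e e' where c: "quotient_chart X c" "cproj a z \<in> cimg c" "chart_embedding c a e" "chart_embedding c b e'"
    using compat[OF ab] z w eq unfolding compatible_charts_def by (metis IntI imageI)
  interpret C: qchart X c by (rule qchart.intro[OF c(1)])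
  have nc: "cdim c = n" using chart_embeddingD(1)[OF c(3)] na by simp
  obtain y0 where y0: "y0 \<in> cdom c" "cproj c y0 = cproj a z" using c(2) by auto
  have ey0: "e y0 \<in> cdom a" "e' y0 \<in> cdom b" using y0 chart_embeddingD(3) c by blast+
  obtain g where g: "g \<in> cgrp a" "e y0 = g z"
    using A.fibre[OF z ey0(1)] chart_embeddingD(4)[OF c(3) y0(1)] y0 by auto
  obtain h where h: "h \<in> cgrp b" "w = h (e' y0)"
    using B.fibre[OF ey0(2) w] chart_embeddingD(4)[OF c(4) y0(1)] y0 eq by auto
  obtain g' where g': "g' \<in> cgrp a" "\<And>z. z \<in> cvecs n \<Longrightarrow> g' (g z) = z" "\<And>z. z \<in> cvecs n \<Longrightarrow> g (g' z) = z"
    by (rule A.g_inverse[OF g(1), unfolded na]) (rule that)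
  obtain h' where h': "h' \<in> cgrp b" "\<And>z. z \<in> cvecs n \<Longrightarrow> h' (h z) = z" "\<And>z. z \<in> cvecs n \<Longrightarrow> h (h' z) = z"
    by (rule B.g_inverse[OF h(1), unfolded na]) (rule that)
  let ?C = "cdom c" and ?i = "inv_into (cdom c) e" and ?i' = "inv_into (cdom c) e'"
  have E: "open_in_C n (e ` ?C)" "inj_on e ?C" "holo_map n n ?C e" "holo_map n n (e ` ?C) ?i"
    "open_in_C n (e' ` ?C)" "inj_on e' ?C" "holo_map n n ?C e'" "holo_map n n (e' ` ?C) ?i'"
    using c(3,4)[unfolded chart_embedding_def na nc] by blast+
  have Ca: "open_in_C n ?C" using C.dom_open nc by simp
  have oa: "open_in_C n (cdom a)" "open_in_C n (cdom b)" using A.dom_open B.dom_open na by auto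
  define D where "D = {y \<in> cdom a. g y \<in> e ` ?C}"
  define D' where "D' = {y \<in> cdom b. h' y \<in> e' ` ?C}"
  define F where "F y = h (e' (?i (g y)))" for y
  define K where "K y = g' (e (?i' (h' y)))" for y
  have gd: "g \<in> cdom a \<rightarrow> cvecs n" "h' \<in> cdom b \<rightarrow> cvecs n"
    using A.g_dom[OF g(1)] B.g_dom[OF h'(1)] A.dom_sub B.dom_sub na by auto
  have D: "open_in_C n D" "open_in_C n D'"
    unfolding D_def D'_def
    using open_in_C_vimage[OF oa(1) A.g_cont[OF g(1)] gd(1) E(1)] open_in_C_vimage[OF oa(2) B.g_cont[OF h'(1)] gd(2) E(5)]
    by auto
  have en: "e y \<in> cdom a" "e y \<in> cvecs n" "e' y \<in> cdom b" "e' y \<in> cvecs n" if "y \<in> ?C" for y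
    using that chart_embeddingD(3)[OF c(3)] chart_embeddingD(3)[OF c(4)] A.dom_sub B.dom_sub na by auto
  have FD: "F y \<in> D' \<and> K (F y) = y \<and> cproj b (F y) = cproj a y" if y: "y \<in> D" for y
  proof -
    obtain x where x: "x \<in> ?C" "g y = e x" and ya: "y \<in> cdom a" using y by (auto simp: D_def)
    have i: "?i (g y) = x" using x E(2) by simp
    have F: "F y = h (e' x)" by (simp add: F_def i)
    have hF: "h' (F y) = e' x" unfolding F by (rule h'(2)[OF en(4)[OF x(1)]])
    moreover have "F y \<in> cdom b" unfolding F by (rule B.g_dom[OF h(1) en(3)[OF x(1)]])
    moreover have "K (F y) = g' (e x)" unfolding K_def hF by (simp add: inv_into_f_f[OF E(6) x(1)])
    moreover have "g' (e x) = y" using g'(2)[of y] x(2) A.dom_sub[OF ya] na by simp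
    moreover have "cproj b (F y) = cproj a y"
      using B.proj_g[OF h(1) en(3)[OF x(1)]] chart_embeddingD(4)[OF c(4) x(1)] chart_embeddingD(4)[OF c(3) x(1)]
        A.proj_g[OF g(1) ya] x(2) F by simp
    ultimately show ?thesis using x by (auto simp: D'_def)
  qed
  have hF: "holo_map n n D F"
    unfolding F_def
  proof (rule holo_map_compose[OF D(1) oa(2), where G=h and F="\<lambda>y. e' (?i (g y))"])
    have gD: "holo_map n n D g" using A.g_holo[OF g(1)] D na by simp
    have iD: "holo_map n n D (\<lambda>y. ?i (g y))"
      by (rule holo_map_compose[OF D(1) E(1) gD, where G="?i"]) (simp_all add: D_def E(4))
    show "holo_map n n D (\<lambda>y. e' (?i (g y)))"
      by (rule holo_map_compose[OF D(1) Ca iD, where G=e']) (auto simp: D_def E(2,7))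
    show "e' (?i (g y)) \<in> cdom b" if "y \<in> D" for y
      using that en E(2) by (auto simp: D_def)
    show "holo_map n n (cdom b) h" using B.g_holo[OF h(1)] oa(2) na by simp
  qed
  have hK: "holo_map n n D' K"
    unfolding K_def
  proof (rule holo_map_compose[OF D(2) oa(1), where G=g' and F="\<lambda>y. e (?i' (h' y))"])
    have gD: "holo_map n n D' h'" using B.g_holo[OF h'(1)] D na by simp
    have iD: "holo_map n n D' (\<lambda>y. ?i' (h' y))"
      by (rule holo_map_compose[OF D(2) E(5) gD, where G="?i'"]) (simp_all add: D'_def E(8))
    show "holo_map n n D' (\<lambda>y. e (?i' (h' y)))"
      by (rule holo_map_compose[OF D(2) Ca iD, where G=e]) (auto simp: D'_def E(3,6))
    show "e (?i' (h' y)) \<in> cdom a" if "y \<in> D'" for y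
      using that en E(6) by (auto simp: D'_def)
    show "holo_map n n (cdom a) g'" using A.g_holo[OF g'(1)] oa(1) na by simp
  qed
  show ?thesis
  proof (rule that[of D F])
    show "z \<in> D" using z imageI[OF y0(1), of e] g(2) by (simp add: D_def)
    show "F z = w" using h(2) inv_into_f_f[OF E(2) y0(1)] g(2) by (simp add: F_def)
    fix y v assume y: "y \<in> D" and v: "v \<in> cvecs n" "v \<noteq> (0::cvec)"
    \<comment> \<open>The map \<open>K\<close>, built in the same way in the opposite direction, is
      a left inverse of \<open>F\<close>, so the differential of \<open>F\<close> is
      injective.\<close>
    have "v = dird v (\<lambda>y. K (F y)) y"
      using dird_cong[OF D(1) y v(1), of "\<lambda>y. K (F y)" "\<lambda>y. y"] FD by simp
    also have "\<dots> = dird (dird v F y) K (F y)"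
      by (rule dird_compose[OF smooth_on_C_diff_at[OF holo_mapD(1)[OF D(1) hF] y]
            smooth_on_C_diff_at[OF holo_mapD(1)[OF D(2) hK]] _ D(1) D(2) y v(1)]) (use FD y in auto)
    finally have "v = dird (dird v F y) K (F y)" .
    moreover have "dird 0 K (F y) = 0" by (simp add: dird_def)
    ultimately show "dird v F y \<noteq> 0" using v by metis
  qed (use D hF FD in \<open>auto simp: D_def D'_def\<close>)
qed

end

section \<open>The pull-back of forms on the space\<close>

lemma local_embeddingD:
  assumes "local_embedding X V N \<Omega> j"
  shows "openin (utop X) V" "open_in_C N \<Omega>" "\<And>x. x \<in> V \<Longrightarrow> j x \<in> \<Omega>"
    "\<And>x. x \<in> V \<Longrightarrow> j x \<in> cvecs N"
proof -
  show "openin (utop X) V" and \<Omega>: "open_in_C N \<Omega>" using assms by (simp_all add: local_embedding_def)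
  have "closedin (top_of_set \<Omega>) (j ` V)" using assms by (simp add: local_embedding_def analytic_subset_def)
  then show *: "j x \<in> \<Omega>" if "x \<in> V" for x using closedin_subset[of "top_of_set \<Omega>" "j ` V"] that by auto
  show "j x \<in> cvecs N" if "x \<in> V" for x using *[OF that] \<Omega> open_in_C_subset by blast
qed

text \<open>The coordinates of \<open>j\<close> are restrictions of the ambient coordinates, hence
  sections of the sheaf, and the chart describes these sections as holomorphic functions
  upstairs.\<close>

lemma (in qchart) local_embedding_holo:
  assumes le: "local_embedding X V N \<Omega> j"
  shows "holo_map n N (cpre c V) (\<lambda>z. j (p z))"
  unfolding holo_map_def
proof (intro conjI allI impI)
  note L = local_embeddingD[OF le]
  show "(\<lambda>z. j (p z)) \<in> cpre c V \<rightarrow> cvecs N" using L(4) by (auto simp: cpre_def)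
  fix i assume "i < N"
  let ?W = "V \<inter> cimg c"
  have W: "openin (utop X) ?W" using L(1) img_open by (rule openin_Int)
  have iff: "(\<lambda>x. coord (j x) i) \<in> hol X ?W \<longleftrightarrow>
      (\<forall>x\<in>?W. \<exists>\<Omega>' F. open_in_C N \<Omega>' \<and> j x \<in> \<Omega>' \<and> \<Omega>' \<subseteq> \<Omega> \<and> holo_on N \<Omega>' F \<and>
            (\<forall>y\<in>?W. j y \<in> \<Omega>' \<longrightarrow> coord (j y) i = F (j y)))"
    by (rule le[unfolded local_embedding_def, THEN conjunct2, THEN conjunct2, THEN conjunct2, THEN conjunct2,
          THEN spec, THEN spec, THEN mp, OF conjI[OF W Int_lower1]])
  have "(\<lambda>x. coord (j x) i) \<in> hol X ?W"
    unfolding iff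
  proof
    fix x assume "x \<in> ?W"
    then show "\<exists>\<Omega>' F. open_in_C N \<Omega>' \<and> j x \<in> \<Omega>' \<and> \<Omega>' \<subseteq> \<Omega> \<and> holo_on N \<Omega>' F \<and>
            (\<forall>y\<in>?W. j y \<in> \<Omega>' \<longrightarrow> coord (j y) i = F (j y))"
      using L(2,3) holo_on_coord[OF L(2)] by (intro exI[of _ \<Omega>] exI[of _ "\<lambda>z. coord z i"]) auto
  qed
  then have "holo_on n (cpre c ?W) ((\<lambda>x. coord (j x) i) \<circ> p)"
    using hol_iff[OF W] by simp
  moreover have "cpre c ?W = cpre c V" by (auto simp: cpre_def)
  ultimately show "holo_on n (cpre c V) (\<lambda>z. coord (j (p z)) i)" by (simp add: o_def)
qed

lemma reg_chartsD:
  assumes "c \<in> reg_charts X"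
  shows "quotient_chart X c" "inj_on (cproj c) (cdom c)"
proof -
  show q: "quotient_chart X c" using assms by (simp add: reg_charts_def)
  interpret qchart X c by (rule qchart.intro[OF q])
  have "cgrp c = {\<lambda>z\<in>cvecs n. z}" using assms by (simp add: reg_charts_def)
  then show "inj_on p D" using fibre dom_sub by (auto simp: inj_on_def)
qed

context orb begin

text \<open>Compatibility is assumed among charts of the atlas only. Here the sheaf takes its place:
  the coordinates of the inverse of a regular chart are sections of \<open>hol X\<close>, so they
  pull back to holomorphic functions on every orbifold chart.\<close>

lemma holo_into_reg_chart:
  assumes c: "c \<in> reg_charts X" and a: "a \<in> \<A>"
  shows "holo_map n (cdim c) (cpre a (cimg c)) (\<lambda>z. inv_into (cdom c) (cproj c) (cproj a z))"
  unfolding holo_map_def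
proof (intro conjI allI impI)
  interpret C: qchart X c by (rule qchart.intro[OF reg_chartsD(1)[OF c]])
  interpret A: qchart X a by (rule ch[OF a])
  let ?i = "inv_into (cdom c) (cproj c)"
  have inv: "?i x \<in> cdom c" if "x \<in> cimg c" for x using that by (rule inv_into_into)
  then show "(\<lambda>z. ?i (cproj a z)) \<in> cpre a (cimg c) \<rightarrow> cvecs (cdim c)"
    using C.dom_sub by (auto simp: cpre_def)
  fix k assume "k < cdim c"
  let ?f = "\<lambda>x. coord (?i x) k" and ?W = "cimg c \<inter> cimg a"
  have pre: "cpre c (cimg c) = cdom c" by (auto simp: cpre_def)
  have "holo_on (cdim c) (cdom c) (?f \<circ> cproj c)"
    by (rule holo_on_cong[OF C.dom_open holo_on_coord[OF C.dom_open, of k]])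
       (simp add: inv_into_f_f[OF reg_chartsD(2)[OF c]])
  then have "?f \<in> hol X (cimg c)" using C.hol_iff[OF C.img_open order_refl] pre by simp
  moreover have W: "openin (utop X) ?W" by (intro openin_Int C.img_open A.img_open)
  moreover have "function_sheaf X" using space by (simp add: reduced_complex_space_def)
  moreover have "?W \<subseteq> cimg c" by simp
  ultimately have "?f \<in> hol X ?W"
    using C.img_open unfolding function_sheaf_def by blast
  then have "holo_on (cdim a) (cpre a ?W) (?f \<circ> cproj a)" using A.hol_iff[OF W] by simp
  moreover have "cpre a ?W = cpre a (cimg c)" by (auto simp: cpre_def)
  ultimately show "holo_on n (cpre a (cimg c)) (\<lambda>z. coord (?i (cproj a z)) k)"
    using dim[OF a] by (simp add: o_def)
qed

section \<open>Uniqueness of the pull-back\<close>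

definition is_pullback :: "nat \<Rightarrow> 'a set \<Rightarrow> 'a sec \<Rightarrow> 'a sec \<Rightarrow> bool" where
  "is_pullback k U \<sigma> \<tau> \<longleftrightarrow> \<tau> \<in> orb_forms X \<A> k U \<and>
     (\<forall>a\<in>\<A>. \<forall>c\<in>reg_charts X. \<forall>z\<in>cpre a (U \<inter> cimg c).
        \<tau> a z = pull_form (cdim a) (cpre a (U \<inter> cimg c))
                  (inv_into (cdom c) (cproj c) \<circ> cproj a) (\<sigma> c) z)"

text \<open>Exactly what the density of free points calls for. It covers total differentials of
  cochains as well, for which only continuity in each chart is established.\<close>

definition contsec :: "'a set \<Rightarrow> 'a sec \<Rightarrow> bool" where
  "contsec U \<tau> \<longleftrightarrow> (\<forall>a z vs. a \<notin> \<A> \<or> z \<notin> cpre a U \<longrightarrow> \<tau> a z vs = 0) \<and>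
     (\<forall>a\<in>\<A>. \<forall>vs. continuous_on (cpre a U) (\<lambda>z. \<tau> a z vs))"

lemma contsec_eqI:
  assumes U: "openin (utop X) U" and \<tau>: "contsec U \<tau>" and \<tau>': "contsec U \<tau>'"
    and eq: "\<And>a z vs. a \<in> \<A> \<Longrightarrow> z \<in> cpre a U \<Longrightarrow> qchart.free a z \<Longrightarrow> \<tau> a z vs = \<tau>' a z vs"
  shows "\<tau> = \<tau>'"
proof (intro ext)
  fix a z vs
  show "\<tau> a z vs = \<tau>' a z vs"
  proof (cases "a \<in> \<A> \<and> z \<in> cpre a U")
    case True
    then have a: "a \<in> \<A>" and z: "z \<in> cpre a U" by auto
    interpret A: qchart X a by (rule ch[OF a])
    show ?thesis
    proof (rule A.eq_if_eq_on_free[OF _ _ _ _ _ z])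
      show "open_in_C (cdim a) (cpre a U)" using pre_open[OF a U] dim[OF a] by simp
      show "cpre a U \<subseteq> cdom a" by (auto simp: cpre_def)
      show "continuous_on (cpre a U) (\<lambda>z. \<tau> a z vs)" "continuous_on (cpre a U) (\<lambda>z. \<tau>' a z vs)"
        using \<tau> \<tau>' a unfolding contsec_def by blast+
    qed (simp add: eq a)
  next
    case False
    then have "a \<notin> \<A> \<or> z \<notin> cpre a U" by blast
    then have "\<tau> a z vs = 0" "\<tau>' a z vs = 0" using \<tau> \<tau>' unfolding contsec_def by blast+
    then show ?thesis by simp
  qed
qed

lemma contsec_orb_forms:
  assumes \<tau>: "\<tau> \<in> orb_forms X \<A> k U"
  shows "contsec U \<tau>"
  using orb_formsD(1)[OF \<tau>] orb_forms_outside[OF \<tau>] smooth_on_C_cont[OF kforms_smooth[OF orb_formsD(2)[OF \<tau>]]]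
  unfolding contsec_def by auto

lemma orb_forms_eqI:
  assumes U: "openin (utop X) U" and \<tau>: "\<tau> \<in> orb_forms X \<A> k U" and \<tau>': "\<tau>' \<in> orb_forms X \<A> k U"
    and eq: "\<And>a z. a \<in> \<A> \<Longrightarrow> z \<in> cpre a U \<Longrightarrow> qchart.free a z \<Longrightarrow> \<tau> a z = \<tau>' a z"
  shows "\<tau> = \<tau>'"
  by (rule contsec_eqI[OF U contsec_orb_forms[OF \<tau>] contsec_orb_forms[OF \<tau>']]) (simp add: eq)

lemma sub_chart_is_reg:
  assumes a: "a \<in> \<A>" and z: "qchart.free a z" and E: "open_in_C n E" "z \<in> E"
  obtains B where "open_in_C n B" "z \<in> B" "B \<subseteq> E \<inter> cdom a" "qchart.sub_chart a B \<in> reg_charts X"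
  by (rule qchart.reg_chart_at_free[OF ch[OF a] z, of E]) (use that E dim[OF a] in auto)

lemma sub_chart_sel:
  assumes "a \<in> \<A>"
  shows "cdim (qchart.sub_chart a B) = n" "cdom (qchart.sub_chart a B) = B" "cproj (qchart.sub_chart a B) = cproj a"
  using qchart.sub_chart_simps[OF ch[OF assms]] dim[OF assms] by simp_all

lemma cpre_sub_chart:
  assumes "a \<in> \<A>" "B \<subseteq> cdom a"
  shows "cpre (qchart.sub_chart a B) U = B \<inter> cpre a U"
  by (rule qchart.cpre_sub_chart[OF ch[OF assms(1)] assms(2)])

text \<open>On \<open>B\<close> the inverse of the regular chart composed with the projection is the
  identity, so the defining condition of the pull-back returns the given form. The case distinction
  on \<open>vs\<close> is the default value of \<open>pull_form\<close>.\<close>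

lemma is_pullback_sub_chart:
  assumes U: "openin (utop X) U" and \<tau>: "is_pullback k U \<sigma> \<tau>" and a: "a \<in> \<A>" and B: "open_in_C n B" "B \<subseteq> cdom a"
    and c: "qchart.sub_chart a B \<in> reg_charts X" and z: "z \<in> B" "z \<in> cpre a U"
  shows "\<tau> a z = (\<lambda>vs. if set vs \<subseteq> cvecs n then \<sigma> (qchart.sub_chart a B) z vs else 0)"
proof -
  interpret A: qchart X a by (rule ch[OF a])
  let ?c = "A.sub_chart B"
  let ?i = "inv_into (cdom ?c) (cproj ?c) \<circ> cproj a"
  have c_img: "openin (utop X) (cimg ?c)" using A.proj_open[of B] B dim[OF a] by simp
  have inj: "inj_on (cproj a) B" using reg_chartsD(2)[OF c] by simp
  have i: "?i y = y" if "y \<in> B" for y using inv_into_f_f[OF inj that] by simp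
  let ?S = "cpre a (U \<inter> cimg ?c)"
  have S: "open_in_C n ?S" by (rule pre_open[OF a openin_Int[OF U c_img]])
  have zS: "z \<in> ?S" using z by (auto simp: cpre_def)
  have "\<tau> a z = pull_form (cdim a) ?S ?i (\<sigma> ?c) z"
    using \<tau> a c zS unfolding is_pullback_def by blast
  also have "\<dots> = pull_form n B (\<lambda>y. y) (\<sigma> ?c) z"
    unfolding dim[OF a] by (rule pull_form_at[OF S B(1) zS z(1)]) (rule i)
  finally show ?thesis using z(1) by (auto simp: pull_form_def)
qed

lemma is_pullback_unique:
  assumes U: "openin (utop X) U" and \<tau>: "is_pullback k U \<sigma> \<tau>" and \<tau>': "is_pullback k U \<sigma> \<tau>'"
  shows "\<tau> = \<tau>'"
proof (rule orb_forms_eqI[OF U])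
  show "\<tau> \<in> orb_forms X \<A> k U" "\<tau>' \<in> orb_forms X \<A> k U" using \<tau> \<tau>' by (auto simp: is_pullback_def)
  fix a z assume a: "a \<in> \<A>" and z: "z \<in> cpre a U" "qchart.free a z"
  obtain B where B: "open_in_C n B" "z \<in> B" "B \<subseteq> cpre a U \<inter> cdom a" "qchart.sub_chart a B \<in> reg_charts X"
    by (rule sub_chart_is_reg[OF a z(2) pre_open[OF a U] z(1)])
  have BD: "B \<subseteq> cdom a" using B(3) by auto
  show "\<tau> a z = \<tau>' a z"
    using is_pullback_sub_chart[OF U \<tau> a B(1) BD B(4,2) z(1)] is_pullback_sub_chart[OF U \<tau>' a B(1) BD B(4,2) z(1)] by simp
qed

lemma orb_pullback_eq:
  assumes "openin (utop X) U" "is_pullback k U \<sigma> \<tau>"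
  shows "orb_pullback X \<A> k U \<sigma> = \<tau>"
  unfolding orb_pullback_def is_pullback_def[symmetric]
  by (rule the_equality, rule assms(2), rule is_pullback_unique[OF assms(1) _ assms(2)])

lemma is_pullback_zero:
  assumes "openin (utop X) U"
  shows "is_pullback k U 0 0"
  by (auto simp: is_pullback_def pull_form_def fun_eq_iff)

section \<open>Existence of the pull-back\<close>

definition loc_form :: "'a set \<Rightarrow> ('a \<Rightarrow> cvec) \<Rightarrow> form \<Rightarrow> 'a sec" where
  "loc_form V j \<Theta> = (\<lambda>a. if a \<in> \<A> then pull_form n (cpre a V) (\<lambda>z. j (cproj a z)) \<Theta> else 0)"

lemma loc_form_orb_forms:
  assumes le: "local_embedding X V N \<Omega> j" and \<Theta>: "\<Theta> \<in> kforms N k \<Omega>"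
  shows "loc_form V j \<Theta> \<in> orb_forms X \<A> k V"
proof -
  note L = local_embeddingD[OF le]
  have ho: "holo_map n N (cpre a V) (\<lambda>z. j (cproj a z))" if "a \<in> \<A>" for a
    using qchart.local_embedding_holo[OF ch[OF that] le] dim[OF that] by simp
  have sm: "smooth_on_C n (cpre a V) (\<lambda>z. j (cproj a z))" if "a \<in> \<A>" for a
    by (rule holo_mapD(1)[OF pre_open[OF that L(1)] ho[OF that]])
  have into: "j (cproj a z) \<in> \<Omega>" if "z \<in> cpre a V" for a z using that L(3) by (auto simp: cpre_def)
  have pull: "pull_form n D F (pull_form n (cpre a V) (\<lambda>z. j (cproj a z)) \<Theta>) = pull_form n D (\<lambda>y. j (q y)) \<Theta>"
    if D: "open_in_C n D" "a \<in> \<A>" "holo_map n n D F" "\<And>z. z \<in> D \<Longrightarrow> F z \<in> cpre a V" "\<And>y. y \<in> D \<Longrightarrow> cproj a (F y) = q y"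
    for D F a q
  proof -
    have "pull_form n D F (pull_form n (cpre a V) (\<lambda>z. j (cproj a z)) \<Theta>) = pull_form n D (\<lambda>y. j (cproj a (F y))) \<Theta>"
      by (rule pull_form_compose[OF D(1) pre_open[OF D(2) L(1)] L(2) holo_mapD(1)[OF D(1,3)] sm[OF D(2)] D(4)])
    also have "\<dots> = pull_form n D (\<lambda>y. j (q y)) \<Theta>"
      by (rule pull_form_cong[OF D(1)]) (simp add: D(5))
    finally show ?thesis .
  qed
  show ?thesis
  proof (rule orb_formsI)
    fix a assume a: "a \<in> \<A>"
    show "loc_form V j \<Theta> a \<in> kforms (cdim a) k (cpre a V)"
      using pull_form_kforms[OF pre_open[OF a L(1)] L(2) sm[OF a] into \<Theta>] a dim[OF a] by (simp add: loc_form_def)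
    fix g assume g: "g \<in> cgrp a"
    show "pull_form (cdim a) (cpre a V) g (loc_form V j \<Theta> a) = loc_form V j \<Theta> a"
      using pull[OF pre_open[OF a L(1)] a g_holo[OF a g pre_open[OF a L(1)]] g_pre[OF a g], of "cproj a"]
        qchart.proj_g[OF ch[OF a] g] a dim[OF a] by (simp add: loc_form_def cpre_def)
  next
    fix a b c e e' assume ab: "a \<in> \<A>" "b \<in> \<A>" and c: "quotient_chart X c" "chart_embedding c a e" "chart_embedding c b e'"
    have *: "pull_form n (cpre c V) e (loc_form V j \<Theta> a) = pull_form n (cpre c V) (\<lambda>y. j (cproj c y)) \<Theta>"
      if "a \<in> \<A>" "chart_embedding c a e" for a e
      using pull[OF emb_holo(2)[OF that(1) c(1) that(2) L(1)] that(1) emb_holo(3)[OF that(1) c(1) that(2) L(1)]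
          chart_embeddingD(5)[OF that(2)], of "cproj c"] chart_embeddingD(4)[OF that(2)] that(1)
      by (simp add: loc_form_def cpre_def)
    show "pull_form (cdim c) (cpre c V) e (loc_form V j \<Theta> a) = pull_form (cdim c) (cpre c V) e' (loc_form V j \<Theta> b)"
      unfolding emb_holo(1)[OF ab(1) c(1,2) L(1)] *[OF ab(1) c(2)] *[OF ab(2) c(3)] ..
  qed (simp add: loc_form_def)
qed

text \<open>The same ambient form is pulled back along the same map, once to the orbifold chart and
  once to the regular chart contained in it. The value is therefore independent of the embedding
  chosen.\<close>

lemma loc_form_sub_chart:
  assumes le: "local_embedding X V N \<Omega> j" and r: "is_restriction X \<sigma> V j \<Theta>"
    and a: "a \<in> \<A>" and B: "open_in_C n B" "B \<subseteq> cdom a"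
    and c: "qchart.sub_chart a B \<in> reg_charts X" and z: "z \<in> B" "z \<in> cpre a V"
  shows "loc_form V j \<Theta> a z = \<sigma> (qchart.sub_chart a B) z"
proof -
  interpret A: qchart X a by (rule ch[OF a])
  note L = local_embeddingD[OF le]
  let ?c = "A.sub_chart B"
  have pc: "cpre ?c V = B \<inter> cpre a V" by (rule A.cpre_sub_chart[OF B(2)])
  have op: "open_in_C n (B \<inter> cpre a V)" by (rule openin_Int[OF B(1) pre_open[OF a L(1)]])
  have zz: "z \<in> B \<inter> cpre a V" using z by simp
  have "\<forall>z\<in>cpre ?c V. \<sigma> ?c z = pull_form (cdim ?c) (cpre ?c V) (j \<circ> cproj ?c) \<Theta> z"
    using r c unfolding is_restriction_def by blast
  from bspec[OF this, of z] have "\<sigma> ?c z = pull_form n (B \<inter> cpre a V) (j \<circ> cproj a) \<Theta> z"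
    using zz by (simp add: pc dim[OF a])
  also have "\<dots> = pull_form n (cpre a V) (\<lambda>z. j (cproj a z)) \<Theta> z"
    by (rule pull_form_at[OF op pre_open[OF a L(1)] zz z(2)]) simp
  finally show ?thesis using a by (simp add: loc_form_def)
qed

text \<open>Ambient forms in local embeddings provide local candidates. Two of them agree on the
  overlap because at free points both return the given form on a small regular chart; so they
  glue.\<close>

lemma is_pullback_exists:
  assumes U: "openin (utop X) U" and \<sigma>: "\<sigma> \<in> space_forms X k U"
  shows "\<exists>\<tau>. is_pullback k U \<sigma> \<tau>"
proof -
  have "\<exists>V N \<Omega> j \<Theta>. x \<in> V \<and> V \<subseteq> U \<and> local_embedding X V N \<Omega> j \<and> \<Theta> \<in> kforms N k \<Omega> \<and> is_restriction X \<sigma> V j \<Theta>"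
    if "x \<in> U" for x using \<sigma> that unfolding space_forms_def by blast
  then obtain V N \<Omega> j \<Theta> where d: "\<And>x. x \<in> U \<Longrightarrow> x \<in> V x \<and> V x \<subseteq> U \<and> local_embedding X (V x) (N x) (\<Omega> x) (j x) \<and>
      \<Theta> x \<in> kforms (N x) k (\<Omega> x) \<and> is_restriction X \<sigma> (V x) (j x) (\<Theta> x)" by metis
  define t where "t x = loc_form (V x) (j x) (\<Theta> x)" for x
  have Vo: "openin (utop X) (V x)" if "x \<in> U" for x using d[OF that] local_embeddingD(1) by blast
  have t: "t x \<in> orb_forms X \<A> k (V x)" if "x \<in> U" for x
    unfolding t_def using d[OF that] loc_form_orb_forms by blast
  have agree: "t x a z = t y a z" if x: "x \<in> U" and y: "y \<in> U" and a: "a \<in> \<A>" and z: "z \<in> cpre a (V x \<inter> V y)" for x y a z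
  proof -
    let ?W = "V x \<inter> V y"
    have W: "openin (utop X) ?W" by (intro openin_Int Vo x y)
    have "rst ?W (t x) = rst ?W (t y)"
    proof (rule orb_forms_eqI[OF W])
      show "rst ?W (t x) \<in> orb_forms X \<A> k ?W" "rst ?W (t y) \<in> orb_forms X \<A> k ?W"
        by (rule orb_forms_rst[OF W _ t[OF x]], simp, rule orb_forms_rst[OF W _ t[OF y]], simp)
      fix a z assume a: "a \<in> \<A>" and z: "z \<in> cpre a ?W" "qchart.free a z"
      obtain B where B: "open_in_C n B" "z \<in> B" "B \<subseteq> cpre a ?W \<inter> cdom a" "qchart.sub_chart a B \<in> reg_charts X"
        by (rule sub_chart_is_reg[OF a z(2) pre_open[OF a W] z(1)])
      have BD: "B \<subseteq> cdom a" using B(3) by auto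
      have "t x a z = \<sigma> (qchart.sub_chart a B) z"
        unfolding t_def by (rule loc_form_sub_chart[OF _ _ a B(1) BD B(4,2)]) (use d[OF x] z in \<open>auto simp: cpre_def\<close>)
      moreover have "t y a z = \<sigma> (qchart.sub_chart a B) z"
        unfolding t_def by (rule loc_form_sub_chart[OF _ _ a B(1) BD B(4,2)]) (use d[OF y] z in \<open>auto simp: cpre_def\<close>)
      ultimately show "rst ?W (t x) a z = rst ?W (t y) a z" using z(1) by (simp add: rst_def)
    qed
    from fun_cong[OF fun_cong[OF this, of a], of z] show ?thesis using z by (simp add: rst_def)
  qed
  \<comment> \<open>At each point the candidate belonging to that very point is used; by
    \<open>agree\<close> any other candidate defined there gives the same value.\<close>
  define \<tau> where "\<tau> = (\<lambda>a z vs. if a \<in> \<A> \<and> z \<in> cpre a U then t (cproj a z) a z vs else 0)"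
  have \<tau>t: "\<tau> a z = t x a z" if x: "x \<in> U" and a: "a \<in> \<A>" and z: "z \<in> cpre a (V x)" for x a z
  proof -
    have zU: "z \<in> cpre a U" using z d[OF x] by (auto simp: cpre_def)
    then have y: "cproj a z \<in> U" by (simp add: cpre_def)
    have "z \<in> cpre a (V (cproj a z) \<inter> V x)" using z d[OF y] by (simp add: cpre_def)
    from agree[OF y x a this] show ?thesis using zU a by (simp add: \<tau>_def)
  qed
  have \<tau>o: "\<tau> \<in> orb_forms X \<A> k U"
  proof (rule orb_forms_local[OF U])
    show "\<tau> a = 0" if "a \<notin> \<A>" for a using that by (simp add: \<tau>_def zero_fun_def)
    show "\<tau> a z vs = 0" if "z \<notin> cpre a U" for a z vs using that by (simp add: \<tau>_def)
    fix x assume x: "x \<in> U"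
    show "\<exists>V \<tau>'. openin (utop X) V \<and> x \<in> V \<and> V \<subseteq> U \<and> \<tau>' \<in> orb_forms X \<A> k V \<and> (\<forall>a\<in>\<A>. \<forall>z\<in>cpre a V. \<tau> a z = \<tau>' a z)"
      using Vo[OF x] d[OF x] t[OF x] \<tau>t[OF x] by (intro exI[of _ "V x"] exI[of _ "t x"]) simp
  qed
  have "is_pullback k U \<sigma> \<tau>"
    unfolding is_pullback_def
  proof (intro conjI ballI \<tau>o)
    fix a c z assume a: "a \<in> \<A>" and c: "c \<in> reg_charts X" and z: "z \<in> cpre a (U \<inter> cimg c)"
    let ?x = "cproj a z" and ?i = "\<lambda>z. inv_into (cdom c) (cproj c) (cproj a z)"
    interpret C: qchart X c by (rule qchart.intro[OF reg_chartsD(1)[OF c]])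
    have x: "?x \<in> U" using z by (simp add: cpre_def)
    note dx = d[OF x]
    have le: "local_embedding X (V ?x) (N ?x) (\<Omega> ?x) (j ?x)" using dx by blast
    let ?S = "cpre a (V ?x \<inter> cimg c)" and ?T = "cpre a (U \<inter> cimg c)"
    have S: "open_in_C n ?S" by (rule pre_open[OF a openin_Int[OF Vo[OF x] C.img_open]])
    have T: "open_in_C n ?T" by (rule pre_open[OF a openin_Int[OF U C.img_open]])
    have zS: "z \<in> ?S" "z \<in> cpre a (V ?x)" using z dx by (auto simp: cpre_def)
    have hi: "holo_map n (cdim c) ?S ?i"
      by (rule holo_map_subset[OF holo_into_reg_chart[OF c a] cpre_mono]) simp
    have ii: "?i y \<in> cpre c (V ?x) \<and> cproj c (?i y) = cproj a y" if "y \<in> ?S" for y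
    proof -
      have "cproj a y \<in> cimg c" "cproj a y \<in> V ?x" using that by (auto simp: cpre_def)
      then show ?thesis by (auto simp: cpre_def f_inv_into_f inv_into_into)
    qed
    have hj: "holo_map (cdim c) (N ?x) (cpre c (V ?x)) (\<lambda>z. j ?x (cproj c z))" by (rule C.local_embedding_holo[OF le])
    have "pull_form (cdim a) ?T (inv_into (cdom c) (cproj c) \<circ> cproj a) (\<sigma> c) z = pull_form n ?S ?i (\<sigma> c) z"
      unfolding dim[OF a] by (rule pull_form_at[OF T S z zS(1)]) simp
    \<comment> \<open>On the regular chart the form is itself a pull-back of the ambient form.
      Composing with the map from the orbifold chart, the regular chart drops out and only the
      embedding after the projection remains.\<close>
    also have "\<dots> = pull_form n ?S ?i (pull_form (cdim c) (cpre c (V ?x)) (j ?x \<circ> cproj c) (\<Theta> ?x)) z"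
    proof (rule fun_cong[OF pull_form_cong_form])
      fix y assume "y \<in> ?S"
      then show "\<sigma> c (?i y) = pull_form (cdim c) (cpre c (V ?x)) (j ?x \<circ> cproj c) (\<Theta> ?x) (?i y)"
        using dx ii c unfolding is_restriction_def by blast
    qed
    also have "\<dots> = pull_form n ?S (\<lambda>y. (j ?x \<circ> cproj c) (?i y)) (\<Theta> ?x) z"
      using pull_form_compose[OF S C.cpre_open[OF Vo[OF x]] local_embeddingD(2)[OF le] holo_mapD(1)[OF S hi]
          holo_mapD(1)[OF C.cpre_open[OF Vo[OF x]] hj], of "\<Theta> ?x"] ii by (simp add: o_def)
    also have "\<dots> = pull_form n (cpre a (V ?x)) (\<lambda>y. j ?x (cproj a y)) (\<Theta> ?x) z"
      by (rule pull_form_at[OF S pre_open[OF a Vo[OF x]] zS]) (simp add: ii)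
    also have "\<dots> = \<tau> a z" using \<tau>t[OF x a zS(2)] a by (simp add: t_def loc_form_def)
    finally show "\<tau> a z = pull_form (cdim a) ?T (inv_into (cdom c) (cproj c) \<circ> cproj a) (\<sigma> c) z" by simp
  qed
  then show ?thesis by blast
qed

lemma is_pullback_orb_pullback:
  assumes "openin (utop X) U" "\<sigma> \<in> space_forms X k U"
  shows "is_pullback k U \<sigma> (orb_pullback X \<A> k U \<sigma>)"
  using is_pullback_exists[OF assms] orb_pullback_eq[OF assms(1)] by blast

lemma orb_pullback_orb_forms:
  assumes "openin (utop X) U" "\<sigma> \<in> space_forms X k U"
  shows "orb_pullback X \<A> k U \<sigma> \<in> orb_forms X \<A> k U"
  using is_pullback_orb_pullback[OF assms] by (simp add: is_pullback_def)

lemma space_forms_kforms: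
  assumes "\<sigma> \<in> space_forms X k U" "c \<in> reg_charts X"
  shows "\<sigma> c \<in> kforms (cdim c) k (cpre c U)"
  using assms orb_formsD(2) unfolding space_forms_def by blast

text \<open>At the free points of a chart the pull-back is the form itself, on the regular chart obtained by
  shrinking the domain. As these points are dense, identities between pull-backs need only be checked
  for the forms on the space.\<close>

lemma orb_pullback_sub_chart:
  assumes U: "openin (utop X) U" and \<sigma>: "\<sigma> \<in> space_forms X k U" and a: "a \<in> \<A>" and B: "open_in_C n B" "B \<subseteq> cdom a"
    and c: "qchart.sub_chart a B \<in> reg_charts X" and z: "z \<in> B"
  shows "orb_pullback X \<A> k U \<sigma> a z = \<sigma> (qchart.sub_chart a B) z"
proof
  fix vs
  have k: "\<sigma> (qchart.sub_chart a B) \<in> kforms n k (B \<inter> cpre a U)"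
    using space_forms_kforms[OF \<sigma> c] sub_chart_sel[OF a] cpre_sub_chart[OF a B(2)] by simp
  show "orb_pullback X \<A> k U \<sigma> a z vs = \<sigma> (qchart.sub_chart a B) z vs"
  proof (cases "z \<in> cpre a U")
    case True
    show ?thesis
      using is_pullback_sub_chart[OF U is_pullback_orb_pullback[OF U \<sigma>] a B c z True]
        kforms_nonempty_tangent[OF k, of vs z] by simp
  next
    case False
    then show ?thesis
      using orb_forms_outside[OF orb_pullback_orb_forms[OF U \<sigma>] False] kforms_zero_outside[OF k, of z vs] by simp
  qed
qed

text \<open>This makes the definite description computable: the pull-back is that of any ambient
  form restricting to \<open>\<sigma>\<close>. Through it the ambient potentials reach the orbifold
  charts.\<close>

lemma orb_pullback_local:
  assumes U: "openin (utop X) U" and \<sigma>: "\<sigma> \<in> space_forms X k U"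
    and le: "local_embedding X V N \<Omega> j" and \<Theta>: "\<Theta> \<in> kforms N k \<Omega>" and r: "is_restriction X \<sigma> V j \<Theta>"
    and VU: "V \<subseteq> U" and a: "a \<in> \<A>" and z: "z \<in> cpre a V"
  shows "orb_pullback X \<A> k U \<sigma> a z = loc_form V j \<Theta> a z"
proof -
  have V: "openin (utop X) V" using local_embeddingD[OF le] by blast
  have "rst V (orb_pullback X \<A> k U \<sigma>) = loc_form V j \<Theta>"
  proof (rule orb_forms_eqI[OF V orb_forms_rst[OF V VU orb_pullback_orb_forms[OF U \<sigma>]] loc_form_orb_forms[OF le \<Theta>]])
    fix a z assume a: "a \<in> \<A>" and z: "z \<in> cpre a V" "qchart.free a z"
    obtain B where B: "open_in_C n B" "z \<in> B" "B \<subseteq> cpre a V \<inter> cdom a" "qchart.sub_chart a B \<in> reg_charts X"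
      by (rule sub_chart_is_reg[OF a z(2) pre_open[OF a V] z(1)])
    have BD: "B \<subseteq> cdom a" using B(3) by auto
    show "rst V (orb_pullback X \<A> k U \<sigma>) a z = loc_form V j \<Theta> a z"
      using orb_pullback_sub_chart[OF U \<sigma> a B(1) BD B(4,2)] loc_form_sub_chart[OF le r a B(1) BD B(4,2) z(1)] z
      by (simp add: rst_def)
  qed
  from fun_cong[OF fun_cong[OF this, of a], of z] show ?thesis using z by (simp add: rst_def)
qed

end

section \<open>Bump functions\<close>

definition flat_exp :: "real poly \<Rightarrow> real \<Rightarrow> real" where
  "flat_exp p x = (if x > 0 then poly p (inverse x) * exp (- inverse x) else 0)"

text \<open>For t = 1/x the derivative of p(t) exp(-t) with respect to x is t^2 (p - p')(t) exp(-t),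
  so the functions \<open>flat_exp p\<close> are closed under differentiation.\<close>

definition flat_step :: "real poly \<Rightarrow> real poly" where
  "flat_step p = [:0, 0, 1:] * (p - pderiv p)"

lemma poly_exp_tendsto_0: "((\<lambda>t::real. poly p t * exp (- t)) \<longlongrightarrow> 0) at_top"
proof -
  have "((\<lambda>t::real. \<Sum>i\<le>degree p. coeff p i * (t ^ i / exp t)) \<longlongrightarrow> (\<Sum>i\<le>degree p. coeff p i * 0)) at_top"
    by (intro tendsto_sum tendsto_mult tendsto_const tendsto_power_div_exp_0)
  then show ?thesis
    by (simp add: poly_altdef sum_distrib_right exp_minus divide_inverse mult.assoc)
qed

lemma flat_exp_deriv: "(flat_exp p has_real_derivative flat_exp (flat_step p) x) (at x)"
proof -
  consider "x > 0" | "x < 0" | "x = 0" by linarith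
  then show ?thesis
  proof cases
    case 1
    have "((\<lambda>x. poly p (inverse x) * exp (- inverse x)) has_real_derivative flat_exp (flat_step p) x) (at x)"
      using 1 by (auto intro!: derivative_eq_intros simp: flat_exp_def flat_step_def power2_eq_square algebra_simps)
    then show ?thesis
      by (rule has_field_derivative_transform_within_open[where S="{0<..}"]) (use 1 in \<open>auto simp: flat_exp_def\<close>)
  next
    case 2
    have "((\<lambda>x. 0) has_real_derivative flat_exp (flat_step p) x) (at x)" using 2 by (simp add: flat_exp_def)
    then show ?thesis
      by (rule has_field_derivative_transform_within_open[where S="{..<0}"]) (use 2 in \<open>auto simp: flat_exp_def\<close>)
  next
    case 3
    have "((\<lambda>h. (flat_exp p h - flat_exp p 0) / (h - 0)) \<longlongrightarrow> 0) (at 0)"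
      unfolding filterlim_at_split
    proof
      show "((\<lambda>h. (flat_exp p h - flat_exp p 0) / (h - 0)) \<longlongrightarrow> 0) (at_left 0)"
        by (rule tendsto_eventually) (auto simp: eventually_at_filter flat_exp_def)
      \<comment> \<open>Dividing by \<open>h\<close> multiplies by t = 1/h, which only changes the
        polynomial; the exponential wins as t tends to infinity.\<close>
      have "((\<lambda>h. poly ([:0, 1:] * p) (inverse h) * exp (- inverse h)) \<longlongrightarrow> (0::real)) (at_right 0)"
        by (rule filterlim_compose[OF poly_exp_tendsto_0 filterlim_inverse_at_top_right])
      then show "((\<lambda>h. (flat_exp p h - flat_exp p 0) / (h - 0)) \<longlongrightarrow> 0) (at_right 0)"
        by (rule Lim_transform_eventually) (auto simp: eventually_at_filter flat_exp_def divide_inverse)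
    qed
    then show ?thesis
      using 3 by (simp add: has_field_derivative_iff flat_exp_def)
  qed
qed

definition flat :: "real \<Rightarrow> real" where "flat = flat_exp 1"

lemma smooth_on_C_flat:
  assumes "open_in_C n D" "smooth_on_C n D f"
  shows "smooth_on_C n D (\<lambda>y. flat (f y))"
  using smooth_on_C_real_comp[OF assms, of UNIV "\<lambda>k. flat_exp ((flat_step ^^ k) 1)" 0] flat_exp_deriv
  by (simp add: flat_def)

lemma flat_pos: "x > 0 \<Longrightarrow> flat x > 0" and flat_nonneg: "flat x \<ge> 0" and flat_zero: "x \<le> 0 \<Longrightarrow> flat x = 0"
  by (auto simp: flat_def flat_exp_def)

text \<open>The squared Euclidean norm. The norm of the type is a sum of absolute values and not
  smooth; the polynomial form makes smoothness immediate.\<close>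

definition sqn :: "nat \<Rightarrow> cvec \<Rightarrow> real" where
  "sqn n y = (\<Sum>i<n. Re (coord y i) * Re (coord y i) + Im (coord y i) * Im (coord y i))"

lemma sqn_eq: "sqn n y = (\<Sum>i<n. (cmod (coord y i))\<^sup>2)"
  unfolding sqn_def cmod_power2 unfolding power2_eq_square ..

lemma smooth_on_C_sqn_comp:
  assumes D: "open_in_C n D" and F: "smooth_on_C n D F"
  shows "smooth_on_C n D (\<lambda>y. sqn m (F y))"
proof -
  have c: "smooth_on_C n D (\<lambda>y. coord (F y) i)" for i
    by (rule smooth_on_C_linear_comp[OF D bounded_linear_coord F])
  show ?thesis
    unfolding sqn_def
    by (intro smooth_on_C_sum[OF D] smooth_on_C_add[OF D] smooth_on_C_mult[OF D] smooth_on_C_Re[OF D] smooth_on_C_Im[OF D] c)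
qed

text \<open>Every coordinate is bounded by r/(n+1) and there are only n of them, so their sum, the
  norm of the type, stays strictly below \<open>r\<close>.\<close>

lemma norm_less_if_sqn_less:
  assumes y: "y \<in> cvecs n" and s: "sqn n y < (r / (real n + 1))\<^sup>2" and r: "r > 0"
  shows "norm y < r"
proof -
  have "cmod (coord y i) \<le> r / (real n + 1)" if "i < n" for i
  proof -
    have "(cmod (coord y i))\<^sup>2 \<le> sqn n y"
      unfolding sqn_eq by (rule member_le_sum[of i "{..<n}" "\<lambda>i. (cmod (coord y i))\<^sup>2"]) (use that in auto)
    then have "(cmod (coord y i))\<^sup>2 \<le> (r / (real n + 1))\<^sup>2" using s by linarith
    then show ?thesis by (rule power2_le_imp_le) (use r in auto)
  qed
  then have "norm y \<le> (\<Sum>i<n. r / (real n + 1))"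
    unfolding norm_eq_sum_coord[OF y] by (intro sum_mono) simp
  also have "\<dots> < r" using r by (simp add: field_simps)
  finally show ?thesis .
qed

section \<open>Cut-off functions on a compact orbifold\<close>

locale korb = orb +
  assumes cpt: "compact_space (utop X)"
begin

abbreviation "T \<equiv> topspace (utop X)"

lemma T_open: "openin (utop X) T" by simp

lemma regular: "regular_space (utop X)"
  using cpt space compact_Hausdorff_imp_regular_space unfolding reduced_complex_space_def by blast

lemma closed_nbhd:
  assumes W: "openin (utop X) W" "x \<in> W"
  obtains U K where "openin (utop X) U" "x \<in> U" "U \<subseteq> K" "closedin (utop X) K" "K \<subseteq> W"
proof -
  have c: "closedin (utop X) (T - W)" using W by (simp add: closedin_diff)
  have x: "x \<in> T - (T - W)" using W openin_subset[OF W(1)] by blast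
  obtain U V where UV: "openin (utop X) U" "openin (utop X) V" "x \<in> U" "T - W \<subseteq> V" "disjnt U V"
    using regular[unfolded regular_space_def, THEN spec, THEN spec, THEN mp, OF conjI[OF c x]] by blast
  show ?thesis
  proof (rule that[of U "T - V"])
    show "U \<subseteq> T - V" using UV openin_subset[OF UV(1)] by (auto simp: disjnt_def)
    show "closedin (utop X) (T - V)" using UV by (simp add: closedin_diff)
  qed (use UV in auto)
qed

lemma smooth_fun_embedding:
  assumes le: "local_embedding X V N \<Omega> j" and \<rho>: "smooth_on_C N \<Omega> \<rho>"
  shows "smooth_fun V (\<lambda>y. \<rho> (j y))"
  unfolding smooth_fun_def
proof
  fix a assume a: "a \<in> \<A>"
  note L = local_embeddingD[OF le]
  have ho: "holo_map n N (cpre a V) (\<lambda>z. j (cproj a z))"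
    using qchart.local_embedding_holo[OF ch[OF a] le] dim[OF a] by simp
  show "smooth_on_C n (cpre a V) (\<lambda>z. \<rho> (j (cproj a z)))"
    by (rule smooth_on_C_compose[OF pre_open[OF a L(1)] L(2) holo_mapD(1)[OF pre_open[OF a L(1)] ho] _ \<rho>])
       (use L(3) in \<open>auto simp: cpre_def\<close>)
qed

text \<open>The bump function is pulled back from the ambient space of a local embedding, so that its
  derivatives vanish in the directions killed by the embedding.\<close>

lemma bump:
  assumes le: "local_embedding X V N \<Omega> j" and x: "x \<in> V" and W: "openin (utop X) W" "x \<in> W"
  obtains \<beta> K \<rho> where "smooth_fun T \<beta>" "\<And>y. \<beta> y \<ge> 0" "\<beta> x > 0" "closedin (utop X) K" "K \<subseteq> W \<inter> V"
    "\<And>y. y \<notin> K \<Longrightarrow> \<beta> y = 0" "smooth_on_C N \<Omega> \<rho>" "\<And>y. y \<in> V \<Longrightarrow> \<beta> y = \<rho> (j y)"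
proof -
  note L = local_embeddingD[OF le]
  obtain U K where U: "openin (utop X) U" "x \<in> U" "U \<subseteq> K" and K: "closedin (utop X) K" "K \<subseteq> W \<inter> V"
    by (rule closed_nbhd[OF openin_Int[OF W(1) L(1)]]) (use W x that in auto)
  have hm: "homeomorphic_map (subtopology (utop X) V) (top_of_set (j ` V)) j"
    using le by (simp add: local_embedding_def)
  have UV: "U \<subseteq> V" using U K by auto
  have "openin (subtopology (utop X) V) U"
    using U(1) UV L(1) by (simp add: openin_open_subtopology)
  then have "openin (top_of_set (j ` V)) (j ` U)"
    using homeomorphic_imp_open_map[OF hm] by (simp add: open_map_def)
  then obtain r where r: "r > 0" "ball (j x) r \<inter> j ` V \<subseteq> j ` U"
    using U(2) unfolding openin_contains_ball by blast
  have inj: "inj_on j V" using homeomorphic_imp_injective_map[OF hm] openin_subset[OF L(1)] by (simp add: Int_absorb1)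
  define s where "s = (r / (real N + 1))\<^sup>2"
  have s: "s > 0" using r by (simp add: s_def)
  define \<rho> where "\<rho> y = flat (s - sqn N (y - j x))" for y
  have \<rho>: "smooth_on_C N \<Omega> \<rho>"
    unfolding \<rho>_def
    by (intro smooth_on_C_flat[OF L(2)] smooth_on_C_diff'[OF L(2)] smooth_on_C_const smooth_on_C_sqn_comp[OF L(2)]
        smooth_on_C_bounded_linear bounded_linear_ident)
  \<comment> \<open>Extension by 0 stays smooth because the function vanishes off \<open>K\<close>,
    which is closed in the whole space and contained in \<open>V\<close>.\<close>
  define \<beta> where "\<beta> y = (if y \<in> V then \<rho> (j y) else 0)" for y
  have zero: "\<beta> y = 0" if "y \<notin> K" for y
  proof (cases "y \<in> V")
    case True
    have "y \<notin> U" using that U by auto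
    then have "j y \<notin> j ` U" using inj True UV by (meson inj_on_image_mem_iff)
    moreover have "j y \<in> ball (j x) r \<inter> j ` V" if "norm (j y - j x) < r"
      using that True by (simp add: dist_norm norm_minus_commute)
    ultimately have "\<not> norm (j y - j x) < r" using r(2) by blast
    then have "\<not> sqn N (j y - j x) < s"
      using norm_less_if_sqn_less[of "j y - j x" N r] L(4)[OF True] L(4)[OF x] r by (auto simp: s_def)
    then show ?thesis using True by (simp add: \<beta>_def \<rho>_def flat_zero)
  qed (simp add: \<beta>_def)
  have "smooth_fun T \<beta>"
  proof (rule smooth_fun_local[OF T_open])
    fix y assume y: "y \<in> T"
    show "\<exists>V' h'. openin (utop X) V' \<and> y \<in> V' \<and> V' \<subseteq> T \<and> smooth_fun V' h' \<and> (\<forall>y\<in>V'. \<beta> y = h' y)"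
    proof (cases "y \<in> V")
      case True
      then show ?thesis
        using L(1) openin_subset[OF L(1)] smooth_fun_embedding[OF le \<rho>]
        by (intro exI[of _ V] exI[of _ "\<lambda>y. \<rho> (j y)"]) (auto simp: \<beta>_def)
    next
      case False
      then show ?thesis
        using K y zero smooth_fun_const[of "T - K" 0]
        by (intro exI[of _ "T - K"] exI[of _ "\<lambda>_. 0"]) auto
    qed
  qed
  moreover have "\<beta> y \<ge> 0" for y by (simp add: \<beta>_def \<rho>_def flat_nonneg)
  moreover have "\<beta> x > 0" using x s by (simp add: \<beta>_def \<rho>_def flat_pos sqn_def)
  ultimately show ?thesis using K zero \<rho> by (intro that[of \<beta> K \<rho>]) (auto simp: \<beta>_def)
qed

lemma chart_at:
  assumes "x \<in> T" obtains a z where "a \<in> \<A>" "z \<in> cdom a" "cproj a z = x"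
proof -
  have "x \<in> (\<Union>a\<in>\<A>. cimg a)" using assms cover by simp
  then obtain a z where "a \<in> \<A>" "z \<in> cdom a" "x = cproj a z" by blast
  then show thesis using that by simp
qed

lemma embedding_at:
  assumes "x \<in> T" obtains V N \<Omega> j where "x \<in> V" "local_embedding X V N \<Omega> j"
  using assms space unfolding reduced_complex_space_def by blast

text \<open>Smoothness is a condition on the charts, so openness downstairs is obtained from
  continuity on each chart and openness of the projections.\<close>

lemma positive_set_open:
  assumes "smooth_fun T h"
  shows "openin (utop X) {y \<in> T. h y > 0}"
proof -
  have "{y \<in> T. h y > 0} = (\<Union>a\<in>\<A>. cproj a ` {z \<in> cdom a. h (cproj a z) > 0})"
  proof (intro subset_antisym subsetI)
    fix x assume x: "x \<in> {y \<in> T. h y > 0}"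
    then have "x \<in> T" by simp
    then obtain a z where "a \<in> \<A>" "z \<in> cdom a" "cproj a z = x" by (rule chart_at)
    then show "x \<in> (\<Union>a\<in>\<A>. cproj a ` {z \<in> cdom a. h (cproj a z) > 0})" using x by blast
  qed (use proj_in in auto)
  moreover have "openin (utop X) (cproj a ` {z \<in> cdom a. h (cproj a z) > 0})" if a: "a \<in> \<A>" for a
  proof (rule qchart.proj_open[OF ch[OF a]])
    have c: "continuous_on (cdom a) (\<lambda>z. h (cproj a z))"
      using smooth_on_C_cont[OF smooth_funD[OF assms a]] pre_top[OF a] by simp
    have "openin (top_of_set (cdom a)) (cdom a \<inter> (\<lambda>z. h (cproj a z)) -` {0<..})"
      by (rule continuous_openin_preimage_gen[OF c]) simp
    moreover have "cdom a \<inter> (\<lambda>z. h (cproj a z)) -` {0<..} = {z \<in> cdom a. h (cproj a z) > 0}" by auto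
    ultimately show "open_in_C (cdim a) {z \<in> cdom a. h (cproj a z) > 0}"
      using qchart.dom_open[OF ch[OF a]] by (rule open_in_C_trans)
  qed auto
  ultimately show ?thesis by auto
qed

lemma finite_positive_cover:
  assumes "\<And>x. x \<in> T \<Longrightarrow> smooth_fun T (\<beta> x)" "\<And>x. x \<in> T \<Longrightarrow> \<beta> x x > 0"
  obtains I where "finite I" "I \<subseteq> T" "\<And>y. y \<in> T \<Longrightarrow> \<exists>i\<in>I. \<beta> i y > 0"
proof -
  let ?O = "\<lambda>x. {y \<in> T. \<beta> x y > 0}"
  have "\<exists>\<F>. finite \<F> \<and> \<F> \<subseteq> ?O ` T \<and> T \<subseteq> \<Union>\<F>"
    using cpt unfolding compact_space_alt
    by (rule allE[of _ "?O ` T"]) (use assms positive_set_open in auto)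
  then obtain \<F> where \<F>: "finite \<F>" "\<F> \<subseteq> ?O ` T" "T \<subseteq> \<Union>\<F>" by blast
  obtain I where I: "I \<subseteq> T" "finite I" "\<F> = ?O ` I" using finite_subset_image[OF \<F>(1,2)] by blast
  show ?thesis by (rule that[OF I(2,1)]) (use \<F>(3) I(3) in auto)
qed

text \<open>Finitely many bump functions have a positive sum by compactness, and are divided by it.
  The supports lie in sets closed in X, so that products with sections over the cover extend by
  0.\<close>

lemma partition_of_unity:
  assumes W: "\<And>x. x \<in> T \<Longrightarrow> openin (utop X) (W x) \<and> x \<in> W x"
  obtains I \<rho> K where "finite I" "I \<subseteq> T" "\<And>i. i \<in> I \<Longrightarrow> smooth_fun T (\<rho> i)"
    "\<And>i. i \<in> I \<Longrightarrow> closedin (utop X) (K i) \<and> K i \<subseteq> W i" "\<And>i y. i \<in> I \<Longrightarrow> y \<notin> K i \<Longrightarrow> \<rho> i y = (0::real)"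
    "\<And>y. y \<in> T \<Longrightarrow> (\<Sum>i\<in>I. \<rho> i y) = 1"
proof -
  have "\<exists>p. smooth_fun T (fst p) \<and> (\<forall>y. fst p y \<ge> 0) \<and> fst p x > 0 \<and> closedin (utop X) (snd p) \<and> snd p \<subseteq> W x \<and>
      (\<forall>y. y \<notin> snd p \<longrightarrow> fst p y = 0)" if x: "x \<in> T" for x
  proof -
    obtain V N \<Omega> j where V: "x \<in> V" "local_embedding X V N \<Omega> j" by (rule embedding_at[OF x])
    obtain \<beta> K \<rho> where "smooth_fun T \<beta>" "\<And>y. \<beta> y \<ge> 0" "\<beta> x > 0" "closedin (utop X) K" "K \<subseteq> W x \<inter> V"
      "\<And>y. y \<notin> K \<Longrightarrow> \<beta> y = 0"
      by (rule bump[OF V(2,1), of "W x"]) (use W[OF x] that in auto)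
    then show ?thesis by (intro exI[of _ "(\<beta>, K)"]) auto
  qed
  then obtain q where q: "\<And>x. x \<in> T \<Longrightarrow> smooth_fun T (fst (q x)) \<and> (\<forall>y. fst (q x) y \<ge> 0) \<and> fst (q x) x > 0 \<and>
      closedin (utop X) (snd (q x)) \<and> snd (q x) \<subseteq> W x \<and> (\<forall>y. y \<notin> snd (q x) \<longrightarrow> fst (q x) y = 0)"
    by metis
  define \<beta> where "\<beta> x = fst (q x)" for x
  obtain I where I: "finite I" "I \<subseteq> T" "\<And>y. y \<in> T \<Longrightarrow> \<exists>i\<in>I. \<beta> i y > 0"
    by (rule finite_positive_cover[of \<beta>]) (use q \<beta>_def that in auto)
  have \<beta>: "smooth_fun T (\<beta> i)" "\<beta> i y \<ge> 0" if "i \<in> I" for i y using q[of i] that I(2) by (auto simp: \<beta>_def)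
  define S where "S y = (\<Sum>i\<in>I. \<beta> i y)" for y
  have Spos: "S y > 0" if "y \<in> T" for y
    unfolding S_def using I(3)[OF that] \<beta>(2) I(1) by (auto intro: sum_pos2)
  have S: "smooth_fun T (\<lambda>y. inverse (S y))"
  proof (rule smooth_fun_inverse[OF T_open])
    show "smooth_fun T S" unfolding S_def by (rule smooth_fun_sum[OF T_open \<beta>(1)])
    show "S y \<noteq> 0" if "y \<in> T" for y using Spos[OF that] by simp
  qed
  show ?thesis
  proof (rule that[of I "\<lambda>i y. \<beta> i y * inverse (S y)" "\<lambda>i. snd (q i)"])
    show "smooth_fun T (\<lambda>y. \<beta> i y * inverse (S y))" if "i \<in> I" for i
      by (rule smooth_fun_mult[OF T_open \<beta>(1)[OF that] S])
    show "(\<Sum>i\<in>I. \<beta> i y * inverse (S y)) = 1" if "y \<in> T" for y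
      using Spos[OF that] by (simp add: sum_distrib_right[symmetric] S_def[symmetric])
  qed (use q I in \<open>auto simp: \<beta>_def\<close>)
qed

text \<open>A second chart is related to the first by the local holomorphic maps of
  \<open>transition\<close>, which lift the identity of X.\<close>

lemma smooth_fun_chart:
  assumes U: "openin (utop X) U" "U \<subseteq> cimg a" and a: "a \<in> \<A>" and h: "smooth_on_C n (cpre a U) (\<lambda>z. h (cproj a z))"
  shows "smooth_fun U h"
  unfolding smooth_fun_def
proof
  fix b assume b: "b \<in> \<A>"
  show "smooth_on_C n (cpre b U) (\<lambda>z. h (cproj b z))"
  proof (rule smooth_on_C_local[OF pre_open[OF b U(1)]])
    fix z assume z: "z \<in> cpre b U"
    then obtain w where w: "w \<in> cdom a" "cproj b z = cproj a w" using U(2) by (auto simp: cpre_def)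
    have zb: "z \<in> cdom b" using z by (simp add: cpre_def)
    obtain D F where DF: "open_in_C n D" "z \<in> D" "D \<subseteq> cdom b" "holo_map n n D F" "F z = w"
      "\<And>y. y \<in> D \<Longrightarrow> F y \<in> cdom a" "\<And>y. y \<in> D \<Longrightarrow> cproj a (F y) = cproj b y"
      by (rule transition[OF b a zb w]) (rule that)
    let ?E = "D \<inter> cpre b U"
    have E: "open_in_C n ?E" by (rule openin_Int[OF DF(1) pre_open[OF b U(1)]])
    have "smooth_on_C n ?E (\<lambda>y. h (cproj a (F y)))"
      by (rule smooth_on_C_compose[OF E pre_open[OF a U(1)] holo_mapD(1)[OF E holo_map_subset[OF DF(4)]] _ h])
         (use DF in \<open>auto simp: cpre_def\<close>)
    then have "smooth_on_C n ?E (\<lambda>y. h (cproj b y))"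
      by (rule smooth_on_C_cong[OF E]) (simp add: DF(7))
    then show "\<exists>E. open_in_C n E \<and> z \<in> E \<and> E \<subseteq> cpre b U \<and> smooth_on_C n E (\<lambda>z. h (cproj b z))"
      using E z DF(2) by (intro exI[of _ ?E]) auto
  qed
qed

end

section \<open>Cech cochains\<close>

lemma rst_rst: "V \<subseteq> U \<Longrightarrow> rst V (rst U \<sigma>) = rst V \<sigma>"
  using cpre_mono by (intro ext) (force simp: rst_def)

lemma rst_zero [simp]: "rst U 0 = 0"
  by (intro ext) (simp add: rst_def)

lemma meets_mono: "set ys \<subseteq> set xs \<Longrightarrow> meets U xs \<subseteq> meets U ys"
  by auto

lemma ext_d_zero: "ext_d n D (\<lambda>z vs. 0) = 0"
  by (intro ext) (simp add: ext_d_def)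

lemma total_d_bad:
  "\<not> (xs \<noteq> [] \<and> set xs \<subseteq> topspace t) \<Longrightarrow> total_d t U c xs = 0"
  by (auto simp: total_d_def fun_eq_iff)

lemma total_d_good:
  assumes "xs \<noteq> []" "set xs \<subseteq> topspace t"
  shows "total_d t U c xs a z vs = (if z \<in> cpre a (meets U xs) then
     (\<Sum>i<length xs. (-1) ^ i * c (omit i xs) a z vs)
       + (-1) ^ (length xs - 1) * ext_d (cdim a) (cpre a (meets U xs)) (c xs a) z vs else 0)"
  using assms by (auto simp: total_d_def rst_def dsec_def ext_d_def)

lemma cech_indices_iff: "xs \<in> cech_indices t m \<longleftrightarrow> xs \<noteq> [] \<and> set xs \<subseteq> topspace t \<and> length xs \<le> Suc m"
  by (simp add: cech_indices_def)

lemma cochains_mem: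
  assumes "c \<in> cochains t S m U" and xs: "xs \<in> cech_indices t m"
  shows "c xs \<in> S (m + 1 - length xs) (meets U xs)"
  using assms(1)[unfolded cochains_def mem_Collect_eq, THEN spec, of xs] unfolding if_P[OF xs] .

lemma cochains_out: "c \<in> cochains t S m U \<Longrightarrow> xs \<notin> cech_indices t m \<Longrightarrow> c xs = 0"
  by (simp add: cochains_def)

lemma cochainsI:
  assumes "\<And>xs. xs \<in> cech_indices t m \<Longrightarrow> c xs \<in> S (m + 1 - length xs) (meets U xs)"
    and "\<And>xs. xs \<notin> cech_indices t m \<Longrightarrow> c xs = 0"
  shows "c \<in> cochains t S m U"
  using assms by (simp add: cochains_def)

lemma meets_open:
  assumes "nbhd_cover t U" "xs \<noteq> []" "set xs \<subseteq> topspace t"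
  shows "openin t (meets U xs)"
proof (rule openin_Inter)
  show "openin t S" if "S \<in> U ` set xs" for S using that assms by (auto simp: nbhd_cover_def)
qed (use assms in auto)

lemma cech_meets_open: "nbhd_cover t U \<Longrightarrow> xs \<in> cech_indices t m \<Longrightarrow> openin t (meets U xs)"
  using meets_open cech_indices_iff by metis

lemma hyper_rel_2_iff:
  "((U, c), (V, c')) \<in> hyper_rel t S 2 \<longleftrightarrow> (U, c) \<in> hyper_cocycles t S 2 \<and> (V, c') \<in> hyper_cocycles t S 2 \<and>
     (\<exists>W. nbhd_cover t W \<and> (\<forall>x\<in>topspace t. W x \<subseteq> U x \<inter> V x) \<and>
        (\<exists>b\<in>cochains t S (Suc 0) W. refine W c - refine W c' = total_d t W b))"
  by (simp add: hyper_rel_def)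

lemma hyper_cocyclesD:
  assumes "(U, c) \<in> hyper_cocycles t S m"
  shows "nbhd_cover t U" "c \<in> cochains t S m U" "total_d t U c = 0"
  using assms by (auto simp: hyper_cocycles_def)

definition form_cochain :: "'a topology \<Rightarrow> 'a sec \<Rightarrow> 'a list \<Rightarrow> 'a sec" where
  "form_cochain t \<sigma> = (\<lambda>xs. if length xs = 1 \<and> set xs \<subseteq> topspace t then \<sigma> else 0)"

lemma form_hyperclass_eq: "form_hyperclass t S m \<sigma> = hyper_rel t S m `` {(\<lambda>_. topspace t, form_cochain t \<sigma>)}"
  by (simp add: form_hyperclass_def form_cochain_def)

lemma nbhd_cover_top: "nbhd_cover t (\<lambda>_. topspace t)"
  by (simp add: nbhd_cover_def)

lemma meets_top: "xs \<noteq> [] \<Longrightarrow> meets (\<lambda>_. topspace t) xs = topspace t"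
  by (cases xs) auto

lemma refine_zero [simp]: "c xs = 0 \<Longrightarrow> refine W c xs = 0"
  by (simp add: refine_def)

section \<open>Refinement and equivalence of cochains\<close>

context korb begin

abbreviation "tX \<equiv> utop X"
abbreviation "Os \<equiv> orb_forms X \<A>"

text \<open>Off the admissible indices the cochain is 0, a section in every degree, so the truncated
  subtraction in the degree does no harm and the index needs no side condition.\<close>

lemma cochain_orb:
  assumes "c \<in> cochains tX Os m U"
  shows "c xs \<in> Os (m + 1 - length xs) (meets U xs)"
  using cochains_mem[OF assms, of xs] cochains_out[OF assms, of xs] by (cases "xs \<in> cech_indices tX m") simp_all

text \<open>Every term is smooth on each chart. Hence identities between total differentials may be
  checked at free points.\<close>

lemma total_d_contsec:
  assumes c: "c \<in> cochains tX Os m U" and U: "nbhd_cover tX U" and xs: "xs \<noteq> []" "set xs \<subseteq> T"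
  shows "contsec (meets U xs) (total_d tX U c xs)"
  unfolding contsec_def
proof (intro conjI allI impI ballI)
  let ?M = "meets U xs"
  have M: "openin tX ?M" by (rule meets_open[OF U xs])
  fix a z vs
  {
    assume "a \<notin> \<A> \<or> z \<notin> cpre a ?M"
    then show "total_d tX U c xs a z vs = 0"
    proof
      assume a: "a \<notin> \<A>"
      have "c ys a = 0" for ys using orb_formsD(1)[OF cochain_orb[OF c] a] .
      then show ?thesis by (simp add: total_d_good[OF xs] ext_d_zero zero_fun_def)
    qed (simp add: total_d_good[OF xs])
  next
    assume a: "a \<in> \<A>"
    have k: "c ys a \<in> kforms n (m + 1 - length ys) (cpre a (meets U ys))" for ys
      using orb_formsD(2)[OF cochain_orb[OF c] a] dim[OF a] by simp
    have s: "smooth_on_C n (cpre a ?M) (\<lambda>z. c (omit i xs) a z vs)" for i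
      by (rule smooth_on_C_subset[OF kforms_smooth[OF k] cpre_mono[OF meets_mono[OF set_omit]]])
    have "smooth_on_C n (cpre a ?M) (\<lambda>z. (\<Sum>i<length xs. (-1) ^ i * c (omit i xs) a z vs)
       + (-1) ^ (length xs - 1) * ext_d n (cpre a ?M) (c xs a) z vs)"
      by (intro smooth_on_C_add smooth_on_C_sum smooth_on_C_mult smooth_on_C_const s pre_open[OF a M]
          ext_d_smooth[OF pre_open[OF a M] k])
    then have "continuous_on (cpre a ?M) (\<lambda>z. (\<Sum>i<length xs. (-1) ^ i * c (omit i xs) a z vs)
       + (-1) ^ (length xs - 1) * ext_d n (cpre a ?M) (c xs a) z vs)" by (rule smooth_on_C_cont)
    then show "continuous_on (cpre a ?M) (\<lambda>z. total_d tX U c xs a z vs)"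
      by (rule continuous_on_eq) (simp add: total_d_good[OF xs] dim[OF a])
  }
qed

lemma contsec_zero: "contsec U 0"
  using contsec_orb_forms[OF orb_forms_zero] .

lemma cochains_lincomb:
  assumes b: "b \<in> cochains tX Os m W" "b' \<in> cochains tX Os m W" and W: "nbhd_cover tX W"
  shows "(\<lambda>xs a z vs. x * b xs a z vs + y * b' xs a z vs) \<in> cochains tX Os m W"
proof (rule cochainsI)
  fix xs assume xs: "xs \<in> cech_indices tX m"
  show "(\<lambda>a z vs. x * b xs a z vs + y * b' xs a z vs) \<in> Os (m + 1 - length xs) (meets W xs)"
    by (rule orb_forms_lincomb[OF cech_meets_open[OF W xs] cochains_mem[OF b(1) xs] cochains_mem[OF b(2) xs]])
next
  fix xs assume "xs \<notin> cech_indices tX m"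
  then show "(\<lambda>a z vs. x * b xs a z vs + y * b' xs a z vs) = 0"
    using cochains_out[OF b(1)] cochains_out[OF b(2)] by (simp add: zero_fun_def)
qed

lemma total_d_lincomb:
  assumes b: "b \<in> cochains tX Os m W" "b' \<in> cochains tX Os m W" and W: "nbhd_cover tX W"
  shows "total_d tX W (\<lambda>xs a z vs. x * b xs a z vs + y * b' xs a z vs) =
    (\<lambda>xs a z vs. x * total_d tX W b xs a z vs + y * total_d tX W b' xs a z vs)"
proof (intro ext)
  fix xs a z vs
  show "total_d tX W (\<lambda>xs a z vs. x * b xs a z vs + y * b' xs a z vs) xs a z vs =
      x * total_d tX W b xs a z vs + y * total_d tX W b' xs a z vs"
  proof (cases "xs \<noteq> [] \<and> set xs \<subseteq> T")
    case True
    then have xs: "xs \<noteq> []" "set xs \<subseteq> T" by auto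
    have "ext_d (cdim a) (cpre a (meets W xs)) (\<lambda>z vs. x * b xs a z vs + y * b' xs a z vs) z vs =
        x * ext_d (cdim a) (cpre a (meets W xs)) (b xs a) z vs + y * ext_d (cdim a) (cpre a (meets W xs)) (b' xs a) z vs"
    proof (cases "a \<in> \<A>")
      case True
      have "ext_d n (cpre a (meets W xs)) (\<lambda>z vs. x * b xs a z vs + y * b' xs a z vs) =
          (\<lambda>z vs. x * ext_d n (cpre a (meets W xs)) (b xs a) z vs + y * ext_d n (cpre a (meets W xs)) (b' xs a) z vs)"
        by (rule ext_d_lincomb[OF pre_open[OF True meets_open[OF W xs]]])
           (use orb_formsD(2)[OF cochain_orb[OF b(1)] True] orb_formsD(2)[OF cochain_orb[OF b(2)] True] dim[OF True] in auto)
      then show ?thesis using dim[OF True] by simp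
    next
      case False
      then have "b xs a = 0" "b' xs a = 0"
        using orb_formsD(1)[OF cochain_orb[OF b(1)]] orb_formsD(1)[OF cochain_orb[OF b(2)]] by auto
      then show ?thesis by (simp add: ext_d_def)
    qed
    then show ?thesis
      by (simp add: total_d_good[OF xs] sum.distrib sum_distrib_left algebra_simps)
  next
    case False
    then show ?thesis by (simp add: total_d_bad)
  qed
qed

lemma refine_cochains:
  assumes b: "b \<in> cochains tX Os m W" and W': "nbhd_cover tX W'" and sub: "\<And>x. W' x \<subseteq> W x"
  shows "refine W' b \<in> cochains tX Os m W'"
proof (rule cochainsI)
  fix xs assume xs: "xs \<in> cech_indices tX m"
  have "meets W' xs \<subseteq> meets W xs" using sub by blast
  then show "refine W' b xs \<in> Os (m + 1 - length xs) (meets W' xs)"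
    unfolding refine_def by (rule orb_forms_rst[OF cech_meets_open[OF W' xs] _ cochains_mem[OF b xs]])
qed (simp add: cochains_out[OF b])

lemma refine_total_d:
  assumes b: "b \<in> cochains tX Os m W" and W: "nbhd_cover tX W" and W': "nbhd_cover tX W'" and sub: "\<And>x. W' x \<subseteq> W x"
  shows "refine W' (total_d tX W b) = total_d tX W' (refine W' b)"
proof (intro ext)
  fix xs a z vs
  show "refine W' (total_d tX W b) xs a z vs = total_d tX W' (refine W' b) xs a z vs"
  proof (cases "(xs \<noteq> [] \<and> set xs \<subseteq> T) \<and> z \<in> cpre a (meets W' xs)")
    case True
    then have xs: "xs \<noteq> []" "set xs \<subseteq> T" and z: "z \<in> cpre a (meets W' xs)" by auto
    have mm: "meets W' ys \<subseteq> meets W ys" for ys using sub by blast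
    have zW: "z \<in> cpre a (meets W xs)" using z cpre_mono[OF mm] by blast
    have om: "refine W' b (omit i xs) a z vs = b (omit i xs) a z vs" for i
    proof -
      have "cpre a (meets W' xs) \<subseteq> cpre a (meets W' (omit i xs))"
        by (intro cpre_mono meets_mono set_omit)
      then show ?thesis using z by (auto simp: refine_def rst_def)
    qed
    have "ext_d (cdim a) (cpre a (meets W' xs)) (refine W' b xs a) z = ext_d (cdim a) (cpre a (meets W xs)) (b xs a) z"
    proof (cases "a \<in> \<A>")
      case True
      show ?thesis
        unfolding dim[OF True]
        by (rule ext_d_at[OF pre_open[OF True meets_open[OF W' xs]] pre_open[OF True meets_open[OF W xs]] z zW])
           (simp add: refine_def rst_def)
    next
      case False
      then have "b xs a = 0" using orb_formsD(1)[OF cochain_orb[OF b]] by blast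
      moreover from this have "refine W' b xs a = 0" by (intro ext) (simp add: refine_def rst_def)
      ultimately show ?thesis by (simp add: zero_fun_def ext_d_zero)
    qed
    then show ?thesis using z zW by (simp add: total_d_good[OF xs] om refine_def[of _ "total_d tX W b"] rst_def)
  next
    case False
    then consider "\<not> (xs \<noteq> [] \<and> set xs \<subseteq> T)" | "xs \<noteq> []" "set xs \<subseteq> T" "z \<notin> cpre a (meets W' xs)" by blast
    then show ?thesis
    proof cases
      case 1
      then show ?thesis by (simp add: total_d_bad)
    next
      case 2
      then show ?thesis by (simp add: total_d_good refine_def rst_def)
    qed
  qed
qed

lemma refine_refine:
  assumes "\<And>x. W' x \<subseteq> W x"
  shows "refine W' (refine W c) = refine W' c"
proof
  fix xs
  have "meets W' xs \<subseteq> meets W xs" using assms by blast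
  then show "refine W' (refine W c) xs = refine W' c xs" by (simp add: refine_def rst_rst)
qed

lemma refine_diff: "refine W (c - c') = refine W c - refine W c'"
  by (intro ext) (simp add: refine_def rst_def)

lemma hyper_rel_sym:
  assumes "((U, c), (V, c')) \<in> hyper_rel tX Os 2"
  shows "((V, c'), (U, c)) \<in> hyper_rel tX Os 2"
proof -
  obtain W b where W: "nbhd_cover tX W" "\<forall>x\<in>T. W x \<subseteq> U x \<inter> V x" and b: "b \<in> cochains tX Os (Suc 0) W"
    and eq: "refine W c - refine W c' = total_d tX W b"
    using assms unfolding hyper_rel_2_iff by blast
  \<comment> \<open>The negative of \<open>b\<close>, in the shape of a linear combination of two
    cochains.\<close>
  let ?b = "\<lambda>xs a z vs. (-1) * b xs a z vs + 0 * b xs a z vs"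
  have "refine W c' - refine W c = - (refine W c - refine W c')" by simp
  also have "\<dots> = total_d tX W ?b"
    unfolding eq total_d_lincomb[OF b b W(1)] by (intro ext) simp
  finally have "refine W c' - refine W c = total_d tX W ?b" .
  moreover have "?b \<in> cochains tX Os (Suc 0) W" by (rule cochains_lincomb[OF b b W(1)])
  moreover have "\<forall>x\<in>T. W x \<subseteq> V x \<inter> U x" using W(2) by blast
  ultimately show ?thesis
    using W(1) assms unfolding hyper_rel_2_iff by blast
qed

text \<open>The two primitives live on different covers; both are restricted to the intersection of
  the covers and added there, since refinement commutes with the total differential.\<close>

lemma hyper_rel_trans:
  assumes 1: "((U1, c1), (U2, c2)) \<in> hyper_rel tX Os 2" and 2: "((U2, c2), (U3, c3)) \<in> hyper_rel tX Os 2"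
  shows "((U1, c1), (U3, c3)) \<in> hyper_rel tX Os 2"
proof -
  obtain W b where W: "nbhd_cover tX W" "\<forall>x\<in>T. W x \<subseteq> U1 x \<inter> U2 x" and b: "b \<in> cochains tX Os (Suc 0) W"
    and eq: "refine W c1 - refine W c2 = total_d tX W b"
    using 1 unfolding hyper_rel_2_iff by blast
  obtain W' b' where W': "nbhd_cover tX W'" "\<forall>x\<in>T. W' x \<subseteq> U2 x \<inter> U3 x" and b': "b' \<in> cochains tX Os (Suc 0) W'"
    and eq': "refine W' c2 - refine W' c3 = total_d tX W' b'"
    using 2 unfolding hyper_rel_2_iff by blast
  let ?W = "\<lambda>x. W x \<inter> W' x"
  have cov: "nbhd_cover tX ?W" using W(1) W'(1) by (auto simp: nbhd_cover_def)
  have s: "?W x \<subseteq> W x" "?W x \<subseteq> W' x" for x by auto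
  note rb = refine_cochains[OF b cov s(1)] refine_cochains[OF b' cov s(2)]
  let ?b = "\<lambda>xs a z vs. 1 * refine ?W b xs a z vs + 1 * refine ?W b' xs a z vs"
  have "refine ?W c1 - refine ?W c2 = total_d tX ?W (refine ?W b)"
    using arg_cong[OF eq, of "refine ?W"]
    by (simp only: refine_diff refine_refine[OF s(1)] refine_total_d[OF b W(1) cov s(1)])
  moreover have "refine ?W c2 - refine ?W c3 = total_d tX ?W (refine ?W b')"
    using arg_cong[OF eq', of "refine ?W"]
    by (simp only: refine_diff refine_refine[OF s(2)] refine_total_d[OF b' W'(1) cov s(2)])
  moreover have "refine ?W c1 - refine ?W c3 = (refine ?W c1 - refine ?W c2) + (refine ?W c2 - refine ?W c3)" by simp
  ultimately have "refine ?W c1 - refine ?W c3 = total_d tX ?W (refine ?W b) + total_d tX ?W (refine ?W b')" by (simp only:)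
  also have "\<dots> = total_d tX ?W ?b"
    unfolding total_d_lincomb[OF rb cov] by (intro ext) simp
  finally have "refine ?W c1 - refine ?W c3 = total_d tX ?W ?b" .
  moreover have "?b \<in> cochains tX Os (Suc 0) ?W" by (rule cochains_lincomb[OF rb cov])
  moreover have "\<forall>x\<in>T. ?W x \<subseteq> U1 x \<inter> U3 x" using W(2) W'(2) by blast
  ultimately show ?thesis
    using cov 1 2 unfolding hyper_rel_2_iff by blast
qed

section \<open>Pull-back of cochains\<close>

definition pullc :: "nat \<Rightarrow> ('a \<Rightarrow> 'a set) \<Rightarrow> ('a list \<Rightarrow> 'a sec) \<Rightarrow> 'a list \<Rightarrow> 'a sec" where
  "pullc m U c = (\<lambda>xs. if xs \<in> cech_indices tX m then orb_pullback X \<A> (m + 1 - length xs) (meets U xs) (c xs) else 0)"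

lemma pullc_cochains:
  assumes c: "c \<in> cochains tX (space_forms X) m U" and U: "nbhd_cover tX U"
  shows "pullc m U c \<in> cochains tX Os m U"
proof (rule cochainsI)
  fix xs assume xs: "xs \<in> cech_indices tX m"
  show "pullc m U c xs \<in> Os (m + 1 - length xs) (meets U xs)"
    using orb_pullback_orb_forms[OF cech_meets_open[OF U xs] cochains_mem[OF c xs]] xs by (simp add: pullc_def)
qed (simp add: pullc_def)

lemma pullc_sub_chart:
  assumes c: "c \<in> cochains tX (space_forms X) m U" and U: "nbhd_cover tX U"
    and a: "a \<in> \<A>" and B: "open_in_C n B" "B \<subseteq> cdom a" and r: "qchart.sub_chart a B \<in> reg_charts X" and z: "z \<in> B"
  shows "pullc m U c xs a z = c xs (qchart.sub_chart a B) z"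
proof (cases "xs \<in> cech_indices tX m")
  case True
  then show ?thesis
    using orb_pullback_sub_chart[OF cech_meets_open[OF U True] cochains_mem[OF c True] a B r z] by (simp add: pullc_def)
next
  case False
  then show ?thesis using cochains_out[OF c False] by (simp add: pullc_def fun_eq_iff)
qed

text \<open>The pulled back cochain coincides on all of \<open>B\<close> with the original one on
  the regular chart over \<open>B\<close>, and the exterior derivative is local. Commutation of the
  pull-back with the differential thus needs no chain rule for forms of higher degree.\<close>

lemma total_d_pullc_sub_chart:
  assumes c: "c \<in> cochains tX (space_forms X) m U" and U: "nbhd_cover tX U"
    and a: "a \<in> \<A>" and B: "open_in_C n B" "B \<subseteq> cdom a" and r: "qchart.sub_chart a B \<in> reg_charts X" and z: "z \<in> B"
  shows "total_d tX U (pullc m U c) xs a z vs = total_d tX U c xs (qchart.sub_chart a B) z vs"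
proof (cases "xs \<noteq> [] \<and> set xs \<subseteq> T")
  case True
  then have xs: "xs \<noteq> []" "set xs \<subseteq> T" by auto
  let ?r = "qchart.sub_chart a B" and ?M = "meets U xs"
  have M: "openin tX ?M" by (rule meets_open[OF U xs])
  have rM: "cpre ?r ?M = B \<inter> cpre a ?M" by (rule cpre_sub_chart[OF a B(2)])
  note P = pullc_sub_chart[OF c U a B r]
  show ?thesis
  proof (cases "z \<in> cpre a ?M")
    case z': True
    have "ext_d n (cpre a ?M) (pullc m U c xs a) z = ext_d n (B \<inter> cpre a ?M) (c xs ?r) z"
      by (rule ext_d_at[OF pre_open[OF a M] openin_Int[OF B(1) pre_open[OF a M]] z']) (use z z' P in auto)
    then show ?thesis
      using z z' by (simp add: total_d_good[OF xs] rM dim[OF a] sub_chart_sel[OF a] P[OF z])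
  qed (simp add: total_d_good[OF xs] rM)
next
  case False
  then show ?thesis by (simp add: total_d_bad)
qed

lemma pullc_cocycle:
  assumes "(U, c) \<in> hyper_cocycles tX (space_forms X) m"
  shows "(U, pullc m U c) \<in> hyper_cocycles tX Os m"
proof -
  note H = hyper_cocyclesD[OF assms]
  have "total_d tX U (pullc m U c) xs = 0" for xs
  proof (cases "xs \<noteq> [] \<and> set xs \<subseteq> T")
    case True
    then have xs: "xs \<noteq> []" "set xs \<subseteq> T" by auto
    have M: "openin tX (meets U xs)" by (rule meets_open[OF H(1) xs])
    show ?thesis
    proof (rule contsec_eqI[OF M total_d_contsec[OF pullc_cochains[OF H(2,1)] H(1) xs] contsec_zero])
      fix a z vs assume a: "a \<in> \<A>" and z: "z \<in> cpre a (meets U xs)" "qchart.free a z"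
      obtain B where B: "open_in_C n B" "z \<in> B" "B \<subseteq> cpre a (meets U xs) \<inter> cdom a" "qchart.sub_chart a B \<in> reg_charts X"
        by (rule sub_chart_is_reg[OF a z(2) pre_open[OF a M] z(1)])
      have BD: "B \<subseteq> cdom a" using B(3) by auto
      show "total_d tX U (pullc m U c) xs a z vs = 0 a z vs"
        using total_d_pullc_sub_chart[OF H(2,1) a B(1) BD B(4,2)] H(3) by simp
    qed
  qed (simp add: total_d_bad)
  then have "total_d tX U (pullc m U c) = 0" by (intro ext) simp
  then show ?thesis using H pullc_cochains[OF H(2,1)] by (simp add: hyper_cocycles_def)
qed

lemma refine_contsec:
  assumes c: "c \<in> cochains tX Os m U" and W: "nbhd_cover tX W" "\<forall>x\<in>T. W x \<subseteq> U x" and xs: "xs \<noteq> []" "set xs \<subseteq> T"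
  shows "contsec (meets W xs) (refine W c xs)"
proof -
  have "meets W xs \<subseteq> meets U xs" using W(2) xs(2) by blast
  from orb_forms_rst[OF meets_open[OF W(1) xs] this cochain_orb[OF c, of xs]]
  show ?thesis unfolding refine_def by (rule contsec_orb_forms)
qed

lemma contsec_diff:
  assumes "contsec U \<sigma>" "contsec U \<tau>" shows "contsec U (\<sigma> - \<tau>)"
  using assms unfolding contsec_def by (auto intro!: continuous_on_diff)

text \<open>Both sides of the required equation are continuous sections, and at free points they are
  the two sides of the given equation on a small regular chart.\<close>

lemma pullc_rel:
  assumes "((U, c), (V, c')) \<in> hyper_rel tX (space_forms X) 2"
  shows "((U, pullc 2 U c), (V, pullc 2 V c')) \<in> hyper_rel tX Os 2"
proof -
  obtain W b where W: "nbhd_cover tX W" "\<forall>x\<in>T. W x \<subseteq> U x \<inter> V x" and b: "b \<in> cochains tX (space_forms X) (Suc 0) W"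
    and eq: "refine W c - refine W c' = total_d tX W b"
    and cc: "(U, c) \<in> hyper_cocycles tX (space_forms X) 2" "(V, c') \<in> hyper_cocycles tX (space_forms X) 2"
    using assms unfolding hyper_rel_2_iff by blast
  note H = hyper_cocyclesD[OF cc(1)] and H' = hyper_cocyclesD[OF cc(2)]
  have WU: "\<forall>x\<in>T. W x \<subseteq> U x" "\<forall>x\<in>T. W x \<subseteq> V x" using W(2) by auto
  let ?P = "pullc 2 U c" and ?P' = "pullc 2 V c'" and ?b = "pullc (Suc 0) W b"
  note oc = pullc_cochains[OF H(2,1)] pullc_cochains[OF H'(2,1)] pullc_cochains[OF b W(1)]
  have "(refine W ?P - refine W ?P') xs = total_d tX W ?b xs" for xs
  proof (cases "xs \<noteq> [] \<and> set xs \<subseteq> T")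
    case True
    then have xs: "xs \<noteq> []" "set xs \<subseteq> T" by auto
    have M: "openin tX (meets W xs)" by (rule meets_open[OF W(1) xs])
    have cs: "contsec (meets W xs) ((refine W ?P - refine W ?P') xs)"
      using contsec_diff[OF refine_contsec[OF oc(1) W(1) WU(1) xs] refine_contsec[OF oc(2) W(1) WU(2) xs]]
      by simp
    show ?thesis
    proof (rule contsec_eqI[OF M cs total_d_contsec[OF oc(3) W(1) xs]])
      fix a z vs assume a: "a \<in> \<A>" and z: "z \<in> cpre a (meets W xs)" "qchart.free a z"
      obtain B where B: "open_in_C n B" "z \<in> B" "B \<subseteq> cpre a (meets W xs) \<inter> cdom a" "qchart.sub_chart a B \<in> reg_charts X"
        by (rule sub_chart_is_reg[OF a z(2) pre_open[OF a M] z(1)])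
      have BD: "B \<subseteq> cdom a" using B(3) by auto
      let ?r = "qchart.sub_chart a B"
      have zr: "z \<in> cpre ?r (meets W xs)" using z B(2) cpre_sub_chart[OF a BD] by simp
      have "(refine W ?P - refine W ?P') xs a z vs = (refine W c - refine W c') xs ?r z vs"
        using z(1) zr pullc_sub_chart[OF H(2,1) a B(1) BD B(4,2)] pullc_sub_chart[OF H'(2,1) a B(1) BD B(4,2)]
        by (simp add: refine_def rst_def)
      also have "\<dots> = total_d tX W ?b xs a z vs"
        unfolding eq total_d_pullc_sub_chart[OF b W(1) a B(1) BD B(4,2)] ..
      finally show "(refine W ?P - refine W ?P') xs a z vs = total_d tX W ?b xs a z vs" .
    qed
  next
    case False
    then have "?P xs = 0" "?P' xs = 0" by (auto simp: pullc_def cech_indices_iff)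
    then show ?thesis using False by (simp add: total_d_bad)
  qed
  then have "refine W ?P - refine W ?P' = total_d tX W ?b" by (intro ext) (simp only:)
  then show ?thesis
    using pullc_cocycle[OF cc(1)] pullc_cocycle[OF cc(2)] W oc(3) unfolding hyper_rel_2_iff by blast
qed

end

section \<open>Global forms in the Cech complex\<close>

lemma total_d_zero [simp]: "total_d t U 0 = 0"
  by (intro ext) (simp add: total_d_def rst_def dsec_def ext_d_def)

text \<open>On two indices the two restrictions of the same global form cancel, and on longer lists
  every term is 0; only the exterior derivative on single indices survives.\<close>

lemma total_d_form_cochain:
  "total_d t (\<lambda>_. topspace t) (form_cochain t \<sigma>) xs =
    (if length xs = 1 \<and> set xs \<subseteq> topspace t then dsec (topspace t) \<sigma> else 0)"
proof (cases "xs \<noteq> [] \<and> set xs \<subseteq> topspace t")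
  case True
  then have xs: "xs \<noteq> []" "set xs \<subseteq> topspace t" by auto
  have "length xs \<noteq> 0" using xs by simp
  then consider "length xs = Suc 0" | "length xs = Suc (Suc 0)" | "length xs > 2" by linarith
  then show ?thesis
  proof cases
    case 1
    then obtain x where "xs = [x]" by (auto simp: length_Suc_conv)
    then show ?thesis using xs by (intro ext) (simp add: total_d_good form_cochain_def dsec_def ext_d_def)
  next
    case 2
    then obtain x y where "xs = [x, y]" by (auto simp: length_Suc_conv)
    then show ?thesis using xs by (intro ext) (simp add: total_d_good form_cochain_def ext_d_def)
  next
    case 3
    have "form_cochain t \<sigma> (omit i xs) = 0" if "i < length xs" for i
    proof -
      have "length (omit i xs) \<noteq> 1" using length_omit[OF that] 3 by linarith
      then show ?thesis by (simp add: form_cochain_def)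
    qed
    moreover have "form_cochain t \<sigma> xs = 0" using 3 by (simp add: form_cochain_def)
    ultimately show ?thesis using 3 by (intro ext) (simp add: total_d_good[OF xs] ext_d_def)
  qed
qed (auto simp: total_d_bad)

context korb begin

text \<open>Membership asks for local embeddings inside \<open>U\<close> even for the zero form;
  they are borrowed from the given section.\<close>

lemma space_forms_zero:
  assumes "\<sigma> \<in> space_forms X k U"
  shows "0 \<in> space_forms X m U"
  unfolding space_forms_def
proof (intro CollectI conjI ballI)
  show "0 \<in> orb_forms X (reg_charts X) m U" by (rule orb_forms_zero)
  fix x assume "x \<in> U"
  then obtain V N \<Omega> j where "x \<in> V" "V \<subseteq> U" "local_embedding X V N \<Omega> j"
    using assms unfolding space_forms_def by blast
  moreover have "is_restriction X 0 V j (\<lambda>z vs. 0)"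
    by (simp add: is_restriction_def pull_form_def fun_eq_iff)
  ultimately show "\<exists>V N \<Omega> j \<Theta>. x \<in> V \<and> V \<subseteq> U \<and> local_embedding X V N \<Omega> j \<and>
       \<Theta> \<in> kforms N m \<Omega> \<and> is_restriction X 0 V j \<Theta>"
    using kforms_0 by blast
qed

lemma hyper_rel_refl:
  assumes c: "(U, c) \<in> hyper_cocycles tX S 2" and 0: "\<And>\<sigma> V k m. \<sigma> \<in> S k V \<Longrightarrow> 0 \<in> S m V"
  shows "((U, c), (U, c)) \<in> hyper_rel tX S 2"
proof -
  note H = hyper_cocyclesD[OF c]
  have "0 \<in> cochains tX S (Suc 0) U"
  proof (rule cochainsI)
    fix xs assume "xs \<in> cech_indices tX (Suc 0)"
    then have "xs \<in> cech_indices tX 2" by (auto simp: cech_indices_iff)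
    from 0[OF cochains_mem[OF H(2) this]]
    show "(0 :: 'a list \<Rightarrow> 'a sec) xs \<in> S (Suc 0 + 1 - length xs) (meets U xs)" by simp
  qed simp
  then show ?thesis
    using c H(1) unfolding hyper_rel_2_iff
    by (intro conjI exI[of _ U] bexI[of _ 0]) auto
qed

lemma hyper_rel_class_eq:
  assumes "(p, q) \<in> hyper_rel tX Os 2"
  shows "hyper_rel tX Os 2 `` {p} = hyper_rel tX Os 2 `` {q}"
proof -
  obtain U c V c' where pq: "p = (U, c)" "q = (V, c')" by fastforce
  show ?thesis
    using hyper_rel_trans[OF assms[unfolded pq]] hyper_rel_trans[OF hyper_rel_sym[OF assms[unfolded pq]]]
    unfolding pq by auto
qed

lemma pullc_form_cochain:
  "pullc 2 (\<lambda>_. T) (form_cochain tX \<omega>) = form_cochain tX (orb_pullback X \<A> 2 T \<omega>)"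
proof
  fix xs
  show "pullc 2 (\<lambda>_. T) (form_cochain tX \<omega>) xs = form_cochain tX (orb_pullback X \<A> 2 T \<omega>) xs"
  proof (cases "xs \<in> cech_indices tX 2")
    case True
    then have "meets (\<lambda>_. T) xs = T" by (intro meets_top) (simp add: cech_indices_iff)
    then show ?thesis
      using True orb_pullback_eq[OF T_open is_pullback_zero[OF T_open]]
      by (auto simp: pullc_def form_cochain_def cech_indices_iff)
  qed (auto simp: pullc_def form_cochain_def cech_indices_iff)
qed

text \<open>The pull-back of a class is a union over all its representatives. By
  \<open>pullc_rel\<close> each contributes the same class, so the union equals the contribution of
  the form itself.\<close>

lemma hyper_pullback_form_hyperclass:
  assumes co: "((\<lambda>_. T), form_cochain tX \<omega>) \<in> hyper_cocycles tX (space_forms X) 2"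
  shows "hyper_pullback X \<A> 2 (form_hyperclass tX (space_forms X) 2 \<omega>) =
    form_hyperclass tX Os 2 (orb_pullback X \<A> 2 T \<omega>)"
proof -
  let ?p = "(\<lambda>_. T, form_cochain tX \<omega>)" and ?R = "hyper_rel tX (space_forms X) 2"
  have "hyper_rel tX Os 2 `` {(U, pullc 2 U c)} = form_hyperclass tX Os 2 (orb_pullback X \<A> 2 T \<omega>)"
    if "(U, c) \<in> ?R `` {?p}" for U c
    using hyper_rel_class_eq[OF pullc_rel] that
    unfolding form_hyperclass_eq pullc_form_cochain[symmetric] by blast
  moreover have "?p \<in> ?R `` {?p}" using hyper_rel_refl[OF co space_forms_zero] by simp
  ultimately show ?thesis
    unfolding hyper_pullback_def form_hyperclass_eq[of _ "space_forms X"] pullc_def[symmetric] by blast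
qed

lemma rst_self: "\<sigma> \<in> Os k U \<Longrightarrow> rst U \<sigma> = \<sigma>"
  by (intro ext) (simp add: rst_def orb_forms_outside)

lemma form_cochain_cochains:
  assumes "\<sigma> \<in> Os m T" shows "form_cochain tX \<sigma> \<in> cochains tX Os m (\<lambda>_. T)"
proof (rule cochainsI)
  fix xs assume "xs \<in> cech_indices tX m"
  then have "meets (\<lambda>_. T) xs = T" by (intro meets_top) (simp add: cech_indices_iff)
  then show "form_cochain tX \<sigma> xs \<in> Os (m + 1 - length xs) (meets (\<lambda>_. T) xs)"
    using assms by (simp add: form_cochain_def)
qed (auto simp: form_cochain_def cech_indices_iff)

lemma form_cochain_cocycle:
  assumes "\<sigma> \<in> closed_sections tX Os m"
  shows "(\<lambda>_. T, form_cochain tX \<sigma>) \<in> hyper_cocycles tX Os m"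
proof -
  have "total_d tX (\<lambda>_. T) (form_cochain tX \<sigma>) = 0"
    using assms by (intro ext) (simp add: total_d_form_cochain closed_sections_def)
  then show ?thesis
    using assms form_cochain_cochains nbhd_cover_top by (simp add: hyper_cocycles_def closed_sections_def)
qed

lemma form_cochain_rel:
  assumes \<sigma>: "\<sigma> \<in> closed_sections tX Os 2" and \<tau>: "\<tau> \<in> closed_sections tX Os 2"
    and \<eta>: "\<eta> \<in> Os (Suc 0) T" "\<sigma> - \<tau> = dsec T \<eta>"
  shows "((\<lambda>_. T, form_cochain tX \<sigma>), (\<lambda>_. T, form_cochain tX \<tau>)) \<in> hyper_rel tX Os 2"
proof -
  have "(refine (\<lambda>_. T) (form_cochain tX \<sigma>) - refine (\<lambda>_. T) (form_cochain tX \<tau>)) xs =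
      total_d tX (\<lambda>_. T) (form_cochain tX \<eta>) xs" for xs
  proof (cases "length xs = 1 \<and> set xs \<subseteq> T")
    case True
    then have "meets (\<lambda>_. T) xs = T" by (intro meets_top) auto
    moreover have "rst T \<sigma> = \<sigma>" "rst T \<tau> = \<tau>"
      using \<sigma> \<tau> rst_self by (auto simp: closed_sections_def)
    ultimately show ?thesis
      unfolding total_d_form_cochain using True \<eta>(2) by (simp add: refine_def form_cochain_def)
  next
    case False
    then show ?thesis unfolding total_d_form_cochain by (auto simp: refine_def form_cochain_def)
  qed
  then have "refine (\<lambda>_. T) (form_cochain tX \<sigma>) - refine (\<lambda>_. T) (form_cochain tX \<tau>) =
      total_d tX (\<lambda>_. T) (form_cochain tX \<eta>)" by blast
  then show ?thesis
    using form_cochain_cocycle[OF \<sigma>] form_cochain_cocycle[OF \<tau>] form_cochain_cochains[OF \<eta>(1)] nbhd_cover_top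
    unfolding hyper_rel_2_iff by blast
qed

lemma total_d_at:
  assumes "total_d tX W b xs a z vs = 0" "xs \<noteq> []" "set xs \<subseteq> T" "a \<in> \<A>" "z \<in> cpre a (meets W xs)"
  shows "(\<Sum>i<length xs. (-1) ^ i * b (omit i xs) a z vs)
       + (-1) ^ (length xs - 1) * ext_d n (cpre a (meets W xs)) (b xs a) z vs = 0"
  using assms total_d_good[OF assms(2,3), of W b a z vs] dim by simp

text \<open>A primitive in the Cech complex is turned into a global one: if \<open>(\<rho>\<^sub>i)\<close> is a partition of unity
  subordinate to the cover, the sections \<open>b\<^sub>x + d(\<Sum> \<rho>\<^sub>i b\<^sub>x\<^sub>i)\<close> agree on overlaps.\<close>

lemma form_cochain_rel_imp_exact:
  assumes \<sigma>: "\<sigma> \<in> closed_sections tX Os 2" and \<tau>: "\<tau> \<in> closed_sections tX Os 2"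
    and rel: "((\<lambda>_. T, form_cochain tX \<sigma>), (\<lambda>_. T, form_cochain tX \<tau>)) \<in> hyper_rel tX Os 2"
  obtains \<eta> where "\<eta> \<in> Os (Suc 0) T" "\<sigma> - \<tau> = dsec T \<eta>"
proof -
  obtain W b where W: "nbhd_cover tX W" and b: "b \<in> cochains tX Os (Suc 0) W"
    and eq: "refine W (form_cochain tX \<sigma>) - refine W (form_cochain tX \<tau>) = total_d tX W b"
    using rel unfolding hyper_rel_2_iff by blast
  have Wx: "openin tX (W x) \<and> x \<in> W x" if "x \<in> T" for x using W that by (simp add: nbhd_cover_def)
  obtain I \<rho> K where I: "finite I" "I \<subseteq> T" and \<rho>: "\<And>i. i \<in> I \<Longrightarrow> smooth_fun T (\<rho> i)"
    and K: "\<And>i. i \<in> I \<Longrightarrow> closedin tX (K i) \<and> K i \<subseteq> W i" "\<And>i y. i \<in> I \<Longrightarrow> y \<notin> K i \<Longrightarrow> \<rho> i y = (0::real)"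
    and sum1: "\<And>y. y \<in> T \<Longrightarrow> (\<Sum>i\<in>I. \<rho> i y) = 1"
    by (rule partition_of_unity[OF Wx]) (use that in auto)
  have pT: "cproj a z \<in> T" if "a \<in> \<A>" "z \<in> cpre a U" for a z U using that proj_in by (auto simp: cpre_def)
  have b1: "b [x] \<in> Os (Suc 0) (W x)" if "x \<in> T" for x
    using cochains_mem[OF b, of "[x]"] that by (simp add: cech_indices_iff)
  have b2: "b [x, y] \<in> Os 0 (W x \<inter> W y)" if "x \<in> T" "y \<in> T" for x y
    using cochains_mem[OF b, of "[x, y]"] that by (simp add: cech_indices_iff)
  have b3: "b [x, y, z] = 0" for x y z by (rule cochains_out[OF b]) (simp add: cech_indices_iff)
  have b0: "b [] = 0" by (rule cochains_out[OF b]) (simp add: cech_indices_iff)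
  have Wo: "openin tX (W x)" if "x \<in> T" for x using Wx[OF that] by simp
  have Wxy: "openin tX (W x \<inter> W y)" if "x \<in> T" "y \<in> T" for x y by (rule openin_Int[OF Wo[OF that(1)] Wo[OF that(2)]])
  have k2: "b [x, y] a \<in> kforms n 0 (cpre a (W x \<inter> W y))" if "x \<in> T" "y \<in> T" "a \<in> \<A>" for x y a
    using orb_formsD(2)[OF b2[OF that(1,2)] that(3)] dim[OF that(3)] by simp
  have td0: "total_d tX W b xs a z vs = 0" if "length xs \<noteq> 1" for xs a z vs
  proof -
    have "total_d tX W b xs = 0"
      unfolding eq[symmetric] using that by (simp add: refine_def form_cochain_def)
    then show ?thesis by simp
  qed
  have r2: "b [y] a z vs - b [x] a z vs = ext_d n (cpre a (W x \<inter> W y)) (b [x, y] a) z vs"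
    if "x \<in> T" "y \<in> T" "a \<in> \<A>" "z \<in> cpre a (W x \<inter> W y)" for x y a z vs
    using total_d_at[OF td0, of "[x, y]" a z vs] that by simp
  have r3: "b [x, y] a z vs = b [x, i] a z vs - b [y, i] a z vs"
    if "x \<in> T" "y \<in> T" "i \<in> T" "a \<in> \<A>" "z \<in> cpre a (W x \<inter> W y \<inter> W i)" for x y i a z vs
    using total_d_at[OF td0, of "[x, y, i]" a z vs] that
    by (simp add: b3 ext_d_zero zero_fun_def numeral_3_eq_3 numeral_2_eq_2 Int_assoc)
  \<comment> \<open>The section \<open>b [x, i]\<close> exists only over the intersection of
    \<open>W x\<close> and \<open>W i\<close>; the factor \<open>\<rho> i\<close> lets the product
    extend by 0 to \<open>W x\<close>.\<close>
  define f where "f x = (\<lambda>i a z vs. \<rho> i (cproj a z) * b [x, i] a z vs)" for x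
  define F where "F x = (\<Sum>i\<in>I. f x i)" for x
  have F_app: "F x a z vs = (\<Sum>i\<in>I. \<rho> i (cproj a z) * b [x, i] a z vs)" for x a z vs
  proof -
    have "(\<Sum>i\<in>J. f x i) a z vs = (\<Sum>i\<in>J. \<rho> i (cproj a z) * b [x, i] a z vs)" for J
      by (induction J rule: infinite_finite_induct) (simp_all add: f_def)
    then show ?thesis by (simp add: F_def)
  qed
  have f: "f x i \<in> Os 0 (W x)" if x: "x \<in> T" and i: "i \<in> I" for x i
  proof (rule orb_forms_local[OF Wo[OF x]])
    have iT: "i \<in> T" using i I(2) by blast
    note bo = b2[OF x iT]
    show "f x i a = 0" if "a \<notin> \<A>" for a
      using orb_formsD(1)[OF bo that] by (intro ext) (simp add: f_def)
    show "f x i a z vs = 0" if "z \<notin> cpre a (W x)" for a z vs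
    proof -
      have "z \<notin> cpre a (W x \<inter> W i)" using that by (auto simp: cpre_def)
      then show ?thesis using orb_forms_outside[OF bo] by (simp add: f_def)
    qed
    fix y assume y: "y \<in> W x"
    show "\<exists>V \<tau>. openin tX V \<and> y \<in> V \<and> V \<subseteq> W x \<and> \<tau> \<in> Os 0 V \<and> (\<forall>a\<in>\<A>. \<forall>z\<in>cpre a V. f x i a z = \<tau> a z)"
    proof (cases "y \<in> K i")
      case True
      then have yV: "y \<in> W x \<inter> W i" using K(1)[OF i] y by blast
      have s: "smooth_fun (W x \<inter> W i) (\<rho> i)"
        by (rule smooth_fun_subset[OF \<rho>[OF i] openin_subset[OF Wxy[OF x iT]]])
      show ?thesis
        using Wxy[OF x iT] yV orb_forms_mult[OF Wxy[OF x iT] bo s]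
        by (intro exI[of _ "W x \<inter> W i"] exI[of _ "f x i"]) (simp add: f_def)
    next
      case False
      have "openin tX (W x - K i)" using Wo[OF x] K(1)[OF i] by (simp add: openin_diff)
      moreover have "\<forall>a\<in>\<A>. \<forall>z\<in>cpre a (W x - K i). f x i a z = (0 :: 'a sec) a z"
        using K(2)[OF i] by (auto simp: f_def cpre_def fun_eq_iff)
      ultimately show ?thesis using y False orb_forms_zero[of X \<A> 0 "W x - K i"] by blast
    qed
  qed
  have F: "F x \<in> Os 0 (W x)" if "x \<in> T" for x
    unfolding F_def by (rule orb_forms_sum[OF Wo[OF that] f[OF that]])
  have kF: "F x a \<in> kforms n 0 (cpre a (W x))" if "x \<in> T" "a \<in> \<A>" for x a
    using orb_formsD(2)[OF F[OF that(1)] that(2)] dim[OF that(2)] by simp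
  \<comment> \<open>The cocycle identity \<open>r3\<close> says that \<open>b [x, i]\<close> and
    \<open>b [y, i]\<close> differ by \<open>b [x, y]\<close>, which does not depend on
    \<open>i\<close>; the weights sum to 1.\<close>
  have F_diff: "F x a z vs = F y a z vs + b [x, y] a z vs"
    if xy: "x \<in> T" "y \<in> T" and a: "a \<in> \<A>" and z: "z \<in> cpre a (W x \<inter> W y)" for x y a z vs
  proof -
    have "\<rho> i (cproj a z) * b [x, i] a z vs = \<rho> i (cproj a z) * b [y, i] a z vs + \<rho> i (cproj a z) * b [x, y] a z vs"
      if i: "i \<in> I" for i
    proof (cases "\<rho> i (cproj a z) = 0")
      case False
      then have "cproj a z \<in> W i" using K[OF i] by blast
      then have "z \<in> cpre a (W x \<inter> W y \<inter> W i)" using z by (simp add: cpre_def)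
      from r3[OF xy _ a this] have "b [x, i] a z vs = b [y, i] a z vs + b [x, y] a z vs" using i I(2) by auto
      then show ?thesis by (simp add: distrib_left)
    qed simp
    then have "F x a z vs = (\<Sum>i\<in>I. \<rho> i (cproj a z) * b [y, i] a z vs + \<rho> i (cproj a z) * b [x, y] a z vs)"
      unfolding F_app by (rule sum.cong[OF refl])
    also have "\<dots> = F y a z vs + (\<Sum>i\<in>I. \<rho> i (cproj a z)) * b [x, y] a z vs"
      by (simp add: F_app sum.distrib sum_distrib_right)
    finally show ?thesis using sum1[OF pT[OF a z]] by simp
  qed
  \<comment> \<open>By \<open>r2\<close>, passing from \<open>x\<close> to \<open>y\<close> changes
    \<open>b\<close> by the exterior derivative of \<open>b [x, y]\<close>; by \<open>F_diff\<close>
    the second summand changes by the opposite amount.\<close>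
  define \<eta>0 where "\<eta>0 x = b [x] + dsec (W x) (F x)" for x
  have \<eta>0: "\<eta>0 x \<in> Os (Suc 0) (W x)" if "x \<in> T" for x
    unfolding \<eta>0_def by (rule orb_forms_add[OF Wo[OF that] b1[OF that] dsec_0_orb_forms[OF Wo[OF that] F[OF that]]])
  have \<eta>0_app: "\<eta>0 x a z vs = b [x] a z vs + ext_d n (cpre a (W x)) (F x a) z vs" if "a \<in> \<A>" for x a z vs
    by (simp add: \<eta>0_def dsec_def dim[OF that])
  have agree: "\<eta>0 x a z vs = \<eta>0 y a z vs"
    if xy: "x \<in> T" "y \<in> T" and a: "a \<in> \<A>" and z: "z \<in> cpre a (W x \<inter> W y)" for x y a z vs
  proof -
    let ?M = "cpre a (W x \<inter> W y)"
    have M: "open_in_C n ?M" by (rule pre_open[OF a Wxy[OF xy]])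
    have sub: "?M \<subseteq> cpre a (W x)" "?M \<subseteq> cpre a (W y)" by (auto simp: cpre_def)
    \<comment> \<open>Linearity of the exterior derivative is stated for forms on one domain, so
      \<open>F y\<close> is first cut down to the overlap.\<close>
    let ?G = "\<lambda>z vs. if z \<in> ?M then F y a z vs else 0"
    have G: "?G \<in> kforms n 0 ?M" by (rule kforms_restrict[OF M kF[OF xy(2) a] sub(2)])
    have "ext_d n (cpre a (W x)) (F x a) z = ext_d n ?M (\<lambda>z vs. 1 * ?G z vs + 1 * b [x, y] a z vs) z"
      by (rule ext_d_at[OF pre_open[OF a Wo[OF xy(1)]] M _ z]) (use z sub F_diff[OF xy a] in auto)
    also have "\<dots> = (\<lambda>vs. ext_d n ?M ?G z vs + ext_d n ?M (b [x, y] a) z vs)"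
      unfolding ext_d_lincomb[OF M G k2[OF xy a]] by simp
    also have "ext_d n ?M ?G z = ext_d n (cpre a (W y)) (F y a) z"
      by (rule ext_d_at[OF M pre_open[OF a Wo[OF xy(2)]] z]) (use z sub in auto)
    finally have "ext_d n (cpre a (W x)) (F x a) z vs = ext_d n (cpre a (W y)) (F y a) z vs + ext_d n ?M (b [x, y] a) z vs"
      by simp
    then show ?thesis using r2[OF xy a z, of vs] by (simp add: \<eta>0_app[OF a])
  qed
  \<comment> \<open>The cover is indexed by the points of X, so every point selects its own
    neighbourhood.\<close>
  define \<eta> where "\<eta> = (\<lambda>a z vs. if a \<in> \<A> \<and> z \<in> cdom a then \<eta>0 (cproj a z) a z vs else 0)"
  have \<eta>_eq: "\<eta> a z = \<eta>0 x a z" if x: "x \<in> T" and a: "a \<in> \<A>" and z: "z \<in> cpre a (W x)" for x a z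
  proof
    fix vs
    have y: "cproj a z \<in> T" by (rule pT[OF a z])
    have "z \<in> cpre a (W (cproj a z) \<inter> W x)" using z Wx[OF y] by (simp add: cpre_def)
    from agree[OF y x a this] show "\<eta> a z vs = \<eta>0 x a z vs" using z a by (simp add: \<eta>_def cpre_def)
  qed
  have "\<eta> \<in> Os (Suc 0) T"
  proof (rule orb_forms_local[OF T_open])
    show "\<eta> a = 0" if "a \<notin> \<A>" for a using that by (intro ext) (simp add: \<eta>_def)
    show "\<eta> a z vs = 0" if "z \<notin> cpre a T" for a z vs using that pre_top by (auto simp: \<eta>_def)
    fix x assume x: "x \<in> T"
    show "\<exists>V \<tau>. openin tX V \<and> x \<in> V \<and> V \<subseteq> T \<and> \<tau> \<in> Os (Suc 0) V \<and> (\<forall>a\<in>\<A>. \<forall>z\<in>cpre a V. \<eta> a z = \<tau> a z)"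
      using Wx[OF x] openin_subset[OF Wo[OF x]] \<eta>0[OF x] \<eta>_eq[OF x]
      by (intro exI[of _ "W x"] exI[of _ "\<eta>0 x"]) simp
  qed
  moreover have "(\<sigma> - \<tau>) a z vs = dsec T \<eta> a z vs" for a z vs
  proof (cases "a \<in> \<A> \<and> z \<in> cdom a")
    case True
    then have a: "a \<in> \<A>" and z: "z \<in> cdom a" by auto
    let ?x = "cproj a z"
    have x: "?x \<in> T" by (rule proj_in[OF a z])
    let ?P = "cpre a (W ?x)"
    have P: "open_in_C n ?P" by (rule pre_open[OF a Wo[OF x]])
    have zP: "z \<in> ?P" using z Wx[OF x] by (simp add: cpre_def)
    have k1: "b [?x] a \<in> kforms n (Suc 0) ?P" using orb_formsD(2)[OF b1[OF x] a] dim[OF a] by simp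
    have kd: "ext_d n ?P (F ?x a) \<in> kforms n (Suc 0) ?P" by (rule ext_d_0form_kforms[OF P kF[OF x a]])
    have "dsec T \<eta> a z = ext_d n (cdom a) (\<eta> a) z" by (simp add: dsec_def dim[OF a] pre_top[OF a])
    also have "\<dots> = ext_d n ?P (\<lambda>z vs. 1 * b [?x] a z vs + 1 * ext_d n ?P (F ?x a) z vs) z"
      by (rule ext_d_at[OF dom_open[OF a] P z zP]) (simp add: \<eta>_eq[OF x a] \<eta>0_app[OF a] fun_eq_iff)
    also have "\<dots> = ext_d n ?P (b [?x] a) z"
      unfolding ext_d_lincomb[OF P k1 kd] ext_d_ext_d_0form[OF P kF[OF x a]] by (simp add: fun_eq_iff)
    \<comment> \<open>The correction is itself a differential and drops out, so on single indices
      only the given equation in the total complex is left.\<close>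
    finally have "dsec T \<eta> a z vs = ext_d n ?P (b [?x] a) z vs" by simp
    also have "\<dots> = total_d tX W b [?x] a z vs"
      using zP x by (simp add: total_d_good b0 dim[OF a])
    also have "\<dots> = (\<sigma> - \<tau>) a z vs"
      unfolding eq[symmetric] using x zP by (simp add: refine_def form_cochain_def rst_def)
    finally show ?thesis ..
  next
    case False
    have s: "\<sigma> \<in> Os 2 T" "\<tau> \<in> Os 2 T" using \<sigma> \<tau> by (simp_all add: closed_sections_def)
    have "\<sigma> a z vs = 0" "\<tau> a z vs = 0" "dsec T \<eta> a z vs = 0"
      using False orb_formsD(1)[OF s(1), of a] orb_formsD(1)[OF s(2), of a] pre_top[of a]
        orb_forms_outside[OF s(1), of z a vs] orb_forms_outside[OF s(2), of z a vs]
      by (cases "a \<in> \<A>"; auto simp: dsec_def ext_d_def \<eta>_def)+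
    then show ?thesis by simp
  qed
  ultimately show ?thesis using that by blast
qed

section \<open>The natural morphism on classes of forms\<close>

lemma cohomologous_iff:
  "(\<sigma>, \<tau>) \<in> cohomologous tX Os 2 \<longleftrightarrow> \<sigma> \<in> closed_sections tX Os 2 \<and> \<tau> \<in> closed_sections tX Os 2 \<and>
    (\<exists>\<eta>\<in>Os (Suc 0) T. \<sigma> - \<tau> = dsec T \<eta>)"
  by (simp add: cohomologous_def)

text \<open>The substance is the direction from the Cech complex to global forms, which makes the
  comparison map injective on classes of closed forms. Symmetry and transitivity for global forms
  are also inherited this way from \<open>hyper_rel\<close>.\<close>

lemma cohomologous_iff_rel:
  assumes "\<sigma> \<in> closed_sections tX Os 2" "\<tau> \<in> closed_sections tX Os 2"
  shows "(\<sigma>, \<tau>) \<in> cohomologous tX Os 2 \<longleftrightarrow>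
    ((\<lambda>_. T, form_cochain tX \<sigma>), (\<lambda>_. T, form_cochain tX \<tau>)) \<in> hyper_rel tX Os 2"
proof
  assume "(\<sigma>, \<tau>) \<in> cohomologous tX Os 2"
  then obtain \<eta> where "\<eta> \<in> Os (Suc 0) T" "\<sigma> - \<tau> = dsec T \<eta>" unfolding cohomologous_iff by blast
  then show "((\<lambda>_. T, form_cochain tX \<sigma>), (\<lambda>_. T, form_cochain tX \<tau>)) \<in> hyper_rel tX Os 2"
    by (rule form_cochain_rel[OF assms])
next
  assume "((\<lambda>_. T, form_cochain tX \<sigma>), (\<lambda>_. T, form_cochain tX \<tau>)) \<in> hyper_rel tX Os 2"
  then obtain \<eta> where "\<eta> \<in> Os (Suc 0) T" "\<sigma> - \<tau> = dsec T \<eta>" by (rule form_cochain_rel_imp_exact[OF assms])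
  then show "(\<sigma>, \<tau>) \<in> cohomologous tX Os 2" unfolding cohomologous_iff using assms by blast
qed

lemma cohomologous_refl:
  assumes "\<sigma> \<in> closed_sections tX Os 2"
  shows "(\<sigma>, \<sigma>) \<in> cohomologous tX Os 2"
  unfolding cohomologous_iff_rel[OF assms assms]
  by (rule hyper_rel_refl[OF form_cochain_cocycle[OF assms]]) simp

lemma form_hyperclass_eq_imp_cohomologous:
  assumes "\<sigma> \<in> closed_sections tX Os 2" "\<tau> \<in> closed_sections tX Os 2"
    and "form_hyperclass tX Os 2 \<sigma> = form_hyperclass tX Os 2 \<tau>"
  shows "(\<sigma>, \<tau>) \<in> cohomologous tX Os 2"
proof -
  have "((\<lambda>_. T, form_cochain tX \<tau>), (\<lambda>_. T, form_cochain tX \<tau>)) \<in> hyper_rel tX Os 2"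
    using cohomologous_refl[OF assms(2)] cohomologous_iff_rel[OF assms(2,2)] by simp
  then show ?thesis
    using assms(3) unfolding cohomologous_iff_rel[OF assms(1,2)] form_hyperclass_eq by blast
qed

lemma orb_class_eq:
  assumes st: "(\<sigma>, \<tau>) \<in> cohomologous tX Os 2"
  shows "orb_class X \<A> 2 \<sigma> = orb_class X \<A> 2 \<tau>"
proof -
  have c: "\<sigma> \<in> closed_sections tX Os 2" "\<tau> \<in> closed_sections tX Os 2" using st by (simp_all add: cohomologous_iff)
  have r: "((\<lambda>_. T, form_cochain tX \<sigma>), (\<lambda>_. T, form_cochain tX \<tau>)) \<in> hyper_rel tX Os 2"
    using st cohomologous_iff_rel[OF c] by simp
  have "(\<sigma>, \<rho>) \<in> cohomologous tX Os 2 \<longleftrightarrow> (\<tau>, \<rho>) \<in> cohomologous tX Os 2" for \<rho>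
  proof (cases "\<rho> \<in> closed_sections tX Os 2")
    case True
    then show ?thesis
      using hyper_rel_class_eq[OF r] unfolding cohomologous_iff_rel[OF c(1) True] cohomologous_iff_rel[OF c(2) True]
      by blast
  qed (simp add: cohomologous_iff)
  then show ?thesis by (auto simp: orb_class_def)
qed

lemma orb_comparison_orb_class:
  assumes \<sigma>: "\<sigma> \<in> closed_sections tX Os 2"
  shows "orb_comparison X \<A> 2 (orb_class X \<A> 2 \<sigma>) = form_hyperclass tX Os 2 \<sigma>"
proof -
  have "form_hyperclass tX Os 2 \<tau> = form_hyperclass tX Os 2 \<sigma>" if "\<tau> \<in> orb_class X \<A> 2 \<sigma>" for \<tau>
  proof -
    have st: "(\<sigma>, \<tau>) \<in> cohomologous tX Os 2" using that by (simp add: orb_class_def)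
    then have "\<tau> \<in> closed_sections tX Os 2" by (simp add: cohomologous_iff)
    from hyper_rel_class_eq[OF cohomologous_iff_rel[OF \<sigma> this, THEN iffD1, OF st]]
    show ?thesis by (simp add: form_hyperclass_eq)
  qed
  moreover have "\<sigma> \<in> orb_class X \<A> 2 \<sigma>" using cohomologous_refl[OF \<sigma>] by (simp add: orb_class_def)
  ultimately show ?thesis unfolding orb_comparison_def by blast
qed

lemma orb_class_H_orb: "\<sigma> \<in> closed_sections tX Os 2 \<Longrightarrow> orb_class X \<A> 2 \<sigma> \<in> H_orb X \<A> 2"
  unfolding H_orb_def global_cohomology_def orb_class_def by (rule quotientI)

text \<open>The class of the pulled back form is one preimage under the comparison map, so the
  preimage chosen by \<open>inv_into\<close> is a genuine one; injectivity identifies the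
  two.\<close>

lemma natural_morphism_form_hyperclass:
  assumes \<kappa>: "form_hyperclass tX (space_forms X) 2 \<omega> \<in> H_dR X 2"
    and \<tau>: "orb_pullback X \<A> 2 T \<omega> \<in> closed_sections tX Os 2"
  shows "natural_morphism X \<A> 2 (form_hyperclass tX (space_forms X) 2 \<omega>) = orb_class X \<A> 2 (orb_pullback X \<A> 2 T \<omega>)"
proof -
  let ?\<tau> = "orb_pullback X \<A> 2 T \<omega>" and ?p = "(\<lambda>_. T, form_cochain tX \<omega>)"
  obtain U c where Uc: "(U, c) \<in> hyper_cocycles tX (space_forms X) 2"
    "form_hyperclass tX (space_forms X) 2 \<omega> = hyper_rel tX (space_forms X) 2 `` {(U, c)}"
    using \<kappa> unfolding H_dR_def hypercohomology_def by (auto elim!: quotientE)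
  \<comment> \<open>That the cochain of the form is a cocycle is extracted from membership in
    \<open>H_dR\<close>: a class contains its representative, which is thereby related to the
    cochain, and only cocycles are related.\<close>
  have "(U, c) \<in> hyper_rel tX (space_forms X) 2 `` {?p}"
    using hyper_rel_refl[OF Uc(1) space_forms_zero] Uc(2) by (simp add: form_hyperclass_eq)
  then have co: "?p \<in> hyper_cocycles tX (space_forms X) 2"
    unfolding Image_singleton_iff hyper_rel_2_iff by blast
  let ?h = "inv_into (H_orb X \<A> 2) (orb_comparison X \<A> 2) (form_hyperclass tX Os 2 ?\<tau>)"
  have img: "form_hyperclass tX Os 2 ?\<tau> \<in> orb_comparison X \<A> 2 ` H_orb X \<A> 2"
    using orb_comparison_orb_class[OF \<tau>] orb_class_H_orb[OF \<tau>] by (metis imageI)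
  have h: "?h \<in> H_orb X \<A> 2" "orb_comparison X \<A> 2 ?h = form_hyperclass tX Os 2 ?\<tau>"
    by (rule inv_into_into[OF img], rule f_inv_into_f[OF img])
  obtain \<sigma> where \<sigma>: "\<sigma> \<in> closed_sections tX Os 2" "?h = orb_class X \<A> 2 \<sigma>"
    using h(1) unfolding H_orb_def global_cohomology_def orb_class_def by (rule quotientE)
  have "form_hyperclass tX Os 2 \<sigma> = form_hyperclass tX Os 2 ?\<tau>"
    using orb_comparison_orb_class[OF \<sigma>(1)] h(2) \<sigma>(2) by simp
  then have "orb_class X \<A> 2 \<sigma> = orb_class X \<A> 2 ?\<tau>"
    by (rule orb_class_eq[OF form_hyperclass_eq_imp_cohomologous[OF \<sigma>(1) \<tau>]])
  then show ?thesis
    unfolding natural_morphism_def hyper_pullback_form_hyperclass[OF co] using \<sigma>(2) by simp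
qed

end

section \<open>Positivity\<close>

lemma dird_0 [simp]: "dird 0 f z = 0"
  by (simp add: dird_def)

lemma i_ddbar_at:
  assumes D: "open_in_C n D" and E: "open_in_C n E" and z: "z \<in> D" "z \<in> E"
    and \<phi>: "smooth_on_C n D \<phi>" and \<psi>: "smooth_on_C n E \<psi>" and eq: "\<And>y. y \<in> D \<Longrightarrow> y \<in> E \<Longrightarrow> \<phi> y = \<psi> y"
  shows "i_ddbar n D \<phi> z = i_ddbar n E \<psi> z"
proof
  fix vs
  have DE: "open_in_C n (D \<inter> E)" by (rule openin_Int[OF D E])
  have h: "hess \<phi> z u w = hess \<psi> z u w" if "u \<in> cvecs n" "w \<in> cvecs n" for u w
    by (rule dird_cong[OF DE _ that(1)], use z in simp, rule dird_cong[OF DE _ that(2)], simp, use eq in simp)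
  show "i_ddbar n D \<phi> z vs = i_ddbar n E \<psi> z vs"
  proof (cases "vs \<in> tangent_lists n 2")
    case True
    then obtain v w where "v \<in> cvecs n" "w \<in> cvecs n" "vs = [v, w]" by (auto simp: tangent_lists_2)
    then show ?thesis
      by (simp add: i_ddbar_hess[OF D \<phi> z(1)] i_ddbar_hess[OF E \<psi> z(2)] h)
  qed (simp add: i_ddbar_def)
qed

lemma i_ddbar_pull_at:
  assumes D: "open_in_C n D" and E: "open_in_C m E" and F: "holo_map n m D F"
    and FE: "\<And>z. z \<in> D \<Longrightarrow> F z \<in> E" and \<phi>: "smooth_on_C m E \<phi>" and z: "z \<in> D" and v: "v \<in> cvecs n"
  shows "i_ddbar n D (\<lambda>y. \<phi> (F y)) z [v, cmul \<i> v] = i_ddbar m E \<phi> (F z) [dird v F z, cmul \<i> (dird v F z)]"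
proof -
  have "i_ddbar n D (\<lambda>y. \<phi> (F y)) = pull_form n D F (i_ddbar m E \<phi>)"
    by (rule i_ddbar_pull[OF D E F FE \<phi>, symmetric])
  then show ?thesis using z v holo_mapD(4)[OF D F z v] by (simp add: pull_form_def)
qed

text \<open>The value is twice the Levi form of \<open>\<phi>\<close> in the direction dF v, which
  is positive unless that direction vanishes.\<close>

lemma smooth_strictly_psh_pull_nonneg:
  assumes D: "open_in_C n D" and E: "open_in_C m E" and F: "holo_map n m D F"
    and FE: "\<And>z. z \<in> D \<Longrightarrow> F z \<in> E" and \<phi>: "smooth_strictly_psh m E \<phi>" and z: "z \<in> D" and v: "v \<in> cvecs n"
  shows "i_ddbar n D (\<lambda>y. \<phi> (F y)) z [v, cmul \<i> v] \<ge> 0"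
    and "i_ddbar n D (\<lambda>y. \<phi> (F y)) z [v, cmul \<i> v] = 0 \<Longrightarrow> dird v F z = 0"
proof -
  have s: "smooth_on_C m E \<phi>" using \<phi> by (simp add: smooth_strictly_psh_def)
  let ?w = "dird v F z"
  have w: "?w \<in> cvecs m" by (rule holo_mapD(3)[OF D F z v])
  have eq: "i_ddbar n D (\<lambda>y. \<phi> (F y)) z [v, cmul \<i> v] = 2 * Re (levi m \<phi> (F z) ?w ?w)"
    using i_ddbar_pull_at[OF D E F FE s z v] i_ddbar_pos_eq[OF E s FE[OF z] w] Re_levi[OF E s FE[OF z] w] by simp
  have pos: "Re (levi m \<phi> (F z) ?w ?w) > 0" if "?w \<noteq> 0"
    using \<phi> FE[OF z] w that by (simp add: smooth_strictly_psh_def)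
  have "Re (levi m \<phi> (F z) ?w ?w) = 0" if "?w = 0"
    unfolding Re_levi[OF E s FE[OF z] w] by (simp add: that)
  with eq pos show "i_ddbar n D (\<lambda>y. \<phi> (F y)) z [v, cmul \<i> v] \<ge> 0"
    and "i_ddbar n D (\<lambda>y. \<phi> (F y)) z [v, cmul \<i> v] = 0 \<Longrightarrow> ?w = 0" by fastforce+
qed

lemma hess_mult:
  fixes f g :: "cvec \<Rightarrow> real"
  assumes D: "open_in_C n D" and f: "smooth_on_C n D f" and g: "smooth_on_C n D g"
    and z: "z \<in> D" and v: "v \<in> cvecs n" and w: "w \<in> cvecs n"
  shows "hess (\<lambda>y. f y * g y) z v w =
    f z * hess g z v w + dird v f z * dird w g z + dird w f z * dird v g z + hess f z v w * g z"
proof -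
  note fw = smooth_on_C_dird[OF f w] and gw = smooth_on_C_dird[OF g w]
  have "hess (\<lambda>y. f y * g y) z v w = dird v (\<lambda>y. f y * dird w g y + dird w f y * g y) z"
    by (rule dird_cong[OF D z v])
       (rule dird_bilinear[OF smooth_on_C_diff_at[OF f] smooth_on_C_diff_at[OF g] D _ w bounded_bilinear_mult])
  also have "\<dots> = dird v (\<lambda>y. f y * dird w g y) z + dird v (\<lambda>y. dird w f y * g y) z"
    by (rule dird_add[OF smooth_on_C_diff_at[OF smooth_on_C_mult[OF D f gw] z]
          smooth_on_C_diff_at[OF smooth_on_C_mult[OF D fw g] z] D z v])
  finally show ?thesis
    using dird_bilinear[OF smooth_on_C_diff_at[OF f z] smooth_on_C_diff_at[OF gw z] D z v bounded_bilinear_mult]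
      dird_bilinear[OF smooth_on_C_diff_at[OF fw z] smooth_on_C_diff_at[OF g z] D z v bounded_bilinear_mult]
    by simp
qed

lemma hess_sum:
  fixes f :: "'i \<Rightarrow> cvec \<Rightarrow> real"
  assumes D: "open_in_C n D" and f: "\<And>i. i \<in> I \<Longrightarrow> smooth_on_C n D (f i)"
    and z: "z \<in> D" and v: "v \<in> cvecs n" and w: "w \<in> cvecs n"
  shows "hess (\<lambda>y. \<Sum>i\<in>I. f i y) z v w = (\<Sum>i\<in>I. hess (f i) z v w)"
proof -
  have "hess (\<lambda>y. \<Sum>i\<in>I. f i y) z v w = dird v (\<lambda>y. \<Sum>i\<in>I. dird w (f i) y) z"
    by (rule dird_cong[OF D z v]) (rule dird_sum[OF smooth_on_C_diff_at[OF f] D _ w])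
  also have "\<dots> = (\<Sum>i\<in>I. hess (f i) z v w)"
    by (rule dird_sum[OF smooth_on_C_diff_at[OF smooth_on_C_dird[OF f w]] D z v, OF _ z])
  finally show ?thesis .
qed

lemma i_ddbar_sum_pos_eq:
  assumes D: "open_in_C n D" and f: "\<And>i. i \<in> I \<Longrightarrow> smooth_on_C n D (f i)" and z: "z \<in> D" and v: "v \<in> cvecs n"
  shows "i_ddbar n D (\<lambda>y. \<Sum>i\<in>I. f i y) z [v, cmul \<i> v] = (\<Sum>i\<in>I. i_ddbar n D (f i) z [v, cmul \<i> v])"
proof -
  have s: "smooth_on_C n D (\<lambda>y. \<Sum>i\<in>I. f i y)" by (rule smooth_on_C_sum[OF D f])
  have "hess (\<lambda>y. \<Sum>i\<in>I. f i y) z w w = (\<Sum>i\<in>I. hess (f i) z w w)" if "w \<in> cvecs n" for w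
    by (rule hess_sum[OF D f z that that])
  then show ?thesis
    unfolding i_ddbar_pos_eq[OF D s z v]
    using v by (simp add: i_ddbar_pos_eq[OF D f z v] sum.distrib flip: sum_divide_distrib)
qed

text \<open>In a direction killed by \<open>dF\<close>, all derivatives of \<open>\<rho> \<circ> F\<close> entering the Levi form of a product vanish.\<close>

lemma i_ddbar_mult_kernel:
  assumes D: "open_in_C n D" and E: "open_in_C m E" and F: "holo_map n m D F"
    and FE: "\<And>z. z \<in> D \<Longrightarrow> F z \<in> E" and \<rho>: "smooth_on_C m E \<rho>" and u: "smooth_on_C n D u"
    and z: "z \<in> D" and v: "v \<in> cvecs n" and ker: "dird v F z = 0"
  shows "i_ddbar n D (\<lambda>y. \<rho> (F y) * u y) z [v, cmul \<i> v] = \<rho> (F z) * i_ddbar n D u z [v, cmul \<i> v]"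
proof -
  note F' = holo_mapD[OF D F]
  have s: "smooth_on_C n D (\<lambda>y. \<rho> (F y))" by (rule smooth_on_C_compose[OF D E F'(1) FE \<rho>])
  have iv: "cmul \<i> v \<in> cvecs n" using v by simp
  have d: "dird w (\<lambda>y. \<rho> (F y)) z = 0" if "w \<in> cvecs n" "dird w F z = 0" for w
    using dird_compose[OF smooth_on_C_diff_at[OF F'(1) z] smooth_on_C_diff_at[OF \<rho> FE[OF z]] FE D E z that(1)] that(2) by simp
  have 1: "dird v (\<lambda>y. \<rho> (F y)) z = 0" by (rule d[OF v ker])
  have 2: "dird (cmul \<i> v) (\<lambda>y. \<rho> (F y)) z = 0"
    by (rule d[OF iv]) (simp only: F'(4)[OF z v] ker cmul_zero)
  have "i_ddbar n D (\<lambda>y. \<rho> (F y)) z [v, cmul \<i> v] = 0"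
    using i_ddbar_pull_at[OF D E F FE \<rho> z v] ker i_ddbar_pos_eq[OF E \<rho> FE[OF z] cvecs_zero]
    by simp
  \<comment> \<open>Only the sum vanishes: each Hessian by itself may contain a contribution of the
    second derivatives of \<open>F\<close>. The product formula uses only this sum, multiplied by
    \<open>u z\<close>.\<close>
  then have 3: "hess (\<lambda>y. \<rho> (F y)) z v v + hess (\<lambda>y. \<rho> (F y)) z (cmul \<i> v) (cmul \<i> v) = 0"
    unfolding i_ddbar_pos_eq[OF D s z v] by simp
  have "hess (\<lambda>y. \<rho> (F y)) z v v * u z + hess (\<lambda>y. \<rho> (F y)) z (cmul \<i> v) (cmul \<i> v) * u z = 0"
    using 3 by (simp flip: distrib_right)
  then show ?thesis
    unfolding i_ddbar_pos_eq[OF D smooth_on_C_mult[OF D s u] z v] i_ddbar_pos_eq[OF D u z v]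
      hess_mult[OF D s u z v v] hess_mult[OF D s u z iv iv] 1 2
    by (simp add: algebra_simps add_divide_distrib)
qed

section \<open>The squared norm as a potential\<close>

lemma sqn_rcoord: "sqn n y = (\<Sum>k<2*n. rcoord k y * rcoord k y)"
  unfolding sum_double by (simp add: sqn_def rcoord_def)

lemma sqn_nonneg: "sqn n y \<ge> 0"
  by (simp add: sqn_eq sum_nonneg)

lemma sqn_pos:
  assumes "v \<in> cvecs n" "v \<noteq> 0" shows "sqn n v > 0"
proof (rule ccontr)
  assume "\<not> sqn n v > 0"
  then have "sqn n v = 0" using sqn_nonneg[of n v] by linarith
  then have "\<forall>i<n. coord v i = 0" by (simp add: sqn_eq sum_nonneg_eq_0_iff)
  then have "v = 0" by (intro cvec_eqI_on[OF assms(1)]) auto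
  with assms show False by simp
qed

lemma smooth_on_C_sqn: "open_in_C n D \<Longrightarrow> smooth_on_C n D (sqn m)"
  using smooth_on_C_sqn_comp[of n D "\<lambda>y. y" m] smooth_on_C_bounded_linear[OF bounded_linear_ident] by simp

lemma i_ddbar_sqn_pos:
  assumes D: "open_in_C n D" and z: "z \<in> D" and v: "v \<in> cvecs n" "v \<noteq> 0"
  shows "i_ddbar n D (sqn n) z [v, cmul \<i> v] > 0"
proof -
  have h: "hess (sqn n) z w w = 2 * sqn n w" if w: "w \<in> cvecs n" for w
  proof -
    have r: "smooth_on_C n D (rcoord k)" for k by (rule smooth_on_C_bounded_linear[OF bounded_linear_rcoord])
    have d: "dird w (rcoord k) y = rcoord k w" for k y by (rule dird_bounded_linear[OF bounded_linear_rcoord])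
    have "hess (rcoord k) z w w = 0" for k
    proof -
      have "dird w (rcoord k) = (\<lambda>_. rcoord k w)" using d by blast
      then show ?thesis by simp
    qed
    then have "hess (\<lambda>y. rcoord k y * rcoord k y) z w w = 2 * (rcoord k w * rcoord k w)" for k
      unfolding hess_mult[OF D r r z w w] d by simp
    then have "hess (\<lambda>y. \<Sum>k<2*n. rcoord k y * rcoord k y) z w w = (\<Sum>k<2*n. 2 * (rcoord k w * rcoord k w))"
      by (subst hess_sum[OF D smooth_on_C_mult[OF D r r] z w w]) simp_all
    moreover have "sqn n = (\<lambda>y. \<Sum>k<2*n. rcoord k y * rcoord k y)" using sqn_rcoord by blast
    ultimately show ?thesis by (simp add: sum_distrib_left)
  qed
  have "i_ddbar n D (sqn n) z [v, cmul \<i> v] = sqn n v + sqn n (cmul \<i> v)"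
    unfolding i_ddbar_pos_eq[OF D smooth_on_C_sqn[OF D] z v(1)] using h v by simp
  then show ?thesis using sqn_pos[OF v] sqn_nonneg[of n "cmul \<i> v"] by linarith
qed

section \<open>Compactness in points and directions\<close>

lemma kforms_2_expand:
  assumes \<omega>: "\<omega> \<in> kforms n 2 D" and z: "z \<in> D" and v: "v \<in> cvecs n" and w: "w \<in> cvecs n"
  shows "\<omega> z [v, w] = (\<Sum>k<2*n. \<Sum>l<2*n. rcoord k v * (rcoord l w * \<omega> z [rbasis k, rbasis l]))"
proof -
  note a = kforms_alternating[OF \<omega> z]
  have "\<omega> z [v, w] = \<omega> z ([] @ (\<Sum>k<2*n. rcoord k v *\<^sub>R rbasis k) # [w])"
    using rbasis_expand[OF v] by simp
  also have "\<dots> = (\<Sum>k<2*n. rcoord k v * \<omega> z ([] @ rbasis k # [w]))"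
    by (rule alternating_multilinear_sum[OF a]) (use w in auto)
  also have "\<dots> = (\<Sum>k<2*n. rcoord k v * (\<Sum>l<2*n. rcoord l w * \<omega> z [rbasis k, rbasis l]))"
  proof (rule sum.cong[OF refl])
    fix k assume k: "k \<in> {..<2*n}"
    have "\<omega> z ([rbasis k] @ (\<Sum>l<2*n. rcoord l w *\<^sub>R rbasis l) # []) = (\<Sum>l<2*n. rcoord l w * \<omega> z ([rbasis k] @ rbasis l # []))"
      by (rule alternating_multilinear_sum[OF a]) (use k in auto)
    then show "rcoord k v * \<omega> z ([] @ rbasis k # [w]) = rcoord k v * (\<Sum>l<2*n. rcoord l w * \<omega> z [rbasis k, rbasis l])"
      using rbasis_expand[OF w] by simp
  qed
  finally show ?thesis by (simp add: sum_distrib_left)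
qed

text \<open>A form is smooth in the point for fixed vectors. Expansion of both vectors in the real
  basis gives joint continuity in point and direction.\<close>

lemma continuous_on_kforms_2:
  assumes \<omega>: "\<omega> \<in> kforms n 2 D"
  shows "continuous_on (D \<times> cvecs n) (\<lambda>p. \<omega> (fst p) [snd p, cmul \<i> (snd p)])"
proof (rule continuous_on_eq)
  have c: "continuous_on (D \<times> cvecs n) (\<lambda>p. \<omega> (fst p) vs)" for vs
    by (rule continuous_on_compose2[OF smooth_on_C_cont[OF kforms_smooth[OF \<omega>]]]) (auto intro: continuous_intros)
  show "continuous_on (D \<times> cvecs n) (\<lambda>p. \<Sum>k<2*n. \<Sum>l<2*n. rcoord k (snd p) * (rcoord l (cmul \<i> (snd p)) * \<omega> (fst p) [rbasis k, rbasis l]))"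
    by (intro continuous_on_sum continuous_on_mult c
        bounded_linear.continuous_on[OF bounded_linear_rcoord] bounded_linear.continuous_on[OF bounded_linear_cmul]
        continuous_on_snd continuous_on_id)
  show "(\<Sum>k<2*n. \<Sum>l<2*n. rcoord k (snd p) * (rcoord l (cmul \<i> (snd p)) * \<omega> (fst p) [rbasis k, rbasis l])) =
      \<omega> (fst p) [snd p, cmul \<i> (snd p)]" if "p \<in> D \<times> cvecs n" for p
    using that by (intro kforms_2_expand[OF \<omega>, symmetric]) auto
qed

text \<open>Quadratic dependence on the direction reduces positivity to unit vectors, a compact
  set.\<close>

lemma kforms_2_scaleR:
  assumes \<omega>: "\<omega> \<in> kforms n 2 D" and z: "z \<in> D" and v: "v \<in> cvecs n"
  shows "\<omega> z [c *\<^sub>R v, cmul \<i> (c *\<^sub>R v)] = c\<^sup>2 * \<omega> z [v, cmul \<i> v]"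
proof -
  have "cmul \<i> v \<in> cvecs n" "c *\<^sub>R v \<in> cvecs n" "cmul \<i> (c *\<^sub>R v) \<in> cvecs n" using v by simp_all
  then show ?thesis
    using linear_cmul[OF bounded_linear.linear[OF bounded_linear_rcoord]]
    unfolding kforms_2_expand[OF \<omega> z \<open>c *\<^sub>R v \<in> cvecs n\<close> \<open>cmul \<i> (c *\<^sub>R v) \<in> cvecs n\<close>] kforms_2_expand[OF \<omega> z v \<open>cmul \<i> v \<in> cvecs n\<close>]
    by (simp add: cmul_scaleR sum_distrib_left power2_eq_square mult_ac)
qed

text \<open>Only points with \<open>q1 x \<le> 0\<close> can cause trouble. They form a compact set
  on which \<open>q0\<close> has no zero, hence a positive minimum, while \<open>q1\<close> is
  bounded below. The bound holds for all smaller \<open>d\<close> too, so that finitely many such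
  estimates can be combined.\<close>

lemma compact_small_perturbation:
  fixes q0 q1 :: "'b::topological_space \<Rightarrow> real"
  assumes C: "compact C" and q: "continuous_on C q0" "continuous_on C q1"
    and nn: "\<And>x. x \<in> C \<Longrightarrow> q0 x \<ge> 0" and pos: "\<And>x. x \<in> C \<Longrightarrow> q0 x = 0 \<Longrightarrow> q1 x > 0"
  obtains e where "e > 0" "\<And>d x. 0 < d \<Longrightarrow> d \<le> e \<Longrightarrow> x \<in> C \<Longrightarrow> q0 x + d * q1 x > 0"
proof -
  let ?B = "{x \<in> C. q1 x \<le> 0}"
  have B: "compact ?B"
  proof -
    obtain S where S: "closed S" "S \<inter> C = C \<inter> q1 -` {..0}"
      using q(2) unfolding continuous_on_closed_invariant by (metis closed_atMost inf_commute)
    have "?B = C \<inter> S" using S(2) by blast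
    then show ?thesis using compact_Int_closed[OF C S(1)] by simp
  qed
  show ?thesis
  proof (cases "?B = {}")
    case True
    show ?thesis
    proof (rule that[of 1])
      fix d x assume "(0::real) < d" "x \<in> C"
      moreover have "q1 x > 0" using \<open>x \<in> C\<close> True by force
      ultimately show "q0 x + d * q1 x > 0" using nn[of x] by (simp add: add_nonneg_pos)
    qed simp
  next
    case False
    have sub: "?B \<subseteq> C" by auto
    obtain a where a: "a \<in> ?B" "\<And>y. y \<in> ?B \<Longrightarrow> q0 a \<le> q0 y"
      using continuous_attains_inf[OF B False continuous_on_subset[OF q(1) sub]] by blast
    obtain b where b: "b \<in> ?B" "\<And>y. y \<in> ?B \<Longrightarrow> q1 b \<le> q1 y"
      using continuous_attains_inf[OF B False continuous_on_subset[OF q(2) sub]] by blast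
    have m: "q0 a > 0" using a(1) nn[of a] pos[of a] by force
    \<comment> \<open>The minimum of \<open>q0\<close> divided by one plus the largest size of
      \<open>q1\<close> on the bad set; the 1 makes the denominator positive and the final
      inequality strict.\<close>
    define e where "e = q0 a / (1 - q1 b)"
    have b0: "q1 b \<le> 0" using b(1) by simp
    show ?thesis
    proof (rule that[of e])
      show "e > 0" using m b0 by (simp add: e_def)
      fix d x assume d: "0 < d" "d \<le> e" and x: "x \<in> C"
      show "q0 x + d * q1 x > 0"
      proof (cases "q1 x > 0")
        case True
        then show ?thesis using nn[OF x] d by (simp add: add_nonneg_pos)
      next
        case False
        then have xB: "x \<in> ?B" using x by simp
        have "d * (- q1 x) \<le> e * (- q1 b)"
          by (rule mult_mono) (use d b(2)[OF xB] xB in auto)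
        also have "\<dots> < e * (1 - q1 b)" using d by (simp add: right_diff_distrib)
        also have "\<dots> = q0 a" using b0 by (simp add: e_def)
        finally show ?thesis using a(2)[OF xB] by simp
      qed
    qed
  qed
qed

text \<open>Right multiplication by \<open>h\<close> permutes the finite group. Composition is taken
  in the extensional sense, to stay inside the group.\<close>

lemma (in qchart) sum_sqn_invariant:
  assumes h: "h \<in> G" and z: "z \<in> D"
  shows "(\<Sum>g\<in>G. sqn n (g (h z))) = (\<Sum>g\<in>G. sqn n (g z))"
proof -
  let ?r = "\<lambda>g. compose (cvecs n) g h"
  have hB: "h \<in> Bij (cvecs n)" using subgroup.subset[OF grp] h by (auto simp: BijGroup_def)
  have "?r g \<in> G" if g: "g \<in> G" for g
  proof -
    have gB: "g \<in> Bij (cvecs n)" using subgroup.subset[OF grp] g by (auto simp: BijGroup_def)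
    show ?thesis using subgroup.m_closed[OF grp g h] gB hB by (simp add: BijGroup_def)
  qed
  then have sub: "?r ` G \<subseteq> G" by blast
  have inj: "inj_on ?r G"
  proof (rule inj_onI)
    fix g g' assume g: "g \<in> G" "g' \<in> G" and eq: "?r g = ?r g'"
    show "g = g'"
    proof (rule extensionalityI[OF g_ext[OF g(1)] g_ext[OF g(2)]])
      fix x assume x: "x \<in> cvecs n"
      then obtain y where y: "y \<in> cvecs n" "x = h y" using g_bij[OF h] by (auto simp: bij_betw_def)
      show "g x = g' x" using fun_cong[OF eq, of y] y by (simp add: compose_def)
    qed
  qed
  have img: "?r ` G = G" by (rule endo_inj_surj[OF fin sub inj])
  have "(\<Sum>g\<in>G. sqn n (g z)) = (\<Sum>g\<in>G. sqn n (?r g z))"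
    using sum.reindex[OF inj, of "\<lambda>g. sqn n (g z)"] unfolding img by simp
  then show ?thesis using dom_sub[OF z] by (simp add: compose_def)
qed

section \<open>Forms with local potentials\<close>

context korb begin

text \<open>The potential is a function on X, the same for all charts over \<open>V\<close>. Both
  the pulled back Kaehler form and its perturbation are of this kind, and closedness, type and
  transformation rules are proved for both through it.\<close>

definition locally_ddbar :: "'a sec \<Rightarrow> bool" where
  "locally_ddbar \<sigma> \<longleftrightarrow> (\<forall>x\<in>T. \<exists>V h. openin tX V \<and> x \<in> V \<and> smooth_fun V h \<and>
     (\<forall>a\<in>\<A>. \<forall>z\<in>cpre a V. \<sigma> a z = i_ddbar n (cpre a V) (\<lambda>z. h (cproj a z)) z))"

lemma locally_ddbarD:
  assumes "locally_ddbar \<sigma>" "a \<in> \<A>" "z \<in> cdom a"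
  obtains V h where "openin tX V" "z \<in> cpre a V" "smooth_fun V h"
    "\<And>b y. b \<in> \<A> \<Longrightarrow> y \<in> cpre b V \<Longrightarrow> \<sigma> b y = i_ddbar n (cpre b V) (\<lambda>z. h (cproj b z)) y"
proof -
  have "cproj a z \<in> T" by (rule proj_in[OF assms(2,3)])
  then obtain V h where "openin tX V" "cproj a z \<in> V" "smooth_fun V h"
    "\<forall>a\<in>\<A>. \<forall>z\<in>cpre a V. \<sigma> a z = i_ddbar n (cpre a V) (\<lambda>z. h (cproj a z)) z"
    using assms(1) unfolding locally_ddbar_def by blast
  then show ?thesis using assms(3) by (intro that[of V h]) (auto simp: cpre_def)
qed

lemma locally_ddbar_ddbar_sec: "smooth_fun T h \<Longrightarrow> locally_ddbar (ddbar_sec T h)"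
  unfolding locally_ddbar_def by (intro ballI exI[of _ T] exI[of _ h]) (simp add: ddbar_sec_def)

lemma locally_ddbar_closed:
  assumes \<sigma>: "locally_ddbar \<sigma>" and a: "a \<in> \<A>"
  shows "ext_d n (cdom a) (\<sigma> a) = 0"
proof (intro ext)
  fix z vs
  show "ext_d n (cdom a) (\<sigma> a) z vs = 0 z vs"
  proof (cases "z \<in> cdom a")
    case True
    obtain V h where V: "openin tX V" "z \<in> cpre a V" "smooth_fun V h"
      "\<And>b y. b \<in> \<A> \<Longrightarrow> y \<in> cpre b V \<Longrightarrow> \<sigma> b y = i_ddbar n (cpre b V) (\<lambda>z. h (cproj b z)) y"
      by (rule locally_ddbarD[OF \<sigma> a True]) (rule that)
    note P = pre_open[OF a V(1)]
    have "ext_d n (cdom a) (\<sigma> a) z = ext_d n (cpre a V) (i_ddbar n (cpre a V) (\<lambda>z. h (cproj a z))) z"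
      by (rule ext_d_at[OF dom_open[OF a] P True V(2)]) (rule V(4)[OF a])
    then show ?thesis by (simp add: ext_d_i_ddbar[OF P smooth_funD[OF V(3) a]])
  qed (simp add: ext_d_def)
qed

lemma locally_ddbar_type_1_1:
  assumes \<sigma>: "locally_ddbar \<sigma>" and a: "a \<in> \<A>"
  shows "type_1_1 n (cdom a) (\<sigma> a)"
  unfolding type_1_1_def
proof (intro ballI)
  fix z v w assume z: "z \<in> cdom a" and vw: "v \<in> cvecs n" "w \<in> cvecs n"
  obtain V h where V: "openin tX V" "z \<in> cpre a V" "smooth_fun V h"
    "\<And>b y. b \<in> \<A> \<Longrightarrow> y \<in> cpre b V \<Longrightarrow> \<sigma> b y = i_ddbar n (cpre b V) (\<lambda>z. h (cproj b z)) y"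
    by (rule locally_ddbarD[OF \<sigma> a z]) (rule that)
  show "\<sigma> a z [cmul \<i> v, cmul \<i> w] = \<sigma> a z [v, w]"
    using i_ddbar_type_1_1[OF pre_open[OF a V(1)] smooth_funD[OF V(3) a]] V(2) vw
    unfolding V(4)[OF a V(2)] type_1_1_def by blast
qed

text \<open>Compatibility of orbifold forms is a condition on chart embeddings, whereas the maps of
  \<open>transition\<close> are not presented as such. The common potential transforms under any
  holomorphic map that lifts the identity of X.\<close>

lemma locally_ddbar_transition:
  assumes \<sigma>: "locally_ddbar \<sigma>" and ab: "a \<in> \<A>" "b \<in> \<A>"
    and D: "open_in_C n D" "z \<in> D" "D \<subseteq> cdom b" and F: "holo_map n n D F"
    and Fa: "\<And>y. y \<in> D \<Longrightarrow> F y \<in> cdom a" "\<And>y. y \<in> D \<Longrightarrow> cproj a (F y) = cproj b y"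
    and v: "v \<in> cvecs n"
  shows "\<sigma> b z [v, cmul \<i> v] = \<sigma> a (F z) [dird v F z, cmul \<i> (dird v F z)]"
proof -
  have zb: "z \<in> cdom b" using D by blast
  obtain V h where V: "openin tX V" "z \<in> cpre b V" "smooth_fun V h"
    "\<And>b y. b \<in> \<A> \<Longrightarrow> y \<in> cpre b V \<Longrightarrow> \<sigma> b y = i_ddbar n (cpre b V) (\<lambda>z. h (cproj b z)) y"
    by (rule locally_ddbarD[OF \<sigma> ab(2) zb]) (rule that)
  let ?E = "D \<inter> cpre b V"
  have E: "open_in_C n ?E" by (rule openin_Int[OF D(1) pre_open[OF ab(2) V(1)]])
  have FE: "F y \<in> cpre a V" if "y \<in> ?E" for y using that Fa by (auto simp: cpre_def)
  have hF: "holo_map n n ?E F" by (rule holo_map_subset[OF F]) simp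
  note Pa = pre_open[OF ab(1) V(1)] and Pb = pre_open[OF ab(2) V(1)]
  note ha = smooth_funD[OF V(3) ab(1)] and hb = smooth_funD[OF V(3) ab(2)]
  have zE: "z \<in> ?E" using D V(2) by simp
  have s: "smooth_on_C n ?E (\<lambda>y. h (cproj a (F y)))"
    by (rule smooth_on_C_compose[OF E Pa holo_mapD(1)[OF E hF] FE ha])
  have "\<sigma> b z [v, cmul \<i> v] = i_ddbar n (cpre b V) (\<lambda>z. h (cproj b z)) z [v, cmul \<i> v]" using V(4)[OF ab(2) V(2)] by simp
  also have "i_ddbar n (cpre b V) (\<lambda>z. h (cproj b z)) z = i_ddbar n ?E (\<lambda>y. h (cproj a (F y))) z"
    by (rule i_ddbar_at[OF Pb E V(2) zE hb s]) (simp add: Fa(2))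
  also have "\<dots> [v, cmul \<i> v] = i_ddbar n (cpre a V) (\<lambda>z. h (cproj a z)) (F z) [dird v F z, cmul \<i> (dird v F z)]"
    by (rule i_ddbar_pull_at[OF E Pa hF FE ha zE v])
  also have "\<dots> = \<sigma> a (F z) [dird v F z, cmul \<i> (dird v F z)]" using V(4)[OF ab(1) FE[OF zE]] by simp
  finally show ?thesis .
qed

text \<open>The estimate must hold in all charts over \<open>U\<close>, possibly infinitely many. It
  is obtained by compactness in a single chart and carried over to the others by
  \<open>transition\<close>, whose injective differential keeps directions nonzero; homogeneity
  makes the size of the new direction irrelevant.\<close>

lemma small_perturbation_near:
  assumes \<sigma>: "\<sigma> \<in> Os 2 T" "locally_ddbar \<sigma>" and \<tau>: "\<tau> \<in> Os 2 T" "locally_ddbar \<tau>"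
    and nn: "\<And>a z v. a \<in> \<A> \<Longrightarrow> z \<in> cdom a \<Longrightarrow> v \<in> cvecs n \<Longrightarrow> v \<noteq> 0 \<Longrightarrow> \<sigma> a z [v, cmul \<i> v] \<ge> 0"
    and pos: "\<And>a z v. a \<in> \<A> \<Longrightarrow> z \<in> cdom a \<Longrightarrow> v \<in> cvecs n \<Longrightarrow> v \<noteq> 0 \<Longrightarrow> \<sigma> a z [v, cmul \<i> v] = 0 \<Longrightarrow> \<tau> a z [v, cmul \<i> v] > 0"
    and x: "x \<in> T"
  obtains U e where "openin tX U" "x \<in> U" "e > 0"
    "\<And>d a z v. 0 < d \<Longrightarrow> d \<le> e \<Longrightarrow> a \<in> \<A> \<Longrightarrow> z \<in> cpre a U \<Longrightarrow> v \<in> cvecs n \<Longrightarrow> v \<noteq> 0 \<Longrightarrow>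
      \<sigma> a z [v, cmul \<i> v] + d * \<tau> a z [v, cmul \<i> v] > 0"
proof -
  obtain a z0 where a: "a \<in> \<A>" and z0: "z0 \<in> cdom a" "cproj a z0 = x" by (rule chart_at[OF x])
  interpret A: qchart X a by (rule ch[OF a])
  obtain r where r: "r > 0" "ball z0 r \<inter> cvecs n \<subseteq> cdom a" by (rule open_in_C_ball_sub[OF dom_open[OF a] z0(1)])
  have z0n: "z0 \<in> cvecs n" using z0(1) dom_open[OF a] open_in_C_subset by blast
  \<comment> \<open>Half the radius puts the closed ball inside the chart; times the unit sphere of
    directions it is the compact set of the estimate.\<close>
  define B where "B = cball z0 (r/2) \<inter> cvecs n"
  define S where "S = {v \<in> cvecs n. norm v = 1}"
  have Bsub: "B \<subseteq> cdom a" using r by (auto simp: B_def)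
  have S0: "v \<in> cvecs n" "v \<noteq> 0" if "v \<in> S" for v using that by (auto simp: S_def)
  have "compact B"
  proof -
    have "cball z0 (r/2) \<subseteq> {z. norm z \<le> norm z0 + r/2}"
    proof
      fix z assume "z \<in> cball z0 (r/2)"
      then have "norm (z - z0) \<le> r/2" by (simp add: dist_norm norm_minus_commute)
      then show "z \<in> {z. norm z \<le> norm z0 + r/2}" using norm_triangle_sub[of z z0] by simp
    qed
    then have "B = {z \<in> cvecs n. norm z \<le> norm z0 + r/2} \<inter> cball z0 (r/2)" by (auto simp: B_def)
    then show ?thesis using compact_Int_closed[OF compact_cvecs_ball closed_cball] by simp
  qed
  then have C: "compact (B \<times> S)" unfolding S_def by (rule compact_Times[OF _ compact_cvecs_sphere])
  have k: "\<sigma> a \<in> kforms n 2 (cdom a)" "\<tau> a \<in> kforms n 2 (cdom a)"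
    using orb_formsD(2)[OF \<sigma>(1) a] orb_formsD(2)[OF \<tau>(1) a] dim[OF a] pre_top[OF a] by simp_all
  have sub: "B \<times> S \<subseteq> cdom a \<times> cvecs n" using Bsub S0 by auto
  obtain e where e: "e > 0" "\<And>d p. 0 < d \<Longrightarrow> d \<le> e \<Longrightarrow> p \<in> B \<times> S \<Longrightarrow>
      \<sigma> a (fst p) [snd p, cmul \<i> (snd p)] + d * \<tau> a (fst p) [snd p, cmul \<i> (snd p)] > 0"
  proof (rule compact_small_perturbation[OF C continuous_on_subset[OF continuous_on_kforms_2[OF k(1)] sub]
        continuous_on_subset[OF continuous_on_kforms_2[OF k(2)] sub]])
    fix p assume p: "p \<in> B \<times> S"
    then have f: "fst p \<in> cdom a" "snd p \<in> cvecs n" "snd p \<noteq> 0" using Bsub S0 by auto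
    show "\<sigma> a (fst p) [snd p, cmul \<i> (snd p)] \<ge> 0" by (rule nn[OF a f])
    show "\<sigma> a (fst p) [snd p, cmul \<i> (snd p)] = 0 \<Longrightarrow> \<tau> a (fst p) [snd p, cmul \<i> (snd p)] > 0" by (rule pos[OF a f])
  qed (rule that)
  have main: "\<sigma> a w [v, cmul \<i> v] + d * \<tau> a w [v, cmul \<i> v] > 0"
    if d: "0 < d" "d \<le> e" and w: "w \<in> B" and v: "v \<in> cvecs n" "v \<noteq> 0" for d w v
  proof -
    define s where "s = (1 / norm v) *\<^sub>R v"
    have s: "s \<in> S" using v by (simp add: S_def s_def)
    have vs: "v = norm v *\<^sub>R s" using v by (simp add: s_def)
    have wa: "w \<in> cdom a" using w Bsub by blast
    have q: "\<sigma> a w [v, cmul \<i> v] = (norm v)\<^sup>2 * \<sigma> a w [s, cmul \<i> s]" "\<tau> a w [v, cmul \<i> v] = (norm v)\<^sup>2 * \<tau> a w [s, cmul \<i> s]"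
      using kforms_2_scaleR[OF k(1) wa S0(1)[OF s], of "norm v"] kforms_2_scaleR[OF k(2) wa S0(1)[OF s], of "norm v"] vs by simp_all
    have "(norm v)\<^sup>2 * (\<sigma> a w [s, cmul \<i> s] + d * \<tau> a w [s, cmul \<i> s]) > 0"
      using e(2)[OF d, of "(w, s)"] w s v by simp
    then show ?thesis unfolding q by (simp add: algebra_simps)
  qed
  let ?B' = "ball z0 (r/2) \<inter> cvecs n"
  have B': "open_in_C n ?B'" "?B' \<subseteq> B" "?B' \<subseteq> cdom a" "z0 \<in> ?B'" using open_in_C_ball[OF z0n] Bsub z0n r by (auto simp: B_def)
  show ?thesis
  proof (rule that[of "cproj a ` ?B'" e])
    show "openin tX (cproj a ` ?B')" by (rule A.proj_open) (use B' dim[OF a] in auto)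
    show "x \<in> cproj a ` ?B'" using B'(4) z0(2) by blast
    fix d b z v assume d: "0 < d" "d \<le> e" and b: "b \<in> \<A>" and z: "z \<in> cpre b (cproj a ` ?B')" and v: "v \<in> cvecs n" "v \<noteq> 0"
    obtain w where w: "w \<in> ?B'" "cproj b z = cproj a w" using z by (auto simp: cpre_def)
    have zb: "z \<in> cdom b" and wa: "w \<in> cdom a" using z w B' by (auto simp: cpre_def)
    obtain D F where DF: "open_in_C n D" "z \<in> D" "D \<subseteq> cdom b" "holo_map n n D F" "F z = w"
      "\<And>y. y \<in> D \<Longrightarrow> F y \<in> cdom a" "\<And>y. y \<in> D \<Longrightarrow> cproj a (F y) = cproj b y"
      "\<And>y v. y \<in> D \<Longrightarrow> v \<in> cvecs n \<Longrightarrow> v \<noteq> 0 \<Longrightarrow> dird v F y \<noteq> 0"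
      by (rule transition[OF b a zb wa w(2)]) (rule that)
    have t: "\<sigma> b z [v, cmul \<i> v] = \<sigma> a (F z) [dird v F z, cmul \<i> (dird v F z)]"
      "\<tau> b z [v, cmul \<i> v] = \<tau> a (F z) [dird v F z, cmul \<i> (dird v F z)]"
      by (rule locally_ddbar_transition[OF \<sigma>(2) a b DF(1-4,6,7) v(1)], assumption+)
         (rule locally_ddbar_transition[OF \<tau>(2) a b DF(1-4,6,7) v(1)], assumption+)
    have "w \<in> B" using w(1) B'(2) by blast
    from main[OF d this holo_mapD(3)[OF DF(1,4,2) v(1)] DF(8)[OF DF(2) v]]
    show "\<sigma> b z [v, cmul \<i> v] + d * \<tau> b z [v, cmul \<i> v] > 0" unfolding t DF(5) .
  qed (rule e(1))
qed

lemma small_perturbation: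
  assumes \<sigma>: "\<sigma> \<in> Os 2 T" "locally_ddbar \<sigma>" and \<tau>: "\<tau> \<in> Os 2 T" "locally_ddbar \<tau>"
    and nn: "\<And>a z v. a \<in> \<A> \<Longrightarrow> z \<in> cdom a \<Longrightarrow> v \<in> cvecs n \<Longrightarrow> v \<noteq> 0 \<Longrightarrow> \<sigma> a z [v, cmul \<i> v] \<ge> 0"
    and pos: "\<And>a z v. a \<in> \<A> \<Longrightarrow> z \<in> cdom a \<Longrightarrow> v \<in> cvecs n \<Longrightarrow> v \<noteq> 0 \<Longrightarrow> \<sigma> a z [v, cmul \<i> v] = 0 \<Longrightarrow> \<tau> a z [v, cmul \<i> v] > 0"
  obtains e where "e > 0"
    "\<And>a z v. a \<in> \<A> \<Longrightarrow> z \<in> cdom a \<Longrightarrow> v \<in> cvecs n \<Longrightarrow> v \<noteq> 0 \<Longrightarrow> \<sigma> a z [v, cmul \<i> v] + e * \<tau> a z [v, cmul \<i> v] > 0"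
proof -
  have "\<exists>U e. openin tX U \<and> x \<in> U \<and> e > 0 \<and>
    (\<forall>d a z v. 0 < d \<longrightarrow> d \<le> e \<longrightarrow> a \<in> \<A> \<longrightarrow> z \<in> cpre a U \<longrightarrow> v \<in> cvecs n \<longrightarrow> v \<noteq> 0 \<longrightarrow>
      \<sigma> a z [v, cmul \<i> v] + d * \<tau> a z [v, cmul \<i> v] > 0)" if x: "x \<in> T" for x
    by (rule small_perturbation_near[OF \<sigma> \<tau> nn pos x]) blast+
  then obtain U e where Ue: "\<And>x. x \<in> T \<Longrightarrow> openin tX (U x) \<and> x \<in> U x \<and> e x > 0 \<and>
    (\<forall>d a z v. 0 < d \<longrightarrow> d \<le> e x \<longrightarrow> a \<in> \<A> \<longrightarrow> z \<in> cpre a (U x) \<longrightarrow> v \<in> cvecs n \<longrightarrow> v \<noteq> 0 \<longrightarrow>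
      \<sigma> a z [v, cmul \<i> v] + d * \<tau> a z [v, cmul \<i> v] > 0)" by metis
  have "\<exists>\<F>. finite \<F> \<and> \<F> \<subseteq> U ` T \<and> T \<subseteq> \<Union>\<F>"
    using cpt unfolding compact_space_alt
    by (rule allE[of _ "U ` T"]) (use Ue in auto)
  then obtain \<F> where \<F>: "finite \<F>" "\<F> \<subseteq> U ` T" "T \<subseteq> \<Union>\<F>" by blast
  obtain I where I: "I \<subseteq> T" "finite I" "\<F> = U ` I" using finite_subset_image[OF \<F>(1,2)] by blast
  \<comment> \<open>The number 1 keeps the set nonempty when the finite index set is empty.\<close>
  define d where "d = Min (insert 1 (e ` I))"
  have fI: "finite (insert 1 (e ` I))" using I by simp
  have d: "d > 0" unfolding d_def using Min_gr_iff[OF fI] Ue I(1) by auto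
  show ?thesis
  proof (rule that[OF d])
    fix a z v assume a: "a \<in> \<A>" and z: "z \<in> cdom a" and v: "v \<in> cvecs n" "v \<noteq> 0"
    have "cproj a z \<in> T" by (rule proj_in[OF a z])
    then obtain i where i: "i \<in> I" "cproj a z \<in> U i" using \<F>(3) I(3) by blast
    have zi: "z \<in> cpre a (U i)" using z i by (simp add: cpre_def)
    have di: "d \<le> e i" unfolding d_def using Min_le[OF fI] i(1) by blast
    show "\<sigma> a z [v, cmul \<i> v] + d * \<tau> a z [v, cmul \<i> v] > 0"
      using Ue[of i] i(1) I(1) d di a zi v by blast
  qed
qed

section \<open>The pulled back form and potentials positive in its degenerate directions\<close>

lemma kahler_pullback_at:
  assumes \<omega>: "kahler_form X \<omega>" and x: "x \<in> T"
  obtains V N \<Omega> j \<phi> where "x \<in> V" "local_embedding X V N \<Omega> j" "smooth_strictly_psh N \<Omega> \<phi>"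
    "\<And>a z. a \<in> \<A> \<Longrightarrow> z \<in> cpre a V \<Longrightarrow>
      orb_pullback X \<A> 2 T \<omega> a z = i_ddbar n (cpre a V) (\<lambda>z. \<phi> (j (cproj a z))) z"
proof -
  obtain V N \<Omega> j \<phi> where V: "x \<in> V" "local_embedding X V N \<Omega> j" "smooth_strictly_psh N \<Omega> \<phi>"
    "is_restriction X \<omega> V j (i_ddbar N \<Omega> \<phi>)"
    using \<omega> x unfolding kahler_form_def by blast
  note L = local_embeddingD[OF V(2)]
  have s: "smooth_on_C N \<Omega> \<phi>" using V(3) by (simp add: smooth_strictly_psh_def)
  have sf: "\<omega> \<in> space_forms X 2 T" using \<omega> by (simp add: kahler_form_def)
  have "orb_pullback X \<A> 2 T \<omega> a z = i_ddbar n (cpre a V) (\<lambda>z. \<phi> (j (cproj a z))) z"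
    if a: "a \<in> \<A>" and z: "z \<in> cpre a V" for a z
  proof -
    have ho: "holo_map n N (cpre a V) (\<lambda>z. j (cproj a z))"
      using qchart.local_embedding_holo[OF ch[OF a] V(2)] dim[OF a] by simp
    \<comment> \<open>The ambient potential composed with the embedding is a function on
      \<open>V\<close>, so it is a potential in every chart over \<open>V\<close> at once.\<close>
    have "pull_form n (cpre a V) (\<lambda>z. j (cproj a z)) (i_ddbar N \<Omega> \<phi>) = i_ddbar n (cpre a V) (\<lambda>z. \<phi> (j (cproj a z)))"
      by (rule i_ddbar_pull[OF pre_open[OF a L(1)] L(2) ho _ s]) (use L(3) in \<open>auto simp: cpre_def\<close>)
    then show ?thesis
      using orb_pullback_local[OF T_open sf V(2) i_ddbar_kforms[OF L(2) s] V(4) openin_subset[OF L(1)] a z] a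
      by (simp add: loc_form_def)
  qed
  then show ?thesis using V by (intro that) blast+
qed

lemma locally_ddbar_kahler_pullback:
  assumes "kahler_form X \<omega>"
  shows "locally_ddbar (orb_pullback X \<A> 2 T \<omega>)"
  unfolding locally_ddbar_def
proof
  fix x assume "x \<in> T"
  then obtain V N \<Omega> j \<phi> where V: "x \<in> V" "local_embedding X V N \<Omega> j" "smooth_strictly_psh N \<Omega> \<phi>"
    "\<And>a z. a \<in> \<A> \<Longrightarrow> z \<in> cpre a V \<Longrightarrow>
      orb_pullback X \<A> 2 T \<omega> a z = i_ddbar n (cpre a V) (\<lambda>z. \<phi> (j (cproj a z))) z"
    by (rule kahler_pullback_at[OF assms]) (rule that)
  have "smooth_fun V (\<lambda>y. \<phi> (j y))"
    using V(3) by (intro smooth_fun_embedding[OF V(2)]) (simp add: smooth_strictly_psh_def)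
  then show "\<exists>V h. openin tX V \<and> x \<in> V \<and> smooth_fun V h \<and>
     (\<forall>a\<in>\<A>. \<forall>z\<in>cpre a V. orb_pullback X \<A> 2 T \<omega> a z = i_ddbar n (cpre a V) (\<lambda>z. h (cproj a z)) z)"
    using V local_embeddingD(1)[OF V(2)] by (intro exI[of _ V] exI[of _ "\<lambda>y. \<phi> (j y)"]) simp
qed

text \<open>The squared norm is averaged over the group, so that it descends to X. Each summand is
  the squared norm composed with an invertible linear map and keeps strict positivity.\<close>

lemma chart_potential:
  assumes a: "a \<in> \<A>"
  obtains u where "smooth_fun (cimg a) u"
    "\<And>z v. z \<in> cdom a \<Longrightarrow> v \<in> cvecs n \<Longrightarrow> v \<noteq> 0 \<Longrightarrow> i_ddbar n (cdom a) (\<lambda>z. u (cproj a z)) z [v, cmul \<i> v] > 0"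
proof -
  interpret A: qchart X a by (rule ch[OF a])
  have na: "cdim a = n" by (rule dim[OF a])
  note Do = dom_open[OF a]
  define s where "s z = (\<Sum>g\<in>cgrp a. sqn n (g z))" for z
  \<comment> \<open>An arbitrary preimage is chosen; the value does not depend on it, since
    preimages differ by a group element and \<open>s\<close> is invariant.\<close>
  define u where "u x = s (inv_into (cdom a) (cproj a) x)" for x
  have u: "u (cproj a z) = s z" if z: "z \<in> cdom a" for z
  proof -
    let ?w = "inv_into (cdom a) (cproj a) (cproj a z)"
    have w: "?w \<in> cdom a" "cproj a ?w = cproj a z" using z by (simp_all add: inv_into_into f_inv_into_f)
    obtain h where h: "h \<in> cgrp a" "?w = h z" using A.fibre[OF z w(1)] w(2) by metis
    show ?thesis using A.sum_sqn_invariant[OF h(1) z] unfolding u_def h(2) s_def na .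
  qed
  have sg: "smooth_on_C n (cdom a) (\<lambda>z. sqn n (g z))" if "g \<in> cgrp a" for g
    by (rule smooth_on_C_sqn_comp[OF Do holo_mapD(1)[OF Do g_holo[OF a that Do]]])
  have s: "smooth_on_C n (cdom a) s" unfolding s_def by (rule smooth_on_C_sum[OF Do sg])
  have su: "smooth_on_C n (cdom a) (\<lambda>z. u (cproj a z))"
    by (rule smooth_on_C_cong[OF Do s]) (simp add: u)
  have pre: "cpre a (cimg a) = cdom a" by (auto simp: cpre_def)
  show ?thesis
  proof (rule that)
    show "smooth_fun (cimg a) u" by (rule smooth_fun_chart[OF A.img_open order_refl a]) (simp add: pre su)
    fix z v assume z: "z \<in> cdom a" and v: "v \<in> cvecs n" "v \<noteq> (0 :: cvec)"
    have gz: "g z \<in> cvecs n" "holo_map n n (cdom a) g" if "g \<in> cgrp a" "z \<in> cdom a" for g z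
      using A.g_in[OF that(1) A.dom_sub[OF that(2)]] g_holo[OF a that(1) Do] na by simp_all
    have uu: "open_in_C n (cvecs n)" by simp
    have t: "i_ddbar n (cdom a) (\<lambda>z. sqn n (g z)) z [v, cmul \<i> v] > 0" if g: "g \<in> cgrp a" for g
    proof -
      obtain h where h: "h \<in> cgrp a" "\<And>z. z \<in> cvecs n \<Longrightarrow> h (g z) = z" by (rule A.g_inverse[OF g, unfolded na]) (rule that)
      note hg = gz(2)[OF g z] and hh = g_holo[OF a h(1) uu]
      have dg: "dird v g z \<in> cvecs n" by (rule holo_mapD(3)[OF Do hg z v(1)])
      \<comment> \<open>Differentiating the identity h o g shows that the differential of
        \<open>g\<close> does not kill \<open>v\<close>.\<close>
      have "v = dird v (\<lambda>y. h (g y)) z"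
        using dird_cong[OF Do z v(1), of "\<lambda>y. h (g y)" "\<lambda>y. y"] h(2) A.dom_sub na by simp
      also have "\<dots> = dird (dird v g z) h (g z)"
        by (rule dird_compose[OF smooth_on_C_diff_at[OF holo_mapD(1)[OF Do hg] z]
              smooth_on_C_diff_at[OF holo_mapD(1)[OF uu hh] gz(1)[OF g z]] gz(1)[OF g] Do uu z v(1)])
      finally have "dird v g z \<noteq> 0" using v(2) by force
      then show ?thesis
        using i_ddbar_pull_at[OF Do uu hg gz(1)[OF g] smooth_on_C_sqn[OF uu] z v(1)]
          i_ddbar_sqn_pos[OF uu gz(1)[OF g z] dg] by simp
    qed
    have "i_ddbar n (cdom a) (\<lambda>z. u (cproj a z)) z [v, cmul \<i> v] = i_ddbar n (cdom a) s z [v, cmul \<i> v]"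
      by (rule fun_cong[OF i_ddbar_at[OF Do Do z z su s]]) (simp add: u)
    also have "\<dots> = (\<Sum>g\<in>cgrp a. i_ddbar n (cdom a) (\<lambda>z. sqn n (g z)) z [v, cmul \<i> v])"
      unfolding s_def by (rule i_ddbar_sum_pos_eq[OF Do sg z v(1)])
    also have "\<dots> > 0" using t A.fin A.id_in_G by (intro sum_pos) auto
    finally show "i_ddbar n (cdom a) (\<lambda>z. u (cproj a z)) z [v, cmul \<i> v] > 0" .
  qed
qed

lemma ddbar_chart_transfer:
  assumes a: "a \<in> \<A>" and b: "b \<in> \<A>" and u: "smooth_fun (cimg a) u"
    and pos: "\<And>z v. z \<in> cdom a \<Longrightarrow> v \<in> cvecs n \<Longrightarrow> v \<noteq> 0 \<Longrightarrow> i_ddbar n (cdom a) (\<lambda>z. u (cproj a z)) z [v, cmul \<i> v] > 0"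
    and U: "openin tX U" "U \<subseteq> cimg a" and z: "z \<in> cpre b U" and v: "v \<in> cvecs n" "v \<noteq> 0"
  shows "i_ddbar n (cpre b U) (\<lambda>z. u (cproj b z)) z [v, cmul \<i> v] > 0"
proof -
  obtain w where w: "w \<in> cdom a" "cproj b z = cproj a w" using z U(2) by (auto simp: cpre_def)
  have zb: "z \<in> cdom b" using z by (simp add: cpre_def)
  obtain D F where DF: "open_in_C n D" "z \<in> D" "D \<subseteq> cdom b" "holo_map n n D F" "F z = w"
    "\<And>y. y \<in> D \<Longrightarrow> F y \<in> cdom a" "\<And>y. y \<in> D \<Longrightarrow> cproj a (F y) = cproj b y"
    "\<And>y v. y \<in> D \<Longrightarrow> v \<in> cvecs n \<Longrightarrow> v \<noteq> 0 \<Longrightarrow> dird v F y \<noteq> 0"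
    by (rule transition[OF b a zb w]) (rule that)
  have pre: "cpre a (cimg a) = cdom a" by (auto simp: cpre_def)
  have sa: "smooth_on_C n (cdom a) (\<lambda>z. u (cproj a z))" using smooth_funD[OF u a] pre by simp
  have sb: "smooth_on_C n (cpre b U) (\<lambda>z. u (cproj b z))" by (rule smooth_funD[OF smooth_fun_subset[OF u U(2)] b])
  have sF: "smooth_on_C n D (\<lambda>y. u (cproj a (F y)))"
    by (rule smooth_on_C_compose[OF DF(1) dom_open[OF a] holo_mapD(1)[OF DF(1,4)] DF(6) sa])
  have "i_ddbar n (cpre b U) (\<lambda>z. u (cproj b z)) z [v, cmul \<i> v] = i_ddbar n D (\<lambda>y. u (cproj a (F y))) z [v, cmul \<i> v]"
    by (rule fun_cong[OF i_ddbar_at[OF pre_open[OF b U(1)] DF(1) z DF(2) sb sF]]) (simp add: DF(7))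
  also have "\<dots> = i_ddbar n (cdom a) (\<lambda>z. u (cproj a z)) (F z) [dird v F z, cmul \<i> (dird v F z)]"
    by (rule i_ddbar_pull_at[OF DF(1) dom_open[OF a] DF(4,6) sa DF(2) v(1)])
  also have "\<dots> > 0" by (rule pos[OF DF(6)[OF DF(2)] holo_mapD(3)[OF DF(1,4,2) v(1)] DF(8)[OF DF(2) v]])
  finally show ?thesis .
qed

lemma kahler_pullback_nonneg:
  assumes \<omega>: "kahler_form X \<omega>" and a: "a \<in> \<A>" and z: "z \<in> cdom a" and v: "v \<in> cvecs n"
  shows "orb_pullback X \<A> 2 T \<omega> a z [v, cmul \<i> v] \<ge> 0"
proof -
  obtain V N \<Omega> j \<phi> where V: "cproj a z \<in> V" "local_embedding X V N \<Omega> j" "smooth_strictly_psh N \<Omega> \<phi>"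
    "\<And>a z. a \<in> \<A> \<Longrightarrow> z \<in> cpre a V \<Longrightarrow>
      orb_pullback X \<A> 2 T \<omega> a z = i_ddbar n (cpre a V) (\<lambda>z. \<phi> (j (cproj a z))) z"
    by (rule kahler_pullback_at[OF \<omega> proj_in[OF a z]]) (rule that)
  note L = local_embeddingD[OF V(2)]
  have zV: "z \<in> cpre a V" using z V(1) by (simp add: cpre_def)
  have ho: "holo_map n N (cpre a V) (\<lambda>z. j (cproj a z))"
    using qchart.local_embedding_holo[OF ch[OF a] V(2)] dim[OF a] by simp
  show ?thesis
    unfolding V(4)[OF a zV]
    by (rule smooth_strictly_psh_pull_nonneg(1)[OF pre_open[OF a L(1)] L(2) ho _ V(3) zV v])
       (use L(3) in \<open>auto simp: cpre_def\<close>)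
qed

text \<open>The degenerate directions of the pulled back form are those killed by the local embeddings.
  In them the bump function, which comes from the ambient space, behaves like a constant.\<close>

lemma local_potential:
  assumes \<omega>: "kahler_form X \<omega>" and x: "x \<in> T"
  obtains \<beta> h where "smooth_fun T \<beta>" "\<beta> x > 0" "smooth_fun T h"
    "\<And>a z v. a \<in> \<A> \<Longrightarrow> z \<in> cdom a \<Longrightarrow> v \<in> cvecs n \<Longrightarrow> v \<noteq> 0 \<Longrightarrow> orb_pullback X \<A> 2 T \<omega> a z [v, cmul \<i> v] = 0 \<Longrightarrow>
      i_ddbar n (cdom a) (\<lambda>z. h (cproj a z)) z [v, cmul \<i> v] \<ge> 0 \<and>
      (\<beta> (cproj a z) > 0 \<longrightarrow> i_ddbar n (cdom a) (\<lambda>z. h (cproj a z)) z [v, cmul \<i> v] > 0)"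
proof -
  obtain V N \<Omega> j \<phi> where V: "x \<in> V" "local_embedding X V N \<Omega> j" "smooth_strictly_psh N \<Omega> \<phi>"
    "\<And>a z. a \<in> \<A> \<Longrightarrow> z \<in> cpre a V \<Longrightarrow>
      orb_pullback X \<A> 2 T \<omega> a z = i_ddbar n (cpre a V) (\<lambda>z. \<phi> (j (cproj a z))) z"
    by (rule kahler_pullback_at[OF \<omega> x]) (rule that)
  note L = local_embeddingD[OF V(2)]
  obtain a z0 where a: "a \<in> \<A>" and z0: "z0 \<in> cdom a" "cproj a z0 = x" by (rule chart_at[OF x])
  obtain u where u: "smooth_fun (cimg a) u"
    "\<And>z v. z \<in> cdom a \<Longrightarrow> v \<in> cvecs n \<Longrightarrow> v \<noteq> 0 \<Longrightarrow> i_ddbar n (cdom a) (\<lambda>z. u (cproj a z)) z [v, cmul \<i> v] > 0"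
    by (rule chart_potential[OF a]) (rule that)
  have io: "openin tX (cimg a)" by (rule qchart.img_open[OF ch[OF a]])
  have xi: "x \<in> cimg a" using z0 by blast
  obtain \<beta> K \<rho> where \<beta>: "smooth_fun T \<beta>" "\<And>y. \<beta> y \<ge> 0" "\<beta> x > 0" "closedin tX K" "K \<subseteq> cimg a \<inter> V"
    "\<And>y. y \<notin> K \<Longrightarrow> \<beta> y = 0" "smooth_on_C N \<Omega> \<rho>" "\<And>y. y \<in> V \<Longrightarrow> \<beta> y = \<rho> (j y)"
    by (rule bump[OF V(2,1) io xi]) (rule that)
  let ?U = "cimg a \<inter> V"
  have U: "openin tX ?U" by (rule openin_Int[OF io L(1)])
  \<comment> \<open>Off the image of the chart \<open>u\<close> has no controlled values, but there
    \<open>\<beta>\<close> vanishes; near points outside \<open>K\<close> the product is identically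
    0.\<close>
  define h where "h y = \<beta> y * u y" for y
  have h: "smooth_fun T h"
  proof (rule smooth_fun_local[OF T_open])
    fix y assume y: "y \<in> T"
    show "\<exists>V h'. openin tX V \<and> y \<in> V \<and> V \<subseteq> T \<and> smooth_fun V h' \<and> (\<forall>y\<in>V. h y = h' y)"
    proof (cases "y \<in> K")
      case True
      have "smooth_fun ?U h" unfolding h_def
        by (rule smooth_fun_mult[OF U smooth_fun_subset[OF \<beta>(1) openin_subset[OF U]] smooth_fun_subset[OF u(1)]]) simp
      then show ?thesis using True U openin_subset[OF U] \<beta>(5) by (intro exI[of _ ?U] exI[of _ h]) auto
    next
      case False
      have "openin tX (T - K)" using \<beta>(4) by blast
      then show ?thesis
        using y False \<beta>(6) smooth_fun_const[of "T - K" 0] by (intro exI[of _ "T - K"] exI[of _ "\<lambda>_. 0"]) (auto simp: h_def)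
    qed
  qed
  show ?thesis
  proof (rule that[OF \<beta>(1,3) h])
    fix b z v assume b: "b \<in> \<A>" and z: "z \<in> cdom b" and v: "v \<in> cvecs n" "v \<noteq> (0 :: cvec)"
      and ker: "orb_pullback X \<A> 2 T \<omega> b z [v, cmul \<i> v] = 0"
    have hT: "smooth_on_C n (cdom b) (\<lambda>z. h (cproj b z))" using smooth_funD[OF h b] pre_top[OF b] by simp
    note Do = dom_open[OF b]
    let ?q = "i_ddbar n (cdom b) (\<lambda>z. h (cproj b z)) z [v, cmul \<i> v]"
    show "?q \<ge> 0 \<and> (\<beta> (cproj b z) > 0 \<longrightarrow> ?q > 0)"
    proof (cases "cproj b z \<in> K")
      case True
      then have zU: "z \<in> cpre b ?U" and zV: "z \<in> cpre b V" using z \<beta>(5) by (auto simp: cpre_def)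
      note Po = pre_open[OF b U]
      have ho: "holo_map n N (cpre b V) (\<lambda>z. j (cproj b z))"
        using qchart.local_embedding_holo[OF ch[OF b] V(2)] dim[OF b] by simp
      have hoU: "holo_map n N (cpre b ?U) (\<lambda>z. j (cproj b z))" by (rule holo_map_subset[OF ho cpre_mono]) simp
      have into: "j (cproj b y) \<in> \<Omega>" if "y \<in> cpre b V" for y using that L(3) by (simp add: cpre_def)
      have intoU: "j (cproj b y) \<in> \<Omega>" if "y \<in> cpre b ?U" for y using that L(3) by (simp add: cpre_def)
      \<comment> \<open>Strict plurisubharmonicity of the ambient potential turns the vanishing of
        the pulled back form into the vanishing of the differential of the embedding after the
        projection.\<close>
      have k: "dird v (\<lambda>z. j (cproj b z)) z = 0"
        by (rule smooth_strictly_psh_pull_nonneg(2)[OF pre_open[OF b L(1)] L(2) ho into V(3) zV v(1)])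
           (use ker V(4)[OF b zV] in simp_all)
      have su: "smooth_on_C n (cpre b ?U) (\<lambda>z. u (cproj b z))" by (rule smooth_funD[OF smooth_fun_subset[OF u(1)] b]) simp
      have s\<rho>: "smooth_on_C n (cpre b ?U) (\<lambda>y. \<rho> (j (cproj b y)) * u (cproj b y))"
        by (rule smooth_on_C_mult[OF Po smooth_on_C_compose[OF Po L(2) holo_mapD(1)[OF Po hoU] intoU \<beta>(7)] su])
      have "?q = i_ddbar n (cpre b ?U) (\<lambda>y. \<rho> (j (cproj b y)) * u (cproj b y)) z [v, cmul \<i> v]"
        by (rule fun_cong[OF i_ddbar_at[OF Do Po z zU hT s\<rho>]]) (simp add: h_def \<beta>(8) cpre_def)
      also have "\<dots> = \<rho> (j (cproj b z)) * i_ddbar n (cpre b ?U) (\<lambda>z. u (cproj b z)) z [v, cmul \<i> v]"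
        by (rule i_ddbar_mult_kernel[OF Po L(2) hoU intoU \<beta>(7) su zU v(1) k])
      also have "\<rho> (j (cproj b z)) = \<beta> (cproj b z)" using \<beta>(8) zV by (simp add: cpre_def)
      finally have "?q = \<beta> (cproj b z) * i_ddbar n (cpre b ?U) (\<lambda>z. u (cproj b z)) z [v, cmul \<i> v]" .
      moreover have "i_ddbar n (cpre b ?U) (\<lambda>z. u (cproj b z)) z [v, cmul \<i> v] > 0"
        by (rule ddbar_chart_transfer[OF a b u U Int_lower1 zU v])
      ultimately show ?thesis using \<beta>(2)[of "cproj b z"] by simp
    next
      case False
      have KT: "openin tX (T - K)" using \<beta>(4) by blast
      have zK: "z \<in> cpre b (T - K)" using z False proj_in[OF b z] by (simp add: cpre_def)
      note Po = pre_open[OF b KT]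
      have "i_ddbar n (cdom b) (\<lambda>z. h (cproj b z)) z = i_ddbar n (cpre b (T - K)) (\<lambda>_. 0) z"
        by (rule i_ddbar_at[OF Do Po z zK hT smooth_on_C_const]) (simp add: h_def \<beta>(6) cpre_def)
      moreover have "i_ddbar n (cpre b (T - K)) (\<lambda>_. 0) z [v, cmul \<i> v] = 0"
      proof -
        have "dird w (\<lambda>_. 0 :: real) = (\<lambda>_. 0)" for w by (intro ext) simp
        then show ?thesis unfolding i_ddbar_pos_eq[OF Po smooth_on_C_const zK v(1)] by simp
      qed
      ultimately show ?thesis using \<beta>(6)[OF False] by simp
    qed
  qed
qed

text \<open>In a degenerate direction every local contribution is nonnegative, and at least one is
  strictly positive because the finitely many sets where \<open>\<beta> i\<close> is positive cover
  the space. In other directions nothing is claimed about the sum.\<close>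

lemma global_potential:
  assumes \<omega>: "kahler_form X \<omega>"
  obtains f where "smooth_fun T f"
    "\<And>a z v. a \<in> \<A> \<Longrightarrow> z \<in> cdom a \<Longrightarrow> v \<in> cvecs n \<Longrightarrow> v \<noteq> 0 \<Longrightarrow> orb_pullback X \<A> 2 T \<omega> a z [v, cmul \<i> v] = 0 \<Longrightarrow>
      ddbar_sec T f a z [v, cmul \<i> v] > 0"
proof -
  let ?Q = "\<lambda>h a z v. i_ddbar n (cdom a) (\<lambda>z. h (cproj a z)) z [v, cmul \<i> v]"
  have "\<exists>\<beta> h. smooth_fun T \<beta> \<and> \<beta> x > 0 \<and> smooth_fun T h \<and> (\<forall>a\<in>\<A>. \<forall>z\<in>cdom a. \<forall>v\<in>cvecs n. v \<noteq> 0 \<longrightarrow>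
      orb_pullback X \<A> 2 T \<omega> a z [v, cmul \<i> v] = 0 \<longrightarrow> ?Q h a z v \<ge> 0 \<and> (\<beta> (cproj a z) > 0 \<longrightarrow> ?Q h a z v > 0))"
    if x: "x \<in> T" for x
    by (rule local_potential[OF \<omega> x]) blast
  then obtain \<beta> h where bh: "\<And>x. x \<in> T \<Longrightarrow> smooth_fun T (\<beta> x) \<and> \<beta> x x > 0 \<and> smooth_fun T (h x) \<and>
      (\<forall>a\<in>\<A>. \<forall>z\<in>cdom a. \<forall>v\<in>cvecs n. v \<noteq> 0 \<longrightarrow>
      orb_pullback X \<A> 2 T \<omega> a z [v, cmul \<i> v] = 0 \<longrightarrow> ?Q (h x) a z v \<ge> 0 \<and> (\<beta> x (cproj a z) > 0 \<longrightarrow> ?Q (h x) a z v > 0))"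
    by metis
  obtain I where I: "finite I" "I \<subseteq> T" "\<And>y. y \<in> T \<Longrightarrow> \<exists>i\<in>I. \<beta> i y > 0"
    by (rule finite_positive_cover[of \<beta>]) (use bh that in auto)
  have hs: "smooth_fun T (h i)" if "i \<in> I" for i using bh I(2) that by blast
  show ?thesis
  proof (rule that)
    show "smooth_fun T (\<lambda>y. \<Sum>i\<in>I. h i y)" by (rule smooth_fun_sum[OF T_open hs])
    fix a z v assume a: "a \<in> \<A>" and z: "z \<in> cdom a" and v: "v \<in> cvecs n" "v \<noteq> (0 :: cvec)"
      and ker: "orb_pullback X \<A> 2 T \<omega> a z [v, cmul \<i> v] = 0"
    have hd: "smooth_on_C n (cdom a) (\<lambda>z. h i (cproj a z))" if "i \<in> I" for i
      using smooth_funD[OF hs[OF that] a] pre_top[OF a] by simp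
    have nn: "?Q (h i) a z v \<ge> 0" if "i \<in> I" for i using bh[of i] that I(2) a z v ker by blast
    obtain i where i: "i \<in> I" "\<beta> i (cproj a z) > 0" using I(3)[OF proj_in[OF a z]] by blast
    have pos: "?Q (h i) a z v > 0" using bh[of i] i I(2) a z v ker by blast
    have "ddbar_sec T (\<lambda>y. \<Sum>i\<in>I. h i y) a z [v, cmul \<i> v] = (\<Sum>i\<in>I. ?Q (h i) a z v)"
      using a pre_top[OF a] i_ddbar_sum_pos_eq[OF dom_open[OF a] hd z v(1)] by (simp add: ddbar_sec_def)
    also have "\<dots> > 0" by (rule sum_pos2[OF I(1) i(1)]) (rule pos, rule nn)
    finally show "ddbar_sec T (\<lambda>y. \<Sum>i\<in>I. h i y) a z [v, cmul \<i> v] > 0" .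
  qed
qed

section \<open>A Kaehler form in the class\<close>

lemma locally_ddbar_closed_section:
  assumes \<sigma>: "\<sigma> \<in> Os 2 T" "locally_ddbar \<sigma>"
  shows "\<sigma> \<in> closed_sections tX Os 2"
proof -
  have "dsec T \<sigma> a = 0" for a
  proof (cases "a \<in> \<A>")
    case True
    then show ?thesis using locally_ddbar_closed[OF \<sigma>(2) True] by (simp add: dsec_def dim pre_top)
  qed (simp add: dsec_def orb_formsD(1)[OF \<sigma>(1)] zero_fun_def ext_d_zero)
  then show ?thesis using \<sigma>(1) by (simp add: closed_sections_def fun_eq_iff)
qed

lemma kahler_pullback_closed:
  assumes "kahler_form X \<omega>"
  shows "orb_pullback X \<A> 2 T \<omega> \<in> closed_sections tX Os 2"
  using assms orb_pullback_orb_forms[OF T_open] locally_ddbar_kahler_pullback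
  by (intro locally_ddbar_closed_section) (simp_all add: kahler_form_def)

lemma orbifold_kahler_form_in_class:
  assumes \<omega>: "kahler_form X \<omega>"
  obtains \<omega>' where "orbifold_kahler_form X \<A> \<omega>'" "(\<omega>', orb_pullback X \<A> 2 T \<omega>) \<in> cohomologous tX Os 2"
proof -
  let ?\<tau> = "orb_pullback X \<A> 2 T \<omega>"
  have \<tau>c: "?\<tau> \<in> closed_sections tX Os 2" by (rule kahler_pullback_closed[OF \<omega>])
  then have \<tau>: "?\<tau> \<in> Os 2 T" by (simp add: closed_sections_def)
  have \<tau>l: "locally_ddbar ?\<tau>" by (rule locally_ddbar_kahler_pullback[OF \<omega>])
  obtain f where f: "smooth_fun T f"
    "\<And>a z v. a \<in> \<A> \<Longrightarrow> z \<in> cdom a \<Longrightarrow> v \<in> cvecs n \<Longrightarrow> v \<noteq> 0 \<Longrightarrow> ?\<tau> a z [v, cmul \<i> v] = 0 \<Longrightarrow>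
      ddbar_sec T f a z [v, cmul \<i> v] > 0"
    by (rule global_potential[OF \<omega>]) (rule that)
  let ?f = "ddbar_sec T f"
  have fo: "?f \<in> Os 2 T" by (rule ddbar_sec_orb_forms[OF T_open f(1)])
  have fl: "locally_ddbar ?f" by (rule locally_ddbar_ddbar_sec[OF f(1)])
  obtain e where e: "e > 0"
    "\<And>a z v. a \<in> \<A> \<Longrightarrow> z \<in> cdom a \<Longrightarrow> v \<in> cvecs n \<Longrightarrow> v \<noteq> 0 \<Longrightarrow> ?\<tau> a z [v, cmul \<i> v] + e * ?f a z [v, cmul \<i> v] > 0"
  proof (rule small_perturbation[OF \<tau> \<tau>l fo fl])
    fix a z v assume avz: "a \<in> \<A>" "z \<in> cdom a" "v \<in> cvecs n" "v \<noteq> (0 :: cvec)"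
    show "?\<tau> a z [v, cmul \<i> v] \<ge> 0" by (rule kahler_pullback_nonneg[OF \<omega> avz(1-3)])
    show "?\<tau> a z [v, cmul \<i> v] = 0 \<Longrightarrow> ?f a z [v, cmul \<i> v] > 0" by (rule f(2)[OF avz])
  qed (rule that)
  define \<omega>' where "\<omega>' = (\<lambda>a z vs. 1 * ?\<tau> a z vs + e * ?f a z vs)"
  have o: "\<omega>' \<in> Os 2 T" unfolding \<omega>'_def by (rule orb_forms_lincomb[OF T_open \<tau> fo])
  have k: "?\<tau> a \<in> kforms n 2 (cdom a)" "?f a \<in> kforms n 2 (cdom a)" "\<omega>' a \<in> kforms n 2 (cdom a)" if "a \<in> \<A>" for a
    using orb_formsD(2)[OF \<tau> that] orb_formsD(2)[OF fo that] orb_formsD(2)[OF o that] dim[OF that] pre_top[OF that] by simp_all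
  have cl: "ext_d n (cdom a) (\<omega>' a) = 0" if "a \<in> \<A>" for a
    unfolding \<omega>'_def ext_d_lincomb[OF dom_open[OF that] k(1,2)[OF that]]
      locally_ddbar_closed[OF \<tau>l that] locally_ddbar_closed[OF fl that] by (simp add: fun_eq_iff)
  have kf: "orbifold_kahler_form X \<A> \<omega>'"
    unfolding orbifold_kahler_form_def kahler_form_on_def
  proof (intro conjI ballI impI o)
    fix a assume a: "a \<in> \<A>"
    show "\<omega>' a \<in> kforms (cdim a) 2 (cdom a)" "ext_d (cdim a) (cdom a) (\<omega>' a) = 0" using k(3)[OF a] cl[OF a] dim[OF a] by simp_all
    show "type_1_1 (cdim a) (cdom a) (\<omega>' a)"
      using locally_ddbar_type_1_1[OF \<tau>l a] locally_ddbar_type_1_1[OF fl a] by (simp add: type_1_1_def \<omega>'_def dim[OF a])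
    fix z v assume "z \<in> cdom a" "v \<in> cvecs (cdim a)" "v \<noteq> 0"
    then show "0 < \<omega>' a z [v, cmul \<i> v]" using e(2)[OF a] dim[OF a] by (simp add: \<omega>'_def)
  qed
  let ?d = "dc_sec T f"
  have d: "?d \<in> Os (Suc 0) T" by (rule dc_sec_orb_forms[OF T_open f(1)])
  \<comment> \<open>The primitive of the perturbation, again written as a linear combination of two
    sections.\<close>
  define \<eta> where "\<eta> = (\<lambda>a z vs. e * ?d a z vs + 0 * ?d a z vs)"
  have \<eta>: "\<eta> \<in> Os (Suc 0) T" unfolding \<eta>_def by (rule orb_forms_lincomb[OF T_open d d])
  have "(\<omega>' - ?\<tau>) a = dsec T \<eta> a" for a
  proof (cases "a \<in> \<A>")
    case True
    have kd: "?d a \<in> kforms n (Suc 0) (cdom a)" using orb_formsD(2)[OF d True] dim[OF True] pre_top[OF True] by simp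
    have "dsec T \<eta> a = (\<lambda>z vs. e * ext_d n (cdom a) (?d a) z vs)"
      unfolding dsec_def dim[OF True] pre_top[OF True] \<eta>_def ext_d_lincomb[OF dom_open[OF True] kd kd] by simp
    moreover have "ext_d n (cdom a) (?d a) = ?f a"
      using fun_cong[OF dsec_dc_sec[OF T_open f(1)], of a] by (simp add: dsec_def dim[OF True] pre_top[OF True])
    ultimately show ?thesis by (simp add: \<omega>'_def fun_eq_iff)
  next
    case False
    have "dsec T \<eta> a = 0" by (simp add: dsec_def orb_formsD(1)[OF \<eta> False] zero_fun_def ext_d_zero)
    then show ?thesis by (simp add: orb_formsD(1)[OF o False] orb_formsD(1)[OF \<tau> False])
  qed
  then have eq: "\<omega>' - ?\<tau> = dsec T \<eta>" by blast
  have "dsec T \<omega>' a = 0" for a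
  proof (cases "a \<in> \<A>")
    case True
    then show ?thesis using cl[OF True] by (simp add: dsec_def dim pre_top)
  qed (simp add: dsec_def orb_formsD(1)[OF o] zero_fun_def ext_d_zero)
  then have "\<omega>' \<in> closed_sections tX Os 2" using o by (simp add: closed_sections_def fun_eq_iff)
  then have "(\<omega>', ?\<tau>) \<in> cohomologous tX Os 2" unfolding cohomologous_iff using \<tau>c \<eta> eq by blast
  with kf show ?thesis by (rule that)
qed

end

theorem lemma1:
  fixes X :: "'a ringed" and \<A> :: "'a chart set" and n :: nat
  assumes "complex_orbifold X n \<A>"
    and "compact_space (utop X)"
    and "kahler_complex_space X"
  shows "(\<forall>\<kappa>. kahler_class X \<kappa> \<longrightarrow> orbifold_kahler_class X \<A> (natural_morphism X \<A> 2 \<kappa>))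
    \<and> kahler_orbifold X n \<A>"
proof (intro conjI allI impI)
  interpret korb X n \<A> by unfold_locales (fact assms(1), fact assms(2))
  fix \<kappa> assume "kahler_class X \<kappa>"
  then obtain \<omega> where \<kappa>: "\<kappa> \<in> H_dR X 2" and \<omega>: "kahler_form X \<omega>"
    and eq: "\<kappa> = form_hyperclass (utop X) (space_forms X) 2 \<omega>"
    unfolding kahler_class_def by blast
  let ?\<tau> = "orb_pullback X \<A> 2 T \<omega>"
  obtain \<omega>' where \<omega>': "orbifold_kahler_form X \<A> \<omega>'" "(\<omega>', ?\<tau>) \<in> cohomologous (utop X) (orb_forms X \<A>) 2"
    by (rule orbifold_kahler_form_in_class[OF \<omega>]) (rule that)
  have "natural_morphism X \<A> 2 \<kappa> = orb_class X \<A> 2 ?\<tau>"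
    unfolding eq by (rule natural_morphism_form_hyperclass[OF \<kappa>[unfolded eq] kahler_pullback_closed[OF \<omega>]])
  also have "\<dots> = orb_class X \<A> 2 \<omega>'" by (rule orb_class_eq[OF \<omega>'(2), symmetric])
  finally have nm: "natural_morphism X \<A> 2 \<kappa> = orb_class X \<A> 2 \<omega>'" .
  have "\<omega>' \<in> closed_sections (utop X) (orb_forms X \<A>) 2" using \<omega>'(2) unfolding cohomologous_iff by blast
  then show "orbifold_kahler_class X \<A> (natural_morphism X \<A> 2 \<kappa>)"
    unfolding orbifold_kahler_class_def nm using orb_class_H_orb \<omega>'(1) by blast
next
  interpret korb X n \<A> by unfold_locales (fact assms(1), fact assms(2))
  obtain \<omega> where \<omega>: "kahler_form X \<omega>" using assms(3) unfolding kahler_complex_space_def by blast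
  obtain \<omega>' where "orbifold_kahler_form X \<A> \<omega>'"
    by (rule orbifold_kahler_form_in_class[OF \<omega>]) (rule that)
  then show "kahler_orbifold X n \<A>" unfolding kahler_orbifold_def using assms(1) by blast
qed

end
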